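(* Let $M$ be either $T^2\times S^2$ or the total space of the nontrivial $S^2$-fibration over $T^2$. For any positive number $C$ there exist a Lorentz metric $g$ on $M$ and a finite subgroup $\Gamma\leq\operatorname{Isom}(M,g)$ such that every abelian subgroup $A\leq\Gamma$ satisfies $[\Gamma:A]>C$.
   Context: $T^2$ is the $2$-torus and $S^2$ the $2$-sphere. The nontrivial $S^2$-fibration over $T^2$ is the total space of the nontrivial orientable smooth $S^2$-bundle over $T^2$. A Lorentz metric on a smooth $4$-manifold is a smooth pseudo-Riemannian metric of signature $(3,1)$ (three positive directions, one negative). $\operatorname{Isom}(M,g)$ is the group of diffeomorphisms of $M$ preserving $g$. *)

theory Defs
  imports "HOL-Analysis.Analysis" "HOL-Algebra.Bij" "HOL-Algebra.Coset"
begin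

section \<open>Smooth maps between subsets of Euclidean spaces\<close>

text \<open>Intended for open \<open>S\<close>, where it says that all iterated directional derivatives of
  order less than \<open>k\<close> are differentiable and those of order \<open>k\<close> are continuous.\<close>

primrec Ck_on :: "nat \<Rightarrow> ('a::euclidean_space \<Rightarrow> 'b::euclidean_space) \<Rightarrow> 'a set \<Rightarrow> bool" where
  "Ck_on 0 f S \<longleftrightarrow> continuous_on S f"
| "Ck_on (Suc k) f S \<longleftrightarrow>
     (\<forall>x\<in>S. f differentiable (at x)) \<and>
     (\<forall>v. Ck_on k (\<lambda>x. frechet_derivative f (at x) v) S)"

text \<open>On an arbitrary set, smoothness means local extendability to a smooth map on an open set;
  if \<open>S\<close> is open this is the usual notion.\<close>

definition smooth_on :: "'a::euclidean_space set \<Rightarrow> ('a \<Rightarrow> 'b::euclidean_space) \<Rightarrow> bool" where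
  "smooth_on S f \<longleftrightarrow>
     (\<forall>x\<in>S. \<exists>W F. open W \<and> x \<in> W \<and> (\<forall>k. Ck_on k F W) \<and> (\<forall>y\<in>S \<inter> W. F y = f y))"


section \<open>Smooth manifolds\<close>

type_synonym ('a, 'e) chart = "'a set \<times> ('a \<Rightarrow> 'e)"

text \<open>The dimension is that of the model space \<open>'e\<close>.  Atlases need not be maximal; only the
  values of a chart on its own domain are relevant.\<close>

record ('a, 'e) manifold =
  mtop :: "'a topology"
  charts :: "('a, 'e) chart set"

abbreviation points :: "('a, 'e) manifold \<Rightarrow> 'a set" where
  "points M \<equiv> topspace (mtop M)"

definition smooth_manifold :: "('a, 'e::euclidean_space) manifold \<Rightarrow> bool" where
  "smooth_manifold M \<longleftrightarrow>
     Hausdorff_space (mtop M) \<and> second_countable (mtop M) \<and>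
     (\<forall>(U, \<phi>)\<in>charts M. openin (mtop M) U \<and> open (\<phi> ` U) \<and>
        homeomorphic_map (subtopology (mtop M) U) (top_of_set (\<phi> ` U)) \<phi>) \<and>
     (\<Union>(U, \<phi>)\<in>charts M. U) = points M \<and>
     (\<forall>(U, \<phi>)\<in>charts M. \<forall>(V, \<psi>)\<in>charts M. smooth_on (\<phi> ` (U \<inter> V)) (\<psi> \<circ> inv_into U \<phi>))"

definition smooth_map ::
  "('a, 'e::euclidean_space) manifold \<Rightarrow> ('b, 'f::euclidean_space) manifold \<Rightarrow> ('a \<Rightarrow> 'b) \<Rightarrow> bool"
where
  "smooth_map M N f \<longleftrightarrow>
     continuous_map (mtop M) (mtop N) f \<and>
     (\<forall>(U, \<phi>)\<in>charts M. \<forall>(V, \<psi>)\<in>charts N.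
        smooth_on (\<phi> ` {p \<in> U. f p \<in> V}) (\<psi> \<circ> f \<circ> inv_into U \<phi>))"

definition diffeomorphism ::
  "('a, 'e::euclidean_space) manifold \<Rightarrow> ('b, 'f::euclidean_space) manifold \<Rightarrow> ('a \<Rightarrow> 'b) \<Rightarrow> bool"
where
  "diffeomorphism M N f \<longleftrightarrow>
     bij_betw f (points M) (points N) \<and> smooth_map M N f \<and>
     smooth_map N M (inv_into (points M) f)"

definition diffeomorphic ::
  "('a, 'e::euclidean_space) manifold \<Rightarrow> ('b, 'f::euclidean_space) manifold \<Rightarrow> bool" where
  "diffeomorphic M N \<longleftrightarrow> (\<exists>f. diffeomorphism M N f)"

definition open_submanifold :: "('a, 'e) manifold \<Rightarrow> 'a set \<Rightarrow> ('a, 'e) manifold" where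
  "open_submanifold M U =
     \<lparr>mtop = subtopology (mtop M) U, charts = (\<lambda>(V, \<phi>). (V \<inter> U, \<phi>)) ` charts M\<rparr>"

text \<open>The maximal smooth structure of an embedded submanifold \<open>S\<close> of a Euclidean space.  It is a
  smooth manifold in the above sense when \<open>S\<close> is an embedded submanifold of dimension
  \<open>DIM('e)\<close>; for other \<open>S\<close> the charts do not cover.\<close>

definition embedded_manifold :: "'b::euclidean_space set \<Rightarrow> ('b, 'e::euclidean_space) manifold" where
  "embedded_manifold S =
     \<lparr>mtop = top_of_set S,
      charts = {(U, \<phi>). openin (top_of_set S) U \<and> open (\<phi> ` U) \<and> inj_on \<phi> U \<and>
                        smooth_on U \<phi> \<and> smooth_on (\<phi> ` U) (inv_into U \<phi>)}\<rparr>"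


section \<open>The torus, the sphere, and sphere bundles over the torus\<close>

abbreviation T2 :: "(complex \<times> complex) set" where
  "T2 \<equiv> sphere 0 1 \<times> sphere 0 1"

abbreviation S2 :: "(real^3) set" where
  "S2 \<equiv> sphere 0 1"

abbreviation torus :: "(complex \<times> complex, real^2) manifold" where
  "torus \<equiv> embedded_manifold T2"

abbreviation torus_times_sphere :: "((complex \<times> complex) \<times> (real^3), real^4) manifold" where
  "torus_times_sphere \<equiv> embedded_manifold (T2 \<times> S2)"

text \<open>The radial extension \<open>y \<mapsto> |y| f(y/|y|)\<close> of a diffeomorphism \<open>f\<close> of the sphere is smooth
  away from the origin; at a point \<open>x\<close> of the sphere its derivative maps \<open>x\<close> to \<open>f x\<close> and
  restricts to the differential of \<open>f\<close> on the tangent plane at \<open>x\<close>.  So its determinant is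
  positive iff that differential preserves the orientation given by the outward normal.\<close>

definition orientation_preserving_S2 :: "(real^3 \<Rightarrow> real^3) \<Rightarrow> bool" where
  "orientation_preserving_S2 f \<longleftrightarrow>
     (\<forall>x\<in>S2. det (matrix (frechet_derivative (\<lambda>y. norm y *\<^sub>R f (y /\<^sub>R norm y)) (at x))) > 0)"

definition over :: "('a, 'e) manifold \<Rightarrow> ('a \<Rightarrow> 'b) \<Rightarrow> 'b set \<Rightarrow> 'a set" where
  "over M \<pi> U = {p \<in> points M. \<pi> p \<in> U}"

definition local_trivialization ::
  "('a, real^4) manifold \<Rightarrow> ('a \<Rightarrow> complex \<times> complex) \<Rightarrow>
   (complex \<times> complex) set \<Rightarrow> ('a \<Rightarrow> (complex \<times> complex) \<times> (real^3)) \<Rightarrow> bool" where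
  "local_trivialization M \<pi> U \<Phi> \<longleftrightarrow>
     openin (top_of_set T2) U \<and>
     diffeomorphism (open_submanifold M (over M \<pi> U))
       (embedded_manifold (U \<times> S2) :: (_, real^4) manifold) \<Phi> \<and>
     (\<forall>p\<in>over M \<pi> U. fst (\<Phi> p) = \<pi> p)"

definition S2_bundle_over_T2 ::
  "('a, real^4) manifold \<Rightarrow> ('a \<Rightarrow> complex \<times> complex) \<Rightarrow> bool" where
  "S2_bundle_over_T2 M \<pi> \<longleftrightarrow>
     smooth_manifold M \<and> smooth_map M torus \<pi> \<and>
     (\<forall>b\<in>T2. \<exists>U \<Phi>. b \<in> U \<and> local_trivialization M \<pi> U \<Phi>)"

text \<open>Orientability of the bundle: the fibres can be oriented consistently, that is, the structure
  group reduces to the orientation preserving diffeomorphisms of the fibre.\<close>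

definition orientable_S2_bundle ::
  "('a, real^4) manifold \<Rightarrow> ('a \<Rightarrow> complex \<times> complex) \<Rightarrow> bool" where
  "orientable_S2_bundle M \<pi> \<longleftrightarrow>
     S2_bundle_over_T2 M \<pi> \<and>
     (\<exists>\<T>. (\<forall>(U, \<Phi>)\<in>\<T>. local_trivialization M \<pi> U \<Phi>) \<and>
          (\<Union>(U, \<Phi>)\<in>\<T>. U) = T2 \<and>
          (\<forall>(U, \<Phi>)\<in>\<T>. \<forall>(V, \<Psi>)\<in>\<T>. \<forall>b\<in>U \<inter> V.
             orientation_preserving_S2 (\<lambda>q. snd (\<Psi> (inv_into (over M \<pi> U) \<Phi> (b, q))))))"

definition trivial_S2_bundle ::
  "('a, real^4) manifold \<Rightarrow> ('a \<Rightarrow> complex \<times> complex) \<Rightarrow> bool" where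
  "trivial_S2_bundle M \<pi> \<longleftrightarrow>
     (\<exists>\<Phi>. diffeomorphism M torus_times_sphere \<Phi> \<and> (\<forall>p\<in>points M. fst (\<Phi> p) = \<pi> p))"

definition is_nontrivial_S2_fibration_over_T2 :: "('a, real^4) manifold \<Rightarrow> bool" where
  "is_nontrivial_S2_fibration_over_T2 M \<longleftrightarrow>
     (\<exists>\<pi>. orientable_S2_bundle M \<pi> \<and> \<not> trivial_S2_bundle M \<pi>)"


section \<open>Lorentz metrics and their isometry groups\<close>

definition has_signature :: "nat \<Rightarrow> nat \<Rightarrow> ('e::euclidean_space \<Rightarrow> 'e \<Rightarrow> real) \<Rightarrow> bool" where
  "has_signature m n B \<longleftrightarrow>
     bilinear B \<and> (\<forall>v w. B v w = B w v) \<and> m + n = DIM('e) \<and>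
     (\<exists>P N. subspace P \<and> dim P = m \<and> (\<forall>v\<in>P - {0}. B v v > 0) \<and>
            subspace N \<and> dim N = n \<and> (\<forall>v\<in>N - {0}. B v v < 0))"

text \<open>A metric tensor is given by its components: \<open>g (U, \<phi>) p\<close> is the bilinear form at \<open>p \<in> U\<close>
  with the tangent space identified with \<open>'e\<close> through the chart \<open>\<phi>\<close>.  The last clause is the
  transformation law of covariant 2-tensors.\<close>

type_synonym ('a, 'e) metric = "('a, 'e) chart \<Rightarrow> 'a \<Rightarrow> 'e \<Rightarrow> 'e \<Rightarrow> real"

definition pseudo_Riemannian_metric ::
  "nat \<Rightarrow> nat \<Rightarrow> ('a, 'e::euclidean_space) manifold \<Rightarrow> ('a, 'e) metric \<Rightarrow> bool" where
  "pseudo_Riemannian_metric m n M g \<longleftrightarrow>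
     (\<forall>(U, \<phi>)\<in>charts M. \<forall>p\<in>U. has_signature m n (g (U, \<phi>) p)) \<and>
     (\<forall>(U, \<phi>)\<in>charts M. \<forall>v w. smooth_on (\<phi> ` U) (\<lambda>y. g (U, \<phi>) (inv_into U \<phi> y) v w)) \<and>
     (\<forall>(U, \<phi>)\<in>charts M. \<forall>(V, \<psi>)\<in>charts M. \<forall>p\<in>U \<inter> V.
        let D = frechet_derivative (\<psi> \<circ> inv_into U \<phi>) (at (\<phi> p))
        in \<forall>v w. g (U, \<phi>) p v w = g (V, \<psi>) p (D v) (D w))"

definition Lorentz_metric :: "('a, real^4) manifold \<Rightarrow> ('a, real^4) metric \<Rightarrow> bool" where
  "Lorentz_metric M g \<longleftrightarrow> pseudo_Riemannian_metric 3 1 M g"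

definition isometry ::
  "('a, 'e::euclidean_space) manifold \<Rightarrow> ('a, 'e) metric \<Rightarrow> ('a \<Rightarrow> 'a) \<Rightarrow> bool" where
  "isometry M g f \<longleftrightarrow>
     diffeomorphism M M f \<and>
     (\<forall>(U, \<phi>)\<in>charts M. \<forall>(V, \<psi>)\<in>charts M. \<forall>p\<in>U. f p \<in> V \<longrightarrow>
        (let D = frechet_derivative (\<psi> \<circ> f \<circ> inv_into U \<phi>) (at (\<phi> p))
         in \<forall>v w. g (U, \<phi>) p v w = g (V, \<psi>) (f p) (D v) (D w)))"

text \<open>As in \<^const>\<open>BijGroup\<close>, elements are extensional functions on the underlying point set, so
  that each isometry is represented exactly once.\<close>

definition isometry_group ::
  "('a, 'e::euclidean_space) manifold \<Rightarrow> ('a, 'e) metric \<Rightarrow> ('a \<Rightarrow> 'a) monoid" where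
  "isometry_group M g =
     (BijGroup (points M)) \<lparr>carrier := {f \<in> Bij (points M). isometry M g f}\<rparr>"

definition subgroup_index :: "('g, 'm) monoid_scheme \<Rightarrow> 'g set \<Rightarrow> nat" where
  "subgroup_index G A = card (rcosets\<^bsub>G\<^esub> A)"

end

theory Submission imports Defs begin

text \<open>Pull the bundle back to the universal cover \<open>\<real>\<^sup>2\<close> of the torus and trivialise it there. Closing
  up along the two generators produces a loop of orientation preserving diffeomorphisms of the sphere.
  Such a loop is isotopic to \<open>b \<mapsto> rot (n b)\<close>, with \<open>n\<close> arbitrary in its parity class: fix a pole, remove
  the winding of the derivative there, make the maps the identity near the pole, and deform the
  remaining diffeomorphisms of the plane by first straightening the angle of a gradient to a constant
  and then integrating it to a function without critical points.
  So the total space is a quotient of \<open>\<real>\<^sup>2 \<times> S2\<close> by \<open>(x, y, q) \<mapsto> (x + 1, y, q)\<close> and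
  \<open>(x, y, q) \<mapsto> (x, y + 1, rot (- n x) q)\<close>, where \<open>n = k p\<close> for a large prime \<open>p\<close> and \<open>k \<in> {1, 2}\<close>.
  The \<open>p\<close>-th roots of these two maps descend to isometries of order \<open>p\<close> of the metric
  \<open>dx\<^sup>2 - dy\<^sup>2 + |dq + 2 \<pi> n y dx J q|\<^sup>2\<close>. They generate a finite Heisenberg group and do not commute,
  so an abelian subgroup misses one of them and hence has index at least \<open>p\<close>.\<close>

section \<open>Smooth maps on open sets\<close>

text \<open>The hard part is a uniqueness statement, with parameters, for diffeomorphisms of the
  plane that are the identity far out. It is reduced to single functions: a function increasing
  along a direction field has no critical point, and such functions form a convex set, so solutions
  for nearby parameters can be averaged. For one parameter they exist because no closed curve can
  follow a field whose angle is a global real function. This only yields a positive Jacobian;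
  bijectivity is recovered on the sphere, where a local homeomorphism with one value taken exactly
  once is bijective. The choice n = k p meets two demands: the p-th roots descend because n / p is
  an integer, and their commutator is a rotation by n / p^2 = k / p of a turn, nontrivial exactly
  when p does not divide k. The factor k adjusts the parity of n, p being odd. In the metric, 2
  \<pi> n y dx is a connection form: y -> y + b adds 2 \<pi> n b dx, which the derivative of the
  rotation by - n b x cancels.\<close>

definition smo :: "'a::euclidean_space set => ('a => 'b::euclidean_space) => bool" where
 "smo S f \<longleftrightarrow> (\<forall>k. Ck_on k f S)"

abbreviation pd :: "'a::euclidean_space => ('a => 'b::euclidean_space) => 'a => 'b" where
 "pd v f \<equiv> %x. frechet_derivative f (at x) v"

named_theorems smo_intros

lemma has_pd: "f differentiable (at x) ==> (f has_derivative (%v. pd v f x)) (at x)"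
 using frechet_derivative_works by fastforce

lemma pd_eq: "(f has_derivative D) (at x) ==> pd v f x = D v"
 using frechet_derivative_at by metis

lemma has_derivative_cong_open:
 assumes "open S" "x \<in> S" "!!y. y \<in> S ==> f y = g y"
 shows "(f has_derivative D) (at x) \<longleftrightarrow> (g has_derivative D) (at x)"
 using has_derivative_transform_within_open[OF _ assms(1,2), of f D UNIV g]
  has_derivative_transform_within_open[OF _ assms(1,2), of g D UNIV f] assms(3) by auto

lemma pd_cong:
 assumes "open S" "x \<in> S" "!!y. y \<in> S ==> f y = g y"
 shows "pd v f x = pd v g x"
 using has_derivative_cong_open[OF assms] by (simp add: frechet_derivative_def)

lemma differentiable_cong_open:
 assumes "open S" "x \<in> S" "!!y. y \<in> S ==> f y = g y"
 shows "f differentiable (at x) \<longleftrightarrow> g differentiable (at x)"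
 using has_derivative_cong_open[OF assms] by (simp add: differentiable_def)

lemma Ck_cong:
 assumes "open S" "!!x. x \<in> S ==> f x = g x"
 shows "Ck_on k f S \<longleftrightarrow> Ck_on k g S"
 using assms(2)
proof (induction k arbitrary: f g)
 case 0 then show ?case by (simp cong: continuous_on_cong)
next
 case (Suc k)
 have "Ck_on k (pd v f) S = Ck_on k (pd v g) S" for v
  by (rule Suc.IH) (rule pd_cong[OF assms(1) _ Suc.prems])
 moreover have "(\<forall>x\<in>S. f differentiable at x) \<longleftrightarrow> (\<forall>x\<in>S. g differentiable at x)"
  using differentiable_cong_open[of S _ f g] assms(1) Suc.prems by blast
 ultimately show ?case by simp
qed

lemma Ck_transform: "Ck_on k g S ==> open S ==> (!!x. x \<in> S ==> f x = g x) ==> Ck_on k f S"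
 using Ck_cong[of S f g k] by blast

lemma Ck_subset: "Ck_on k f S ==> T \<subseteq> S ==> Ck_on k f T"
 by (induction k arbitrary: f) (auto intro: continuous_on_subset)

lemma Ck_local:
 "(!!x. x \<in> S ==> \<exists>W. open W & x \<in> W & Ck_on k f W) ==> Ck_on k f S"
proof (induction k arbitrary: f)
 case 0
 then have "!!x. x \<in> S ==> isCont f x"
  by (metis Ck_on.simps(1) continuous_on_eq_continuous_at)
 then show ?case by (simp add: continuous_at_imp_continuous_on)
next
 case (Suc k)
 have "\<forall>v. Ck_on k (pd v f) S"
  by (intro allI Suc.IH) (use Suc.prems in force)
 moreover have "f differentiable at x" if "x \<in> S" for x using Suc.prems[OF that] by auto
 ultimately show ?case by auto
qed

lemma Ck_SucD: "Ck_on (Suc k) f S ==> Ck_on k f S"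
proof (induction k arbitrary: f)
 case 0
 then show ?case using differentiable_imp_continuous_within
  by (auto intro!: continuous_at_imp_continuous_on)
next
 case (Suc k)
 then show ?case by simp
qed

lemma Ck_const: "Ck_on k (%x. c) S"
 by (induction k arbitrary: c) auto

lemma smo_const [smo_intros, simp]: "smo S (%x. c)"
 by (simp add: smo_def Ck_const)

lemma smo_bounded_linear: assumes "bounded_linear f" shows "smo S f"
proof -
 have d: "(f has_derivative f) (at x)" for x
  using assms by (rule bounded_linear_imp_has_derivative)
 have "Ck_on k f S" for k
 proof (cases k)
  case 0 then show ?thesis
   using assms by (simp add: linear_continuous_on)
 next
  case (Suc m)
  have "pd v f = (%x. f v)" for v by (rule ext) (rule pd_eq[OF d])
  then show ?thesis using d Ck_const by (auto simp: Suc differentiable_def)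
 qed
 then show ?thesis by (simp add: smo_def)
qed

lemma smo_ident [smo_intros, simp]: "smo S (%x. x)" by (rule smo_bounded_linear) (rule bounded_linear_ident)

lemma Ck_add: "open S ==> Ck_on k f S ==> Ck_on k g S ==> Ck_on k (%x. f x + g x) S"
proof (induction k arbitrary: f g)
 case 0 then show ?case by (auto intro: continuous_intros)
next
 case (Suc k)
 have "Ck_on k (pd v (%x. f x + g x)) S" for v
 proof -
  have "Ck_on k (%x. pd v f x + pd v g x) S" using Suc by auto
  moreover have "pd v (%x. f x + g x) x = pd v f x + pd v g x" if "x \<in> S" for x
   using Suc.prems that by (intro pd_eq) (auto intro!: derivative_eq_intros has_pd)
  ultimately show ?thesis by (rule Ck_transform[OF _ Suc.prems(1)])
 qed
 then show ?case using Suc.prems by auto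
qed

lemma Ck_sum: "open S ==> (!!i. i \<in> I ==> Ck_on k (f i) S) ==> Ck_on k (%x. \<Sum>i\<in>I. f i x) S"
 by (induction I rule: infinite_finite_induct) (auto intro: Ck_const Ck_add)


lemma Ck_bilinear:
 fixes f :: "'d::euclidean_space => 'a::euclidean_space" and g :: "'d => 'b::euclidean_space"
  and p :: "'a => 'b => 'c::euclidean_space"
 assumes "bounded_bilinear p" "open S"
 shows "Ck_on k f S ==> Ck_on k g S ==> Ck_on k (%x. p (f x) (g x)) S"
proof (induction k arbitrary: f g)
 case 0 then show ?case using bounded_bilinear.continuous_on[OF assms(1)] by auto
next
 case (Suc k)
 have d: "((%x. p (f x) (g x)) has_derivative (%v. p (f x) (pd v g x) + p (pd v f x) (g x))) (at x)"
  if "x \<in> S" for x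
  by (rule bounded_bilinear.FDERIV[OF assms(1) has_pd has_pd]) (use Suc.prems that in auto)
 have "Ck_on k (pd v (%x. p (f x) (g x))) S" for v
 proof -
  have "Ck_on k (%x. p (f x) (pd v g x) + p (pd v f x) (g x)) S"
   using Suc by (intro Ck_add assms Suc.IH) (auto intro: Ck_SucD)
  then show ?thesis by (rule Ck_transform[OF _ assms(2)]) (rule pd_eq[OF d])
 qed
 then show ?case using d by (auto simp: differentiable_def)
qed

text \<open>The chain rule gives \<open>pd (pd v f x) g (f x)\<close>, whose direction depends on x.
  Expanding that direction in \<open>Basis\<close> leaves coefficients coming from \<open>f\<close>
  times partial derivatives of \<open>g\<close> in fixed directions, to which the induction
  hypothesis applies.\<close>

lemma Ck_compose:
 fixes f :: "'d::euclidean_space => 'a::euclidean_space" and g :: "'a => 'b::euclidean_space"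
 assumes "open S" "open T" "f ` S \<subseteq> T"
 shows "Ck_on k g T ==> Ck_on k f S ==> Ck_on k (%x. g (f x)) S"
proof (induction k arbitrary: g)
 case 0 then show ?case using assms continuous_on_compose2 by fastforce
next
 case (Suc k)
 have d: "((%x. g (f x)) has_derivative (%v. pd (pd v f x) g (f x))) (at x)" if "x \<in> S" for x
  using Suc.prems that assms has_derivative_compose[OF has_pd[of f x] has_pd[of g "f x"]]
  by (auto simp: o_def)
 have "Ck_on k (pd v (%x. g (f x))) S" for v
 proof -
  have "Ck_on k (%x. \<Sum>i\<in>Basis. (pd v f x \<bullet> i) *\<^sub>R pd i g (f x)) S"
  proof (intro Ck_sum assms Ck_bilinear[OF bounded_bilinear_scaleR])
   fix i :: 'a assume "i \<in> Basis"
   show "Ck_on k (%x. pd v f x \<bullet> i) S"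
    using Ck_bilinear[OF bounded_bilinear_inner assms(1), of k "pd v f" "%_. i"] Suc.prems Ck_const by auto
   show "Ck_on k (%x. pd i g (f x)) S"
    using Suc by (intro Suc.IH) (auto intro: Ck_SucD)
  qed
  moreover have "pd v (%x. g (f x)) x = (\<Sum>i\<in>Basis. (pd v f x \<bullet> i) *\<^sub>R pd i g (f x))" if "x \<in> S" for x
  proof -
   have "linear (%w. pd w g (f x))"
    using Suc.prems that assms has_derivative_linear[OF has_pd] by auto
   then have "pd (pd v f x) g (f x) = (\<Sum>i\<in>Basis. (pd v f x \<bullet> i) *\<^sub>R pd i g (f x))"
    by (subst euclidean_representation[symmetric, of "pd v f x"])
      (simp only: linear_sum linear_cmul)
   then show ?thesis using pd_eq[OF d[OF that]] by simp
  qed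
  ultimately show ?thesis by (rule Ck_transform[OF _ assms(1)])
 qed
 then show ?case using d by (auto simp: differentiable_def)
qed

lemma smo_cong: "open S ==> (!!x. x \<in> S ==> f x = g x) ==> smo S f \<longleftrightarrow> smo S g"
 unfolding smo_def using Ck_cong by blast

lemma smo_transform: "smo S g ==> open S ==> (!!x. x \<in> S ==> f x = g x) ==> smo S f"
 using smo_cong[of S f g] by blast

lemma smo_subset: "smo S f ==> T \<subseteq> S ==> smo T f"
 unfolding smo_def using Ck_subset by blast

lemma smo_local: "(!!x. x \<in> S ==> \<exists>W. open W & x \<in> W & smo W f) ==> smo S f"
 unfolding smo_def by (rule allI, rule Ck_local) blast

lemma smo_differentiable: "smo S f ==> x \<in> S ==> f differentiable (at x)"
 unfolding smo_def by (metis Ck_on.simps(2))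

lemma smo_has_pd: "smo S f ==> x \<in> S ==> (f has_derivative (%v. pd v f x)) (at x)"
 using has_pd smo_differentiable by blast

lemma smo_pd: "smo S f ==> smo S (pd v f)"
 unfolding smo_def by (metis Ck_on.simps(2))

lemma smo_continuous: "smo S f ==> continuous_on S f"
 unfolding smo_def by (metis Ck_on.simps(1))

lemma smoI_deriv:
 assumes "!!x. x \<in> S ==> (f has_derivative D x) (at x)" "!!v. smo S (%x. D x v)" "open S"
 shows "smo S f"
 unfolding smo_def
proof
 fix k
 have "Ck_on (Suc k) f S"
 proof -
  have "Ck_on k (pd v f) S" for v
   using assms(2)[of v] Ck_cong[OF assms(3), of "pd v f" "%x. D x v"] pd_eq[OF assms(1)]
   unfolding smo_def by blast
  then show ?thesis using assms(1) by (auto simp: differentiable_def)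
 qed
 then show "Ck_on k f S" by (rule Ck_SucD)
qed

lemma smo_add [smo_intros]: "smo S f ==> smo S g ==> open S ==> smo S (%x. f x + g x)"
 unfolding smo_def using Ck_add by blast

lemma smo_sum [smo_intros]: "(!!i. i \<in> I ==> smo S (f i)) ==> open S ==> smo S (%x. \<Sum>i\<in>I. f i x)"
 unfolding smo_def by (rule allI, rule Ck_sum) auto

lemma smo_bilinear:
 "bounded_bilinear p ==> smo S f ==> smo S g ==> open S ==> smo S (%x. p (f x) (g x))"
 unfolding smo_def by (rule allI, rule Ck_bilinear) auto

lemma smo_compose:
 "smo T g ==> smo S f ==> f ` S \<subseteq> T ==> open S ==> open T ==> smo S (%x. g (f x))"
 unfolding smo_def by (rule allI, rule Ck_compose[where T = T]) auto

lemma smo_compose_UNIV: "smo UNIV g ==> smo S f ==> open S ==> smo S (%x. g (f x))"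
 using smo_compose[of UNIV g S f] by auto

lemma smo_linear: "bounded_linear h ==> smo S f ==> open S ==> smo S (%x. h (f x))"
 by (rule smo_compose_UNIV[OF smo_bounded_linear])

lemmas smo_linears [smo_intros] =
 smo_linear[OF bounded_linear_fst] smo_linear[OF bounded_linear_snd]
 smo_linear[OF bounded_linear_Re] smo_linear[OF bounded_linear_Im]
 smo_linear[OF bounded_linear_cnj] smo_linear[OF bounded_linear_of_real[where 'a=complex]]
 smo_linear[OF bounded_linear_vec_nth]

lemma smo_minus [smo_intros]: "smo S f ==> open S ==> smo S (%x. - f x)"
 by (rule smo_linear[OF bounded_linear_minus[OF bounded_linear_ident]])

lemma smo_diff [smo_intros]: "smo S f ==> smo S g ==> open S ==> smo S (%x. f x - g x)"
 using smo_add[of S f "%x. - g x"] smo_minus[of S g] by simp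

lemmas smo_scaleR [smo_intros] = smo_bilinear[OF bounded_bilinear_scaleR]
lemmas smo_inner [smo_intros] = smo_bilinear[OF bounded_bilinear_inner]

lemma smo_mult_real [smo_intros]:
 "smo S f ==> smo S g ==> open S ==> smo S (%x. f x * g x :: real)"
 by (rule smo_bilinear[OF bounded_bilinear_mult])

lemma smo_mult_complex [smo_intros]:
 "smo S f ==> smo S g ==> open S ==> smo S (%x. f x * g x :: complex)"
 by (rule smo_bilinear[OF bounded_bilinear_mult])

lemma smo_componentwise:
 fixes f :: "'a::euclidean_space => 'b::euclidean_space"
 assumes "!!b. b \<in> Basis ==> smo S (%x. f x \<bullet> b)" "open S"
 shows "smo S f"
proof -
 have "smo S (%x. \<Sum>b\<in>Basis. (f x \<bullet> b) *\<^sub>R b)"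
  by (intro smo_intros assms)
 then show ?thesis by (simp add: euclidean_representation)
qed

lemma smo_Pair [smo_intros]:
 assumes "smo S f" "smo S g" "open S" shows "smo S (%x. (f x, g x))"
proof -
 have "bounded_linear (%a. (a, 0))" "bounded_linear (%a. (0, a))"
  by (auto intro!: bounded_linear_intros)
 then have "smo S (%x. (f x, 0) + (0, g x))"
  by (intro smo_add smo_linear[of "%a. (a,0)"] smo_linear[of "%a. (0,a)"] assms)
 then show ?thesis by simp
qed

lemma smo_vec_lambda [smo_intros]:
 fixes f :: "'a::euclidean_space => 'n::finite => real"
 assumes "!!i. smo S (%x. f x i)" "open S" shows "smo S (%x. \<chi> i. f x i)"
 by (rule smo_componentwise) (use assms in \<open>auto simp: Basis_vec_def inner_axis\<close>)

lemma smo_Complex [smo_intros]: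
 assumes "smo S f" "smo S g" "open S" shows "smo S (%x. Complex (f x) (g x))"
 by (rule smo_componentwise) (use assms in \<open>auto simp: Basis_complex_def inner_complex_def\<close>)

lemma smo_real_deriv:
 fixes f :: "real => 'b::euclidean_space"
 assumes "!!x. x \<in> S ==> (f has_vector_derivative f' x) (at x)" "smo S f'" "open S"
 shows "smo S f"
 by (rule smoI_deriv[where D = "%x v. v *\<^sub>R f' x"])
   (use assms in \<open>auto simp: has_vector_derivative_def intro: smo_intros\<close>)

text \<open>The order k is raised for all members of \<open>F\<close> at once. This suits functions
  whose derivatives stay in an explicit set, such as sine and cosine up to sign, or c / x^n with
  varying c and n.\<close>

lemma smo_real_coinduct:
 fixes F :: "(real => 'b::euclidean_space) set"
 assumes "!!f. f \<in> F ==> \<exists>f'\<in>F. \<forall>x\<in>S. (f has_vector_derivative f' x) (at x)" "f \<in> F" "open S"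
 shows "smo S f"
proof -
 have "Ck_on k f S" if "f \<in> F" for f k
  using that
 proof (induction k arbitrary: f)
  case 0
  then show ?case using assms(1)[OF 0]
   by (auto intro!: continuous_at_imp_continuous_on dest: has_vector_derivative_continuous)
 next
  case (Suc k)
  obtain f' where f': "f' \<in> F" "\<forall>x\<in>S. (f has_vector_derivative f' x) (at x)"
   using assms(1)[OF Suc.prems] by blast
  have "Ck_on k (pd v f) S" for v
  proof -
   have "Ck_on k (%x. v *\<^sub>R f' x) S"
    using Ck_bilinear[OF bounded_bilinear_scaleR assms(3), of k "%_. v" f'] Suc.IH[OF f'(1)] Ck_const by auto
   moreover have "pd v f x = v *\<^sub>R f' x" if "x \<in> S" for x
    by (rule pd_eq) (use f'(2) that in \<open>auto simp: has_vector_derivative_def\<close>)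
   ultimately show ?thesis by (rule Ck_transform[OF _ assms(3)])
  qed
  then show ?case using f'(2) by (auto simp: differentiable_def has_vector_derivative_def)
 qed
 then show ?thesis using assms(2) by (simp add: smo_def)
qed

lemma smo_exp_real: "smo UNIV (exp :: real => real)"
 by (rule smo_real_coinduct[of "{exp}"])
   (auto simp: has_real_derivative_iff_has_vector_derivative[symmetric] intro!: derivative_eq_intros)

lemma smo_sin_cos: "smo UNIV (sin :: real => real)" "smo UNIV (cos :: real => real)"
proof -
 let ?F = "{sin, cos, %x. - sin x, %x. - cos x} :: (real => real) set"
 have "!!f. f \<in> ?F ==> \<exists>f'\<in>?F. \<forall>x\<in>UNIV. (f has_vector_derivative f' x) (at x)"
  unfolding has_real_derivative_iff_has_vector_derivative[symmetric]
  by (auto intro!: derivative_eq_intros)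
 then show "smo UNIV (sin :: real => real)" "smo UNIV (cos :: real => real)"
  using smo_real_coinduct[of ?F UNIV] by auto
qed

lemma smo_inverse_real: "smo (- {0}) (inverse :: real => real)"
proof -
 let ?F = "{f. \<exists>c n. f = (%x. c * inverse x ^ n)} :: (real => real) set"
 have "\<exists>f'\<in>?F. \<forall>x\<in>-{0}. (f has_vector_derivative f' x) (at x)" if "f \<in> ?F" for f
 proof -
  obtain c n where f: "f = (%x. c * inverse x ^ n)" using \<open>f \<in> ?F\<close> by blast
  have "(f has_vector_derivative (- c * real n) * inverse x ^ (Suc n)) (at x)" if "x \<in> -{0}" for x
   unfolding has_real_derivative_iff_has_vector_derivative[symmetric]
  proof -
   have "((%x. c * inverse x ^ n) has_field_derivative
     c * (real n * (- (inverse x * 1 * inverse x) * inverse x ^ (n - Suc 0)))) (at x)"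
    using that by (intro DERIV_cmult DERIV_power DERIV_inverse' DERIV_ident) auto
   moreover have "c * (real n * (- (inverse x * 1 * inverse x) * inverse x ^ (n - Suc 0)))
     = - c * real n * inverse x ^ Suc n"
    by (cases n) simp_all
   ultimately show "(f has_field_derivative (- c * real n) * inverse x ^ (Suc n)) (at x)"
    unfolding f by metis
  qed
  then show ?thesis by (intro bexI[of _ "%x. (- c * real n) * inverse x ^ Suc n"]) blast+
 qed
 moreover have "inverse \<in> ?F" by (auto intro!: exI[of _ "1::real"] exI[of _ "1::nat"])
 ultimately show ?thesis by (rule smo_real_coinduct[of ?F]) auto
qed

lemma smo_ln: "smo {0<..} (ln :: real => real)"
 by (rule smo_real_deriv[where f' = inverse])
   (auto simp: has_real_derivative_iff_has_vector_derivative[symmetric] field_simps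
    intro!: derivative_eq_intros smo_subset[OF smo_inverse_real])

lemma smo_exp_realI [smo_intros]: "smo S f ==> open S ==> smo S (%x. exp (f x :: real))"
 by (rule smo_compose_UNIV[OF smo_exp_real])
lemma smo_sinI [smo_intros]: "smo S f ==> open S ==> smo S (%x. sin (f x :: real))"
 by (rule smo_compose_UNIV[OF smo_sin_cos(1)])
lemma smo_cosI [smo_intros]: "smo S f ==> open S ==> smo S (%x. cos (f x :: real))"
 by (rule smo_compose_UNIV[OF smo_sin_cos(2)])
lemma smo_lnI [smo_intros]: "smo S f ==> (!!x. x \<in> S ==> f x > 0) ==> open S ==> smo S (%x. ln (f x :: real))"
 by (rule smo_compose[OF smo_ln]) auto
lemma smo_inverseI [smo_intros]: "smo S f ==> (!!x. x \<in> S ==> f x ~= 0) ==> open S ==> smo S (%x. inverse (f x :: real))"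
 by (rule smo_compose[OF smo_inverse_real]) auto
lemma smo_divideI [smo_intros]: "smo S g ==> smo S f ==> (!!x. x \<in> S ==> f x ~= 0) ==> open S ==> smo S (%x. g x / (f x :: real))"
 unfolding divide_inverse by (intro smo_intros)
lemma smo_powerI [smo_intros]: "smo S f ==> open S ==> smo S (%x. (f x :: real) ^ n)"
 by (induction n) (auto intro: smo_intros)
lemma smo_sqrtI [smo_intros]:
 assumes "smo S f" "!!x. x \<in> S ==> f x > 0" "open S" shows "smo S (%x. sqrt (f x))"
proof (rule smo_transform)
 show "smo S (%x. exp (ln (f x) / 2))" by (intro smo_intros assms) auto
 show "sqrt (f x) = exp (ln (f x) / 2)" if "x \<in> S" for x
  using assms(2)[OF that] by (simp add: ln_sqrt[symmetric])
qed (rule assms)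
lemma smo_normI [smo_intros]:
 "smo S f ==> (!!x. x \<in> S ==> f x ~= 0) ==> open S ==> smo S (%x. norm (f x))"
 unfolding norm_eq_sqrt_inner by (intro smo_intros) auto
lemma smo_cisI [smo_intros]: "smo S f ==> open S ==> smo S (%x. cis (f x))"
 by (rule smo_transform[where g = "%x. Complex (cos (f x)) (sin (f x))"])
   (auto intro: smo_intros simp: complex_eq_iff)
lemma smo_exp_complex [smo_intros]: "smo S f ==> open S ==> smo S (%x. exp (f x :: complex))"
 by (rule smo_transform[where g = "%x. of_real (exp (Re (f x))) * cis (Im (f x))"])
   (intro smo_intros | simp add: exp_eq_polar)+
lemma smo_inverse_complex [smo_intros]:
 assumes "smo S f" "!!x. x \<in> S ==> f x ~= 0" "open S" shows "smo S (%x. inverse (f x :: complex))"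
proof (rule smo_transform)
 have nz: "Re (f x)^2 + Im (f x)^2 ~= 0" if "x \<in> S" for x
  using assms(2)[OF that] by (auto simp: complex_eq_iff sum_power2_eq_zero_iff)
 show "smo S (%x. cnj (f x) * of_real (inverse (Re (f x)^2 + Im (f x)^2)))"
  by (intro smo_intros assms nz)
 show "inverse (f x) = cnj (f x) * of_real (inverse (Re (f x)^2 + Im (f x)^2))" for x
  by (simp add: complex_eq_iff divide_inverse del: of_real_inverse)
qed (rule assms)
lemma smo_divide_complex [smo_intros]:
 "smo S g ==> smo S f ==> (!!x. x \<in> S ==> f x ~= 0) ==> open S ==> smo S (%x. g x / (f x :: complex))"
 unfolding divide_inverse by (intro smo_intros)

text \<open>Near x, continuity keeps h y - h x away from the other branches, so h y = h x + Ln (f y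
  / f x). Hence the derivative of h is the logarithmic derivative of f, whichever branch h follows
  globally.\<close>

lemma smo_logarithm:
 fixes f h :: "'a::euclidean_space => complex"
 assumes "continuous_on S h" "!!x. x \<in> S ==> f x = exp (h x)" "smo S f" "open S"
 shows "smo S h"
proof (rule smoI_deriv[where D = "%x v. pd v f x / f x"])
 fix x assume x: "x \<in> S"
 define g where "g y = h x + Ln (f y / f x)" for y
 have fx: "f x ~= 0" using assms(2) x by simp
 have "isCont h x" using assms x continuous_on_eq_continuous_at by blast
 then obtain d where d: "d > 0" "!!y. dist y x < d ==> dist (h y) (h x) < 1"
  unfolding continuous_at_eps_delta by (metis zero_less_one)
 obtain e where e: "e > 0" "ball x e \<subseteq> S" using assms(4) x openE by blast
 have "(g has_derivative (%v. pd v f x / f x)) (at x)"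
 proof -
  have 1: "((%y. f y / f x) has_derivative (%v. pd v f x / f x)) (at x)"
   using fx by (auto intro!: derivative_eq_intros smo_has_pd[OF assms(3) x])
  have 2: "(Ln has_derivative (%v. 1 * v)) (at (f x / f x))"
   using fx has_field_derivative_Ln[of 1] unfolding has_field_derivative_def by (simp add: mult_1_left[abs_def])
  show ?thesis unfolding g_def
   using has_derivative_add[OF has_derivative_const has_derivative_compose[OF 1 2]] by simp
 qed
 moreover have "g y = h y" if "y \<in> ball x (min d e)" for y
 proof -
  have y: "y \<in> S" "dist y x < d" using that e by (auto simp: dist_commute)
  have "f y / f x = exp (h y - h x)" using assms(2) x y by (simp add: exp_diff)
  moreover have "\<bar>Im (h y - h x)\<bar> < 1"
   using d(2)[OF y(2)] abs_Im_le_cmod[of "h y - h x"] by (simp add: dist_norm)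
  ultimately show ?thesis unfolding g_def using pi_gt3 by (simp add: Ln_exp)
 qed
 ultimately show "(h has_derivative (%v. pd v f x / f x)) (at x)"
  using has_derivative_transform_within_open[of g _ x UNIV "ball x (min d e)" h] d e by auto
next
 show "smo S (%x. pd v f x / f x)" for v
  using assms by (intro smo_intros smo_pd) auto
qed (rule assms)

lemma smo_LnI [smo_intros]:
 assumes "smo S f" "!!x. x \<in> S ==> f x \<notin> \<real>\<^sub>\<le>\<^sub>0" "open S" shows "smo S (%x. Ln (f x))"
proof (rule smo_logarithm[of S _ f])
 show "continuous_on S (%x. Ln (f x))"
  by (rule continuous_on_Ln'[OF smo_continuous]) (use assms in auto)
 show "f x = exp (Ln (f x))" if "x \<in> S" for x
  using assms(2)[OF that] by (subst exp_Ln) auto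
qed (use assms in auto)


section \<open>Smoothness on arbitrary subsets through local extensions\<close>

lemma smo_imp_smooth_on:
 assumes "smo S f" "open S" shows "smooth_on S f"
 unfolding smooth_on_def by (intro ballI exI[of _ S] exI[of _ f]) (use assms in \<open>auto simp: smo_def\<close>)

lemma smooth_on_iff_smo: "smooth_on S f \<longleftrightarrow> (\<forall>x\<in>S. \<exists>W F. open W & x \<in> W & smo W F & (\<forall>y\<in>S \<inter> W. F y = f y))"
 unfolding smooth_on_def smo_def ..

lemma smooth_onE:
 assumes "smooth_on S f" "x \<in> S"
 obtains W F where "open W" "x \<in> W" "smo W F" "\<forall>y\<in>S \<inter> W. F y = f y"
proof -
 have "\<exists>W F. open W & x \<in> W & smo W F & (\<forall>y\<in>S \<inter> W. F y = f y)"
  using assms unfolding smooth_on_iff_smo by (rule bspec)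
 then show thesis by (elim exE conjE) (rule that)
qed

lemma smooth_onI:
 assumes "!!x. x \<in> S ==> \<exists>W F. open W & x \<in> W & smo W F & (\<forall>y\<in>S \<inter> W. F y = f y)"
 shows "smooth_on S f"
 unfolding smooth_on_iff_smo by (rule ballI) (rule assms)

lemma smooth_on_open_iff: "open S ==> smooth_on S f \<longleftrightarrow> smo S f"
proof
 assume S: "open S" and f: "smooth_on S f"
 show "smo S f"
 proof (rule smo_local)
  fix x assume x: "x \<in> S"
  then obtain W F where W: "open W" "x \<in> W" "smo W F" "\<forall>y\<in>S \<inter> W. F y = f y"
   by (rule smooth_onE[OF f])
  then have "smo (S \<inter> W) f" using S by (intro smo_transform[OF smo_subset[OF W(3)]]) auto
  then show "\<exists>W. open W & x \<in> W & smo W f" using S W x by blast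
 qed
qed (rule smo_imp_smooth_on)

lemma smooth_on_subset: 
 assumes f: "smooth_on S f" and T: "T \<subseteq> S" shows "smooth_on T f"
proof (rule smooth_onI)
 fix x assume "x \<in> T"
 then have x: "x \<in> S" using T by auto
 obtain W F where W: "open W" "x \<in> W" "smo W F" "\<forall>y\<in>S \<inter> W. F y = f y"
  by (rule smooth_onE[OF f x])
 show "\<exists>W F. open W & x \<in> W & smo W F & (\<forall>y\<in>T \<inter> W. F y = f y)"
  by (rule exI[of _ W], rule exI[of _ F]) (use W T in auto)
qed

lemma smo_smooth_on: "smo W f ==> open W ==> S \<subseteq> W ==> smooth_on S f"
 by (rule smooth_on_subset[OF smo_imp_smooth_on])

lemma smooth_on_transform:
 assumes f: "smooth_on S g" and eq: "!!x. x \<in> S ==> f x = g x" shows "smooth_on S f"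
proof (rule smooth_onI)
 fix x assume x: "x \<in> S"
 obtain W F where W: "open W" "x \<in> W" "smo W F" "\<forall>y\<in>S \<inter> W. F y = g y"
  by (rule smooth_onE[OF f x])
 show "\<exists>W F. open W & x \<in> W & smo W F & (\<forall>y\<in>S \<inter> W. F y = f y)"
  by (rule exI[of _ W], rule exI[of _ F]) (use W eq in auto)
qed

lemma smooth_on_local:
 assumes "!!x. x \<in> S ==> \<exists>W. open W & x \<in> W & smooth_on (S \<inter> W) f"
 shows "smooth_on S f"
proof (rule smooth_onI)
 fix x assume x: "x \<in> S"
 obtain W where W: "open W" "x \<in> W" "smooth_on (S \<inter> W) f" using assms[OF x] by blast
 obtain V F where V: "open V" "x \<in> V" "smo V F" "\<forall>y\<in>(S \<inter> W) \<inter> V. F y = f y"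
  by (rule smooth_onE[OF W(3), of x]) (use x W(2) in auto)
 then show "\<exists>W F. open W & x \<in> W & smo W F & (\<forall>y\<in>S \<inter> W. F y = f y)"
  using W smo_subset[OF V(3), of "W \<inter> V"] by (intro exI[of _ "W \<inter> V"] exI[of _ F]) auto
qed

lemma smooth_on_continuous: "smooth_on S f ==> continuous_on S f"
proof -
 assume f: "smooth_on S f"
 have "continuous (at x within S) f" if x: "x \<in> S" for x
 proof -
  obtain W F where W: "open W" "x \<in> W" "smo W F" "\<forall>y\<in>S \<inter> W. F y = f y"
   by (rule smooth_onE[OF f x])
  have "isCont F x" using W smo_continuous continuous_on_eq_continuous_at by blast
  then have "continuous (at x within S) F" using continuous_at_imp_continuous_at_within by blast
  then show ?thesis
   by (rule continuous_transform_within_openin[where S="S \<inter> W"]) (use W x in auto)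
 qed
 then show ?thesis by (simp add: continuous_on_eq_continuous_within)
qed

lemma smooth_on_compose:
 assumes "smooth_on T g" "smooth_on S f" "f ` S \<subseteq> T"
 shows "smooth_on S (%x. g (f x))"
proof (rule smooth_onI)
 fix x assume x: "x \<in> S"
 obtain V F where V: "open V" "x \<in> V" "smo V F" "\<forall>y\<in>S \<inter> V. F y = f y"
  by (rule smooth_onE[OF assms(2) x])
 have fx: "f x \<in> T" using x assms(3) by auto
 obtain W G where W: "open W" "f x \<in> W" "smo W G" "\<forall>y\<in>T \<inter> W. G y = g y"
  by (rule smooth_onE[OF assms(1) fx])
 let ?U = "V \<inter> F -` W"
 have o: "open ?U" using V W smo_continuous continuous_open_preimage by blast
 have "smo ?U (%y. G (F y))"
  by (rule smo_compose[OF W(3) smo_subset[OF V(3)]]) (use V W o in auto)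
 moreover have "\<forall>y\<in>S \<inter> ?U. G (F y) = g (f y)" "x \<in> ?U" using V W x assms(3) by auto
 ultimately show "\<exists>W F. open W & x \<in> W & smo W F & (\<forall>y\<in>S \<inter> W. F y = g (f y))"
  using o by blast
qed

lemma smooth_on_compose_smo:
 "smo T g ==> open T ==> smooth_on S f ==> f ` S \<subseteq> T ==> smooth_on S (%x. g (f x))"
 by (rule smooth_on_compose[OF smo_imp_smooth_on])

lemma smooth_on_smo_compose:
 "smooth_on T g ==> smo S f ==> open S ==> f ` S \<subseteq> T ==> smo S (%x. g (f x))"
 using smooth_on_compose[of T g S f] by (simp add: smooth_on_open_iff)

lemma smooth_on_Pair:
 assumes "smooth_on S f" "smooth_on S g" shows "smooth_on S (%x. (f x, g x))"
proof (rule smooth_onI)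
 fix x assume x: "x \<in> S"
 obtain V F where V: "open V" "x \<in> V" "smo V F" "\<forall>y\<in>S \<inter> V. F y = f y"
  by (rule smooth_onE[OF assms(1) x])
 obtain W G where W: "open W" "x \<in> W" "smo W G" "\<forall>y\<in>S \<inter> W. G y = g y"
  by (rule smooth_onE[OF assms(2) x])
 show "\<exists>W F. open W & x \<in> W & smo W F & (\<forall>y\<in>S \<inter> W. F y = (f y, g y))"
  using V W smo_subset[OF V(3), of "V \<inter> W"] smo_subset[OF W(3), of "V \<inter> W"]
  by (intro exI[of _ "V \<inter> W"] exI[of _ "%y. (F y, G y)"]) (auto intro!: smo_Pair)
qed

section \<open>Directed cones along a planar vector field\<close>

lemma continuous_on_frac:
 fixes g :: "real => 'a::topological_space"
 assumes g: "continuous_on {0..1} g" and "g 0 = g 1"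
 shows "continuous_on UNIV (%x. g (frac x))"
proof -
 have k: "continuous_on {of_int k..of_int k + 1} (%x. g (frac x))" for k
 proof (rule continuous_on_eq)
  show "continuous_on {of_int k..of_int k + 1} (%x. g (x - of_int k))"
   by (rule continuous_on_compose2[OF g]) (auto intro!: continuous_intros)
  show "g (x - of_int k) = g (frac x)" if "x \<in> {of_int k..of_int k + 1}" for x
  proof (cases "x = of_int k + 1")
   case True
   then have "x = of_int (k + 1)" by simp
   then have "frac x = 0" by (simp only: frac_of_int)
   then show ?thesis using True assms(2) by simp
  next
   case False
   then have "\<lfloor>x\<rfloor> = k" using that by (intro floor_unique) auto
   then show ?thesis by (simp add: frac_def)
  qed
 qed
 have "isCont (%x. g (frac x)) x" for x
 proof -
  define j where "j = \<lfloor>x\<rfloor>"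
  have x: "of_int j <= x" "x < of_int j + 1" unfolding j_def by linarith+
  \<comment> \<open>Two neighbouring closed unit intervals together form a neighbourhood of x, also
    when x is an integer.\<close>
  let ?T = "{of_int (j-1)..of_int (j-1) + 1} \<union> {of_int j..of_int j + 1::real}"
  have "continuous_on ?T (%x. g (frac x))"
   by (intro continuous_on_closed_Un k closed_atLeastAtMost)
  moreover have "x \<in> interior ?T"
   by (rule interiorI[of "{of_int j - 1<..<of_int j + 1}"]) (use x in auto)
  ultimately show ?thesis by (rule continuous_on_interior)
 qed
 then show ?thesis by (simp add: continuous_at_imp_continuous_on)
qed

text \<open>Two logarithms of one number differ by a multiple of 2 \<pi> \<i>, so h takes values in
  a discrete set and connectedness does the rest. The winding arguments below rest on this.\<close>

lemma exp_const_imp_const: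
 fixes h :: "'a::topological_space => complex"
 assumes "connected S" "continuous_on S h" "!!p. p \<in> S ==> exp (h p) = w" "p \<in> S" "q \<in> S"
 shows "h p = h q"
proof -
 have "h constant_on S"
 proof (rule continuous_discrete_range_constant[OF assms(1,2)])
  fix x assume x: "x \<in> S"
  have "1 <= norm (h y - h x)" if "y \<in> S" "h y ~= h x" for y
  proof -
   have "exp (h y) = exp (h x)" using assms(3) x that by simp
   then obtain n :: int where n: "h y = h x + (of_int (2 * n) * pi) * \<i>" unfolding exp_eq by blast
   then have "n ~= 0" using that by auto
   then have "1 <= \<bar>real_of_int n\<bar>" by linarith
   moreover have "norm (h y - h x) = 2 * \<bar>real_of_int n\<bar> * pi" using n by (simp add: norm_mult)
   moreover have "2 * \<bar>real_of_int n\<bar> * pi \<ge> 2 * 1 * pi"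
    using \<open>1 <= \<bar>real_of_int n\<bar>\<close> by (intro mult_mono) auto
   ultimately show ?thesis using pi_gt3 by linarith
  qed
  then show "\<exists>e>0. \<forall>y. y \<in> S & h y ~= h x --> e <= norm (h y - h x)" by (intro exI[of _ 1]) auto
 qed
 then show ?thesis using assms(4,5) unfolding constant_on_def by auto
qed

text \<open>Hopf's argument: with \<open>\<alpha> (x, d)\<close> a continuous logarithm of the secant from \<open>x\<close> to \<open>x + d\<close>,
 the difference of the logarithms for the secants \<open>(x + d, 1 - d)\<close> and \<open>(x, d)\<close> is a constant odd
 multiple of \<open>\<i> \<pi>\<close>; applying this twice, the tangent direction turns by a nonzero
 multiple of \<open>2 \<pi>\<close>.\<close>

lemma no_simple_loop_along_field:
 fixes \<gamma> :: "real => complex" and \<theta> :: "real => real"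
 assumes cont: "continuous_on UNIV \<gamma>" "continuous_on UNIV \<theta>"
  and per: "!!x. \<gamma> (x + 1) = \<gamma> x" "!!x. \<theta> (x + 1) = \<theta> x"
  and simple: "!!x d. 0 < d ==> d < 1 ==> \<gamma> (x + d) ~= \<gamma> x"
  and d0: "0 < d0" "d0 < 1" and cone: "!!x. Re ((\<gamma> (x + d0) - \<gamma> x) * cnj (cis (\<theta> x))) > 0"
 shows False
proof -
 let ?S = "UNIV \<times> {0<..<1::real} :: (real \<times> real) set"
 define f where "f p = \<gamma> (fst p + snd p) - \<gamma> (fst p)" for p
 have cS: "convex ?S" by (intro convex_Times convex_UNIV convex_real_interval)
 have \<gamma>c: "continuous_on T (%p. \<gamma> (g p))" if "continuous_on T g" for T :: "'b::topological_space set" and g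
  by (rule continuous_on_compose2[OF cont(1) that]) auto
 have fc: "continuous_on ?S f" unfolding f_def by (intro continuous_intros \<gamma>c)
 obtain \<alpha> where \<alpha>: "continuous_on ?S \<alpha>" "!!p. p \<in> ?S ==> f p = exp (\<alpha> p)"
  using continuous_logarithm_on_contractible[OF fc convex_imp_contractible[OF cS]] simple
  unfolding f_def by (metis (no_types, lifting) SigmaE eq_iff_diff_eq_0 fst_conv greaterThanLessThan_iff snd_conv)
 define h where "h p = \<alpha> (fst p + snd p, 1 - snd p) - \<alpha> p" for p
 have hc: "continuous_on ?S h" unfolding h_def
  by (intro continuous_on_diff \<alpha>(1) continuous_on_compose2[OF \<alpha>(1)]) (auto intro!: continuous_intros)
 have "exp (h p) = -1" if "p \<in> ?S" for p
 proof -
  obtain x d where p: "p = (x, d)" "0 < d" "d < 1" using \<open>p \<in> ?S\<close> by auto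
  have "exp (h p) = f (x + d, 1 - d) / f p"
   using p \<alpha>(2)[of p] \<alpha>(2)[of "(x + d, 1 - d)"] by (simp add: h_def exp_diff)
  also have "f (x + d, 1 - d) = - f p" using p per(1)[of x] by (simp add: f_def)
  finally have "exp (h p) = - f p / f p" .
  moreover have "f p ~= 0" using p simple[of d x] by (simp add: f_def)
  ultimately show ?thesis by simp
 qed
 then have hconst: "h p = h q" if "p \<in> ?S" "q \<in> ?S" for p q
  using exp_const_imp_const[OF convex_connected[OF cS] hc] that by blast
 let ?c = "h (0, d0)"
 have c: "exp ?c = -1" using \<open>!!p. p \<in> ?S ==> exp (h p) = -1\<close> d0 by auto
 \<comment> \<open>The two differences are \<alpha> (d0, 1 - d0) - \<alpha> (0, d0) and \<alpha> (1,
   d0) - \<alpha> (d0, 1 - d0); they telescope to the change of the secant logarithm over one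
   period.\<close>
 have "h (0, d0) = ?c" "h (d0, 1 - d0) = ?c" using d0 by (auto intro!: hconst)
 then have 1: "\<alpha> (1, d0) = \<alpha> (0, d0) + 2 * ?c" unfolding h_def by simp
 \<comment> \<open>The cone condition puts the secant, seen relative to the field, into the right
   half plane, so its principal logarithm is continuous and periodic. As \<theta> is periodic too,
   the secant logarithm returns to its value after one period, which forces \<open>?c\<close> to be
   0.\<close>
 define L where "L x = Ln (f (x, d0) * cnj (cis (\<theta> x)))" for x
 define k where "k x = \<alpha> (x, d0) - \<i> * of_real (\<theta> x) - L x" for x
 have fcx: "continuous_on UNIV (%x. f (x, d0))" unfolding f_def by (simp, intro continuous_intros \<gamma>c)
 have Lc: "continuous_on UNIV L" unfolding L_def
  by (intro continuous_on_Ln' continuous_on_mult fcx continuous_on_cnj continuous_on_compose2[OF continuous_on_cis[OF continuous_on_id] cont(2)])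
    (use cone in \<open>auto simp: f_def complex_nonpos_Reals_iff not_le[symmetric]\<close>)
 have kc: "continuous_on UNIV k" unfolding k_def
  by (intro continuous_on_diff Lc continuous_on_mult continuous_on_const continuous_on_of_real cont
     continuous_on_compose2[OF \<alpha>(1)]) (use d0 in \<open>auto intro!: continuous_intros\<close>)
 have "exp (k x) = 1" for x
 proof -
  have nz: "f (x, d0) * cnj (cis (\<theta> x)) ~= 0" using cone[of x] by (auto simp: f_def)
  have "exp (k x) = f (x, d0) / cis (\<theta> x) / (f (x, d0) * cnj (cis (\<theta> x)))"
   using d0 nz \<alpha>(2)[of "(x, d0)"] unfolding k_def L_def
   by (simp add: exp_diff cis_conv_exp[symmetric])
  also have "\<dots> = 1" using nz by (simp add: cis_cnj cis_inverse[symmetric] field_simps cis_mult)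
  finally show ?thesis .
 qed
 then have "k 1 = k 0" using exp_const_imp_const[OF connected_UNIV kc] by blast
 moreover have "L 1 = L 0" "\<theta> 1 = \<theta> 0"
  using per(1)[of 0] per(2)[of 0] per(1)[of d0] by (simp_all add: L_def f_def add.commute)
 ultimately have "\<alpha> (1, d0) = \<alpha> (0, d0)" unfolding k_def by simp
 with 1 have "?c = 0" by simp
 with c show False by simp
qed

text \<open>A shortest closed arc is simple. The cone condition at z = \<gamma> x keeps parameters
  with equal image more than \<eta> apart, so by compactness there is a coinciding pair with least
  gap; the arc between them, repeated periodically, contradicts the simple case.\<close>

lemma no_loop_along_field:
 fixes \<gamma> :: "real => complex" and \<theta> :: "complex => real"
 assumes cont: "continuous_on {a..b} \<gamma>" "continuous_on UNIV \<theta>" and ab: "a < b" and loop: "\<gamma> a = \<gamma> b"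
  and er: "\<eta> > 0" "r > 0"
  and cone: "!!x y z. a <= x ==> x < y ==> y <= b ==> y <= x + \<eta> ==> dist z (\<gamma> x) < r
   ==> Re ((\<gamma> y - \<gamma> x) * cnj (cis (\<theta> z))) > 0"
 shows False
proof -
 have loc: "\<gamma> x ~= \<gamma> y" if "a <= x" "x < y" "y <= b" "y <= x + \<eta>" for x y
  using cone[OF that, of "\<gamma> x"] er by auto
 let ?K = "{a..b} \<times> {a..b} :: (real \<times> real) set"
 define D where "D = {p \<in> ?K. \<gamma> (fst p) = \<gamma> (snd p) & fst p + \<eta> <= snd p}"
 have c1: "continuous_on ?K (%p. \<gamma> (fst p) - \<gamma> (snd p))"
  by (intro continuous_on_diff continuous_on_compose2[OF cont(1)]) (auto intro!: continuous_intros)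
 have "closed (?K \<inter> (%p. \<gamma> (fst p) - \<gamma> (snd p)) -` {0})"
  by (rule continuous_closed_preimage[OF c1]) (auto intro: closed_Times)
 moreover have "closed {p :: real \<times> real. fst p + \<eta> <= snd p}"
  by (intro closed_Collect_le continuous_intros)
 moreover have "D = ?K \<inter> ((?K \<inter> (%p. \<gamma> (fst p) - \<gamma> (snd p)) -` {0}) \<inter> {p. fst p + \<eta> <= snd p})"
  unfolding D_def by auto
 ultimately have "compact D"
  by (auto intro!: compact_Int_closed closed_Int compact_Times)
 moreover have "D ~= {}" using loc[of a b] ab loop unfolding D_def by (force intro!: exI[of _ "(a,b)"])
 moreover have "continuous_on D (%p. snd p - fst p)" by (intro continuous_intros)
 ultimately obtain p where p: "p \<in> D" "!!q. q \<in> D ==> snd p - fst p <= snd q - fst q"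
  using continuous_attains_inf[of D "%p. snd p - fst p"] by auto
 obtain s t where st: "p = (s, t)" by force
 have s: "a <= s" "s + \<eta> <= t" "t <= b" "\<gamma> s = \<gamma> t" using p(1) unfolding D_def st by auto
 define l where "l = t - s"
 have l: "l > 0" "l \<ge> \<eta>" "s + l = t" using s er unfolding l_def by auto
 have min: "\<gamma> x ~= \<gamma> y" if "s <= x" "x < y" "y <= t" "y - x < l" for x y
 proof (cases "y <= x + \<eta>")
  case True then show ?thesis using loc[of x y] that s by auto
 next
  case False
  show ?thesis
  proof
   assume "\<gamma> x = \<gamma> y"
   then have "(x, y) \<in> D" using False that s unfolding D_def by auto
   from p(2)[OF this] show False using that unfolding st l_def by simp
  qed
 qed
 define g where "g x = \<gamma> (s + l * x)" for x
 define G where "G x = g (frac x)" for x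
 have sx: "s + l * x \<in> {s..t}" if "0 <= x" "x <= 1" for x
  using that l mult_left_mono[of x 1 l] by auto
 have g: "continuous_on {0..1} g" unfolding g_def
  by (rule continuous_on_compose2[OF cont(1)]) (use s sx in \<open>force intro!: continuous_intros\<close>)+
 have g01: "g 0 = g 1" using s l by (simp add: g_def)
 have Gc: "continuous_on UNIV G" unfolding G_def by (rule continuous_on_frac[OF g g01])
 have Gper: "G (x + 1) = G x" for x by (simp add: G_def frac_1_eq)
 have "uniformly_continuous_on {0..1} g" by (rule compact_uniformly_continuous[OF g]) simp
 then obtain e where e: "e > 0" "!!x y. x \<in> {0..1} ==> y \<in> {0..1} ==> dist y x < e ==> dist (g y) (g x) < r"
  unfolding uniformly_continuous_on_def using er by metis
 \<comment> \<open>Small enough for the cone condition, as l * d0 <= \<eta>, and for uniform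
   continuity, as d0 < e: across the seam both arcs are tested against the same angle \<theta> (G
   x).\<close>
 define d0 where "d0 = min (min (e/2) (\<eta> / l / 2)) (1/2)"
 have d0: "0 < d0" "d0 < 1" "d0 < e"
  using e er l unfolding d0_def by (auto simp: min_def)
 have "l * d0 <= l * (\<eta> / l / 2)" using l unfolding d0_def by (intro mult_left_mono) auto
 then have d0': "l * d0 <= \<eta>" using l er by simp
 note d0 = d0 d0'
 show False
 proof (rule no_simple_loop_along_field[OF Gc continuous_on_compose2[OF cont(2) Gc] Gper _ _ d0(1,2)])
  fix x d :: real assume d: "0 < d" "d < 1"
  let ?A = "frac x" and ?B = "frac (x + d)"
  have fr: "0 <= ?A" "?A < 1" "0 <= ?B" "?B < 1" by (auto simp: frac_lt_1)
  have "?A ~= ?B"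
  proof
   assume "?A = ?B"
   then have "d = of_int (\<lfloor>x + d\<rfloor> - \<lfloor>x\<rfloor>)" by (simp add: frac_def)
   then show False using d by (smt (verit) of_int_0_less_iff of_int_less_1_iff)
  qed
  moreover have "g y ~= g z" if "0 <= y" "y < z" "z < 1" for y z
  proof -
   have "l * (z - y) < l * 1" using that l by (intro mult_strict_left_mono) auto
   then show ?thesis unfolding g_def using that l sx[of y] sx[of z]
    by (intro min) (auto simp: algebra_simps)
  qed
  ultimately show "G (x + d) ~= G x" unfolding G_def using fr
   by (metis linorder_neqE_linordered_idom)
 next
  fix x
  show "\<theta> (G (x + 1)) = \<theta> (G x)" by (simp add: Gper)
  let ?A = "frac x"
  have fr: "0 <= ?A" "?A < 1" by (auto simp: frac_lt_1)
  have ld: "l * d0 > 0" "a <= s + l * ?A" using l d0 fr s by (auto intro: add_increasing2)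
  show "Re ((G (x + d0) - G x) * cnj (cis (\<theta> (G x)))) > 0"
  proof (cases "?A + d0 < 1")
   case True
   then have "frac (x + d0) = ?A + d0"
    using d0 fr by (metis add.commute frac_add frac_eq less_eq_real_def)
   then show ?thesis unfolding G_def g_def using True fr d0 ld l sx[of "?A + d0"] s er
    by (intro cone) (auto simp: algebra_simps)
  next
   case False
   then have fB: "frac (x + d0) = ?A + d0 - 1"
    using d0 fr frac_add[of x d0] by (simp add: frac_eq)
   define B where "B = ?A + d0 - 1"
   have B: "0 <= B" "B < d0" using False fr unfolding B_def by auto
   \<comment> \<open>The secant crosses the seam and is split there. Both pieces point into the half
     plane of \<theta> (G x), the second one because \<gamma> s = g 1 lies within r of G x.\<close>
   have t1: "Re ((\<gamma> t - \<gamma> (s + l * ?A)) * cnj (cis (\<theta> (G x)))) > 0"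
   proof (rule cone)
    have "l * (1 - ?A) <= l * d0" using False l by (intro mult_left_mono) auto
    then show "t <= s + l * ?A + \<eta>" using d0 l by (simp add: algebra_simps)
    have "l * ?A < l * 1" using fr l by (intro mult_strict_left_mono) auto
    then show "s + l * ?A < t" using l by linarith
   qed (use sx[of ?A] fr s er in \<open>auto simp: G_def g_def\<close>)
   have t2: "Re ((\<gamma> (s + l * B) - \<gamma> s) * cnj (cis (\<theta> (G x)))) \<ge> 0"
   proof (cases "B = 0")
    case False
    have "l * B <= l * d0" using B l by (intro mult_left_mono) auto
    then have "s + l * B <= s + \<eta>" using d0 by linarith
    moreover have "dist (g ?A) (g 1) < r" using e(2)[of 1 ?A] fr False B d0 \<open>\<not> ?A + d0 < 1\<close>
     by (auto simp: dist_real_def)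
    ultimately have "Re ((\<gamma> (s + l * B) - \<gamma> s) * cnj (cis (\<theta> (G x)))) > 0"
     using B False d0 l s sx[of B] g01 by (intro cone) (auto simp: G_def g_def)
    then show ?thesis by simp
   qed simp
   have "G (x + d0) - G x = (\<gamma> t - \<gamma> (s + l * ?A)) + (\<gamma> (s + l * B) - \<gamma> s)"
    using s fB unfolding G_def g_def B_def by simp
   then show ?thesis using t1 t2 by (simp add: ring_distribs)
  qed
 qed auto
qed

text \<open>Steps of length below r within 60 degrees of the field. The strict inequality excludes w
  = z, and the margin 1/2 leaves room for a change of the unit direction by less than 1/2.\<close>

definition cone_step :: "real => (complex => real) => complex => complex => bool" where
 "cone_step r \<theta> z w \<longleftrightarrow> norm (w - z) < r & Re ((w - z) * cnj (cis (\<theta> z))) > norm (w - z) / 2"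

lemma tranclp_imp_chain:
 assumes "R\<^sup>+\<^sup>+ x y"
 shows "\<exists>m w. m > 0 & w 0 = x & w m = y & (\<forall>i<m. R (w i) (w (Suc i)))"
 using assms
proof (induction rule: tranclp_induct)
 case (base y)
 then show ?case by (intro exI[of _ 1] exI[of _ "%i. if i = 0 then x else y"]) auto
next
 case (step y z)
 then obtain m w where "m > 0 & w 0 = x & w m = y & (\<forall>i<m. R (w i) (w (Suc i)))" by blast
 then show ?case using step(2)
  by (intro exI[of _ "Suc m"] exI[of _ "%i. if i <= m then w i else z"]) (auto simp: less_Suc_eq le_Suc_eq)
qed

text \<open>A cyclic chain of steps is a closed polygon. Over a parameter interval of length at most
  1 its secants are nonnegative combinations of edges that start close together, so that all of them
  lie in one open half plane; \<open>no_loop_along_field\<close> applies with \<eta> = 1.\<close>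

lemma cone_step_acyclic:
 fixes \<theta> :: "complex => real"
 assumes \<theta>: "continuous_on UNIV \<theta>" and r: "r > 0"
  and near: "!!z w. dist z w < 3 * r ==> norm (cis (\<theta> z) - cis (\<theta> w)) < 1/2"
 shows "\<not> (cone_step r \<theta>)\<^sup>+\<^sup>+ x x"
proof
 assume "(cone_step r \<theta>)\<^sup>+\<^sup>+ x x"
 then obtain m w where m: "m > 0" "w 0 = x" "w m = x" "!!i. i < m ==> cone_step r \<theta> (w i) (w (Suc i))"
  using tranclp_imp_chain[of "cone_step r \<theta>" x x] by blast
 define e where "e i = w (Suc i) - w i" for i
 \<comment> \<open>\<open>cl (t - real i)\<close> is the portion of edge i covered at time t, so
   \<gamma> runs through one edge per unit of time.\<close>
 define cl where "cl t = max 0 (min 1 t)" for t :: real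
 define \<gamma> where "\<gamma> t = w 0 + (\<Sum>i<m. cl (t - real i) *\<^sub>R e i)" for t
 have e: "norm (e i) < r" "Re (e i * cnj (cis (\<theta> (w i)))) > norm (e i) / 2" if "i < m" for i
  using m(4)[OF that] unfolding cone_step_def e_def by auto
 have \<gamma>c: "continuous_on {0..real m} \<gamma>" unfolding \<gamma>_def cl_def by (intro continuous_intros)
 have tel: "w 0 + (\<Sum>i<k. e i) = w k" for k by (induction k) (auto simp: e_def add.assoc[symmetric])
 have seg: "\<gamma> t = w k + (t - real k) *\<^sub>R e k" if "k < m" "real k <= t" "t <= real k + 1" for k t
 proof -
  have "(\<Sum>i<m. cl (t - real i) *\<^sub>R e i) = (\<Sum>i<Suc k. cl (t - real i) *\<^sub>R e i)"
   using that by (intro sum.mono_neutral_right) (auto simp: cl_def)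
  also have "\<dots> = (\<Sum>i<k. e i) + (t - real k) *\<^sub>R e k"
   using that by (auto simp: cl_def intro!: sum.cong arg_cong2[where f="(+)"])
  finally show ?thesis using tel[of k] by (simp add: \<gamma>_def add.assoc[symmetric])
 qed
 have near_w: "dist (\<gamma> s) (w i) < r" if i: "i < m" "real i < s + 1" "s < real i + 1" "0 <= s" for s i
 proof (cases "real i <= s")
  case True
  have "norm ((s - real i) *\<^sub>R e i) <= 1 * norm (e i)"
   unfolding norm_scaleR using True i by (intro mult_right_mono) auto
  then show ?thesis using seg[of i s] True i e(1)[of i] by (simp add: dist_norm)
 next
  case False
  then obtain k where k: "i = Suc k" using i by (cases i) auto
  have "\<gamma> s - w i = (s - real i) *\<^sub>R e k"
   using seg[of k s] False i k tel[of i] tel[of k] by (simp add: e_def algebra_simps)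
  moreover have "norm ((s - real i) *\<^sub>R e k) <= 1 * norm (e k)"
   unfolding norm_scaleR using False i by (intro mult_right_mono) auto
  ultimately show ?thesis using e(1)[of k] i k by (simp add: dist_norm)
 qed
 show False
 proof (rule no_loop_along_field[OF \<gamma>c \<theta> _ _ _ r, where \<eta> = 1])
  have "\<gamma> 0 = w 0" using seg[of 0 0] m by simp
  moreover have "\<gamma> (real m) = w m"
   using seg[of "m - 1" "real m"] m by (simp add: e_def of_nat_diff)
  ultimately show "\<gamma> 0 = \<gamma> (real m)" using m by simp
 next
  fix s t z assume st: "0 <= s" "s < t" "t <= real m" "t <= s + 1" "dist z (\<gamma> s) < r"
  define c where "c i = cl (t - real i) - cl (s - real i)" for i
  have d: "\<gamma> t - \<gamma> s = (\<Sum>i<m. c i *\<^sub>R e i)"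
   unfolding \<gamma>_def c_def by (simp add: sum_subtractf[symmetric] scaleR_diff_left)
  have c0: "c i \<ge> 0" for i using st unfolding c_def cl_def by auto
  have pos: "Re (e i * cnj (cis (\<theta> z))) > 0" if i: "i < m" "c i ~= 0" for i
  proof -
   have "real i < s + 1" "s < real i + 1" using i(2) st unfolding c_def cl_def
    by (auto simp: max_def min_def split: if_splits)
   then have "dist (\<gamma> s) (w i) < r" using near_w i st by blast
   then have "dist z (w i) < 3 * r" using st(5) dist_triangle[of z "w i" "\<gamma> s"] r by linarith
   then have n: "norm (cis (\<theta> z) - cis (\<theta> (w i))) < 1/2" by (rule near)
   have nz: "norm (e i) > 0" using e(2)[OF i(1)] by auto
   have "\<bar>Re (e i * cnj (cis (\<theta> z) - cis (\<theta> (w i))))\<bar> <= norm (e i) * norm (cis (\<theta> z) - cis (\<theta> (w i)))"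
    by (metis abs_Re_le_cmod complex_mod_cnj norm_mult)
   also have "\<dots> <= norm (e i) * (1/2)" using n by (intro mult_left_mono) auto
   finally show ?thesis using e(2)[OF i(1)]
    by (simp only: right_diff_distrib complex_cnj_diff minus_complex.simps)
  qed
  \<comment> \<open>Strict positivity needs one edge of positive weight: the edge on which s
    lies.\<close>
  define k where "k = nat \<lfloor>s\<rfloor>"
  have k: "real k <= s" "s < real k + 1" "k < m" using st unfolding k_def by linarith+
  have ck: "c k > 0" using k st unfolding c_def cl_def by auto
  have "Re ((\<gamma> t - \<gamma> s) * cnj (cis (\<theta> z))) = (\<Sum>i<m. c i * Re (e i * cnj (cis (\<theta> z))))"
   unfolding d sum_distrib_right Re_sum by (intro sum.cong) auto
  also have "\<dots> > 0"
  proof (rule sum_pos2[of _ k])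
   show "c i * Re (e i * cnj (cis (\<theta> z))) \<ge> 0" if "i \<in> {..<m}" for i
    using c0[of i] pos[of i] that by (cases "c i = 0") auto
   show "0 < c k * Re (e k * cnj (cis (\<theta> z)))" using ck k pos[of k] by auto
  qed (use k in auto)
  finally show "Re ((\<gamma> t - \<gamma> s) * cnj (cis (\<theta> z))) > 0" .
 qed (use m in auto)
qed

section \<open>A function increasing along a planar direction field\<close>

lemma line_deriv:
 fixes f :: "'a::euclidean_space => real"
 assumes "f differentiable (at (z + s *\<^sub>R v))"
 shows "((%t. f (z + t *\<^sub>R v)) has_real_derivative pd v f (z + s *\<^sub>R v)) (at s)"
proof -
 have "((%t. z + t *\<^sub>R v) has_derivative (%h. h *\<^sub>R v)) (at s)"
  by (auto intro!: derivative_eq_intros)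
 from has_derivative_compose[OF this has_pd[OF assms]]
 have "((%t. f (z + t *\<^sub>R v)) has_derivative (%h. pd (h *\<^sub>R v) f (z + s *\<^sub>R v))) (at s)" .
 moreover have "(%h. pd (h *\<^sub>R v) f (z + s *\<^sub>R v)) = (%h. pd v f (z + s *\<^sub>R v) * h)"
  using has_derivative_linear[OF has_pd[OF assms]] by (auto simp: linear_cmul)
 ultimately show ?thesis by (simp add: has_field_derivative_def)
qed

lemma pd_linear: "f differentiable (at x) ==> linear (%v. pd v f x)"
 using has_derivative_linear[OF has_pd] .

lemma pd_basis_sum:
 fixes f :: "'a::euclidean_space => 'b::euclidean_space"
 assumes "f differentiable (at x)"
 shows "pd v f x = (\<Sum>b\<in>Basis. (v \<bullet> b) *\<^sub>R pd b f x)"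
proof -
 have "pd v f x = pd (\<Sum>b\<in>Basis. (v \<bullet> b) *\<^sub>R b) f x" by (simp add: euclidean_representation)
 also have "\<dots> = (\<Sum>b\<in>Basis. (v \<bullet> b) *\<^sub>R pd b f x)"
  using pd_linear[OF assms] by (simp only: linear_sum linear_cmul)
 finally show ?thesis .
qed

lemma uniformly_continuous_const_outside:
 fixes f :: "'a::euclidean_space => 'b::metric_space"
 assumes f: "continuous_on UNIV f" and c: "!!x. norm x > \<rho> ==> f x = c"
 shows "uniformly_continuous_on UNIV f"
 unfolding uniformly_continuous_on_def
proof (intro allI impI)
 fix e :: real assume e: "e > 0"
 have "uniformly_continuous_on (cball 0 (\<rho> + 2)) f"
  by (rule compact_uniformly_continuous[OF continuous_on_subset[OF f]]) auto
 then obtain d where d: "d > 0" "!!x y. x \<in> cball 0 (\<rho>+2) ==> y \<in> cball 0 (\<rho>+2) ==> dist y x < d ==> dist (f y) (f x) < e"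
  unfolding uniformly_continuous_on_def using e by meson
 have "dist (f y) (f x) < e" if "dist y x < min d 1" for x y
 proof (cases "norm x <= \<rho> + 1")
  case True
  moreover have "norm y <= norm x + dist y x" by (metis dist_norm norm_triangle_sub)
  ultimately show ?thesis using d(2)[of x y] that by auto
 next
  case False
  have "norm x <= norm y + dist y x" by (metis dist_norm dist_commute norm_triangle_sub)
  then have "norm y > \<rho>" using False that by auto
  then show ?thesis using c[of x] c[of y] False e by simp
 qed
 then show "\<exists>d>0. \<forall>x\<in>UNIV. \<forall>x'\<in>UNIV. dist x' x < d --> dist (f x') (f x) < e"
  using d(1) by (intro exI[of _ "min d 1"]) auto
qed

section \<open>Flat functions and smooth steps\<close>

definition flat :: "nat => real => real" where
 "flat n x = (if x <= 0 then 0 else inverse x ^ n * exp (- inverse x))"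

lemma flat_tendsto_0: "(flat n \<longlongrightarrow> 0) (at 0)"
proof (rule filterlim_split_at)
 have "eventually (%x. 0 = flat n x) (at_left 0)"
  by (auto simp: flat_def eventually_at_filter)
 then show "(flat n \<longlongrightarrow> 0) (at_left 0)" by (rule Lim_transform_eventually[rotated]) simp
 have "((%x. inverse x ^ n / exp (inverse x)) \<longlongrightarrow> (0::real)) (at_right 0)"
  by (rule filterlim_compose[OF tendsto_power_div_exp_0 filterlim_inverse_at_top_right])
 moreover have "eventually (%x. inverse x ^ n / exp (inverse x) = flat n x) (at_right 0)"
  by (auto simp: flat_def eventually_at_filter exp_minus divide_inverse)
 ultimately show "(flat n \<longlongrightarrow> 0) (at_right 0)" by (rule Lim_transform_eventually)
qed

text \<open>The exponent n exists for the sake of this formula: up to linear combinations the family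
  is closed under differentiation, so smoothness becomes an induction over the order for all n at
  once. At 0 the difference quotient is \<open>flat (n+1)\<close>, which tends to 0.\<close>

lemma flat_deriv: "(flat n has_real_derivative (flat (n+2) x - real n * flat (n+1) x)) (at x)"
proof -
 consider "x < 0" | "x = 0" | "x > 0" by linarith
 then show ?thesis
 proof cases
  case 1
  have "((%x. 0) has_real_derivative 0) (at x)" by simp
  then have "(flat n has_real_derivative 0) (at x)"
   by (rule has_field_derivative_transform_within_open[of _ _ _ "{..<0}"]) (use 1 in \<open>auto simp: flat_def\<close>)
  then show ?thesis using 1 by (simp add: flat_def)
 next
  case 2
  have "eventually (%h. flat (n+1) h = (flat n (0 + h) - flat n 0) / h) (at 0)"
   by (auto simp: flat_def eventually_at_filter divide_inverse)
  then have "(flat n has_real_derivative 0) (at 0)"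
   unfolding DERIV_def by (rule Lim_transform_eventually[rotated]) (rule flat_tendsto_0)
  then show ?thesis using 2 by (simp add: flat_def)
 next
  case 3
  have p: "inverse x ^ n * real n * (inverse x) = real n * (inverse x ^ (n - Suc 0) * inverse x * inverse x)"
   by (cases n) simp_all
  have "((%x. inverse x ^ n * exp (- inverse x)) has_real_derivative
    (real n * (- (inverse x * 1 * inverse x) * inverse x ^ (n - Suc 0))) * exp (- inverse x)
    + exp (- inverse x) * - (- (inverse x * 1 * inverse x)) * inverse x ^ n) (at x)"
   using 3 by (intro DERIV_mult DERIV_power DERIV_inverse' DERIV_ident DERIV_fun_exp DERIV_minus) auto
  then have "(flat n has_real_derivative (real n * (- (inverse x * 1 * inverse x) * inverse x ^ (n - Suc 0))) * exp (- inverse x)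
    + exp (- inverse x) * - (- (inverse x * 1 * inverse x)) * inverse x ^ n) (at x)"
   by (rule has_field_derivative_transform_within_open[of _ _ _ "{0<..}"]) (use 3 in \<open>auto simp: flat_def\<close>)
  moreover have "(real n * (- (inverse x * 1 * inverse x) * inverse x ^ (n - Suc 0))) * exp (- inverse x)
    + exp (- inverse x) * - (- (inverse x * 1 * inverse x)) * inverse x ^ n
    = flat (n+2) x - real n * flat (n+1) x"
   using 3 by (cases n) (simp_all add: flat_def algebra_simps)
  ultimately show ?thesis by simp
 qed
qed

lemma smo_flat: "smo UNIV (flat n)"
proof -
 have "Ck_on k (flat n) UNIV" for k
 proof (induction k arbitrary: n)
  case 0
  then show ?case using flat_deriv DERIV_isCont by (simp, intro continuous_at_imp_continuous_on) blast
 next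
  case (Suc k)
  have d: "(flat n has_derivative (%v. (flat (n+2) x - real n * flat (n+1) x) * v)) (at x)" for x
   using flat_deriv[of n x] by (simp add: has_field_derivative_def)
  have "Ck_on k (%x. (flat (n+2) x + (- real n) * flat (n+1) x) * v) UNIV" for v
   by (intro Ck_bilinear[OF bounded_bilinear_mult] Ck_add Suc.IH Ck_const open_UNIV)
  then have "Ck_on k (pd v (flat n)) UNIV" for v
   by (rule Ck_transform) (auto simp: pd_eq[OF d])
  then show ?case using d by (auto simp: differentiable_def)
 qed
 then show ?thesis by (simp add: smo_def)
qed

definition stp :: "real => real" where
 "stp x = flat 0 x / (flat 0 x + flat 0 (1 - x))"

lemma flat_simps [simp]: "x <= 0 ==> flat n x = 0" "0 <= flat n x" "0 < flat n x \<longleftrightarrow> x > 0"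
 by (auto simp: flat_def)

lemma stp_denom_pos: "flat 0 x + flat 0 (1 - x) > 0"
 by (cases "x > 0") (auto intro: add_pos_nonneg add_nonneg_pos)

lemma smo_flatI [smo_intros]: "smo S f ==> open S ==> smo S (%x. flat n (f x))"
 by (rule smo_compose_UNIV[OF smo_flat])

lemma smo_stp: "smo UNIV stp"
 unfolding stp_def[abs_def] using stp_denom_pos by (intro smo_intros open_UNIV) (metis less_irrefl)

lemma smo_stpI [smo_intros]: "smo S f ==> open S ==> smo S (%x. stp (f x))"
 by (rule smo_compose_UNIV[OF smo_stp])

lemma stp_simps [simp]: "x <= 0 ==> stp x = 0" "x \<ge> 1 ==> stp x = 1" "0 <= stp x" "stp x <= 1"
proof -
 show "x <= 0 ==> stp x = 0" "0 <= stp x" by (auto simp: stp_def)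
 show "stp x = 1" if "x \<ge> 1"
 proof -
  have "flat 0 x > 0" "flat 0 (1 - x) = 0" using that by simp_all
  then show ?thesis by (simp add: stp_def del: flat_simps)
 qed
 show "stp x <= 1" using stp_denom_pos[of x] by (auto simp: stp_def divide_le_eq)
qed

section \<open>Mollification of indicator functions\<close>

lemma pd_zero_outside:
 fixes f :: "'a::euclidean_space => 'b::euclidean_space"
 assumes "!!x. norm x > \<rho> ==> f x = 0" "norm x > \<rho>"
 shows "pd v f x = 0"
proof -
 have "open {x::'a. norm x > \<rho>}" by (intro open_Collect_less continuous_intros)
 then have "pd v f x = pd v (%x. 0) x" by (rule pd_cong) (use assms in auto)
 then show ?thesis using pd_eq[OF has_derivative_const] by metis
qed

text \<open>The partial derivatives vanish outside a ball and are therefore uniformly continuous,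
  which makes the remainder estimate uniform in w. This uniformity is what permits differentiation
  under the integral below.\<close>

lemma uniformly_differentiable:
 fixes ph :: "'a::euclidean_space => real"
 assumes ph: "smo UNIV ph" "!!x. norm x > \<rho> ==> ph x = 0" and e: "e > 0"
 shows "\<exists>\<delta>>0. \<forall>w h. norm h < \<delta> --> \<bar>ph (w + h) - ph w - pd h ph w\<bar> <= e * norm h"
proof -
 define e' where "e' = e / real DIM('a)"
 have e': "e' > 0" "real DIM('a) * e' = e" using e by (auto simp: e'_def)
 have dph: "ph differentiable (at x)" for x using smo_differentiable[OF ph(1)] by simp
 have "\<exists>d>0. \<forall>x y. dist y x < d --> dist (pd b ph y) (pd b ph x) < e'" for b
 proof -
  have "uniformly_continuous_on UNIV (pd b ph)"
   by (rule uniformly_continuous_const_outside[OF smo_continuous[OF smo_pd[OF ph(1)]]])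
     (rule pd_zero_outside[OF ph(2)])
  then show ?thesis using e'(1) unfolding uniformly_continuous_on_def by auto
 qed
 then obtain D where D: "!!b. D b > 0" "!!b x y. dist y x < D b ==> dist (pd b ph y) (pd b ph x) < e'"
  by metis
 define \<delta> where "\<delta> = Min (D ` Basis)"
 have \<delta>: "\<delta> > 0" "!!b. b \<in> Basis ==> \<delta> <= D b" using D(1) by (auto simp: \<delta>_def)
 have "\<bar>ph (w + h) - ph w - pd h ph w\<bar> <= e * norm h" if h: "norm h < \<delta>" for w h
 proof -
  obtain t where t: "0 < t" "t < 1" "ph (w + 1 *\<^sub>R h) - ph (w + 0 *\<^sub>R h) = (1 - 0) * pd h ph (w + t *\<^sub>R h)"
   using MVT2[of 0 1 "%t. ph (w + t *\<^sub>R h)" "%t. pd h ph (w + t *\<^sub>R h)"] line_deriv[OF dph] by auto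
  have "norm (t *\<^sub>R h) <= norm h" using t by (simp add: mult_left_le_one_le)
  then have near: "dist (w + t *\<^sub>R h) w < \<delta>" using h by (simp add: dist_norm)
  have "ph (w + h) - ph w - pd h ph w = pd h ph (w + t *\<^sub>R h) - pd h ph w" using t by simp
  also have "\<dots> = (\<Sum>b\<in>Basis. (h \<bullet> b) * (pd b ph (w + t *\<^sub>R h) - pd b ph w))"
   by (subst (1 2) pd_basis_sum[OF dph]) (simp add: sum_subtractf[symmetric] right_diff_distrib)
  also have "\<bar>\<dots>\<bar> <= (\<Sum>b\<in>(Basis::'a set). norm h * e')"
  proof (rule order_trans[OF sum_abs], rule sum_mono)
   fix b :: 'a assume b: "b \<in> Basis"
   have "\<bar>pd b ph (w + t *\<^sub>R h) - pd b ph w\<bar> <= e'"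
    using D(2)[of "w + t *\<^sub>R h" w b] near \<delta>(2)[OF b] by (simp add: dist_real_def)
   then show "\<bar>(h \<bullet> b) * (pd b ph (w + t *\<^sub>R h) - pd b ph w)\<bar> <= norm h * e'"
    unfolding abs_mult using Basis_le_norm[OF b, of h] by (intro mult_mono) auto
  qed
  also have "\<dots> = e * norm h" using e'(2) by simp
  finally show ?thesis .
 qed
 then show ?thesis using \<delta>(1) by blast
qed

text \<open>An average of the indicator of I around z with weight \<open>ph\<close>, see
  \<open>conv_shift\<close>. With z placed in the argument of \<open>ph\<close>, derivatives fall on
  the smooth factor, at the price of a minus sign.\<close>

definition conv :: "('a::euclidean_space => real) => 'a set => 'a => real" where
 "conv ph I z = (LINT y|lborel. ph (y - z) * indicator I y)"

lemma conv_integrable: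
 fixes ph :: "'a::euclidean_space => real"
 assumes ph: "continuous_on UNIV ph" "!!x. norm x > \<rho> ==> ph x = 0" and I: "I \<in> sets borel"
 shows "integrable lborel (%y. ph (y - z) * indicator I y)"
proof -
 have "bounded (ph ` cball 0 \<rho>)"
  by (intro compact_imp_bounded compact_continuous_image continuous_on_subset[OF ph(1)]) auto
 then obtain B where "\<forall>x\<in>cball 0 \<rho>. \<bar>ph x\<bar> <= B" by (auto simp: bounded_iff simp del: mem_cball)
 then have B: "!!x. norm x <= \<rho> ==> \<bar>ph x\<bar> <= B" by auto
 have "continuous_on UNIV (%y. ph (y - z))"
  by (rule continuous_on_compose2[OF ph(1)]) (auto intro!: continuous_intros)
 then have m: "(%y. ph (y - z)) \<in> borel_measurable borel" by (rule borel_measurable_continuous_onI)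
 show ?thesis
 proof (rule integrableI_bounded_set[where A = "cball z \<rho>" and B = "\<bar>B\<bar>"])
  show "(%y. ph (y - z) * indicator I y) \<in> borel_measurable lborel" using m I by simp
  show "emeasure lborel (cball z \<rho>) < \<infinity>" using emeasure_bounded_finite[of "cball z \<rho>"] by simp
  show "AE x in lborel. x \<in> cball z \<rho> --> norm (ph (x - z) * indicator I x) <= \<bar>B\<bar>"
   using B by (intro AE_I2) (force simp: dist_norm norm_minus_commute abs_mult indicator_def)
  show "AE x in lborel. x \<notin> cball z \<rho> --> ph (x - z) * indicator I x = 0"
   using ph(2) by (intro AE_I2) (auto simp: dist_norm norm_minus_commute)
 qed simp
qed

lemma conv_has_derivative:
 fixes ph :: "'a::euclidean_space => real"
 assumes ph: "smo UNIV ph" "!!x. norm x > \<rho> ==> ph x = 0" and I: "I \<in> sets borel"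
 shows "(conv ph I has_derivative (%v. - conv (pd v ph) I z)) (at z)"
proof -
 have dph: "ph differentiable (at x)" for x using smo_differentiable[OF ph(1)] by simp
 have i1: "integrable lborel (%y. ph (y - z) * indicator I y)" for z
  by (rule conv_integrable[OF smo_continuous[OF ph(1)] ph(2) I])
 have i2: "integrable lborel (%y. pd v ph (y - z) * indicator I y)" for z v
  by (rule conv_integrable[OF smo_continuous[OF smo_pd[OF ph(1)]] pd_zero_outside[OF ph(2)] I])
 have lin: "linear (%v. - conv (pd v ph) I z)"
 proof (rule linearI)
  fix a b
  have "pd (a + b) ph y = pd a ph y + pd b ph y" for y using linear_add[OF pd_linear[OF dph]] .
  then show "- conv (pd (a + b) ph) I z = - conv (pd a ph) I z + - conv (pd b ph) I z"
   unfolding conv_def using i2 by (simp add: distrib_right)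
 next
  fix c a
  have "pd (c *\<^sub>R a) ph y = c * pd a ph y" for y using linear_cmul[OF pd_linear[OF dph]] by simp
  then show "- conv (pd (c *\<^sub>R a) ph) I z = c *\<^sub>R - conv (pd a ph) I z"
   unfolding conv_def by (simp add: mult.assoc)
 qed
 \<comment> \<open>For y within distance 1 of z, the translates of \<open>ph\<close> to y and to z
   vanish outside this ball, so the remainder is integrated over a set of fixed volume;
   \<open>e1\<close> is chosen below with e1 * V < e.\<close>
 define V where "V = measure lborel (cball z (\<rho> + 1))"
 show ?thesis
 proof (rule has_derivativeI_sandwich[of 1])
  show "bounded_linear (%v. - conv (pd v ph) I z)" using lin by (rule linear_conv_bounded_linear[THEN iffD1])
 next
  show "((%y. norm (conv ph I y - conv ph I z - - conv (pd (y - z) ph) I z) / norm (y - z)) \<longlongrightarrow> 0) (at z)"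
   unfolding tendsto_iff
  proof (intro allI impI)
   fix e :: real assume e: "e > 0"
   define e1 where "e1 = e / (2 * (V + 1))"
   have V: "V \<ge> 0" by (simp add: V_def)
   have V1: "0 < 2 * (V + 1)" using V by (intro mult_pos_pos add_nonneg_pos) auto
   have "V < 2 * (V + 1)" using V by (simp add: distrib_left)
   then have "e * V < e * (2 * (V + 1))" using e by (intro mult_strict_left_mono)
   then have e1: "e1 > 0" "e1 * V < e" unfolding e1_def
    using divide_pos_pos[OF e V1] by (simp_all only: times_divide_eq_left pos_divide_less_eq[OF V1])
   obtain \<delta> where \<delta>: "\<delta> > 0" "!!w h. norm h < \<delta> ==> \<bar>ph (w + h) - ph w - pd h ph w\<bar> <= e1 * norm h"
    using uniformly_differentiable[OF ph e1(1)] by blast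
   have "norm (conv ph I y - conv ph I z - - conv (pd (y - z) ph) I z) / norm (y - z) < e"
    if y: "y ~= z" "dist y z < min \<delta> 1" for y
   proof -
    let ?g = "%x. (ph (x - y) - ph (x - z) + pd (y - z) ph (x - z)) * indicator I x"
    have "conv ph I y - conv ph I z - - conv (pd (y - z) ph) I z = (LINT x|lborel. ?g x)"
     unfolding conv_def using i1 i2 by (simp add: distrib_right left_diff_distrib)
    moreover have "norm (LINT x|lborel. ?g x) <= (LINT x|lborel. (e1 * norm (y - z)) * indicator (cball z (\<rho> + 1)) x)"
    proof (rule Bochner_Integration.integral_norm_bound_integral)
     show "integrable lborel ?g"
      unfolding distrib_right left_diff_distrib using i1 i2 by auto
     show "integrable lborel (%x. e1 * norm (y - z) * indicator (cball z (\<rho> + 1)) x)"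
      by (intro integrable_mult_right integrable_real_indicator) (use emeasure_bounded_finite[of "cball z (\<rho> + 1)"] in auto)
     fix x
     show "norm (?g x) <= e1 * norm (y - z) * indicator (cball z (\<rho> + 1)) x"
     proof (cases "x \<in> cball z (\<rho> + 1)")
      case True
      have "\<bar>ph ((x - z) + (z - y)) - ph (x - z) - pd (z - y) ph (x - z)\<bar> <= e1 * norm (z - y)"
       by (rule \<delta>(2)) (use y in \<open>simp add: dist_norm norm_minus_commute\<close>)
      moreover have "pd (z - y) ph (x - z) = - pd (y - z) ph (x - z)"
       using linear_neg[OF pd_linear[OF dph], of "x - z" "y - z"] by simp
      ultimately show ?thesis using True e1
       by (auto simp: indicator_def norm_minus_commute)
     next
      case False
      then have 1: "norm (x - z) > \<rho> + 1" by (simp add: dist_norm norm_minus_commute)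
      have "norm (x - z) <= norm (x - y) + norm (y - z)" by (metis diff_add_cancel add_diff_eq norm_triangle_ineq)
      then have "norm (x - y) > \<rho>" using 1 y by (simp add: dist_norm)
      moreover have "pd (y - z) ph (x - z) = 0"
       by (rule pd_zero_outside[of \<rho>]) (use ph(2) 1 in auto)
      ultimately have "?g x = 0" using ph(2)[of "x - y"] ph(2)[of "x - z"] 1 by simp
      then show ?thesis using False by simp
     qed
    qed
    moreover have "(LINT x|lborel. (e1 * norm (y - z)) * indicator (cball z (\<rho> + 1)) x) = e1 * norm (y - z) * V"
     by (simp add: V_def)
    ultimately have "norm (conv ph I y - conv ph I z - - conv (pd (y - z) ph) I z) <= e1 * norm (y - z) * V"
     by (simp only: )
    also have "\<dots> < e * norm (y - z)"
     using mult_strict_right_mono[OF e1(2), of "norm (y - z)"] y by (simp add: mult_ac)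
    finally show ?thesis using y by (simp add: divide_less_eq)
   qed
   then have "\<forall>y. y ~= z & dist y z < min \<delta> 1 -->
     dist (norm (conv ph I y - conv ph I z - - conv (pd (y - z) ph) I z) / norm (y - z)) 0 < e"
    by simp
   then show "\<forall>\<^sub>F y in at z. dist (norm (conv ph I y - conv ph I z - - conv (pd (y - z) ph) I z) / norm (y - z)) 0 < e"
    unfolding eventually_at using \<delta>(1) by (intro exI[of _ "min \<delta> 1"]) auto
  qed
 qed auto
qed

lemma smo_conv:
 fixes ph :: "'a::euclidean_space => real"
 assumes ph: "smo UNIV ph" "!!x. norm x > \<rho> ==> ph x = 0" and I: "I \<in> sets borel"
 shows "smo UNIV (conv ph I)"
proof -
 have "Ck_on k (conv ph I) UNIV" for k
  using ph
 proof (induction k arbitrary: ph)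
  case 0
  show ?case using has_derivative_continuous[OF conv_has_derivative[OF 0 I]]
   by (simp add: continuous_on_eq_continuous_within)
 next
  case (Suc k)
  note d = conv_has_derivative[OF Suc.prems I]
  have "Ck_on k (pd v (conv ph I)) UNIV" for v
  proof (rule Ck_transform)
   have "Ck_on k (conv (pd v ph) I) UNIV"
    by (rule Suc.IH[OF smo_pd[OF Suc.prems(1)] pd_zero_outside[OF Suc.prems(2)]])
   then show "Ck_on k (%x. (-1) * conv (pd v ph) I x) UNIV"
    by (intro Ck_bilinear[OF bounded_bilinear_mult] Ck_const) auto
  qed (auto simp: pd_eq[OF d])
  then show ?case using d by (auto simp: differentiable_def)
 qed
 then show ?thesis by (simp add: smo_def)
qed

lemma conv_shift:
 fixes ph :: "'a::euclidean_space => real"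
 assumes "continuous_on UNIV ph" "I \<in> sets borel"
 shows "conv ph I z = (LINT w|lborel. ph w * indicator I (z + w))"
proof -
 have "continuous_on UNIV (%y. ph (y - z))"
  by (rule continuous_on_compose2[OF assms(1)]) (auto intro!: continuous_intros)
 then have m: "(%y. ph (y - z)) \<in> borel_measurable borel" by (rule borel_measurable_continuous_onI)
 have "conv ph I z = (LINT y|distr lborel borel ((+) z). ph (y - z) * indicator I y)"
  by (simp add: lborel_distr_plus conv_def)
 also have "\<dots> = (LINT w|lborel. ph w * indicator I (z + w))"
  using m assms(2) by (subst integral_distr) auto
 finally show ?thesis .
qed

lemma conv_shift_integrable:
 fixes ph :: "'a::euclidean_space => real"
 assumes ph: "continuous_on UNIV ph" "!!x. norm x > \<rho> ==> ph x = 0" and I: "I \<in> sets borel"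
 shows "integrable lborel (%w. ph w * indicator I (z + w))"
proof -
 have "(%w. z + w) \<in> measurable borel borel" by measurable
 then have "(%w. z + w) -` I \<inter> space borel \<in> sets borel" using I by (rule measurable_sets)
 then have pI: "(%w. z + w) -` I \<in> sets borel" by simp
 have "integrable lborel (%y. ph (y - 0) * indicator ((%w. z + w) -` I) y)"
  by (rule conv_integrable[OF ph(1) _ pI]) (rule ph(2))
 then show ?thesis by (simp add: indicator_def)
qed

definition bump :: "real => 'a::euclidean_space => real" where
 "bump ep w = flat 0 (ep\<^sup>2 - w \<bullet> w)"

lemma bump:
 assumes "ep > 0"
 shows "smo UNIV (bump ep :: 'a::euclidean_space => real)" "bump ep w \<ge> 0" "norm w \<ge> ep ==> bump ep w = 0"
  "norm w < ep ==> bump ep w > 0"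
proof -
 show "smo UNIV (bump ep :: 'a::euclidean_space => real)" unfolding bump_def[abs_def] by (intro smo_intros open_UNIV)
 show "bump ep w \<ge> 0" by (simp add: bump_def)
 show "norm w \<ge> ep ==> bump ep w = 0"
  using assms by (simp add: bump_def dot_square_norm power_mono)
 show "norm w < ep ==> bump ep w > 0"
  using assms by (simp add: bump_def dot_square_norm power_strict_mono)
qed

lemma bump_integral_pos:
 assumes ep: "ep > 0"
 shows "(LINT w|lborel. bump ep (w::'a::euclidean_space)) > 0"
proof -
 have c: "continuous_on UNIV (bump ep :: 'a => real)" using smo_continuous[OF bump(1)[OF ep]] .
 have i: "integrable lborel (bump ep :: 'a => real)"
 proof -
  have "integrable lborel (%w::'a. bump ep w * indicator UNIV (0 + w))"
   by (rule conv_shift_integrable[OF c, of ep]) (auto intro: bump(3)[OF ep])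
  then show ?thesis by simp
 qed
 define m where "m = flat 0 (ep\<^sup>2 - (ep/2)\<^sup>2)"
 have m: "m > 0" using ep by (simp add: m_def power_strict_mono)
 have mono: "flat 0 x <= flat 0 y" if "x <= y" for x y
  using that by (auto simp: flat_def le_imp_inverse_le)
 have "(LINT w|lborel. m * indicator (ball (0::'a) (ep/2)) w) <= (LINT w|lborel. bump ep (w::'a))"
 proof (rule integral_mono)
  show "integrable lborel (%w. m * indicator (ball (0::'a) (ep/2)) w)"
   by (intro integrable_mult_right integrable_real_indicator) (use emeasure_bounded_finite[of "ball (0::'a) (ep/2)"] in auto)
  fix w :: 'a
  show "m * indicator (ball (0::'a) (ep/2)) w <= bump ep w"
  proof (cases "w \<in> ball 0 (ep/2)")
   case True
   then have "w \<bullet> w <= (ep/2)\<^sup>2" unfolding dot_square_norm by (intro power_mono) auto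
   then show ?thesis using True unfolding m_def bump_def by (auto intro: mono)
  qed (use bump(2)[OF ep] in auto)
 qed (rule i)
 moreover have "(LINT w|lborel. m * indicator (ball (0::'a) (ep/2)) w) = m * measure lborel (ball (0::'a) (ep/2))"
  by simp
 moreover have "measure lborel (ball (0::'a) (ep/2)) > 0"
  using ep content_ball_pos[of "ep/2" "0::'a"] by simp
 ultimately show ?thesis using m by (smt (verit) mult_pos_pos)
qed

section \<open>Functions increasing along a direction field\<close>

lemma pd_nonneg_of_increasing:
 fixes f :: "'a::euclidean_space => real"
 assumes "f differentiable (at z)" "r > 0" "!!s. 0 < s ==> s < r ==> f z <= f (z + s *\<^sub>R v)"
 shows "pd v f z \<ge> 0"
proof (rule ccontr)
 assume "\<not> pd v f z \<ge> 0"
 moreover have "((%t. f (z + t *\<^sub>R v)) has_real_derivative pd v f z) (at 0)"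
  using line_deriv[of f z 0 v] assms(1) by simp
 ultimately obtain d where d: "d > 0" "!!h. 0 < h ==> h < d ==> f (z + (0 + h) *\<^sub>R v) < f (z + 0 *\<^sub>R v)"
  using DERIV_neg_dec_right[of "%t. f (z + t *\<^sub>R v)" "pd v f z" 0] by (auto simp: not_le)
 define h where "h = min d r / 2"
 have "0 < h" "h < d" "h < r" using d assms(2) by (auto simp: h_def min_def)
 then show False using d(2)[of h] assms(3)[of h] by simp
qed

lemma conv_mono:
 fixes ph :: "'a::euclidean_space => real"
 assumes ph: "continuous_on UNIV ph" "!!x. norm x > \<rho> ==> ph x = 0" "!!x. ph x \<ge> 0" and I: "I \<in> sets borel"
  and imp: "!!w. norm w <= \<rho> ==> z + w \<in> I ==> z' + w \<in> I"
 shows "conv ph I z <= conv ph I z'"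
 unfolding conv_shift[OF ph(1) I]
proof (rule integral_mono)
 fix w
 show "ph w * indicator I (z + w) <= ph w * indicator I (z' + w)"
  using ph(2)[of w] ph(3)[of w] imp[of w] by (cases "norm w <= \<rho>") (auto simp: indicator_def)
qed (rule conv_shift_integrable[OF ph(1,2) I]; assumption)+

text \<open>\<open>I\<close> is the set of points that can be reached from \<open>z0\<close> along the field, and \<open>u\<close> a translate of its
 mollified indicator function.\<close>

lemma local_lyapunov:
 fixes \<theta> :: "complex => real"
 assumes \<theta>: "continuous_on UNIV \<theta>" "!!z. norm z > \<rho> ==> \<theta> z = 0"
 shows "\<exists>(u::complex => real) B. smo UNIV u & (\<forall>z. pd (cis (\<theta> z)) u z \<ge> 0) & pd (cis (\<theta> z0)) u z0 > 0 & (\<forall>z. \<bar>u z\<bar> <= B)"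
proof -
 define n where "n z = cis (\<theta> z)" for z
 have nc: "continuous_on UNIV n" unfolding n_def
  by (rule continuous_on_compose2[OF continuous_on_cis[OF continuous_on_id] \<theta>(1)]) auto
 have "uniformly_continuous_on UNIV n"
  by (rule uniformly_continuous_const_outside[OF nc, of \<rho> 1]) (simp add: n_def \<theta>(2))
 then obtain r0 where r0: "r0 > 0" "!!z w. dist z w < r0 ==> norm (n z - n w) < 1/2"
  unfolding uniformly_continuous_on_def by (metis UNIV_I dist_norm half_gt_zero_iff zero_less_one)
 define r where "r = r0 / 3"
 have r: "r > 0" and near: "!!z w. dist z w < 3 * r ==> norm (cis (\<theta> z) - cis (\<theta> w)) < 1/2"
  using r0 by (auto simp: r_def n_def)
 let ?R = "cone_step r \<theta>"
 note acyc = cone_step_acyclic[OF \<theta>(1) r near]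
 \<comment> \<open>A short step along the direction at z is admissible from every y near z, because
   the directions at y and z differ by less than 1/2.\<close>
 have cstep: "?R y (y + s *\<^sub>R n z)" if "dist y z < 3 * r" "0 < s" "s < r" for y s z
 proof -
  have 1: "norm (n z) = 1" by (simp add: n_def)
  have "n z * cnj (n y) = n z * cnj (n z) + n z * cnj (n y - n z)" by (simp add: algebra_simps)
  also have "n z * cnj (n z) = 1" by (simp add: n_def cis_cnj cis_mult)
  finally have "Re (n z * cnj (n y)) = 1 + Re (n z * cnj (n y - n z))" by simp
  moreover have "\<bar>Re (n z * cnj (n y - n z))\<bar> <= norm (n y - n z)"
   by (metis 1 abs_Re_le_cmod complex_mod_cnj mult_1 norm_mult)
  moreover have "norm (n y - n z) < 1/2" using near[OF that(1)] by (simp add: n_def)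
  ultimately have "Re (n z * cnj (n y)) > 1/2" by linarith
  then have "s * Re (n z * cnj (n y)) > s * (1/2)" using that by (intro mult_strict_left_mono) auto
  then show ?thesis using that 1 unfolding cone_step_def n_def[symmetric] by simp
 qed
 define I where "I = {w. ?R\<^sup>+\<^sup>+ z0 w}"
 have open1: "open {w. ?R y w}" for y
  unfolding cone_step_def by (intro open_Collect_conj open_Collect_less continuous_intros) auto
 have open2: "open {y. ?R y w}" for w
  unfolding cone_step_def n_def[symmetric]
  by (intro open_Collect_conj open_Collect_less continuous_intros nc) auto
 have "I = (\<Union>y\<in>insert z0 I. {w. ?R y w})"
  unfolding I_def by (auto intro: tranclp.intros elim: tranclp.cases)
 moreover have "open (\<Union>y\<in>insert z0 I. {w. ?R y w})" using open1 by blast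
 ultimately have oI: "open I" by simp
 then have bI: "I \<in> sets borel" by simp
 have Istep: "w' \<in> I" if "w \<in> I" "?R w w'" for w w'
  using that unfolding I_def by (auto intro: tranclp.trancl_into_trancl)
 define \<delta> where "\<delta> = r / 2"
 have \<delta>: "0 < \<delta>" "\<delta> < r" using r by (auto simp: \<delta>_def)
 let ?n0 = "n z0"
 \<comment> \<open>The point ahead of z0 is reachable. From the point behind z0 one can reach z0, so
   by acyclicity it is not reachable itself. Both facts persist on small balls, so the mollified
   indicator is positive at the first point and 0 at the second.\<close>
 have p1: "z0 + \<delta> *\<^sub>R ?n0 \<in> I" using cstep[of z0 z0 \<delta>] \<delta> r unfolding I_def by auto
 have p2: "z0 - \<delta> *\<^sub>R ?n0 \<in> {y. ?R y z0}"
  using cstep[of "z0 - \<delta> *\<^sub>R ?n0" z0 \<delta>] \<delta> r by (simp add: dist_norm n_def)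
 obtain e1 where e1: "e1 > 0" "ball (z0 + \<delta> *\<^sub>R ?n0) e1 \<subseteq> I" using oI p1 openE by blast
 obtain e2 where e2: "e2 > 0" "ball (z0 - \<delta> *\<^sub>R ?n0) e2 \<subseteq> {y. ?R y z0}" using open2 p2 openE by blast
 define ep where "ep = min (min e1 e2) r / 2"
 have ep: "ep > 0" "ep < e1" "ep < e2" "ep < r" using e1 e2 r by (auto simp: ep_def min_def)
 let ?ph = "bump ep :: complex => real"
 note phs = bump(1)[OF ep(1), where 'a=complex]
 note phc = smo_continuous[OF phs]
 have ph0: "!!x. norm x > ep ==> ?ph x = 0" by (rule bump(3)[OF ep(1)]) simp
 define ub where "ub = conv ?ph I"
 have ubs: "smo UNIV ub" unfolding ub_def by (rule smo_conv[OF phs ph0 bI])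
 have ubd: "ub differentiable (at x)" for x using smo_differentiable[OF ubs] by simp
 \<comment> \<open>One more step keeps a reachable point reachable, so \<open>ub\<close> does not
   decrease in the direction n z at any point z' close to z, and not only at z itself. This slack
   pays for the translation by \<tau> below.\<close>
 have mono: "pd (n z) ub z' \<ge> 0" if z': "dist z' z < r" for z z'
 proof (rule pd_nonneg_of_increasing[OF ubd r])
  fix s assume s: "0 < s" "s < r"
  show "ub z' <= ub (z' + s *\<^sub>R n z)" unfolding ub_def
  proof (rule conv_mono[OF phc ph0 bump(2)[OF ep(1)] bI])
   fix w :: complex assume w: "norm w <= ep" "z' + w \<in> I"
   have "dist (z' + w) z <= dist z' z + norm w"
    using norm_triangle_ineq[of "z' - z" w] by (simp add: dist_norm algebra_simps)
   then have "dist (z' + w) z < 3 * r" using z' w ep r by linarith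
   from Istep[OF w(2) cstep[OF this s]] show "z' + s *\<^sub>R n z + w \<in> I" by (simp add: add_ac)
  qed
 qed
 have "ub (z0 + \<delta> *\<^sub>R ?n0) = (LINT w|lborel. ?ph w)"
  unfolding ub_def conv_shift[OF phc bI]
 proof (rule Bochner_Integration.integral_cong)
  fix w
  show "?ph w * indicator I (z0 + \<delta> *\<^sub>R ?n0 + w) = ?ph w"
  proof (cases "norm w <= ep")
   case True
   then have "z0 + \<delta> *\<^sub>R ?n0 + w \<in> ball (z0 + \<delta> *\<^sub>R ?n0) e1" using ep by (simp add: dist_norm)
   then show ?thesis using e1 by auto
  qed (use ph0 in auto)
 qed simp
 then have v1: "ub (z0 + \<delta> *\<^sub>R ?n0) > 0" using bump_integral_pos[OF ep(1), where 'a=complex] by simp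
 have v2: "ub (z0 - \<delta> *\<^sub>R ?n0) = 0"
  unfolding ub_def conv_shift[OF phc bI]
 proof (rule integral_eq_zero_AE, rule AE_I2)
  fix w
  show "?ph w * indicator I (z0 - \<delta> *\<^sub>R ?n0 + w) = 0"
  proof (cases "norm w <= ep")
   case True
   then have "z0 - \<delta> *\<^sub>R ?n0 + w \<in> ball (z0 - \<delta> *\<^sub>R ?n0) e2" using ep by (simp add: dist_norm)
   then have "?R (z0 - \<delta> *\<^sub>R ?n0 + w) z0" using e2 by auto
   then have "z0 - \<delta> *\<^sub>R ?n0 + w \<notin> I" using acyc[of z0] unfolding I_def
    by (auto intro: tranclp.trancl_into_trancl)
   then show ?thesis by simp
  qed (use ph0 in auto)
 qed
 \<comment> \<open>The mean value theorem only locates some point of the segment with positive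
   derivative; translating the function moves that point to z0.\<close>
 obtain \<tau> where \<tau>: "-\<delta> < \<tau>" "\<tau> < \<delta>"
  "ub (z0 + \<delta> *\<^sub>R ?n0) - ub (z0 + (-\<delta>) *\<^sub>R ?n0) = (\<delta> - (-\<delta>)) * pd ?n0 ub (z0 + \<tau> *\<^sub>R ?n0)"
  using MVT2[of "-\<delta>" \<delta> "%t. ub (z0 + t *\<^sub>R ?n0)" "%t. pd ?n0 ub (z0 + t *\<^sub>R ?n0)"] line_deriv[OF ubd] \<delta>
  by auto
 then have pos: "pd ?n0 ub (z0 + \<tau> *\<^sub>R ?n0) > 0"
  using v1 v2 \<delta> by (simp add: zero_less_mult_iff)
 define u where "u z = ub (z + \<tau> *\<^sub>R ?n0)" for z
 have us: "smo UNIV u" unfolding u_def[abs_def]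
  by (rule smo_compose_UNIV[OF ubs]) (intro smo_intros open_UNIV)+
 have pdu: "pd v u z = pd v ub (z + \<tau> *\<^sub>R ?n0)" for v z
 proof (rule pd_eq)
  have "((%z. z + \<tau> *\<^sub>R ?n0) has_derivative (%h. h)) (at z)" by (auto intro!: derivative_eq_intros)
  from has_derivative_compose[OF this has_pd[OF ubd]]
  show "(u has_derivative (%v. pd v ub (z + \<tau> *\<^sub>R ?n0))) (at z)" unfolding u_def[abs_def] .
 qed
 have "pd (n z) u z \<ge> 0" for z
  unfolding pdu by (rule mono) (use \<tau> \<delta> in \<open>simp add: dist_norm n_def\<close>)
 moreover have "pd (n z0) u z0 > 0" unfolding pdu by (rule pos)
 moreover have "\<bar>u z\<bar> <= (LINT w|lborel. ?ph w)" for z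
 proof -
  have "\<bar>conv ?ph I x\<bar> <= (LINT w|lborel. ?ph w)" for x
  proof -
   have i: "integrable lborel ?ph"
   proof -
    have "integrable lborel (%w. ?ph w * indicator UNIV (0 + w))"
     by (rule conv_shift_integrable[OF phc ph0]) auto
    then show ?thesis by simp
   qed
   have "norm (LINT w|lborel. ?ph w * indicator I (x + w)) <= (LINT w|lborel. ?ph w)"
    by (rule Bochner_Integration.integral_norm_bound_integral[OF conv_shift_integrable[OF phc ph0 bI] i])
      (auto simp: indicator_def bump(2)[OF ep(1)] abs_mult)
   then show ?thesis unfolding conv_shift[OF phc bI] by simp
  qed
  then show ?thesis by (simp add: u_def ub_def)
 qed
 ultimately show ?thesis using us unfolding n_def by (intro exI[of _ u] exI[of _ "LINT w|lborel. ?ph w"]) auto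
qed

lemma pd_field_continuous:
 fixes u :: "complex => real"
 assumes "smo UNIV u" "continuous_on UNIV n"
 shows "continuous_on UNIV (%z. pd (n z) u z)"
proof -
 have "continuous_on UNIV (%z. \<Sum>b\<in>Basis. (n z \<bullet> b) *\<^sub>R pd b u z)"
  by (intro continuous_intros assms smo_continuous[OF smo_pd[OF assms(1)]])
 moreover have "pd (n z) u z = (\<Sum>b\<in>Basis. (n z \<bullet> b) *\<^sub>R pd b u z)" for z
  by (rule pd_basis_sum) (use smo_differentiable[OF assms(1)] in simp)
 ultimately show ?thesis by simp
qed

text \<open>On the ball of radius \<rho> finitely many local solutions add up to one with positive
  derivative; outside it the field is 1 and \<open>Re\<close> increases by itself. The sum is scaled
  by K to beat \<open>Re\<close> on the ball, and cut off so slowly that the cutoff costs at most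
  1/2.\<close>

lemma lyapunov_real:
 fixes \<theta> :: "complex => real"
 assumes \<theta>: "continuous_on UNIV \<theta>" "!!z. norm z > \<rho> ==> \<theta> z = 0"
 shows "\<exists>(v::complex => real) \<rho>'. smo UNIV v & (\<forall>z. norm z \<ge> \<rho>' --> v z = Re z) & (\<forall>z. pd (cis (\<theta> z)) v z > 0)"
proof -
 define n where "n z = cis (\<theta> z)" for z
 have nc: "continuous_on UNIV n" unfolding n_def
  by (rule continuous_on_compose2[OF continuous_on_cis[OF continuous_on_id] \<theta>(1)]) auto
 have "\<forall>z0. \<exists>(u::complex => real) B. smo UNIV u & (\<forall>z. pd (n z) u z \<ge> 0) & pd (n z0) u z0 > 0 & (\<forall>z. \<bar>u z\<bar> <= B)"
  unfolding n_def using local_lyapunov[of \<theta> \<rho>] \<theta> by blast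
 from choice[OF this] obtain U :: "complex => complex => real" where
  "\<forall>z0. \<exists>B. smo UNIV (U z0) & (\<forall>z. pd (n z) (U z0) z \<ge> 0) & pd (n z0) (U z0) z0 > 0 & (\<forall>z. \<bar>U z0 z\<bar> <= B)"
  by blast
 from choice[OF this] obtain B where U: "!!z0. smo UNIV (U z0)" "!!z0 z. pd (n z) (U z0) z \<ge> 0"
  "!!z0. pd (n z0) (U z0) z0 > 0" "!!z0 z. \<bar>U z0 z\<bar> <= B z0" by blast
 define P where "P z0 = {z. pd (n z) (U z0) z > 0}" for z0
 have Po: "open (P z0)" for z0 unfolding P_def
  by (rule open_Collect_less[OF continuous_on_const pd_field_continuous[OF U(1) nc]])
 have "cball 0 \<rho> \<subseteq> (\<Union>z0\<in>cball 0 \<rho>. P z0)" using U(3) unfolding P_def by auto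
 then obtain F where F: "F \<subseteq> cball 0 \<rho>" "finite F" "cball 0 \<rho> \<subseteq> (\<Union>z0\<in>F. P z0)"
  using compactE_image[OF compact_cball[of "0::complex" \<rho>], of "cball 0 \<rho>" P] Po by blast
 define u where "u z = (\<Sum>z0\<in>F. U z0 z)" for z
 have us: "smo UNIV u" unfolding u_def[abs_def] by (intro smo_intros U open_UNIV)
 have Ud: "U z0 differentiable (at x)" for z0 x using smo_differentiable[OF U(1)] by simp
 have ud: "u differentiable (at x)" for x using smo_differentiable[OF us] by simp
 have pdu: "pd w u z = (\<Sum>z0\<in>F. pd w (U z0) z)" for w z
  by (rule pd_eq) (auto simp: u_def[abs_def] intro!: has_derivative_sum has_pd Ud)
 have u0: "pd (n z) u z \<ge> 0" for z unfolding pdu by (intro sum_nonneg U)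
 have u1: "pd (n z) u z > 0" if z: "z \<in> cball 0 \<rho>" for z
 proof -
  obtain z0 where z0: "z0 \<in> F" "pd (n z) (U z0) z > 0" using F(3) z unfolding P_def by auto
  show ?thesis unfolding pdu by (rule sum_pos2[OF F(2) z0(1), of "%z0. pd (n z) (U z0) z"]) (use z0 U(2) in auto)
 qed
 define Bu where "Bu = (\<Sum>z0\<in>F. B z0)"
 have uB: "\<bar>u z\<bar> <= Bu" for z
  unfolding u_def Bu_def by (rule order_trans[OF sum_abs]) (intro sum_mono U)
 have Bu0: "Bu \<ge> 0" using uB[of 0] by linarith
 obtain m where m: "m > 0" "!!z. z \<in> cball 0 \<rho> ==> pd (n z) u z \<ge> m"
 proof (cases "cball 0 \<rho> = ({}::complex set)")
  case True then show ?thesis using that[of 1] by auto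
 next
  case False
  obtain z where z: "z \<in> cball 0 \<rho>" "!!y. y \<in> cball 0 \<rho> ==> pd (n z) u z <= pd (n y) u y"
   using continuous_attains_inf[OF compact_cball False continuous_on_subset[OF pd_field_continuous[OF us nc]]] by auto
  then show ?thesis using that[of "pd (n z) u z"] u1[OF z(1)] by blast
 qed
 \<comment> \<open>K * m = 2 outweighs \<open>Re (n z)\<close>, which is at least -1, on the
   ball.\<close>
 define K where "K = 2 / m"
 have K: "K > 0" "K * m = 2" using m by (auto simp: K_def)
 define st' where "st' x = pd 1 stp x" for x :: real
 have stder: "(stp has_real_derivative st' x) (at x)" for x
 proof -
  have "stp differentiable (at x)" using smo_differentiable[OF smo_stp] by simp
  from line_deriv[of stp 0 x 1] this show ?thesis by (simp add: st'_def)
 qed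
 have "bounded (st' ` {-1..2})"
  by (intro compact_imp_bounded compact_continuous_image)
    (auto simp: st'_def[abs_def] intro!: continuous_on_subset[OF smo_continuous[OF smo_pd[OF smo_stp]]])
 then obtain S0 where "\<forall>y\<in>st' ` {-1..2}. norm y <= S0" unfolding bounded_iff by blast
 then have S0: "!!x. x \<in> {-1..2} ==> \<bar>st' x\<bar> <= S0" by auto
 have st'0: "st' x = 0" if "x < 0" for x
 proof -
  have "(stp has_real_derivative 0) (at x)"
   by (rule has_field_derivative_transform_within_open[of "%x. 0" _ _ "{..<0}"]) (use that in auto)
  then show ?thesis using DERIV_unique stder by blast
 qed
 have st'1: "st' x = 0" if "x > 1" for x
 proof -
  have "(stp has_real_derivative 0) (at x)"
   by (rule has_field_derivative_transform_within_open[of "%x. 1" _ _ "{1<..}"]) (use that in auto)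
  then show ?thesis using DERIV_unique stder by blast
 qed
 have S0': "S0 \<ge> 0" using S0[of 0] by auto
 \<comment> \<open>The derivative of the cutoff in direction 1 is at most 4 * S0 / L, so the last
   entry brings its product with K * Bu down to 1/2.\<close>
 define L where "L = max 1 (max (\<bar>\<rho>\<bar> + 1) (8 * K * Bu * S0))"
 have L: "L \<ge> 1" "L > \<rho>" "L \<ge> 8 * K * Bu * S0" by (auto simp: L_def)
 define \<eta> where "\<eta> z = stp (2 - (z \<bullet> z) / L\<^sup>2)" for z :: complex
 have \<eta>s: "smo UNIV \<eta>" unfolding \<eta>_def[abs_def] using L by (intro smo_intros open_UNIV) auto
 have \<eta>d: "(\<eta> has_derivative (%h. st' (2 - (z \<bullet> z) / L\<^sup>2) * (- (2 * (z \<bullet> h)) / L\<^sup>2))) (at z)" for z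
 proof -
  have "((%z::complex. 2 - (z \<bullet> z) / L\<^sup>2) has_derivative (%h. - (2 * (z \<bullet> h)) / L\<^sup>2)) (at z)"
   using L by (auto intro!: derivative_eq_intros simp: inner_commute field_simps)
  from has_derivative_compose[OF this, of stp "%h. st' (2 - (z \<bullet> z) / L\<^sup>2) * h"] stder
  show ?thesis unfolding \<eta>_def[abs_def] by (simp add: has_field_derivative_def)
 qed
 have \<eta>1: "\<bar>pd 1 \<eta> z\<bar> * (K * Bu) <= 1/2" for z
 proof -
  define x where "x = 2 - (z \<bullet> z) / L\<^sup>2"
  have e: "pd 1 \<eta> z = st' x * (- (2 * Re z) / L\<^sup>2)" unfolding pd_eq[OF \<eta>d] x_def by simp
  show ?thesis
  proof (cases "x < 0 \<or> x > 1")
   case True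
   then show ?thesis unfolding e using st'0 st'1 by auto
  next
   case False
   then have "(norm z)\<^sup>2 / L\<^sup>2 <= 2" unfolding x_def dot_square_norm by linarith
   then have "(norm z)\<^sup>2 <= 2 * L\<^sup>2" using L by (subst (asm) pos_divide_le_eq) auto
   also have "\<dots> <= (2 * L)\<^sup>2" by (simp add: power_mult_distrib)
   finally have "(norm z)\<^sup>2 <= (2 * L)\<^sup>2" .
   then have "norm z <= 2 * L" by (rule power2_le_imp_le) (use L in simp)
   then have "\<bar>Re z\<bar> <= 2 * L" using abs_Re_le_cmod[of z] by linarith
   then have "2 * \<bar>Re z\<bar> / L\<^sup>2 <= (4 * L) / L\<^sup>2" by (intro divide_right_mono) auto
   then have "\<bar>- (2 * Re z) / L\<^sup>2\<bar> <= 4 / L" using L by (simp add: abs_mult power2_eq_square)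
   moreover have "\<bar>st' x\<bar> <= S0" using S0[of x] False by auto
   ultimately have "\<bar>pd 1 \<eta> z\<bar> <= S0 * (4 / L)" unfolding e abs_mult using S0' by (intro mult_mono) auto
   then have "\<bar>pd 1 \<eta> z\<bar> * (K * Bu) <= S0 * (4 / L) * (K * Bu)" using K Bu0 by (intro mult_right_mono) auto
   also have "\<dots> = (8 * K * Bu * S0) / (2 * L)" using L by (simp add: field_simps)
   also have "\<dots> <= L / (2 * L)" using L by (intro divide_right_mono) auto
   finally show ?thesis using L by simp
  qed
 qed
 define v where "v z = Re z + K * (\<eta> z * u z)" for z
 have vs: "smo UNIV v" unfolding v_def[abs_def] by (intro smo_intros us \<eta>s open_UNIV)
 have vd: "pd w v z = Re w + K * (\<eta> z * pd w u z + pd w \<eta> z * u z)" for w z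
 proof (rule pd_eq)
  have "\<eta> differentiable (at z)" using smo_differentiable[OF \<eta>s] by simp
  then show "(v has_derivative (%w. Re w + K * (\<eta> z * pd w u z + pd w \<eta> z * u z))) (at z)"
   unfolding v_def[abs_def] using ud[of z] by (auto intro!: derivative_eq_intros has_pd)
 qed
 have "pd (n z) v z > 0" for z
 proof (cases "norm z <= \<rho>")
  case True
  have nL: "norm z ^ 2 < L\<^sup>2" using True L by (intro power_strict_mono) auto
  have "(norm z)\<^sup>2 / L\<^sup>2 < 1" using nL L by (subst pos_divide_less_eq) auto
  then have a: "2 - (z \<bullet> z) / L\<^sup>2 > 1" unfolding dot_square_norm by linarith
  have "\<eta> z = 1" unfolding \<eta>_def using a by simp
  moreover have "pd (n z) \<eta> z = 0" unfolding pd_eq[OF \<eta>d] using st'1[OF a] by simp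
  ultimately have "pd (n z) v z = Re (n z) + K * pd (n z) u z" by (simp add: vd)
  moreover have "K * pd (n z) u z \<ge> K * m" using m(2)[of z] True K by (intro mult_left_mono) auto
  moreover have "Re (n z) \<ge> -1" using abs_Re_le_cmod[of "n z"] by (simp add: n_def)
  ultimately show ?thesis using K by linarith
 next
  case False
  then have n1: "n z = 1" using \<theta>(2) by (simp add: n_def)
  have a: "\<eta> z * pd 1 u z \<ge> 0" using u0[of z] n1 by (simp add: \<eta>_def)
  have "\<bar>pd 1 \<eta> z * u z\<bar> * K <= \<bar>pd 1 \<eta> z\<bar> * (K * Bu)"
  proof -
   have "\<bar>pd 1 \<eta> z\<bar> * \<bar>u z\<bar> * K <= \<bar>pd 1 \<eta> z\<bar> * Bu * K"
    using uB[of z] K by (intro mult_right_mono mult_left_mono) auto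
   then show ?thesis by (simp add: abs_mult mult_ac)
  qed
  moreover have "\<bar>K * (pd 1 \<eta> z * u z)\<bar> = \<bar>pd 1 \<eta> z * u z\<bar> * K" using K by (simp add: abs_mult)
  ultimately have "\<bar>K * (pd 1 \<eta> z * u z)\<bar> <= 1/2" using \<eta>1[of z] by linarith
  moreover have "pd 1 v z = 1 + K * (\<eta> z * pd 1 u z) + K * (pd 1 \<eta> z * u z)"
   by (simp add: vd distrib_left)
  moreover have "K * (\<eta> z * pd 1 u z) \<ge> 0" by (rule mult_nonneg_nonneg[OF less_imp_le[OF K(1)] a])
  ultimately show ?thesis unfolding n1 by linarith
 qed
 moreover have "v z = Re z" if "norm z \<ge> 2 * L" for z
 proof -
  have "(2 * L)\<^sup>2 <= norm z ^ 2" using that L by (intro power_mono) auto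
  moreover have "2 * L\<^sup>2 <= (2 * L)\<^sup>2" by (simp add: power_mult_distrib)
  ultimately have "2 * L\<^sup>2 <= (norm z)\<^sup>2" by linarith
  then have "2 <= (norm z)\<^sup>2 / L\<^sup>2" using L by (subst pos_le_divide_eq) auto
  then have "2 - (z \<bullet> z) / L\<^sup>2 <= 0" unfolding dot_square_norm by linarith
  then show ?thesis by (simp add: v_def \<eta>_def)
 qed
 ultimately show ?thesis using vs unfolding n_def
  by (intro exI[of _ v] exI[of _ "2 * L"]) auto
qed

lemma pd_mult_const:
 fixes u :: "complex => real"
 assumes "u differentiable (at (c * z))"
 shows "pd w (%z. u (c * z)) z = pd (c * w) u (c * z)"
proof (rule pd_eq)
 have "((%z. c * z) has_derivative (%h. c * h)) (at z)" by (auto intro!: derivative_eq_intros)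
 from has_derivative_compose[OF this has_pd[OF assms]]
 show "((%z. u (c * z)) has_derivative (%w. pd (c * w) u (c * z))) (at z)" .
qed

text \<open>A rotation of the plane by \<open>cnj c\<close> reduces the field to one that is 1 far
  out. Both c = \<i> and c = 1 occur in \<open>plane_isotopy\<close>, for the imaginary and the real
  part.\<close>

proposition lyapunov:
 fixes \<theta> :: "complex => real"
 assumes \<theta>: "continuous_on UNIV \<theta>" "!!z. norm z > \<rho> ==> \<theta> z = 0" and c: "norm c = 1"
 shows "\<exists>(v::complex => real) \<rho>'. smo UNIV v & (\<forall>z. norm z \<ge> \<rho>' --> v z = Re (cnj c * z)) & (\<forall>z. pd (c * cis (\<theta> z)) v z > 0)"
proof -
 have cc: "cnj c * c = 1" "c * cnj c = 1" using c by (simp_all add: complex_norm_square[symmetric] mult.commute)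
 have "continuous_on UNIV (%z. \<theta> (c * z))"
  by (rule continuous_on_compose2[OF \<theta>(1)]) (auto intro!: continuous_intros)
 from lyapunov_real[OF this, of \<rho>] have "\<exists>(v::complex => real) \<rho>'. smo UNIV v & (\<forall>z. norm z \<ge> \<rho>' --> v z = Re z)
   & (\<forall>z. pd (cis (\<theta> (c * z))) v z > 0)"
  using \<theta>(2) c by (simp add: norm_mult)
 then obtain v :: "complex => real" and \<rho>' where v: "smo UNIV v" "!!z. norm z \<ge> \<rho>' ==> v z = Re z"
   "!!z. pd (cis (\<theta> (c * z))) v z > 0"
  by blast
 let ?v = "%z. v (cnj c * z)"
 have "smo UNIV ?v" by (rule smo_compose_UNIV[OF v(1)]) (intro smo_intros open_UNIV)+
 moreover have "?v z = Re (cnj c * z)" if "norm z \<ge> \<rho>'" for z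
  using v(2)[of "cnj c * z"] that c by (simp add: norm_mult)
 moreover have "pd (c * cis (\<theta> z)) ?v z > 0" for z
 proof -
  have "pd (c * cis (\<theta> z)) ?v z = pd (cnj c * (c * cis (\<theta> z))) v (cnj c * z)"
   by (rule pd_mult_const) (use smo_differentiable[OF v(1)] in simp)
  also have "cnj c * (c * cis (\<theta> z)) = cis (\<theta> (c * (cnj c * z)))"
   using cc by (simp add: mult.assoc[symmetric])
  finally show ?thesis using v(3)[of "cnj c * z"] by simp
 qed
 ultimately show ?thesis by (intro exI[of _ ?v] exI[of _ \<rho>']) auto
qed

section \<open>Families of increasing functions\<close>

lemma pd_slice:
 fixes f :: "'p::euclidean_space \<times> 'a::euclidean_space => 'b::euclidean_space"
 assumes "f differentiable (at (p, z))"
 shows "pd w (%z. f (p, z)) z = pd (0, w) f (p, z)"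
proof (rule pd_eq)
 have "((%z. (p, z)) has_derivative (%w. (0, w))) (at z)" by (auto intro!: derivative_eq_intros)
 from has_derivative_compose[OF this has_pd[OF assms]]
 show "((%z. f (p, z)) has_derivative (%w. pd (0, w) f (p, z))) (at z)" .
qed

text \<open>The chord between two points of the circle is at least 1 minus the cosine of their
  angle, and cosine decreases on [0, \<pi>]; rounding supplies the integer.\<close>

lemma cis_near:
 assumes "e > 0"
 shows "\<exists>\<delta>>0. \<forall>x y. dist (cis (2 * pi * x)) (cis (2 * pi * y)) < \<delta> --> (\<exists>k::int. \<bar>x - y - of_int k\<bar> < e)"
proof -
 define e' where "e' = min e (1/2)"
 have e': "0 < e'" "e' <= 1/2" "e' <= e" using assms by (auto simp: e'_def)
 define \<delta> where "\<delta> = 1 - cos (2 * pi * e')"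
 have "cos (2 * pi * e') < cos 0" using e' by (intro cos_monotone_0_pi) auto
 then have \<delta>: "\<delta> > 0" by (simp add: \<delta>_def)
 have "\<exists>k::int. \<bar>x - y - of_int k\<bar> < e" if d: "dist (cis (2 * pi * x)) (cis (2 * pi * y)) < \<delta>" for x y
 proof -
  define k where "k = round (x - y)"
  define a where "a = \<bar>x - y - of_int k\<bar>"
  have a: "0 <= a" "a <= 1/2" using of_int_round_abs_le[of "x - y"] by (auto simp: a_def k_def abs_minus_commute)
  have c: "cos (2 * pi * (x - y)) = cos (2 * pi * a)"
  proof -
   have "2 * pi * a = \<bar>2 * pi * (x - y - of_int k)\<bar>" by (simp add: a_def abs_mult)
   then have "cos (2 * pi * a) = cos (2 * pi * (x - y - of_int k))" by (simp only: cos_abs_real)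
   also have "\<dots> = cos (2 * pi * (x - y) - 2 * pi * of_int k)" by (simp add: algebra_simps)
   also have "\<dots> = cos (2 * pi * (x - y))" by (simp add: cos_diff)
   finally show ?thesis by simp
  qed
  have "1 - cos (2 * pi * (x - y)) <= norm (1 - cis (2 * pi * (x - y)))"
   using complex_Re_le_cmod[of "1 - cis (2 * pi * (x - y))"] by simp
  also have "\<dots> = norm (cis (2 * pi * y) * (1 - cis (2 * pi * (x - y))))" by (simp add: norm_mult)
  also have "cis (2 * pi * y) * (1 - cis (2 * pi * (x - y))) = cis (2 * pi * y) - cis (2 * pi * x)"
   by (simp add: right_diff_distrib cis_mult)
  also have "norm \<dots> < \<delta>" using d by (simp add: dist_norm norm_minus_commute)
  finally have "cos (2 * pi * a) > cos (2 * pi * e')" unfolding \<delta>_def c by linarith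
  have "a < e'"
  proof (rule ccontr)
   assume "\<not> a < e'"
   then have "cos (2 * pi * a) <= cos (2 * pi * e')" using a e' by (intro cos_monotone_0_pi_le) auto
   then show False using \<open>cos (2 * pi * a) > cos (2 * pi * e')\<close> by linarith
  qed
  then show ?thesis using e' unfolding a_def by (intro exI[of _ k]) linarith
 qed
 then show ?thesis using \<delta> by blast
qed

lemma cis_2pi_plus_1 [simp]: "cis (2 * pi * (b + 1)) = cis (2 * pi * b)"
 by (simp add: distrib_left cis_mult[symmetric])

lemma cis_2pi_plus_int: "cis (2 * pi * (b + of_int k)) = cis (2 * pi * b)"
 by (simp add: distrib_left cis_mult[symmetric] cis_multiple_2pi)

lemma periodic_int:
 fixes f :: "real => 'a"
 assumes "!!x. f (x + 1) = f x" shows "f (x + of_int k) = f x"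
proof (induction k rule: int_induct[where k = 0])
 case (step1 i)
 then show ?case using assms[of "x + of_int i"] by (simp add: add.assoc)
next
 case (step2 i)
 then show ?case using assms[of "x + of_int (i - 1)"] by (simp add: add.assoc)
qed simp

text \<open>The bumps depend on b only through \<open>cis (2 * pi * b)\<close>, which makes them
  periodic; compactness of the unit square leaves finitely many. They stay unnormalised, since
  \<open>lyapunov_family\<close> divides by the total weight.\<close>

lemma circle_partition:
 fixes V :: "real \<times> real => (real \<times> real) set"
 assumes V: "!!q. open (V q)" "!!q. q \<in> V q" "!!q b t. (b + 1, t) \<in> V q \<longleftrightarrow> (b, t) \<in> V q"
 shows "\<exists>I \<beta>. finite I & (\<forall>q. smo UNIV (\<beta> q :: real \<times> real => real)) & (\<forall>q p. \<beta> q p \<ge> 0) &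
   (\<forall>q b t. \<beta> q (b + 1, t) = \<beta> q (b, t)) & (\<forall>q\<in>I. \<forall>p. \<beta> q p ~= 0 --> p \<in> V q) &
   (\<forall>b t. 0 <= t --> t <= 1 --> (\<exists>q\<in>I. \<beta> q (b, t) > 0))"
proof -
 have Vk: "(b + of_int k, t) \<in> V q \<longleftrightarrow> (b, t) \<in> V q" for b k t q
  using periodic_int[of "%b. (b, t) \<in> V q" b k] V(3) by simp
 have "\<exists>\<delta>>0. \<forall>b t. dist (cis (2 * pi * b)) (cis (2 * pi * fst q)) < \<delta> --> \<bar>t - snd q\<bar> < \<delta> --> (b, t) \<in> V q" for q
 proof -
  obtain e where e: "e > 0" "ball q e \<subseteq> V q" using V(1,2) openE by blast
  obtain \<delta> where \<delta>: "\<delta> > 0" "!!x y. dist (cis (2 * pi * x)) (cis (2 * pi * y)) < \<delta> ==> \<exists>k::int. \<bar>x - y - of_int k\<bar> < e / 2"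
   using cis_near[of "e/2"] e by auto
  have "(b, t) \<in> V q" if d: "dist (cis (2 * pi * b)) (cis (2 * pi * fst q)) < \<delta>" "\<bar>t - snd q\<bar> < e / 2" for b t
  proof -
   obtain k :: int where k: "\<bar>b - fst q - of_int k\<bar> < e / 2" using \<delta>(2)[OF d(1)] by blast
   have "dist q (b - of_int k, t) <= \<bar>fst q - (b - of_int k)\<bar> + \<bar>snd q - t\<bar>"
    unfolding dist_prod_def dist_real_def using sqrt_sum_squares_le_sum_abs by (cases q) auto
   also have "\<dots> < e" using k d(2) by linarith
   finally have "(b - of_int k, t) \<in> V q" using e by auto
   then show ?thesis using Vk[of "b - of_int k" k t q] by simp
  qed
  then show ?thesis using \<delta>(1) e(1) by (intro exI[of _ "min \<delta> (e/2)"]) auto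
 qed
 then obtain \<delta> where \<delta>: "!!q. \<delta> q > 0"
  "!!q b t. dist (cis (2 * pi * b)) (cis (2 * pi * fst q)) < \<delta> q ==> \<bar>t - snd q\<bar> < \<delta> q ==> (b, t) \<in> V q"
  by metis
 define \<beta> where "\<beta> q p = bump (\<delta> q) (cis (2 * pi * fst p) - cis (2 * pi * fst q), snd p - snd q)" for q p :: "real \<times> real"
 have s: "smo UNIV (\<beta> q)" for q unfolding \<beta>_def[abs_def]
  by (rule smo_compose_UNIV[OF bump(1)[OF \<delta>(1)]]) (intro smo_intros open_UNIV)+
 have "p \<in> V q" if "\<beta> q p ~= 0" for q p
 proof -
  have n: "norm (cis (2 * pi * fst p) - cis (2 * pi * fst q), snd p - snd q) < \<delta> q"
   using that bump(3)[OF \<delta>(1)] unfolding \<beta>_def by (meson not_le)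
  have "norm (cis (2 * pi * fst p) - cis (2 * pi * fst q)) < \<delta> q" "\<bar>snd p - snd q\<bar> < \<delta> q"
   using n norm_fst_le[of "cis (2 * pi * fst p) - cis (2 * pi * fst q)" "snd p - snd q"]
    norm_snd_le[of "snd p - snd q" "cis (2 * pi * fst p) - cis (2 * pi * fst q)"] by auto
  then show ?thesis using \<delta>(2)[of "fst p" q "snd p"] by (simp add: dist_norm)
 qed
 moreover
 let ?O = "%q. {p. \<beta> q p > 0}"
 have oO: "open (?O q)" for q
  by (rule open_Collect_less[OF continuous_on_const smo_continuous[OF s]])
 have qO: "q \<in> ?O q" for q unfolding \<beta>_def using bump(4)[OF \<delta>(1), of "(0, 0)" q] \<delta>(1)[of q] by (simp add: norm_Pair)
 have "compact ({0..1} \<times> {0..1} :: (real \<times> real) set)" by (intro compact_Times compact_Icc)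
 then obtain I where I: "I \<subseteq> {0..1} \<times> {0..1}" "finite I" "{0..1} \<times> {0..1} \<subseteq> (\<Union>q\<in>I. ?O q)"
  using compactE_image[of "{0..1} \<times> {0..1} :: (real \<times> real) set" "{0..1} \<times> {0..1}" ?O] oO qO by blast
 have per: "\<beta> q (b + 1, t) = \<beta> q (b, t)" for q b t by (simp add: \<beta>_def)
 have "\<exists>q\<in>I. \<beta> q (b, t) > 0" if "0 <= t" "t <= 1" for b t
 proof -
  have "(frac b, t) \<in> {0..1} \<times> {0..1}" using that by (auto simp: less_imp_le frac_lt_1)
  then obtain q where q: "q \<in> I" "\<beta> q (frac b, t) > 0" using I(3) by blast
  have "\<beta> q (frac b + of_int \<lfloor>b\<rfloor>, t) = \<beta> q (frac b, t)"
   by (rule periodic_int[of "%b. \<beta> q (b, t)"]) (rule per)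
  then show ?thesis using q by (intro bexI[of _ q]) (auto simp: frac_def)
 qed
 moreover have "\<beta> q p \<ge> 0" for q p unfolding \<beta>_def by (rule bump(2)[OF \<delta>(1)])
 ultimately show ?thesis using I(2) s per by (intro exI[of _ I] exI[of _ \<beta>]) auto
qed

text \<open>The tube lemma, K being compact.\<close>

lemma open_all_fibre:
 fixes W :: "'p::topological_space \<times> 'a::metric_space => real"
 assumes "continuous_on UNIV W" "compact K"
 shows "open {p. \<forall>z\<in>K. W (p, z) > 0}"
proof (subst open_subopen, intro ballI)
 fix p assume p: "p \<in> {p. \<forall>z\<in>K. W (p, z) > 0}"
 have "open {q. W q > 0}" by (rule open_Collect_less[OF continuous_on_const assms(1)])
 moreover have "{p} \<times> K \<subseteq> {q. W q > 0}" using p by auto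
 ultimately obtain U V where "open U" "open V" "p \<in> U" "K \<subseteq> V" "U \<times> V \<subseteq> {q. W q > 0}"
  using tube_lemma_right[of euclidean euclidean "{q. W q > 0}" K p] assms(2)
  by (auto simp: open_openin[symmetric] euclidean_product_topology)
 then show "\<exists>T. open T & p \<in> T & T \<subseteq> {p. \<forall>z\<in>K. W (p, z) > 0}" by (intro exI[of _ U]) auto
qed

lemma has_pd_affine:
 "pd w (%z. Re (cnj c * z)) z = Re (cnj c * w)"
 by (rule pd_eq) (auto intro!: derivative_eq_intros)

text \<open>Increasing along the field is a convex condition and, by compactness, an open one in the
  parameter, so solutions for single parameters can be averaged with weights depending on the
  parameter alone. The ends are prescribed by including \<open>Re (cnj c * z)\<close> and
  \<open>u1\<close>, each with a weight supported where it is itself increasing.\<close>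

lemma lyapunov_family:
 fixes \<theta> :: "(real \<times> real) \<times> complex => real" and u1 :: "real \<times> complex => real"
 assumes \<theta>: "continuous_on UNIV \<theta>" "!!p z. norm z > \<rho> ==> \<theta> (p, z) = 0"
  and per: "!!b t z. \<theta> ((b + 1, t), z) = \<theta> ((b, t), z)"
  and \<theta>0: "!!b t z. t < 1/3 ==> \<theta> ((b, t), z) = 0" and c: "norm c = 1"
  and u1: "smo UNIV u1" "!!b z. u1 (b + 1, z) = u1 (b, z)" "!!b z. norm z > \<rho> ==> u1 (b, z) = Re (cnj c * z)"
  and pos1: "!!b t z. t > 2/3 ==> pd (0, c * cis (\<theta> ((b, t), z))) u1 (b, z) > 0"
 shows "\<exists>(U :: (real \<times> real) \<times> complex => real) \<rho>'. smo UNIV U &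
  (\<forall>p z. norm z > \<rho>' --> U (p, z) = Re (cnj c * z)) & (\<forall>b t z. U ((b + 1, t), z) = U ((b, t), z)) &
  (\<forall>b t z. t <= 0 --> U ((b, t), z) = Re (cnj c * z)) & (\<forall>b t z. t \<ge> 1 --> U ((b, t), z) = u1 (b, z)) &
  (\<forall>p z. pd (0, c * cis (\<theta> (p, z))) U (p, z) > 0)"
proof -
 let ?n = "%p z. c * cis (\<theta> (p, z))"
 have cc: "cnj c * c = 1" using c by (simp add: complex_norm_square[symmetric] mult.commute)
 have "\<forall>q. \<exists>v \<rho>'. smo UNIV (v::complex => real) & (\<forall>z. norm z \<ge> \<rho>' --> v z = Re (cnj c * z)) & (\<forall>z. pd (?n q z) v z > 0)"
 proof
  fix q
  have "continuous_on UNIV (%z. \<theta> (q, z))"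
   by (rule continuous_on_compose2[OF \<theta>(1)]) (auto intro!: continuous_intros)
  then show "\<exists>v \<rho>'. smo UNIV (v::complex => real) & (\<forall>z. norm z \<ge> \<rho>' --> v z = Re (cnj c * z)) & (\<forall>z. pd (?n q z) v z > 0)"
   by (rule lyapunov[OF _ \<theta>(2) c])
 qed
 from choice[OF this] obtain v where "\<forall>q. \<exists>\<rho>'. smo UNIV (v q) & (\<forall>z. norm z \<ge> \<rho>' --> v q z = Re (cnj c * z)) & (\<forall>z. pd (?n q z) (v q) z > 0)"
  by blast
 from choice[OF this] obtain \<rho>v where v: "!!q. smo UNIV (v q)" "!!q z. norm z \<ge> \<rho>v q ==> v q z = Re (cnj c * z)"
   "!!q z. pd (?n q z) (v q) z > 0" by blast
 define V where "V q = {p. \<forall>z. pd (?n p z) (v q) z > 0}" for q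
 have oV: "open (V q)" for q
 proof -
  \<comment> \<open>Outside this ball the field is c and \<open>v q\<close> is
    \<open>Re (cnj c * z)\<close>, with derivative 1 along the field; only a compact part of each
    fibre is left to control.\<close>
  define R where "R = max \<rho> (\<rho>v q) + 1"
  have out: "pd (?n p z) (v q) z > 0" if "z \<notin> cball 0 R" for p z
  proof -
   have R: "norm z > R" using that by simp
   have \<theta>z: "\<theta> (p, z) = 0" using \<theta>(2) R by (simp add: R_def)
   have "pd (?n p z) (v q) z = pd (?n p z) (%z. Re (cnj c * z)) z"
    by (rule pd_cong[of "{z. norm z > R}"]) (use R v(2) in \<open>auto simp: R_def intro!: open_Collect_less continuous_intros\<close>)
   also have "\<dots> = Re (cnj c * ?n p z)" by (rule has_pd_affine)
   also have "\<dots> = 1" using cc by (simp add: \<theta>z)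
   finally show ?thesis by simp
  qed
  have "continuous_on UNIV (%(p, z). pd (?n p z) (v q) z)"
  proof -
   have "continuous_on UNIV (%x. \<Sum>b\<in>Basis. ((c * cis (\<theta> x)) \<bullet> b) *\<^sub>R pd b (v q) (snd x))"
    by (intro continuous_intros \<theta>(1) continuous_on_compose2[OF smo_continuous[OF smo_pd[OF v(1)]]]
      continuous_on_compose2[OF continuous_on_cis[OF continuous_on_id]]) auto
   moreover have "(%(p, z). pd (?n p z) (v q) z) = (%x. \<Sum>b\<in>Basis. ((c * cis (\<theta> x)) \<bullet> b) *\<^sub>R pd b (v q) (snd x))"
    by (rule ext, clarify, simp only: snd_conv, rule pd_basis_sum) (use smo_differentiable[OF v(1)] in simp)
   ultimately show ?thesis by simp
  qed
  from open_all_fibre[OF this compact_cball[of 0 R]]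
  have "open {p. \<forall>z\<in>cball 0 R. pd (?n p z) (v q) z > 0}" by simp
  also have "{p. \<forall>z\<in>cball 0 R. pd (?n p z) (v q) z > 0} = V q" using out unfolding V_def by blast
  finally show ?thesis .
 qed
 have qV: "q \<in> V q" for q using v(3) by (simp add: V_def)
 have pV: "(b + 1, t) \<in> V q \<longleftrightarrow> (b, t) \<in> V q" for b t q by (simp add: V_def per)
 obtain I \<beta> where \<beta>: "finite I" "!!q. smo UNIV (\<beta> q :: real \<times> real => real)" "!!q p. \<beta> q p \<ge> 0"
   "!!q b t. \<beta> q (b + 1, t) = \<beta> q (b, t)" "!!q p. q \<in> I ==> \<beta> q p ~= 0 ==> p \<in> V q"
   "!!b t. 0 <= t ==> t <= 1 ==> \<exists>q\<in>I. \<beta> q (b, t) > 0"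
  using circle_partition[OF oV qV pV] by blast
 define w0 where "w0 p = flat 0 (1/3 - snd p)" for p :: "real \<times> real"
 define w1 where "w1 p = flat 0 (snd p - 2/3)" for p :: "real \<times> real"
 \<comment> \<open>The extra factor vanishes for t <= 0 and for t >= 1. There only
   \<open>w0\<close>, respectively \<open>w1\<close>, carries weight, so the prescribed end
   functions appear exactly.\<close>
 define w where "w q p = \<beta> q p * (flat 0 (snd p) * flat 0 (1 - snd p))" for q p
 define W where "W p = w0 p + w1 p + (\<Sum>q\<in>I. w q p)" for p
 have ws: "smo UNIV w0" "smo UNIV w1" "smo UNIV (w q)" for q
  unfolding w0_def[abs_def] w1_def[abs_def] w_def[abs_def] by (intro smo_intros open_UNIV \<beta>(2))+
 have Ws: "smo UNIV W" unfolding W_def[abs_def] by (intro smo_intros open_UNIV ws)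
 have w0': "w0 p \<ge> 0" "w1 p \<ge> 0" "w q p \<ge> 0" for p q
  using \<beta>(3) by (auto simp: w0_def w1_def w_def)
 have somepos: "w0 p > 0 \<or> w1 p > 0 \<or> (\<exists>q\<in>I. w q p > 0)" for p
 proof -
  obtain b t where p: "p = (b, t)" by force
  consider "t < 1/3" | "t > 2/3" | "1/3 <= t" "t <= 2/3" by linarith
  then show ?thesis
  proof cases
   case 3
   then obtain q where "q \<in> I" "\<beta> q p > 0" using \<beta>(6)[of t b] p by auto
   moreover have "flat 0 t * flat 0 (1 - t) > 0" using 3 by (intro mult_pos_pos) auto
   ultimately have "w q p > 0" unfolding w_def p by (simp add: mult_pos_pos)
   then show ?thesis using \<open>q \<in> I\<close> by blast
  qed (auto simp: w0_def w1_def p)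
 qed
 have sum0: "(\<Sum>q\<in>I. w q p) \<ge> 0" for p by (intro sum_nonneg w0')
 have Wpos: "W p > 0" for p
  using somepos[of p]
 proof (elim disjE bexE)
  fix q assume "q \<in> I" "0 < w q p"
  then have "(\<Sum>q\<in>I. w q p) > 0" by (intro sum_pos2[OF \<beta>(1), of q "%q. w q p"]) (auto intro: w0')
  then show ?thesis unfolding W_def by (intro add_nonneg_pos add_nonneg_nonneg w0')
 next
  assume "0 < w0 p" then show ?thesis unfolding W_def
   by (intro add_pos_nonneg w0' sum0)
 next
  assume "0 < w1 p" then show ?thesis unfolding W_def
   by (intro add_pos_nonneg add_nonneg_pos w0' sum0)
 qed
 define U where "U x = (w0 (fst x) * Re (cnj c * snd x) + w1 (fst x) * u1 (fst (fst x), snd x)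
   + (\<Sum>q\<in>I. w q (fst x) * v q (snd x))) / W (fst x)" for x
 have Us: "smo UNIV U" unfolding U_def[abs_def]
  using Wpos by (intro smo_intros open_UNIV smo_compose_UNIV[OF ws(1)] smo_compose_UNIV[OF ws(2)]
    smo_compose_UNIV[OF ws(3)] smo_compose_UNIV[OF Ws] smo_compose_UNIV[OF v(1)] smo_compose_UNIV[OF u1(1)])
   (metis less_irrefl)
 have pdU: "pd (0, x) U (p, z) = (w0 p * Re (cnj c * x) + w1 p * pd (0, x) u1 (fst p, z)
   + (\<Sum>q\<in>I. w q p * pd x (v q) z)) / W p" for x p z
 proof -
  have "pd (0, x) U (p, z) = pd x (%z. U (p, z)) z"
   by (rule pd_slice[symmetric]) (use smo_differentiable[OF Us] in simp)
  also have "\<dots> = (w0 p * Re (cnj c * x) + w1 p * pd x (%z. u1 (fst p, z)) z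
   + (\<Sum>q\<in>I. w q p * pd x (v q) z)) / W p"
  proof (rule pd_eq)
   have vd: "(v q has_derivative (%x. pd x (v q) z)) (at z)" for q
    using has_pd smo_differentiable[OF v(1)] by blast
   have "smo UNIV (%z. u1 (fst p, z))" by (rule smo_compose_UNIV[OF u1(1)]) (intro smo_intros open_UNIV)+
   then have ud: "((%z. u1 (fst p, z)) has_derivative (%x. pd x (%z. u1 (fst p, z)) z)) (at z)"
    by (rule smo_has_pd) simp
   have rd: "((%z. Re (cnj c * z)) has_derivative (%x. Re (cnj c * x))) (at z)"
    by (auto intro!: derivative_eq_intros)
   have "((%z. (w0 p * Re (cnj c * z) + w1 p * u1 (fst p, z) + (\<Sum>q\<in>I. w q p * v q z)) * inverse (W p)) has_derivative
     (%x. (w0 p * Re (cnj c * x) + w1 p * pd x (%z. u1 (fst p, z)) z + (\<Sum>q\<in>I. w q p * pd x (v q) z)) * inverse (W p))) (at z)"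
    by (intro has_derivative_mult_left has_derivative_add has_derivative_mult_right has_derivative_sum vd ud rd)
   then show "((%z. U (p, z)) has_derivative (%x. (w0 p * Re (cnj c * x) + w1 p * pd x (%z. u1 (fst p, z)) z
     + (\<Sum>q\<in>I. w q p * pd x (v q) z)) / W p)) (at z)"
    unfolding U_def fst_conv snd_conv divide_inverse .
  qed
  also have "pd x (%z. u1 (fst p, z)) z = pd (0, x) u1 (fst p, z)"
   by (rule pd_slice) (use smo_differentiable[OF u1(1)] in simp)
  finally show ?thesis .
 qed
 have "pd (0, ?n p z) U (p, z) > 0" for p z
 proof -
  obtain b t where p: "p = (b, t)" by force
  have t0: "w0 p * Re (cnj c * ?n p z) \<ge> 0" "w0 p > 0 ==> w0 p * Re (cnj c * ?n p z) > 0"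
  proof -
   have "Re (cnj c * ?n p z) = 1" if "w0 p ~= 0"
   proof -
    have "t < 1/3" using that by (rule_tac ccontr) (auto simp: w0_def p)
    then show ?thesis using \<theta>0[of t b z] cc by (simp add: p)
   qed
   then show "w0 p * Re (cnj c * ?n p z) \<ge> 0" "w0 p > 0 ==> w0 p * Re (cnj c * ?n p z) > 0"
    using w0'(1)[of p] by (cases "w0 p = 0"; simp)+
  qed
  have t1: "w1 p * pd (0, ?n p z) u1 (fst p, z) \<ge> 0" "w1 p > 0 ==> w1 p * pd (0, ?n p z) u1 (fst p, z) > 0"
  proof -
   have "pd (0, ?n p z) u1 (fst p, z) > 0" if "w1 p ~= 0"
   proof -
    have "t > 2/3" using that by (rule_tac ccontr) (auto simp: w1_def p)
    then show ?thesis using pos1[of t b z] by (simp add: p)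
   qed
   then show "w1 p * pd (0, ?n p z) u1 (fst p, z) \<ge> 0" "w1 p > 0 ==> w1 p * pd (0, ?n p z) u1 (fst p, z) > 0"
    using w0'(2)[of p] by (cases "w1 p = 0"; simp)+
  qed
  have t2: "w q p * pd (?n p z) (v q) z \<ge> 0" "w q p > 0 ==> w q p * pd (?n p z) (v q) z > 0" if "q \<in> I" for q
  proof -
   have "pd (?n p z) (v q) z > 0" if "w q p ~= 0"
   proof -
    have "\<beta> q p ~= 0" using that by (auto simp: w_def)
    then show ?thesis using \<beta>(5)[OF \<open>q \<in> I\<close>] by (simp add: V_def)
   qed
   then show "w q p * pd (?n p z) (v q) z \<ge> 0" "w q p > 0 ==> w q p * pd (?n p z) (v q) z > 0"
    using w0'(3)[of q p] by (cases "w q p = 0"; simp)+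
  qed
  have t2': "(\<Sum>q\<in>I. w q p * pd (?n p z) (v q) z) \<ge> 0" by (intro sum_nonneg t2)
  have "w0 p * Re (cnj c * ?n p z) + w1 p * pd (0, ?n p z) u1 (fst p, z)
   + (\<Sum>q\<in>I. w q p * pd (?n p z) (v q) z) > 0"
   using somepos[of p]
  proof (elim disjE bexE)
   fix q assume q: "q \<in> I" "0 < w q p"
   then have "(\<Sum>q\<in>I. w q p * pd (?n p z) (v q) z) > 0"
    by (intro sum_pos2[OF \<beta>(1) q(1), of "%q. w q p * pd (?n p z) (v q) z"] t2)
   then show ?thesis by (intro add_nonneg_pos add_nonneg_nonneg t0(1) t1(1))
  next
   assume "0 < w0 p" then show ?thesis by (intro add_pos_nonneg t0 t1 t2')
  next
   assume "0 < w1 p" then show ?thesis by (intro add_pos_nonneg add_nonneg_pos t0 t1 t2')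
  qed
  then show ?thesis unfolding pdU using Wpos[of p] by simp
 qed
 moreover have "U ((b + 1, t), z) = U ((b, t), z)" for b t z
  by (simp add: U_def W_def w_def w0_def w1_def \<beta>(4) u1(2))
 moreover have "U ((b, t), z) = Re (cnj c * z)" if "t <= 0" for b t z
 proof -
  have "w q (b, t) = 0" "w1 (b, t) = 0" for q using that by (auto simp: w_def w1_def)
  moreover have "W (b, t) = w0 (b, t)" using calculation by (simp add: W_def)
  ultimately show ?thesis using Wpos[of "(b, t)"] by (simp add: U_def)
 qed
 moreover have "U ((b, t), z) = u1 (b, z)" if "t \<ge> 1" for b t z
 proof -
  have "w q (b, t) = 0" "w0 (b, t) = 0" for q using that by (auto simp: w_def w0_def)
  moreover have "W (b, t) = w1 (b, t)" using calculation by (simp add: W_def)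
  ultimately show ?thesis using Wpos[of "(b, t)"] by (simp add: U_def)
 qed
 moreover have "\<exists>\<rho>'. \<forall>p z. norm z > \<rho>' --> U (p, z) = Re (cnj c * z)"
 proof -
  define R where "R = Max (insert \<rho> (\<rho>v ` I))"
  have R: "\<rho> <= R" "!!q. q \<in> I ==> \<rho>v q <= R" using \<beta>(1) by (auto simp: R_def)
  have "U (p, z) = Re (cnj c * z)" if z: "norm z > R" for p z
  proof -
   have "v q z = Re (cnj c * z)" if "q \<in> I" for q using v(2)[of q z] R(2)[OF that] z by simp
   then have "(\<Sum>q\<in>I. w q p * v q z) = (\<Sum>q\<in>I. w q p) * Re (cnj c * z)"
    by (simp add: sum_distrib_right)
   moreover have "u1 (fst p, z) = Re (cnj c * z)" using u1(3) z R(1) by simp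
   ultimately have "U (p, z) = (W p * Re (cnj c * z)) / W p"
    unfolding U_def W_def fst_conv snd_conv by (simp only: distrib_right)
   then show ?thesis using Wpos[of p] by simp
  qed
  then show ?thesis by blast
 qed
 ultimately show ?thesis using Us by blast
qed

section \<open>Isotopies of the plane\<close>

text \<open>The gradient in the \<open>complex\<close> factor alone, encoded so that the derivative
  in direction w is \<open>Re (cnj w * gr f x)\<close>, see \<open>pd_gr\<close>.\<close>

definition gr :: "('p::euclidean_space \<times> complex => real) => 'p \<times> complex => complex" where
 "gr f x = Complex (pd (0, 1) f x) (pd (0, \<i>) f x)"

text \<open>\<open>Im (cnj a * b)\<close> is the determinant of the real matrix with columns a and
  b, so this is the Jacobian determinant along the fibre.\<close>

definition vjac :: "('p::euclidean_space \<times> complex => complex) => 'p \<times> complex => real" where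
 "vjac F x = Im (cnj (pd (0, 1) F x) * pd (0, \<i>) F x)"

lemma pd_vertical:
 fixes f :: "'p::euclidean_space \<times> complex => 'b::euclidean_space"
 assumes "f differentiable (at x)"
 shows "pd (0, w) f x = Re w *\<^sub>R pd (0, 1) f x + Im w *\<^sub>R pd (0, \<i>) f x"
proof -
 have "(0, w) = Re w *\<^sub>R (0, 1) + Im w *\<^sub>R (0::'p, \<i>)" by (simp add: complex_eq_iff)
 then show ?thesis using linear_add[OF pd_linear[OF assms]] linear_cmul[OF pd_linear[OF assms]] by metis
qed

lemma pd_gr:
 assumes "f differentiable (at x)" shows "pd (0, w) f x = Re (cnj w * gr f x)"
 by (subst pd_vertical[OF assms]) (simp add: gr_def)

lemma smo_gr: "smo S f ==> open S ==> smo S (gr f)"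
 unfolding gr_def[abs_def] by (intro smo_intros smo_pd)

lemma smo_vjac: "smo S F ==> open S ==> smo S (vjac F)"
 unfolding vjac_def[abs_def] by (intro smo_intros smo_pd)

lemma pd_periodic:
 assumes "!!x. f (x + a) = f x" "!!x. f differentiable (at x)"
 shows "pd v f (x + a) = pd v f x"
proof -
 have "((%y. y + a) has_derivative (%v. v)) (at x)" by (auto intro!: derivative_eq_intros)
 from has_derivative_compose[OF this has_pd[OF assms(2)]]
 have "(f has_derivative (%v. pd v f (x + a))) (at x)" by (simp add: assms(1))
 from pd_eq[OF this] show ?thesis by simp
qed

lemma has_derivative_Complex:
 assumes "(V has_derivative V') (at x)" "(U has_derivative U') (at x)"
 shows "((%x. Complex (V x) (U x)) has_derivative (%v. Complex (V' v) (U' v))) (at x)"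
proof -
 have "((%x. of_real (V x) + \<i> * of_real (U x)) has_derivative (%v. of_real (V' v) + \<i> * of_real (U' v))) (at x)"
  by (intro has_derivative_add has_derivative_mult_right has_derivative_of_real assms)
 then show ?thesis by (simp add: Complex_eq)
qed

lemma vjac_Complex:
 assumes "V differentiable (at x)" "U differentiable (at x)"
 shows "vjac (%x. Complex (V x) (U x)) x = Re (cnj (- \<i> * gr U x) * gr V x)"
proof -
 have "pd v (%x. Complex (V x) (U x)) x = Complex (pd v V x) (pd v U x)" for v
  by (rule pd_eq, rule has_derivative_Complex[OF has_pd[OF assms(1)] has_pd[OF assms(2)]])
 then show ?thesis by (simp add: vjac_def gr_def algebra_simps)
qed

lemma pd_snd: "pd v snd x = snd v"
 by (rule pd_eq) (auto intro!: derivative_eq_intros)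

lemma nonzero_connected_pos:
 fixes h :: "'a::topological_space => real"
 assumes "connected S" "continuous_on S h" "!!x. x \<in> S ==> h x ~= 0" "a \<in> S" "h a > 0" "x \<in> S"
 shows "h x > 0"
proof (rule ccontr)
 assume "\<not> h x > 0"
 moreover have "connected (h ` S)" by (rule connected_continuous_image[OF assms(2,1)])
 ultimately have "0 \<in> h ` S"
  using assms(4-6) unfolding connected_iff_interval by (meson imageI less_imp_le not_less)
 then show False using assms(3) by auto
qed

text \<open>The imaginary part is deformed first, through functions U without critical points; then
  the real part, through functions V that increase along the level curves of U, whose direction is
  \<open>- \<i> * gr U\<close>. By \<open>vjac_Complex\<close> this derivative of V is, up to a
  positive factor, the Jacobian of the map with real part V and imaginary part U.\<close>

proposition plane_isotopy:
 fixes g :: "real \<times> complex => complex"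
 assumes g: "smo UNIV g" and per: "!!b z. g (b + 1, z) = g (b, z)"
  and far: "!!b z. norm z > \<rho> ==> g (b, z) = z" and jac: "!!x. vjac g x ~= 0"
 shows "\<exists>(F :: (real \<times> real) \<times> complex => complex) \<rho>'. smo UNIV F &
  (\<forall>p z. norm z > \<rho>' --> F (p, z) = z) & (\<forall>b t z. F ((b + 1, t), z) = F ((b, t), z)) &
  (\<forall>b t z. t <= 0 --> F ((b, t), z) = z) & (\<forall>b t z. t \<ge> 1 --> F ((b, t), z) = g (b, z)) &
  (\<forall>x. vjac F x > 0)"
proof -
 define u1 where "u1 x = Im (g x)" for x
 define v1 where "v1 x = Re (g x)" for x
 have us: "smo UNIV u1" "smo UNIV v1" unfolding u1_def[abs_def] v1_def[abs_def] by (intro smo_intros g open_UNIV)+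
 have ud: "u1 differentiable (at x)" "v1 differentiable (at x)" for x
  using smo_differentiable[OF us(1)] smo_differentiable[OF us(2)] by auto
 have gUV: "g = (%x. Complex (v1 x) (u1 x))" by (simp add: u1_def v1_def)
 have jac_eq: "vjac g x = Re (cnj (- \<i> * gr u1 x) * gr v1 x)" for x
  by (subst gUV) (rule vjac_Complex[OF ud(2,1)])
 define z0 where "z0 = complex_of_real (\<bar>\<rho>\<bar> + 1)"
 have z0: "norm z0 > \<rho>" by (simp add: z0_def)
 let ?S = "UNIV \<times> - cball 0 \<rho> :: (real \<times> complex) set"
 have oS: "open ?S" by (intro open_Times open_UNIV open_Compl closed_cball)
 have cS: "connected ?S"
  by (intro connected_Times connected_UNIV connected_complement_bounded_convex) auto
 have gr_far: "gr u1 x = \<i>" "gr v1 x = 1" if "x \<in> ?S" for x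
 proof -
  have "pd v g x = snd v" for v
   using pd_cong[OF oS that, of g snd v] far by (auto simp: pd_snd)
  moreover have "pd v u1 x = Im (pd v g x)" "pd v v1 x = Re (pd v g x)" for v
   unfolding u1_def[abs_def] v1_def[abs_def]
   by (rule pd_eq, rule bounded_linear.has_derivative[OF _ smo_has_pd[OF g]], simp_all add: bounded_linear_Im bounded_linear_Re)+
  ultimately show "gr u1 x = \<i>" "gr v1 x = 1" by (simp_all add: gr_def complex_eq_iff)
 qed
 \<comment> \<open>The Jacobian never vanishes and is positive far out, where g is the
   identity.\<close>
 have jacpos: "vjac g x > 0" for x
 proof (rule nonzero_connected_pos[OF connected_UNIV smo_continuous[OF smo_vjac[OF g open_UNIV]] jac])
  show "vjac g (0, z0) > 0" unfolding jac_eq using gr_far[of "(0, z0)"] z0 by simp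
 qed auto
 have gnz: "gr u1 x ~= 0" for x using jac[of x] unfolding jac_eq by auto
 \<comment> \<open>Far out \<open>gr u1\<close> is \<i>, so f is 1 there and its logarithm can be
   normalised to vanish there; this makes the angle below admissible for
   \<open>lyapunov_family\<close>.\<close>
 define f where "f x = - \<i> * gr u1 x" for x
 have fs: "smo UNIV f" unfolding f_def[abs_def] by (intro smo_intros smo_gr us open_UNIV)
 have fnz: "f x ~= 0" for x using gnz by (simp add: f_def)
 have ffar: "f x = 1" if "x \<in> ?S" for x using gr_far[OF that] by (simp add: f_def)
 obtain h1 where h1: "continuous_on UNIV h1" "!!x. f x = exp (h1 x)"
  using continuous_logarithm_on_contractible[OF smo_continuous[OF fs] contractible_UNIV] fnz by auto
 define h where "h x = h1 x - h1 (0, z0)" for x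
 have hc: "continuous_on UNIV h" unfolding h_def by (intro continuous_intros h1)
 have hexp: "f x = exp (h x)" for x
  using h1(2)[of x] h1(2)[of "(0, z0)"] ffar[of "(0, z0)"] z0 by (simp add: h_def exp_diff)
 have hfar: "h x = 0" if "x \<in> ?S" for x
 proof -
  have "h x = h (0, z0)"
   by (rule exp_const_imp_const[OF cS continuous_on_subset[OF hc] _ that, of 1])
     (use ffar z0 hexp in auto)
  then show ?thesis by (simp add: h_def)
 qed
 have fper: "f (x + (1, 0)) = f x" for x
 proof -
  have "pd v u1 (x + (1, 0)) = pd v u1 x" for v
   by (rule pd_periodic[OF _ ud(1)]) (auto simp: u1_def per)
  then show ?thesis by (simp add: f_def gr_def)
 qed
 have hper: "h (b + 1, z) = h (b, z)" for b z
 proof -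
  define d where "d x = h (x + (1, 0)) - h x" for x
  have dc: "continuous_on UNIV d" unfolding d_def
   by (intro continuous_on_diff hc continuous_on_compose2[OF hc]) (auto intro!: continuous_intros)
  have "exp (d x) = 1" for x
   using hexp[of x] hexp[of "x + (1, 0)"] fper[of x] fnz[of x] by (simp add: d_def exp_diff)
  then have "d (b, z) = d (0, z0)" by (intro exp_const_imp_const[OF connected_UNIV dc, of 1]) auto
  also have "d (0, z0) = 0" using hfar z0 by (simp add: d_def)
  finally show ?thesis by (simp add: d_def)
 qed
 \<comment> \<open>The field \<i> cis \<theta> turns from the constant direction \<i>, for t <= 1/3,
   to the direction of \<open>gr u1\<close>, for t >= 2/3.\<close>
 define \<theta> where "\<theta> x = stp (3 * snd (fst x) - 1) * Im (h (fst (fst x), snd x))" for x :: "(real \<times> real) \<times> complex"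
 have \<theta>c: "continuous_on UNIV \<theta>" unfolding \<theta>_def
  by (intro continuous_on_mult continuous_on_Im continuous_on_compose2[OF hc]
    continuous_on_compose2[OF smo_continuous[OF smo_stp]]) (auto intro!: continuous_intros)
 have \<theta>far: "\<theta> (p, z) = 0" if "norm z > \<rho>" for p z using hfar[of "(fst p, z)"] that by (simp add: \<theta>_def)
 have grf: "gr u1 x = \<i> * f x" for x by (simp add: f_def)
 have pos1: "pd (0, \<i> * cis (\<theta> ((b, t), z))) u1 (b, z) > 0" if "t > 2/3" for b t z
 proof -
  have "\<theta> ((b, t), z) = Im (h (b, z))" using that by (simp add: \<theta>_def)
  then have "cnj (\<i> * cis (\<theta> ((b, t), z))) * gr u1 (b, z) = of_real (exp (Re (h (b, z)))) * (cis (Im (h (b, z))) * cnj (cis (Im (h (b, z)))))"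
   unfolding grf hexp by (simp add: exp_eq_polar mult_ac)
  also have "\<dots> = of_real (exp (Re (h (b, z))))" by (simp add: cis_cnj cis_mult)
  finally show ?thesis by (subst pd_gr[OF ud(1)]) simp
 qed
 have u1far: "u1 (b, z) = Re (cnj \<i> * z)" if "norm z > \<rho>" for b z using far[OF that] by (simp add: u1_def)
 obtain U0 :: "(real \<times> real) \<times> complex => real" and \<rho>0 where U0: "smo UNIV U0"
   "!!p z. norm z > \<rho>0 ==> U0 (p, z) = Re (cnj \<i> * z)" "!!b t z. U0 ((b + 1, t), z) = U0 ((b, t), z)"
   "!!b t z. t <= 0 ==> U0 ((b, t), z) = Re (cnj \<i> * z)" "!!b t z. t \<ge> 1 ==> U0 ((b, t), z) = u1 (b, z)"
   "!!p z. pd (0, \<i> * cis (\<theta> (p, z))) U0 (p, z) > 0"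
 proof -
  have "\<exists>(U :: (real \<times> real) \<times> complex => real) \<rho>'. smo UNIV U &
   (\<forall>p z. norm z > \<rho>' --> U (p, z) = Re (cnj \<i> * z)) & (\<forall>b t z. U ((b + 1, t), z) = U ((b, t), z)) &
   (\<forall>b t z. t <= 0 --> U ((b, t), z) = Re (cnj \<i> * z)) & (\<forall>b t z. t \<ge> 1 --> U ((b, t), z) = u1 (b, z)) &
   (\<forall>p z. pd (0, \<i> * cis (\<theta> (p, z))) U (p, z) > 0)"
   by (rule lyapunov_family[OF \<theta>c \<theta>far _ _ _ us(1) _ u1far pos1]) (auto simp: \<theta>_def hper u1_def per)
  then show thesis using that by (elim exE conjE) blast
 qed
 \<comment> \<open>Compresses the deformation into 1/3 <= t <= 2/3, so that U does not depend on t
   near either end. The second use of \<open>lyapunov_family\<close> needs a constant field for t <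
   1/3 and one compatible with \<open>v1\<close> for t > 2/3.\<close>
 define sh where "sh x = ((fst (fst x), 3 * snd (fst x) - 1), snd x)" for x :: "(real \<times> real) \<times> complex"
 define U where "U x = U0 (sh x)" for x
 define \<theta>' where "\<theta>' x = \<theta> (sh x)" for x
 have shs: "smo UNIV sh" unfolding sh_def[abs_def] by (intro smo_intros open_UNIV)
 have shc: "continuous_on UNIV sh" using smo_continuous[OF shs] .
 have Us: "smo UNIV U" unfolding U_def[abs_def] by (rule smo_compose_UNIV[OF U0(1) shs open_UNIV])
 have Ud: "U differentiable (at x)" for x using smo_differentiable[OF Us] by simp
 have Uper: "U (x + ((1, 0), 0)) = U x" for x
  using U0(3)[of "fst (fst x)" "3 * snd (fst x) - 1" "snd x"] by (simp add: U_def sh_def)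
 have pdU: "pd (0, w) U x = pd (0, w) U0 (sh x)" for w x
 proof -
  have "(sh has_derivative (%v. ((fst (fst v), 3 * snd (fst v)), snd v))) (at x)"
   unfolding sh_def[abs_def] by (auto intro!: derivative_eq_intros)
  from has_derivative_compose[OF this smo_has_pd[OF U0(1)]]
  have "(U has_derivative (%v. pd ((fst (fst v), 3 * snd (fst v)), snd v) U0 (sh x))) (at x)"
   unfolding U_def[abs_def] by simp
  from pd_eq[OF this, of "(0, w)"] show ?thesis by (simp add: zero_prod_def)
 qed
 define k where "k x = gr U x * cnj (\<i> * cis (\<theta>' x))" for x
 have \<theta>'c: "continuous_on UNIV \<theta>'" unfolding \<theta>'_def by (rule continuous_on_compose2[OF \<theta>c shc]) simp
 have kpos: "Re (k x) > 0" for x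
 proof -
  have "pd (0, \<i> * cis (\<theta>' x)) U x > 0"
   unfolding pdU \<theta>'_def using U0(6)[where p="fst (sh x)" and z="snd (sh x)"] by simp
  then show ?thesis unfolding pd_gr[OF Ud] k_def by (simp add: mult.commute)
 qed
 have kc: "continuous_on UNIV k" unfolding k_def
  by (intro continuous_intros smo_continuous[OF smo_gr[OF Us open_UNIV]] continuous_on_compose2[OF continuous_on_cis[OF continuous_on_id] \<theta>'c]) auto
 \<comment> \<open>A continuous angle of \<open>- \<i> * gr U\<close>: the known angle \<theta>' is
   corrected by the argument of k, whose real part is positive because U increases along the first
   field.\<close>
 define \<theta>2 where "\<theta>2 x = \<theta>' x + Im (Ln (k x))" for x
 have \<theta>2c: "continuous_on UNIV \<theta>2" unfolding \<theta>2_def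
  by (intro continuous_on_add \<theta>'c continuous_on_Im continuous_on_Ln' kc)
    (use kpos in \<open>auto simp: complex_nonpos_Reals_iff not_le[symmetric]\<close>)
 have ci: "cis a * cnj (cis a) = 1" for a by (simp add: cis_cnj cis_mult)
 have dir: "cis (\<theta>2 x) = - \<i> * gr U x / of_real (norm (k x))" for x
 proof -
  have kx: "k x ~= 0" using kpos[of x] by auto
  have "k x = of_real (norm (k x)) * cis (Im (Ln (k x)))"
   using kx exp_Ln[OF kx] exp_eq_polar[of "Ln (k x)"] by (simp add: Re_Ln)
  then have "cis (Im (Ln (k x))) = k x / of_real (norm (k x))" using kx by (simp add: field_simps)
  then have "cis (\<theta>2 x) = cis (\<theta>' x) * k x / of_real (norm (k x))"
   by (simp add: \<theta>2_def cis_mult[symmetric])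
  also have "cis (\<theta>' x) * k x = (cis (\<theta>' x) * cnj (cis (\<theta>' x))) * (- \<i> * gr U x)"
   by (simp add: k_def mult_ac)
  finally show ?thesis unfolding ci by simp
 qed
 have key: "pd (0, cis (\<theta>2 x)) V y = Re (cnj (- \<i> * gr U x) * gr V y) / norm (k x)"
  if "V differentiable (at y)" for V x and y :: "'q::euclidean_space \<times> complex"
  unfolding pd_gr[OF that] dir by simp
 define \<rho>2 where "\<rho>2 = max \<rho> \<rho>0"
 have Ufar: "U (p, z) = Im z" if "norm z > \<rho>0" for p z using U0(2)[OF that] by (simp add: U_def sh_def)
 have grU_i: "gr U x = \<i>" if "open T" "x \<in> T" "!!y. y \<in> T ==> U y = Im (snd y)" for x T
 proof -
  have "pd v U x = pd v (%y. Im (snd y)) x" for v by (rule pd_cong[OF that])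
  moreover have "pd v (%y::(real \<times> real) \<times> complex. Im (snd y)) x = Im (snd v)" for v
   by (rule pd_eq) (auto intro!: derivative_eq_intros)
  ultimately show ?thesis by (simp add: gr_def complex_eq_iff)
 qed
 have \<theta>2far: "\<theta>2 (p, z) = 0" if z: "norm z > \<rho>2" for p z
 proof -
  have "gr U (p, z) = \<i>"
   by (rule grU_i[of "UNIV \<times> - cball 0 \<rho>0"]) (use z Ufar in \<open>auto simp: \<rho>2_def intro!: open_Times\<close>)
  moreover have "\<theta>' (p, z) = 0" using \<theta>far z by (simp add: \<theta>'_def sh_def \<rho>2_def)
  ultimately show ?thesis by (simp add: \<theta>2_def k_def)
 qed
 have \<theta>2per: "\<theta>2 ((b + 1, t), z) = \<theta>2 ((b, t), z)" for b t z
 proof -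
  have "pd v U (((b, t), z) + ((1, 0), 0)) = pd v U ((b, t), z)" for v by (rule pd_periodic[OF Uper Ud])
  then have "gr U ((b + 1, t), z) = gr U ((b, t), z)" by (simp add: gr_def)
  moreover have "\<theta>' ((b + 1, t), z) = \<theta>' ((b, t), z)" by (simp add: \<theta>'_def sh_def \<theta>_def hper)
  ultimately show ?thesis by (simp add: \<theta>2_def k_def)
 qed
 have \<theta>20: "\<theta>2 ((b, t), z) = 0" if "t < 1/3" for b t z
 proof -
  let ?T = "(UNIV \<times> {..<1/3}) \<times> UNIV :: ((real \<times> real) \<times> complex) set"
  have "gr U ((b, t), z) = \<i>"
   by (rule grU_i[of ?T]) (use that U0(4) in \<open>auto simp: U_def sh_def intro!: open_Times\<close>)
  moreover have "\<theta>' ((b, t), z) = 0" using that by (simp add: \<theta>'_def sh_def \<theta>_def)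
  ultimately show ?thesis by (simp add: \<theta>2_def k_def)
 qed
 have grU1: "gr U ((b, t), z) = gr u1 (b, z)" if t: "t > 2/3" for b t z
 proof -
  let ?T = "(UNIV \<times> {2/3<..}) \<times> UNIV :: ((real \<times> real) \<times> complex) set"
  have "pd (0, w) U ((b, t), z) = pd (0, w) u1 (b, z)" for w
  proof -
   have "pd (0, w) U ((b, t), z) = pd (0, w) (%x. u1 (fst (fst x), snd x)) ((b, t), z)"
    by (rule pd_cong[of ?T]) (use t U0(5) in \<open>auto simp: U_def sh_def intro!: open_Times\<close>)
   also have "\<dots> = pd (0, w) u1 (b, z)"
   proof -
    have "((%x::(real\<times>real)\<times>complex. (fst (fst x), snd x)) has_derivative (%v. (fst (fst v), snd v))) (at ((b, t), z))"
     by (auto intro!: derivative_eq_intros)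
    from has_derivative_compose[OF this has_pd[OF ud(1)]]
    have "((%x. u1 (fst (fst x), snd x)) has_derivative (%v. pd (fst (fst v), snd v) u1 (b, z))) (at ((b, t), z))"
     by simp
    from pd_eq[OF this, of "(0, w)"] show ?thesis by simp
   qed
   finally show ?thesis .
  qed
  then show ?thesis by (simp add: gr_def)
 qed
 have pos2: "pd (0, 1 * cis (\<theta>2 ((b, t), z))) v1 (b, z) > 0" if t: "t > 2/3" for b t z
 proof -
  have "norm (k ((b, t), z)) > 0" using kpos[of "((b, t), z)"] by auto
  moreover have "pd (0, cis (\<theta>2 ((b, t), z))) v1 (b, z) = vjac g (b, z) / norm (k ((b, t), z))"
   unfolding key[OF ud(2)] grU1[OF t] jac_eq ..
  ultimately show ?thesis using jacpos[of "(b, z)"] by simp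
 qed
 obtain V :: "(real \<times> real) \<times> complex => real" and \<rho>3 where V: "smo UNIV V"
   "!!p z. norm z > \<rho>3 ==> V (p, z) = Re (cnj 1 * z)" "!!b t z. V ((b + 1, t), z) = V ((b, t), z)"
   "!!b t z. t <= 0 ==> V ((b, t), z) = Re (cnj 1 * z)" "!!b t z. t \<ge> 1 ==> V ((b, t), z) = v1 (b, z)"
   "!!p z. pd (0, 1 * cis (\<theta>2 (p, z))) V (p, z) > 0"
 proof -
  have v1far: "v1 (b, z) = Re (cnj 1 * z)" if "norm z > \<rho>2" for b z using far[of z b] that by (simp add: v1_def \<rho>2_def)
  have "\<exists>(U :: (real \<times> real) \<times> complex => real) \<rho>'. smo UNIV U &
   (\<forall>p z. norm z > \<rho>' --> U (p, z) = Re (cnj 1 * z)) & (\<forall>b t z. U ((b + 1, t), z) = U ((b, t), z)) &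
   (\<forall>b t z. t <= 0 --> U ((b, t), z) = Re (cnj 1 * z)) & (\<forall>b t z. t \<ge> 1 --> U ((b, t), z) = v1 (b, z)) &
   (\<forall>p z. pd (0, 1 * cis (\<theta>2 (p, z))) U (p, z) > 0)"
   by (rule lyapunov_family[OF \<theta>2c \<theta>2far \<theta>2per \<theta>20 _ us(2) _ v1far pos2]) (auto simp: v1_def per)
  then show thesis using that by (elim exE conjE) blast
 qed
 define F where "F x = Complex (V x) (U x)" for x
 have Vd: "V differentiable (at x)" for x using smo_differentiable[OF V(1)] by simp
 have Fs: "smo UNIV F" unfolding F_def[abs_def] by (intro smo_intros V(1) Us open_UNIV)
 have "vjac F x > 0" for x
 proof -
  have "norm (k x) > 0" using kpos[of x] by auto
  moreover have "pd (0, cis (\<theta>2 x)) V x > 0" using V(6)[of "fst x" "snd x"] by simp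
  ultimately show ?thesis unfolding key[OF Vd] F_def[abs_def] vjac_Complex[OF Vd Ud]
   by (simp add: zero_less_divide_iff)
 qed
 moreover have "F (p, z) = z" if "norm z > max \<rho>0 \<rho>3" for p z
  using that Ufar V(2) by (simp add: F_def)
 moreover have "F ((b + 1, t), z) = F ((b, t), z)" for b t z
  using V(3) Uper[of "((b, t), z)"] by (simp add: F_def)
 moreover have "F ((b, t), z) = z" if "t <= 0" for b t z
  using V(4)[OF that] U0(4)[of "3 * t - 1"] that by (simp add: F_def U_def sh_def)
 moreover have "F ((b, t), z) = g (b, z)" if "t \<ge> 1" for b t z
  using V(5)[OF that] U0(5)[of "3 * t - 1"] that by (simp add: F_def U_def sh_def u1_def v1_def)
 ultimately show ?thesis using Fs
  by (intro exI[of _ F] exI[of _ "max \<rho>0 \<rho>3"]) auto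
qed

text \<open>The values taken exactly once form a clopen set. It is open because the image of X - U
  is compact, so no further preimage appears nearby; its complement is open because two preimages
  can be separated and each continued, while the values not taken form an open set.\<close>

lemma bij_of_local_homeo:
 fixes f :: "'a::metric_space => 'b::metric_space"
 assumes X: "compact X" and Y: "connected Y" and f: "continuous_on X f" "f ` X \<subseteq> Y"
  and loc: "!!x. x \<in> X ==> \<exists>U. openin (top_of_set X) U & x \<in> U & inj_on f U &
    (\<forall>V. openin (top_of_set X) V --> V \<subseteq> U --> openin (top_of_set Y) (f ` V))"
  and q: "q \<in> Y" "\<exists>!x. x \<in> X & f x = q"
 shows "bij_betw f X Y"
proof -
 define A where "A = {y \<in> Y. \<exists>!x. x \<in> X & f x = y}"
 have cl: "openin (top_of_set Y) (Y - f ` K)" if "compact K" "K \<subseteq> X" for K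
 proof -
  have "compact (f ` K)" using f(1) that continuous_on_subset compact_continuous_image by blast
  then have "openin (top_of_set Y) (Y \<inter> - f ` K)" by (intro openin_open_Int open_Compl compact_imp_closed)
  then show ?thesis by (simp add: Diff_eq)
 qed
 have "openin (top_of_set Y) A"
 proof (subst openin_subopen, intro ballI)
  fix y assume y: "y \<in> A"
  then obtain x where x: "x \<in> X" "f x = y" "!!x'. x' \<in> X ==> f x' = y ==> x' = x" unfolding A_def by blast
  obtain U where U: "openin (top_of_set X) U" "x \<in> U" "inj_on f U"
   "!!V. openin (top_of_set X) V ==> V \<subseteq> U ==> openin (top_of_set Y) (f ` V)"
   using loc[OF x(1)] by blast
  have "closedin (top_of_set X) (X - U)" using U(1) by (simp add: closedin_diff)
  then have "compact (X - U)" using X closedin_compact by blast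
  then have o: "openin (top_of_set Y) (f ` U \<inter> (Y - f ` (X - U)))"
   using U(1,4) by (intro openin_Int cl) auto
  have "f ` U \<inter> (Y - f ` (X - U)) \<subseteq> A"
  proof
   fix y' assume y': "y' \<in> f ` U \<inter> (Y - f ` (X - U))"
   then obtain x' where x': "x' \<in> U" "f x' = y'" by blast
   have "x'' = x'" if "x'' \<in> X" "f x'' = y'" for x''
   proof -
    have "x'' \<in> U" using that y' by blast
    then show ?thesis using inj_onD[OF U(3), of x'' x'] x' that by simp
   qed
   then show "y' \<in> A" using x' y' openin_imp_subset[OF U(1)] unfolding A_def by blast
  qed
  moreover have "y \<in> f ` U \<inter> (Y - f ` (X - U))" using x U(2) y unfolding A_def by blast
  ultimately show "\<exists>T. openin (top_of_set Y) T & y \<in> T & T \<subseteq> A" using o by blast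
 qed
 moreover have "openin (top_of_set Y) (Y - A)"
 proof (subst openin_subopen, intro ballI)
  fix y assume y: "y \<in> Y - A"
  show "\<exists>T. openin (top_of_set Y) T & y \<in> T & T \<subseteq> Y - A"
  proof (cases "y \<in> f ` X")
   case False
   have "Y - f ` X \<subseteq> Y - A" unfolding A_def by blast
   then show ?thesis using cl[OF X order_refl] False y by blast
  next
   case True
   then obtain x1 where x1: "x1 \<in> X" "f x1 = y" by blast
   then obtain x2 where x2: "x2 \<in> X" "f x2 = y" "x1 ~= x2" using y unfolding A_def by blast
   obtain U1 where U1: "openin (top_of_set X) U1" "x1 \<in> U1"
    "!!V. openin (top_of_set X) V ==> V \<subseteq> U1 ==> openin (top_of_set Y) (f ` V)" using loc[OF x1(1)] by blast
   obtain U2 where U2: "openin (top_of_set X) U2" "x2 \<in> U2"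
    "!!V. openin (top_of_set X) V ==> V \<subseteq> U2 ==> openin (top_of_set Y) (f ` V)" using loc[OF x2(1)] by blast
   obtain O1 O2 where O: "open O1" "open O2" "x1 \<in> O1" "x2 \<in> O2" "O1 \<inter> O2 = {}" using hausdorff[OF x2(3)] by blast
   let ?T = "f ` (U1 \<inter> O1) \<inter> f ` (U2 \<inter> O2)"
   have "openin (top_of_set Y) ?T"
    using U1 U2 O by (intro openin_Int U1(3) U2(3) openin_Int_open) auto
   moreover have "y \<in> ?T"
    using x1(2) x2(2) U1(2) U2(2) O(3,4) by (intro IntI image_eqI[of y f x1] image_eqI[of y f x2]) auto
   moreover have "?T \<subseteq> Y - A"
   proof
    fix y' assume y': "y' \<in> ?T"
    obtain a where a: "a \<in> U1 \<inter> O1" "f a = y'" using IntD1[OF y'] by (rule imageE) simp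
    obtain b where b: "b \<in> U2 \<inter> O2" "f b = y'" using IntD2[OF y'] by (rule imageE) simp
    note ab = a b
    then have "a ~= b" "a \<in> X" "b \<in> X" using O(5) openin_imp_subset[OF U1(1)] openin_imp_subset[OF U2(1)] by auto
    then show "y' \<in> Y - A" using ab f(2) unfolding A_def by blast
   qed
   ultimately show ?thesis by blast
  qed
 qed
 moreover have "A \<subseteq> Y" "q \<in> A" using q unfolding A_def by auto
 ultimately have "A = Y"
  using Y unfolding connected_clopen closedin_def topspace_euclidean_subtopology by blast
 then have ex: "\<exists>!x. x \<in> X & f x = y" if "y \<in> Y" for y using that unfolding A_def by blast
 show ?thesis
 proof (rule bij_betw_imageI)
  show "inj_on f X"
  proof (rule inj_onI)
   fix x x' assume "x \<in> X" "x' \<in> X" "f x = f x'"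
   then show "x = x'" using ex[of "f x"] f(2) by auto
  qed
  show "f ` X = Y"
  proof
   show "Y \<subseteq> f ` X"
   proof
    fix y assume "y \<in> Y"
    then obtain x where "x \<in> X" "f x = y" using ex[of y] by auto
    then show "y \<in> f ` X" by auto
   qed
  qed (rule f(2))
 qed
qed

text \<open>Cramer's rule for the real basis a, b of the plane.\<close>

lemma vertical_solve:
 fixes a b y :: complex
 assumes "Im (cnj a * b) ~= 0"
 shows "(Im (cnj y * b) / Im (cnj a * b)) *\<^sub>R a + (Im (cnj a * y) / Im (cnj a * b)) *\<^sub>R b = y"
  "Im (cnj (s *\<^sub>R a + t *\<^sub>R b) * b) / Im (cnj a * b) = s" "Im (cnj a * (s *\<^sub>R a + t *\<^sub>R b)) / Im (cnj a * b) = t"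
proof -
 let ?J = "Im (cnj a * b)"
 have J: "?J = Re a * Im b - Im a * Re b" by simp
 have "Im (cnj y * b) * Re a + Im (cnj a * y) * Re b = ?J * Re y"
    "Im (cnj y * b) * Im a + Im (cnj a * y) * Im b = ?J * Im y" by (simp_all add: algebra_simps)
 then show "(Im (cnj y * b) / ?J) *\<^sub>R a + (Im (cnj a * y) / ?J) *\<^sub>R b = y"
  using assms by (simp add: complex_eq_iff add_divide_distrib[symmetric] del: complex_cnj_mult times_complex.sel)
 have "Im (cnj (s *\<^sub>R a + t *\<^sub>R b) * b) = s * ?J" "Im (cnj a * (s *\<^sub>R a + t *\<^sub>R b)) = t * ?J"
  by (simp_all add: algebra_simps)
 then show "Im (cnj (s *\<^sub>R a + t *\<^sub>R b) * b) / ?J = s" "Im (cnj a * (s *\<^sub>R a + t *\<^sub>R b)) / ?J = t"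
  using assms by (simp_all del: complex_cnj_add times_complex.sel)
qed

text \<open>The inverse function theorem for (p, z) -> (p, F (p, z)). It only provides a
  differentiable inverse; but the derivative of \<mu> is a smooth function of p and \<mu> itself, so
  every order of differentiability yields the next.\<close>

lemma smo_inverse_family:
 fixes F :: "'p::euclidean_space \<times> complex => complex"
 assumes F: "smo W F" and W: "open W" "(p0, z0) \<in> W" and jac: "vjac F (p0, z0) ~= 0"
 shows "\<exists>N \<mu>. open N & (p0, F (p0, z0)) \<in> N & smo N \<mu> & \<mu> (p0, F (p0, z0)) = z0 &
   (\<forall>p w. (p, w) \<in> N --> (p, \<mu> (p, w)) \<in> W & F (p, \<mu> (p, w)) = w) &
   (\<exists>Q. open Q & Q \<subseteq> W & (p0, z0) \<in> Q & (\<forall>p z. (p, z) \<in> Q --> (p, F (p, z)) \<in> N & \<mu> (p, F (p, z)) = z))"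
proof -
 define W' where "W' = W \<inter> vjac F -` (- {0})"
 have jc: "continuous_on W (vjac F)" by (rule smo_continuous[OF smo_vjac[OF F W(1)]])
 have W': "open W'" "(p0, z0) \<in> W'" "W' \<subseteq> W" "!!x. x \<in> W' ==> vjac F x ~= 0"
  unfolding W'_def using jac W continuous_open_preimage[OF jc W(1), of "- {0}"] by auto
 have Fd: "F differentiable (at x)" if "x \<in> W'" for x using smo_differentiable[OF F] that W'(3) by blast
 define H where "H x = (fst x, F x)" for x
 define D where "D x v = (fst v, pd v F x)" for x v
 have HD: "(H has_derivative D x) (at x)" if "x \<in> W'" for x
  unfolding H_def[abs_def] D_def[abs_def] by (intro has_derivative_Pair has_pd[OF Fd[OF that]] derivative_intros)
 have blD: "bounded_linear (D x)" if "x \<in> W'" for x using HD[OF that] by (rule has_derivative_bounded_linear)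
 define H' where "H' x = Blinfun (D x)" for x
 have H'D: "blinfun_apply (H' x) = D x" if "x \<in> W'" for x
  unfolding H'_def by (rule bounded_linear_Blinfun_apply[OF blD[OF that]])
 have cH': "continuous_on W' H'"
 proof (rule continuous_on_blinfun_componentwise)
  fix i :: "'p \<times> complex"
  have "continuous_on W' (%x. D x i)" unfolding D_def
   by (intro continuous_intros continuous_on_subset[OF smo_continuous[OF smo_pd[OF F]] W'(3)])
  then show "continuous_on W' (%x. blinfun_apply (H' x) i)"
   by (rule continuous_on_eq) (simp add: H'D)
 qed
 \<comment> \<open>The inverse of \<open>D x\<close>: the contribution of the parameter direction is
   subtracted, and Cramer's rule solves in the fibre.\<close>
 define E where "E x v = (fst v, Complex (Im (cnj (snd v - pd (fst v, 0) F x) * pd (0, \<i>) F x) / vjac F x)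
   (Im (cnj (pd (0, 1) F x) * (snd v - pd (fst v, 0) F x)) / vjac F x))" for x v
 have split: "pd v F x = pd (fst v, 0) F x + (Re (snd v) *\<^sub>R pd (0, 1) F x + Im (snd v) *\<^sub>R pd (0, \<i>) F x)" if "x \<in> W'" for x v
 proof -
  have "pd v F x = pd (fst v, 0) F x + pd (0, snd v) F x"
   using linear_add[OF pd_linear[OF Fd[OF that]], of "(fst v, 0)" "(0, snd v)"] by simp
  then show ?thesis using pd_vertical[OF Fd[OF that], of "snd v"] by simp
 qed
 have ED: "E x (D x v) = v" if "x \<in> W'" for x v
 proof -
  have j: "Im (cnj (pd (0, 1) F x) * pd (0, \<i>) F x) ~= 0" using W'(4)[OF that] by (simp add: vjac_def)
  show ?thesis unfolding E_def D_def fst_conv snd_conv split[OF that, of v] vjac_def add_diff_cancel_left'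
   using vertical_solve(2,3)[OF j] by (simp add: prod_eq_iff complex_eq_iff)
 qed
 have DE: "D x (E x v) = v" if "x \<in> W'" for x v
 proof -
  have j: "Im (cnj (pd (0, 1) F x) * pd (0, \<i>) F x) ~= 0" using W'(4)[OF that] by (simp add: vjac_def)
  have "pd (E x v) F x = snd v"
   unfolding split[OF that, of "E x v"] using vertical_solve(1)[OF j, of "snd v - pd (fst v, 0) F x"]
   by (simp add: E_def vjac_def)
  then show ?thesis by (simp add: D_def E_def)
 qed
 have Elin: "linear (E x)" if x: "x \<in> W'" for x
 proof (rule linearI)
  have lD: "linear (D x)" using blD[OF x] by (rule bounded_linear.linear)
  fix u v c
  have "E x (D x (E x u) + D x (E x v)) = E x (D x (E x u + E x v))" using linear_add[OF lD] by simp
  then show "E x (u + v) = E x u + E x v" unfolding ED[OF x] DE[OF x] .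
  have "E x (c *\<^sub>R D x (E x u)) = E x (D x (c *\<^sub>R E x u))" using linear_cmul[OF lD] by simp
  then show "E x (c *\<^sub>R u) = c *\<^sub>R E x u" unfolding ED[OF x] DE[OF x] .
 qed
 let ?x0 = "(p0, z0)"
 have blE: "bounded_linear (E ?x0)" using Elin[OF W'(2)] by (rule linear_conv_bounded_linear[THEN iffD1])
 have inv0: "Blinfun (E ?x0) o\<^sub>L H' ?x0 = id_blinfun"
  by (rule blinfun_eqI) (simp add: bounded_linear_Blinfun_apply[OF blE] H'D[OF W'(2)] ED[OF W'(2)])
 have HD': "(H has_derivative blinfun_apply (H' x)) (at x)" if "x \<in> W'" for x
  using HD[OF that] H'D[OF that] by simp
 obtain U' V g g' where g: "open U'" "U' \<subseteq> W'" "?x0 \<in> U'" "open V" "H ?x0 \<in> V" "homeomorphism U' V H g"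
  "!!y. y \<in> V ==> (g has_derivative (g' y)) (at y)"
  "!!y. y \<in> V ==> g' y = inv_into UNIV (blinfun_apply (H' (g y)))"
  "!!y. y \<in> V ==> bij (blinfun_apply (H' (g y)))"
  by (rule inverse_function_theorem[OF W'(1) HD' cH' W'(2) inv0]) (assumption | rule that)+
 have gU: "g y \<in> U'" "H (g y) = y" if "y \<in> V" for y using g(6) that unfolding homeomorphism_def by auto
 have gH: "H x \<in> V" "g (H x) = x" if "x \<in> U'" for x using g(6) that unfolding homeomorphism_def by auto
 define \<mu> where "\<mu> y = snd (g y)" for y
 have gmu: "g y = (fst y, \<mu> y)" if "y \<in> V" for y
  using gU(2)[OF that] by (simp add: \<mu>_def H_def prod_eq_iff)
 have gE: "g' y = E (g y)" if "y \<in> V" for y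
 proof -
  have x: "g y \<in> W'" using gU(1)[OF that] g(2) by blast
  have "inv_into UNIV (D (g y)) = E (g y)" using ED[OF x] DE[OF x] by (intro inv_unique_comp) (auto simp: fun_eq_iff)
  then show ?thesis using g(8)[OF that] H'D[OF x] by simp
 qed
 have \<mu>D: "(\<mu> has_derivative (%v. snd (E (fst y, \<mu> y) v))) (at y)" if "y \<in> V" for y
 proof -
  have "(\<mu> has_derivative (%v. snd (g' y v))) (at y)"
   unfolding \<mu>_def[abs_def] by (rule has_derivative_snd[OF g(7)[OF that]])
  then show ?thesis unfolding gE[OF that] gmu[OF that] .
 qed
 have Es: "smo W' (%x. snd (E x v))" for v
  unfolding E_def snd_conv
  by (intro smo_intros smo_pd smo_subset[OF F W'(3)] smo_vjac W'(1,4))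
 have Ck\<mu>: "Ck_on k \<mu> V" for k
 proof (induction k)
  case 0
  then show ?case using has_derivative_continuous[OF \<mu>D]
   by (simp add: continuous_at_imp_continuous_on)
 next
  case (Suc k)
  have bl: "bounded_linear (%a::complex. (0::'p, a))" "bounded_linear (%y::'p \<times> complex. (fst y, 0::complex))"
   by (auto intro!: bounded_linear_intros)
  have pr: "Ck_on k (%y. (fst y, \<mu> y)) V"
  proof -
   have "Ck_on k (%y. (fst y, 0::complex)) V" using smo_bounded_linear[OF bl(2), of V] by (simp add: smo_def)
   moreover have "Ck_on k (%y. (0::'p, \<mu> y)) V"
    using Ck_compose[of V UNIV \<mu> k "%a. (0::'p, a)"] smo_bounded_linear[OF bl(1), of UNIV] g(4) Suc.IH by (simp add: smo_def)
   ultimately have "Ck_on k (%y. (fst y, 0::complex) + (0::'p, \<mu> y)) V" by (rule Ck_add[OF g(4)])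
   then show ?thesis by simp
  qed
  have im: "(%y. (fst y, \<mu> y)) ` V \<subseteq> W'" using gmu gU(1) g(2) by (metis (no_types, lifting) image_subsetI subsetD)
  have "Ck_on k (pd v \<mu>) V" for v
  proof (rule Ck_transform[OF _ g(4)])
   show "Ck_on k (%y. snd (E (fst y, \<mu> y) v)) V"
    by (rule Ck_compose[OF g(4) W'(1) im _ pr]) (use Es[of v] in \<open>simp add: smo_def\<close>)
  qed (rule pd_eq[OF \<mu>D])
  moreover have "\<forall>y\<in>V. \<mu> differentiable at y" using \<mu>D unfolding differentiable_def by blast
  ultimately show ?case by simp
 qed
 have Hx: "H ?x0 = (p0, F ?x0)" by (simp add: H_def)
 have 1: "(p, \<mu> (p, w)) \<in> W & F (p, \<mu> (p, w)) = w" if "(p, w) \<in> V" for p w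
  using gU[OF that] gmu[OF that] g(2) W'(3) by (auto simp: H_def)
 have 2: "(p, F (p, z)) \<in> V & \<mu> (p, F (p, z)) = z" if "(p, z) \<in> U'" for p z
  using gH[OF that] by (simp add: H_def \<mu>_def)
 have 3: "\<exists>Q. open Q & Q \<subseteq> W & (p0, z0) \<in> Q & (\<forall>p z. (p, z) \<in> Q --> (p, F (p, z)) \<in> V & \<mu> (p, F (p, z)) = z)"
  by (rule exI[of _ U']) (use g 2 W'(3) in auto)
 have 4: "smo V \<mu>" using Ck\<mu> by (simp add: smo_def)
 have 5: "(p0, F (p0, z0)) \<in> V" "\<mu> (p0, F (p0, z0)) = z0" using 2[OF g(3)] by auto
 show ?thesis
  by (rule exI[of _ V], rule exI[of _ \<mu>], intro conjI allI impI) (use g(4) 1 3 4 5 in auto)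
qed

section \<open>Families of diffeomorphisms of the sphere\<close>

definition sg :: "real => complex => real^3" where
 "sg e z = inverse (z \<bullet> z + 1) *\<^sub>R (\<chi> i. if i = 1 then 2 * Re z else if i = 2 then 2 * Im z else e * (z \<bullet> z - 1))"

text \<open>Stereographic projection from the pole (0, 0, e), where e is 1 or -1;
  \<open>sg e\<close> is its inverse and sends 0 to the opposite pole.\<close>

definition ts :: "real => real^3 => complex" where
 "ts e x = inverse (1 - e * x $ 3) *\<^sub>R Complex (x $ 1) (x $ 2)"

text \<open>Angles are counted in full turns, so that integers act trivially.\<close>

definition rot :: "real => real^3 => real^3" where
 "rot t x = (\<chi> i. if i = 1 then cos (2 * pi * t) * x $ 1 - sin (2 * pi * t) * x $ 2
   else if i = 2 then sin (2 * pi * t) * x $ 1 + cos (2 * pi * t) * x $ 2 else x $ 3)"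

abbreviation npole :: "real^3" where "npole \<equiv> axis 3 1"

lemma three_neq [simp]: "(3::3) ~= 1" "(3::3) ~= 2" "(2::3) ~= 1" "(1::3) ~= 2" "(1::3) ~= 3" "(2::3) ~= 3"
 by simp_all

lemma vec3_eq_iff: "(x::real^3) = y \<longleftrightarrow> x $ 1 = y $ 1 & x $ 2 = y $ 2 & x $ 3 = y $ 3"
 by (simp add: vec_eq_iff forall_3)

lemma inner3: "(x::real^3) \<bullet> y = x $ 1 * y $ 1 + x $ 2 * y $ 2 + x $ 3 * y $ 3"
 by (simp add: inner_vec_def sum_3)

lemma S2_iff: "x \<in> S2 \<longleftrightarrow> (x $ 1)\<^sup>2 + (x $ 2)\<^sup>2 + (x $ 3)\<^sup>2 = 1"
 by (simp add: norm_eq_sqrt_inner inner3 power2_eq_square)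

lemma npole_nth [simp]: "npole $ 1 = 0" "npole $ 2 = 0" "npole $ 3 = 1"
 by (simp_all add: axis_def)

lemma npole_S2 [simp]: "npole \<in> S2" "norm npole = 1" by (simp_all add: S2_iff)

lemma S2_npole_iff: "x \<in> S2 ==> x = npole \<longleftrightarrow> x $ 3 = 1"
 unfolding S2_iff vec3_eq_iff by (auto simp: sum_power2_eq_zero_iff)

lemma sg_nth [simp]: "sg e z $ 1 = 2 * Re z / (z \<bullet> z + 1)" "sg e z $ 2 = 2 * Im z / (z \<bullet> z + 1)"
  "sg e z $ 3 = e * (z \<bullet> z - 1) / (z \<bullet> z + 1)"
 by (simp_all add: sg_def divide_inverse)

lemma zz1 [simp]: "z \<bullet> z + 1 ~= (0::real)" "0 < z \<bullet> z + 1" for z :: complex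
 using inner_ge_zero[of z] by linarith+

lemma zz_complex: "z \<bullet> z = (Re z)\<^sup>2 + (Im z)\<^sup>2" for z :: complex
 by (simp add: inner_complex_def power2_eq_square)

lemma sg_S2: assumes "e\<^sup>2 = 1" shows "sg e z \<in> S2"
proof -
 let ?d = "z \<bullet> z + 1"
 have "(2 * Re z)\<^sup>2 + (2 * Im z)\<^sup>2 + (e * (z \<bullet> z - 1))\<^sup>2 = 4 * (z \<bullet> z) + e\<^sup>2 * (z \<bullet> z - 1)\<^sup>2"
  by (simp add: zz_complex power_mult_distrib)
 also have "\<dots> = ?d\<^sup>2" using assms by (simp add: power2_eq_square algebra_simps)
 finally have "((2 * Re z)\<^sup>2 + (2 * Im z)\<^sup>2 + (e * (z \<bullet> z - 1))\<^sup>2) / ?d\<^sup>2 = 1" by simp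
 then show ?thesis unfolding S2_iff sg_nth by (simp add: power_divide add_divide_distrib)
qed

lemma sg_ne: assumes "e\<^sup>2 = 1" shows "1 - e * sg e z $ 3 = 2 / (z \<bullet> z + 1)"
proof -
 have "e * sg e z $ 3 = e\<^sup>2 * (z \<bullet> z - 1) / (z \<bullet> z + 1)" by (simp add: power2_eq_square)
 then have k: "e * sg e z $ 3 = (z \<bullet> z - 1) / (z \<bullet> z + 1)" unfolding assms by simp
 have "1 = (z \<bullet> z + 1) / (z \<bullet> z + 1)" by simp
 then have "1 - e * sg e z $ 3 = (z \<bullet> z + 1) / (z \<bullet> z + 1) - (z \<bullet> z - 1) / (z \<bullet> z + 1)" unfolding k by simp
 then show ?thesis by (simp only: diff_divide_distrib[symmetric]) simp
qed

lemma ts_sg: assumes "e\<^sup>2 = 1" shows "ts e (sg e z) = z"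
 unfolding ts_def sg_ne[OF assms] by (simp add: complex_eq_iff)

lemma sg_ts: assumes "e\<^sup>2 = 1" "x \<in> S2" "e * x $ 3 ~= 1" shows "sg e (ts e x) = x"
proof -
 define d where "d = 1 - e * x $ 3"
 have d: "d ~= 0" using assms by (simp add: d_def)
 have x12: "(x $ 1)\<^sup>2 + (x $ 2)\<^sup>2 = d * (2 - d)"
 proof -
  have "d * (2 - d) = 1 - e\<^sup>2 * (x $ 3)\<^sup>2" by (simp add: d_def power2_eq_square algebra_simps)
  then show ?thesis using assms(1,2) unfolding S2_iff by simp
 qed
 have t: "Re (ts e x) = x $ 1 / d" "Im (ts e x) = x $ 2 / d" by (simp_all add: ts_def d_def divide_inverse)
 have "ts e x \<bullet> ts e x = ((x $ 1)\<^sup>2 + (x $ 2)\<^sup>2) / d\<^sup>2"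
  by (simp add: zz_complex t power_divide add_divide_distrib)
 also have "\<dots> = (2 - d) / d" unfolding x12 using d by (simp add: power2_eq_square)
 finally have z: "ts e x \<bullet> ts e x = (2 - d) / d" .
 then have z1: "ts e x \<bullet> ts e x + 1 = 2 / d" "ts e x \<bullet> ts e x - 1 = 2 * (1 - d) / d" using d by (simp_all add: field_simps)
 have "e * (1 - d) = x $ 3" using assms(1) by (simp add: d_def power2_eq_square mult.assoc[symmetric])
 moreover have "e * (2 * (1 - d) / d) / (2 / d) = e * (1 - d)" using d by simp
 ultimately have "e * (2 * (1 - d) / d) / (2 / d) = x $ 3" by (rule trans[rotated])
 then show ?thesis unfolding vec3_eq_iff sg_nth z1 t using d by simp
qed

lemma ts_ne_iff: "e\<^sup>2 = 1 ==> e * sg e z $ 3 ~= 1"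
 using sg_ne[of e z] by (metis diff_self divide_eq_0_iff zero_neq_numeral zz1(1))

lemma smo_sg:
 assumes "smo S f" "open S" shows "smo S (%x. sg e (f x))"
proof -
 have "smo S (%x. if i = 1 then 2 * Re (f x) else if i = 2 then 2 * Im (f x) else e * (f x \<bullet> f x - 1))" for i :: 3
  using exhaust_3[of i] by (elim disjE) (simp, intro smo_intros assms)+
 then show ?thesis unfolding sg_def
  by (intro smo_scaleR smo_inverseI smo_add smo_inner smo_const smo_vec_lambda assms) auto
qed

lemma open_ts: "open {x :: real^3. e * x $ 3 ~= 1}"
 by (intro open_Collect_neq continuous_intros)

lemma smo_ts: "smo {x. e * x $ 3 ~= 1} (ts e)"
 unfolding ts_def[abs_def] by (intro smo_intros open_ts) auto

lemma rot_nth [simp]: "rot t x $ 1 = cos (2 * pi * t) * x $ 1 - sin (2 * pi * t) * x $ 2"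
 "rot t x $ 2 = sin (2 * pi * t) * x $ 1 + cos (2 * pi * t) * x $ 2" "rot t x $ 3 = x $ 3"
 by (simp_all add: rot_def)

lemma rot_add: "rot (s + t) x = rot s (rot t x)"
 unfolding vec3_eq_iff by (simp add: distrib_left cos_add sin_add algebra_simps)

lemma rot_0 [simp]: "rot 0 x = x" unfolding vec3_eq_iff by simp

lemma rot_int: "rot (of_int k) x = x"
 using cis_2pi_plus_int[of 0 k] unfolding vec3_eq_iff by (simp add: complex_eq_iff)

lemma rot_S2: "rot t x \<in> S2 \<longleftrightarrow> x \<in> S2"
proof -
 have "(c * a - s * b)\<^sup>2 + (s * a + c * b)\<^sup>2 = (c\<^sup>2 + s\<^sup>2) * (a\<^sup>2 + b\<^sup>2)" for a b c s :: real
  by (simp add: power2_eq_square algebra_simps)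
 from this[of "cos (2 * pi * t)" "x $ 1" "sin (2 * pi * t)" "x $ 2"] show ?thesis
  unfolding S2_iff rot_nth by simp
qed

lemma rot_sg: "rot t (sg e z) = sg e (cis (2 * pi * t) * z)"
proof -
 have "norm (cis (2 * pi * t) * z) = norm z" by (simp add: norm_mult)
 then have "(cis (2 * pi * t) * z) \<bullet> (cis (2 * pi * t) * z) = z \<bullet> z" by (simp add: dot_square_norm)
 then show ?thesis unfolding vec3_eq_iff by (simp add: diff_divide_distrib[symmetric] add_divide_distrib[symmetric] algebra_simps)
qed

lemma smo_rot [smo_intros]:
 assumes "smo S a" "smo S f" "open S" shows "smo S (%x. rot (a x) (f x))"
proof -
 have "smo S (%x. if i = 1 then cos (2 * pi * a x) * f x $ 1 - sin (2 * pi * a x) * f x $ 2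
   else if i = 2 then sin (2 * pi * a x) * f x $ 1 + cos (2 * pi * a x) * f x $ 2 else f x $ 3)" for i :: 3
  using exhaust_3[of i] by (elim disjE) (simp, intro smo_intros assms)+
 then show ?thesis unfolding rot_def by (intro smo_vec_lambda assms)
qed

text \<open>Smooth families of diffeomorphisms of the sphere. Joint smoothness of the inverses is
  built in, so that composites and inverses of families are families by substitution alone.\<close>

definition SF :: "'p::euclidean_space set => ('p => real^3 => real^3) => bool" where
 "SF Z c \<longleftrightarrow> (\<forall>z\<in>Z. bij_betw (c z) S2 S2) & smooth_on (Z \<times> S2) (%x. c (fst x) (snd x)) &
   smooth_on (Z \<times> S2) (%x. inv_into S2 (c (fst x)) (snd x))"

lemma SF_D:
 assumes "SF Z c" "z \<in> Z"
 shows "q \<in> S2 ==> c z q \<in> S2" "q \<in> S2 ==> inv_into S2 (c z) q \<in> S2"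
  "q \<in> S2 ==> c z (inv_into S2 (c z) q) = q" "q \<in> S2 ==> inv_into S2 (c z) (c z q) = q"
  "inj_on (c z) S2"
proof -
 have b: "bij_betw (c z) S2 S2" using assms by (simp add: SF_def)
 show "q \<in> S2 ==> c z q \<in> S2" using b bij_betwE by blast
 show "q \<in> S2 ==> inv_into S2 (c z) q \<in> S2" using b by (metis bij_betw_imp_surj_on inv_into_into)
 show "q \<in> S2 ==> c z (inv_into S2 (c z) q) = q" by (rule bij_betw_inv_into_right[OF b])
 show "q \<in> S2 ==> inv_into S2 (c z) (c z q) = q" by (rule bij_betw_inv_into_left[OF b])
 show "inj_on (c z) S2" using b by (rule bij_betw_imp_inj_on)
qed

lemma SF_I:
 assumes "smooth_on (Z \<times> S2) (%x. c (fst x) (snd x))" "smooth_on (Z \<times> S2) (%x. d (fst x) (snd x))"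
  "!!z q. z \<in> Z ==> q \<in> S2 ==> c z q \<in> S2 & d z q \<in> S2 & c z (d z q) = q & d z (c z q) = q"
 shows "SF Z c"
proof -
 have b: "bij_betw (c z) S2 S2" if "z \<in> Z" for z
  by (rule bij_betwI[of _ _ _ "d z"]) (use assms(3)[OF that] in auto)
 have "inv_into S2 (c z) q = d z q" if "z \<in> Z" "q \<in> S2" for z q
  by (rule inv_into_f_eq[OF bij_betw_imp_inj_on[OF b[OF that(1)]]]) (use assms(3)[OF that] in auto)
 then have "smooth_on (Z \<times> S2) (%x. inv_into S2 (c (fst x)) (snd x))"
  by (intro smooth_on_transform[OF assms(2)]) auto
 then show ?thesis using b assms(1) by (simp add: SF_def)
qed

lemma smooth_on_fst: "smooth_on S fst" and smooth_on_snd: "smooth_on S snd"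
 for S :: "('a::euclidean_space \<times> 'b::euclidean_space) set"
 by (rule smo_smooth_on[of UNIV], auto intro!: smo_intros)+

lemma SF_compose_smooth:
 assumes "SF Z c" "smooth_on T f" "smooth_on T g" "f ` T \<subseteq> Z" "g ` T \<subseteq> S2"
 shows "smooth_on T (%x. c (f x) (g x))" "smooth_on T (%x. inv_into S2 (c (f x)) (g x))"
proof -
 have "smooth_on T (%x. (f x, g x))" by (rule smooth_on_Pair[OF assms(2,3)])
 moreover have "(%x. (f x, g x)) ` T \<subseteq> Z \<times> S2" using assms(4,5) by auto
 ultimately show "smooth_on T (%x. c (f x) (g x))" "smooth_on T (%x. inv_into S2 (c (f x)) (g x))"
  using smooth_on_compose[of "Z \<times> S2" _ T "%x. (f x, g x)"] assms(1) unfolding SF_def by force+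
qed

lemma SF_comp:
 assumes "SF Z c" "SF Z d" shows "SF Z (%z q. c z (d z q))"
proof (rule SF_I[where d = "%z q. inv_into S2 (d z) (inv_into S2 (c z) q)"])
 show "smooth_on (Z \<times> S2) (%x. c (fst x) (d (fst x) (snd x)))"
  by (rule SF_compose_smooth(1)[OF assms(1) smooth_on_fst SF_compose_smooth(1)[OF assms(2) smooth_on_fst smooth_on_snd]])
    (use SF_D[OF assms(2)] in auto)
 show "smooth_on (Z \<times> S2) (%x. inv_into S2 (d (fst x)) (inv_into S2 (c (fst x)) (snd x)))"
  by (rule SF_compose_smooth(2)[OF assms(2) smooth_on_fst SF_compose_smooth(2)[OF assms(1) smooth_on_fst smooth_on_snd]])
    (use SF_D[OF assms(1)] in auto)
qed (use SF_D[OF assms(1)] SF_D[OF assms(2)] in auto)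

lemma SF_inv: assumes "SF Z c" shows "SF Z (%z. inv_into S2 (c z))"
 by (rule SF_I[where d = c]) (use assms SF_D[OF assms] in \<open>auto simp: SF_def\<close>)

lemma SF_reparam:
 assumes "SF Z c" "smooth_on Y h" "h ` Y \<subseteq> Z" shows "SF Y (%y. c (h y))"
proof (rule SF_I[where d = "%y. inv_into S2 (c (h y))"])
 have h: "smooth_on (Y \<times> S2) (%x. h (fst x))"
  by (rule smooth_on_compose[OF assms(2) smooth_on_fst]) auto
 show "smooth_on (Y \<times> S2) (%x. c (h (fst x)) (snd x))"
  by (rule SF_compose_smooth(1)[OF assms(1) h smooth_on_snd]) (use assms(3) in auto)
 show "smooth_on (Y \<times> S2) (%x. inv_into S2 (c (h (fst x))) (snd x))"
  by (rule SF_compose_smooth(2)[OF assms(1) h smooth_on_snd]) (use assms(3) in auto)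
 show "c (h z) q \<in> S2 & inv_into S2 (c (h z)) q \<in> S2 & c (h z) (inv_into S2 (c (h z)) q) = q
   & inv_into S2 (c (h z)) (c (h z) q) = q" if "z \<in> Y" "q \<in> S2" for z q
  using SF_D[OF assms(1), of "h z"] that assms(3) by blast
qed

lemma SF_cong:
 assumes "SF Z c" "!!z q. z \<in> Z ==> q \<in> S2 ==> c' z q = c z q" shows "SF Z c'"
proof (rule SF_I[where d = "%z. inv_into S2 (c z)"])
 show "smooth_on (Z \<times> S2) (%x. c' (fst x) (snd x))"
  by (rule smooth_on_transform[where g = "%x. c (fst x) (snd x)"]) (use assms in \<open>auto simp: SF_def\<close>)
 show "smooth_on (Z \<times> S2) (%x. inv_into S2 (c (fst x)) (snd x))" using assms(1) by (simp add: SF_def)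
qed (use assms(2) SF_D[OF assms(1)] in auto)

lemma SF_subset: "SF Z c ==> Y \<subseteq> Z ==> SF Y c"
 unfolding SF_def using smooth_on_subset[of "Z \<times> S2" _ "Y \<times> S2"] by (auto simp: Sigma_mono subset_iff)

lemma SF_local:
 assumes "!!z. z \<in> Z ==> \<exists>W. open W & z \<in> W & SF (Z \<inter> W) c" shows "SF Z c"
proof -
 have *: "smooth_on (Z \<times> S2) f" if f: "!!Y. SF Y c ==> smooth_on (Y \<times> S2) f" for f :: "'a \<times> (real^3) => real^3"
 proof (rule smooth_on_local)
  fix x assume x: "x \<in> Z \<times> S2"
  obtain W where W: "open W" "fst x \<in> W" "SF (Z \<inter> W) c" using assms[of "fst x"] x by auto
  have "(Z \<times> S2) \<inter> (W \<times> UNIV) = (Z \<inter> W) \<times> S2" by auto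
  then show "\<exists>W. open W & x \<in> W & smooth_on ((Z \<times> S2) \<inter> W) f"
   using W f[OF W(3)] x by (intro exI[of _ "W \<times> UNIV"]) (simp add: open_Times mem_Times_iff)
 qed
 have "bij_betw (c z) S2 S2" if "z \<in> Z" for z using assms[OF that] that unfolding SF_def by blast
 then show ?thesis unfolding SF_def by (auto intro!: * simp: SF_def)
qed

lemma SF_id: "SF Z (%z q. q)"
 by (rule SF_I[where d = "%z q. q"]) (auto intro: smooth_on_snd)

lemma SF_rot: assumes "smooth_on Z a" shows "SF Z (%z. rot (a z))"
proof -
 have s: "smooth_on (UNIV \<times> S2) (%x. rot (fst x) (snd x))" "smooth_on (UNIV \<times> S2) (%x. rot (- fst x) (snd x))"
  by (rule smo_smooth_on[of UNIV], auto intro!: smo_intros)+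
 have "SF UNIV rot"
  by (rule SF_I[where d = "%t. rot (- t)"]) (use s in \<open>auto simp: rot_S2[simplified] rot_add[symmetric]\<close>)
 from SF_reparam[OF this assms] show ?thesis by simp
qed

text \<open>\<open>c\<close> is smoothly invertible near \<open>(z0, q0)\<close>.\<close>

definition LI :: "('p::euclidean_space => real^3 => real^3) => 'p => real^3 => bool" where
 "LI c z0 q0 \<longleftrightarrow> (\<exists>Q N \<mu>. open Q & (z0, q0) \<in> Q & smooth_on (Q \<inter> UNIV \<times> S2) (%x. c (fst x) (snd x)) &
   open N & (z0, c z0 q0) \<in> N & smooth_on (N \<inter> UNIV \<times> S2) \<mu> &
   (\<forall>z q. (z, q) \<in> N --> q \<in> S2 --> \<mu> (z, q) \<in> S2 & c z (\<mu> (z, q)) = q) &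
   (\<forall>z q. (z, q) \<in> Q --> q \<in> S2 --> c z q \<in> S2 & (z, c z q) \<in> N & \<mu> (z, c z q) = q))"

text \<open>Local inverses make \<open>c z\<close> a local homeomorphism of the sphere, which is
  compact and connected; \<open>bij_of_local_homeo\<close> then asks for a single value taken
  once.\<close>

lemma LI_bij:
 assumes LI: "!!q. q \<in> S2 ==> LI c z q" and q: "q0 \<in> S2" "\<exists>!x. x \<in> S2 & c z x = q0"
 shows "bij_betw (c z) S2 S2"
proof (rule bij_of_local_homeo[OF _ _ _ _ _ q])
 show "connected S2" by (intro connected_sphere) simp
 show "c z ` S2 \<subseteq> S2" using LI unfolding LI_def by blast
 show "continuous_on S2 (c z)"
 proof (subst continuous_on_eq_continuous_within, intro ballI)
  fix q assume q: "q \<in> S2"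
  obtain Q where Q: "open Q" "(z, q) \<in> Q" "smooth_on (Q \<inter> UNIV \<times> S2) (%x. c (fst x) (snd x))"
   using LI[OF q] unfolding LI_def by blast
  obtain W F where W: "open W" "(z, q) \<in> W" "smo W F"
    "\<forall>y\<in>(Q \<inter> UNIV \<times> S2) \<inter> W. F y = c (fst y) (snd y)"
   by (rule smooth_onE[OF Q(3), of "(z, q)"]) (use Q(2) q in auto)
  have "isCont F (z, q)" using W smo_continuous continuous_on_eq_continuous_at by blast
  then have "isCont (%q. F (z, q)) q"
   by (intro isCont_o2[of q "%q. (z, q)" F]) (auto intro!: continuous_intros)
  then have 1: "continuous (at q within S2) (%q. F (z, q))" by (rule continuous_at_imp_continuous_at_within)
  have o: "open (Pair z -` (Q \<inter> W))" using Q(1) W(1) by (intro open_vimage continuous_intros) auto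
  show "continuous (at q within S2) (c z)"
   by (rule continuous_transform_within_openin[OF 1, of "S2 \<inter> Pair z -` (Q \<inter> W)"])
     (use o q Q(2) W(2,4) in auto)
 qed
 fix q assume q: "q \<in> S2"
 obtain Q N \<mu> where Q: "open Q" "(z, q) \<in> Q" "open N" "smooth_on (N \<inter> UNIV \<times> S2) \<mu>"
   "!!q. (z, q) \<in> N ==> q \<in> S2 ==> \<mu> (z, q) \<in> S2 & c z (\<mu> (z, q)) = q"
   "!!q. (z, q) \<in> Q ==> q \<in> S2 ==> c z q \<in> S2 & (z, c z q) \<in> N & \<mu> (z, c z q) = q"
  using LI[OF q] unfolding LI_def by blast
 have oP: "open (Pair z -` Q)" "open (Pair z -` N)"
  using Q(1,3) by (auto intro!: open_vimage continuous_intros)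
 define U where "U = S2 \<inter> Pair z -` Q"
 show "\<exists>U. openin (top_of_set S2) U & q \<in> U & inj_on (c z) U &
   (\<forall>V. openin (top_of_set S2) V --> V \<subseteq> U --> openin (top_of_set S2) (c z ` V))"
 proof (intro exI[of _ U] conjI allI impI)
  show "openin (top_of_set S2) U" unfolding U_def using oP by auto
  show "q \<in> U" using q Q(2) by (simp add: U_def)
  show "inj_on (c z) U" unfolding U_def by (rule inj_onI) (metis IntD1 IntD2 Q(6) vimageD)
  fix V assume V: "openin (top_of_set S2) V" "V \<subseteq> U"
  let ?T = "S2 \<inter> Pair z -` N"
  have oT: "openin (top_of_set S2) ?T" using oP by auto
  have "continuous_on ?T (%q. \<mu> (z, q))"
   by (rule continuous_on_compose2[OF smooth_on_continuous[OF Q(4)]]) (auto intro!: continuous_intros)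
  then have "openin (top_of_set ?T) (?T \<inter> (%q. \<mu> (z, q)) -` V)"
   using V(1) Q(5) by (intro continuous_openin_preimage[where T = S2]) auto
  then have "openin (top_of_set S2) (?T \<inter> (%q. \<mu> (z, q)) -` V)" using oT openin_trans by blast
  moreover have "?T \<inter> (%q. \<mu> (z, q)) -` V = c z ` V"
  proof (intro equalityI subsetI)
   fix y assume y: "y \<in> ?T \<inter> (%q. \<mu> (z, q)) -` V"
   then have "c z (\<mu> (z, y)) = y" using Q(5) by auto
   then show "y \<in> c z ` V" using y by (metis IntD2 imageI vimageD)
  next
   fix y assume "y \<in> c z ` V"
   then obtain v where v: "v \<in> V" "y = c z v" by blast
   then have "v \<in> S2" "(z, v) \<in> Q" using V(2) unfolding U_def by auto
   then show "y \<in> ?T \<inter> (%q. \<mu> (z, q)) -` V" using Q(6)[of v] v by auto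
  qed
  ultimately show "openin (top_of_set S2) (c z ` V)" by simp
 qed
qed simp

text \<open>By injectivity the global inverse agrees with each local inverse \<mu> where that is
  defined, and inherits its smoothness.\<close>

lemma SF_LI:
 assumes bij: "!!z. z \<in> Z ==> bij_betw (c z) S2 S2" and LI: "!!z q. z \<in> Z ==> q \<in> S2 ==> LI c z q"
 shows "SF Z c"
 unfolding SF_def
proof (intro conjI ballI bij)
 show "smooth_on (Z \<times> S2) (%x. c (fst x) (snd x))"
 proof (rule smooth_on_local)
  fix x assume x: "x \<in> Z \<times> S2"
  then obtain Q where "open Q" "x \<in> Q" "smooth_on (Q \<inter> UNIV \<times> S2) (%x. c (fst x) (snd x))"
   using LI[of "fst x" "snd x"] unfolding LI_def by auto
  then show "\<exists>W. open W & x \<in> W & smooth_on ((Z \<times> S2) \<inter> W) (%x. c (fst x) (snd x))"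
   using smooth_on_subset[of "Q \<inter> UNIV \<times> S2" _ "(Z \<times> S2) \<inter> Q"] by (intro exI[of _ Q]) auto
 qed
 show "smooth_on (Z \<times> S2) (%x. inv_into S2 (c (fst x)) (snd x))"
 proof (rule smooth_on_local)
  fix x assume x: "x \<in> Z \<times> S2"
  obtain z q where zq: "x = (z, q)" "z \<in> Z" "q \<in> S2" using x by auto
  have i: "inv_into S2 (c z) q \<in> S2" "c z (inv_into S2 (c z) q) = q"
   using bij[OF zq(2)] zq(3) bij_betw_inv_into_right by (metis bij_betw_imp_surj_on inv_into_into)+
  obtain N \<mu> where N: "open N" "(z, q) \<in> N" "smooth_on (N \<inter> UNIV \<times> S2) \<mu>"
   "!!z q. (z, q) \<in> N ==> q \<in> S2 ==> \<mu> (z, q) \<in> S2 & c z (\<mu> (z, q)) = q"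
   using LI[OF zq(2) i(1)] i(2) unfolding LI_def by auto
  have "inv_into S2 (c z') q' = \<mu> (z', q')" if "(z', q') \<in> N" "z' \<in> Z" "q' \<in> S2" for z' q'
   by (rule inv_into_f_eq[OF bij_betw_imp_inj_on[OF bij[OF that(2)]]]) (use N(4)[OF that(1,3)] in auto)
  then have "smooth_on ((Z \<times> S2) \<inter> N) (%x. inv_into S2 (c (fst x)) (snd x))"
   by (intro smooth_on_transform[OF smooth_on_subset[OF N(3)]]) auto
  then show "\<exists>W. open W & x \<in> W & smooth_on ((Z \<times> S2) \<inter> W) (%x. inv_into S2 (c (fst x)) (snd x))"
   using N zq by blast
 qed
qed

text \<open>The local inverse in the plane comes from \<open>smo_inverse_family\<close>. Its domains
  are pulled back along \<open>ts e\<close>, which is smooth on an open subset of the ambient space,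
  so the neighbourhoods required by \<open>LI\<close> can be taken open there.\<close>

lemma LI_chart:
 assumes e: "e\<^sup>2 = 1" and F: "smo W F" "open W" "(z0, w0) \<in> W" "vjac F (z0, w0) ~= 0"
  and c: "!!z w. (z, w) \<in> W ==> c z (sg e w) = sg e (F (z, w))"
 shows "LI c z0 (sg e w0)"
proof -
 obtain N \<mu> Q where N: "open N" "(z0, F (z0, w0)) \<in> N" "smo N \<mu>"
   "!!p w. (p, w) \<in> N ==> (p, \<mu> (p, w)) \<in> W & F (p, \<mu> (p, w)) = w"
   "open Q" "Q \<subseteq> W" "(z0, w0) \<in> Q" "!!p z. (p, z) \<in> Q ==> (p, F (p, z)) \<in> N & \<mu> (p, F (p, z)) = z"
  using smo_inverse_family[OF F] by blast
 let ?D = "UNIV \<times> {x :: real^3. e * x $ 3 ~= 1} :: ('a \<times> (real^3)) set"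
 define \<tau> where "\<tau> x = (fst x, ts e (snd x))" for x :: "'a \<times> (real^3)"
 have oD: "open ?D" by (intro open_Times open_UNIV open_ts)
 have \<tau>s: "smo ?D \<tau>" unfolding \<tau>_def[abs_def]
  by (intro smo_intros oD smo_compose[OF smo_ts[of e] _ _ oD open_ts]) auto
 have oP: "open (?D \<inter> \<tau> -` A)" if "open A" for A
  by (rule continuous_open_preimage[OF smo_continuous[OF \<tau>s] oD that])
 have \<tau>sg: "\<tau> (z, sg e w) = (z, w)" for z w by (simp add: \<tau>_def ts_sg[OF e])
 have sgD: "(z, sg e w) \<in> ?D" for z w using ts_ne_iff[OF e] by simp
 have S2D: "snd x = sg e (snd (\<tau> x))" if "x \<in> ?D" "snd x \<in> S2" for x
  using sg_ts[OF e that(2)] that(1) by (auto simp: \<tau>_def)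
 show ?thesis unfolding LI_def
 proof (rule exI[of _ "?D \<inter> \<tau> -` Q"], rule exI[of _ "?D \<inter> \<tau> -` N"], rule exI[of _ "%x. sg e (\<mu> (\<tau> x))"], intro conjI allI impI)
  show "open (?D \<inter> \<tau> -` Q)" "open (?D \<inter> \<tau> -` N)" by (rule oP, rule N)+
  show "(z0, sg e w0) \<in> ?D \<inter> \<tau> -` Q" using sgD N(7) by (auto simp: \<tau>sg)
  show "(z0, c z0 (sg e w0)) \<in> ?D \<inter> \<tau> -` N" using c[OF F(3)] sgD[of z0 "F (z0, w0)"] N(2) by (auto simp: \<tau>sg)
  have "smo (?D \<inter> \<tau> -` Q) (%x. sg e (F (\<tau> x)))"
   by (intro smo_sg smo_compose[OF F(1) smo_subset[OF \<tau>s]] oP N(5) F(2)) (use N(6) in auto)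
  then have "smooth_on ((?D \<inter> \<tau> -` Q) \<inter> UNIV \<times> S2) (%x. sg e (F (\<tau> x)))"
   by (rule smo_smooth_on[OF _ oP[OF N(5)]]) auto
  then show "smooth_on ((?D \<inter> \<tau> -` Q) \<inter> UNIV \<times> S2) (%x. c (fst x) (snd x))"
  proof (rule smooth_on_transform)
   fix x assume x: "x \<in> (?D \<inter> \<tau> -` Q) \<inter> UNIV \<times> S2"
   then have "snd x = sg e (snd (\<tau> x))" "\<tau> x \<in> W" using S2D[of x] N(6) by auto
   then show "c (fst x) (snd x) = sg e (F (\<tau> x))" using c[of "fst x" "snd (\<tau> x)"] by (simp add: \<tau>_def)
  qed
  have "smo (?D \<inter> \<tau> -` N) (%x. sg e (\<mu> (\<tau> x)))"
   by (intro smo_sg smo_compose[OF N(3) smo_subset[OF \<tau>s]] oP N(1)) auto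
  then show "smooth_on ((?D \<inter> \<tau> -` N) \<inter> UNIV \<times> S2) (%x. sg e (\<mu> (\<tau> x)))"
   by (rule smo_smooth_on[OF _ oP[OF N(1)]]) auto
 next
  fix z q assume q: "(z, q) \<in> ?D \<inter> \<tau> -` N" "q \<in> S2"
  show "sg e (\<mu> (\<tau> (z, q))) \<in> S2" by (rule sg_S2[OF e])
  have "\<tau> (z, q) = (z, ts e q)" by (simp add: \<tau>_def)
  then have "(z, \<mu> (\<tau> (z, q))) \<in> W" "F (z, \<mu> (\<tau> (z, q))) = ts e q" using N(4)[of z "ts e q"] q by auto
  then show "c z (sg e (\<mu> (\<tau> (z, q)))) = q" using c S2D[of "(z, q)"] q by (simp add: \<tau>_def)
 next
  fix z q assume q: "(z, q) \<in> ?D \<inter> \<tau> -` Q" "q \<in> S2"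
  have qe: "q = sg e (ts e q)" "\<tau> (z, q) = (z, ts e q)" using S2D[of "(z, q)"] q by (auto simp: \<tau>_def)
  have Qz: "(z, ts e q) \<in> Q" using q qe(2) by auto
  then have cz: "c z q = sg e (F (z, ts e q))" using c[of z "ts e q"] qe(1) N(6) by auto
  show "c z q \<in> S2" unfolding cz by (rule sg_S2[OF e])
  show "(z, c z q) \<in> ?D \<inter> \<tau> -` N" unfolding cz using sgD N(8)[OF Qz] by (auto simp: \<tau>sg)
  show "sg e (\<mu> (\<tau> (z, c z q))) = q" unfolding cz \<tau>sg using N(8)[OF Qz] qe(1) by simp
 qed
qed

text \<open>Complements \<open>LI_chart\<close> at points that the chart formula does not reach:
  there c agrees locally with a family d already known to be invertible, for instance the identity
  near a pole.\<close>

lemma LI_cong: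
 assumes d: "SF Z d" "open Z" "z0 \<in> Z" and Q: "open Q" "(z0, q0) \<in> Q" "q0 \<in> S2"
  and eq: "!!z q. (z, q) \<in> Q ==> z \<in> Z ==> q \<in> S2 ==> c z q = d z q"
 shows "LI c z0 q0"
proof -
 let ?i = "%x. inv_into S2 (d (fst x)) (snd x)"
 have si: "smooth_on (Z \<times> S2) ?i" and sd: "smooth_on (Z \<times> S2) (%x. d (fst x) (snd x))"
  using d(1) by (auto simp: SF_def)
 have "continuous_on (Z \<times> S2) (%x. (fst x, ?i x))"
  by (intro continuous_intros smooth_on_continuous[OF si])
 then have "openin (top_of_set (Z \<times> S2)) ((Z \<times> S2) \<inter> (%x. (fst x, ?i x)) -` Q)"
  using Q(1) by (rule continuous_openin_preimage_gen)
 then obtain N' where N': "open N'" "(Z \<times> S2) \<inter> (%x. (fst x, ?i x)) -` Q = (Z \<times> S2) \<inter> N'"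
  unfolding openin_open by blast
 have N'iff: "(z, q) \<in> N' \<longleftrightarrow> (z, inv_into S2 (d z) q) \<in> Q" if "z \<in> Z" "q \<in> S2" for z q
  using N'(2) that by (auto simp: set_eq_iff)
 let ?Q = "Q \<inter> Z \<times> UNIV" and ?N = "N' \<inter> Z \<times> UNIV"
 have o: "open ?Q" "open ?N" using Q(1) N'(1) d(2) by (auto intro!: open_Int open_Times)
 show ?thesis unfolding LI_def
 proof (rule exI[of _ ?Q], rule exI[of _ ?N], rule exI[of _ ?i], intro conjI allI impI o)
  show "(z0, q0) \<in> ?Q" using Q d by auto
  show "smooth_on (?Q \<inter> UNIV \<times> S2) (%x. c (fst x) (snd x))"
   by (rule smooth_on_transform[OF smooth_on_subset[OF sd]]) (use eq in auto)
  show "smooth_on (?N \<inter> UNIV \<times> S2) ?i" by (rule smooth_on_subset[OF si]) auto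
  show "(z0, c z0 q0) \<in> ?N"
   using eq[OF Q(2) d(3) Q(3)] N'iff[OF d(3) SF_D(1)[OF d(1,3) Q(3)]] SF_D(4)[OF d(1,3) Q(3)] Q(2) d(3) by simp
 next
  fix z q assume "(z, q) \<in> ?N" "q \<in> S2"
  then have z: "z \<in> Z" "q \<in> S2" "(z, inv_into S2 (d z) q) \<in> Q" using N'iff by auto
  show "?i (z, q) \<in> S2" using SF_D(2)[OF d(1) z(1,2)] by simp
  show "c z (?i (z, q)) = q" using eq[OF z(3,1) SF_D(2)[OF d(1) z(1,2)]] SF_D(3)[OF d(1) z(1,2)] by simp
 next
  fix z q assume a: "(z, q) \<in> ?Q" "q \<in> S2"
  then have z: "z \<in> Z" "c z q = d z q" using eq by auto
  show "c z q \<in> S2" using SF_D(1)[OF d(1) z(1) a(2)] z by simp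
  show "?i (z, c z q) = q" using SF_D(4)[OF d(1) z(1) a(2)] z by simp
  show "(z, c z q) \<in> ?N" using N'iff[OF z(1) SF_D(1)[OF d(1) z(1) a(2)]] SF_D(4)[OF d(1) z(1) a(2)] a z by simp
 qed
qed

text \<open>Isotopies of loops, with b the loop parameter. Constancy for t <= 0 and for t >= 1 lets
  isotopies be concatenated without smoothing corners.\<close>

definition isot :: "(real => real^3 => real^3) => (real => real^3 => real^3) => bool" where
 "isot f g \<longleftrightarrow> (\<exists>F :: real => real => real^3 => real^3. SF UNIV (%p. F (fst p) (snd p)) & (\<forall>b t. \<forall>q\<in>S2. F (b + 1) t q = F b t q) &
   (\<forall>b t. \<forall>q\<in>S2. t <= 0 --> F b t q = f b q) & (\<forall>b t. \<forall>q\<in>S2. t \<ge> 1 --> F b t q = g b q))"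

lemma isotE:
 assumes "isot f g"
 obtains F :: "real => real => real^3 => real^3" where "SF UNIV (%p. F (fst p) (snd p))" "\<forall>b t. \<forall>q\<in>S2. F (b + 1) t q = F b t q"
   "\<forall>b t. \<forall>q\<in>S2. t <= 0 --> F b t q = f b q" "\<forall>b t. \<forall>q\<in>S2. t \<ge> 1 --> F b t q = g b q"
 using assms unfolding isot_def by (elim exE conjE) (rule that)

lemma isotI:
 fixes F :: "real => real => real^3 => real^3"
 assumes "SF UNIV (%p. F (fst p) (snd p))" "!!b t q. q \<in> S2 ==> F (b + 1) t q = F b t q"
   "!!b t q. q \<in> S2 ==> t <= 0 ==> F b t q = f b q" "!!b t q. q \<in> S2 ==> t \<ge> 1 ==> F b t q = g b q"
 shows "isot f g"
 unfolding isot_def by (rule exI[of _ F]) (use assms in auto)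

lemma smooth_on_smo_UNIV: "smo UNIV f ==> smooth_on S f"
 by (rule smo_smooth_on[of UNIV]) auto

lemma isot_sym: assumes "isot f g" shows "isot g f"
proof -
 obtain F :: "real => real => real^3 => real^3" where F: "SF UNIV (%p. F (fst p) (snd p))" "\<forall>b t. \<forall>q\<in>S2. F (b + 1) t q = F b t q"
   "\<forall>b t. \<forall>q\<in>S2. t <= 0 --> F b t q = f b q" "\<forall>b t. \<forall>q\<in>S2. t \<ge> 1 --> F b t q = g b q"
  by (rule isotE[OF assms])
 have "SF UNIV (%p. F (fst (fst p, 1 - snd p)) (snd (fst p, 1 - snd p)))"
  by (rule SF_reparam[OF F(1)]) (auto intro!: smooth_on_smo_UNIV smo_intros)
 then show ?thesis by (intro isotI[of "%b t. F b (1 - t)"]) (use F in auto)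
qed

lemma isot_trans: assumes "isot f g" "isot g h" shows "isot f h"
proof -
 obtain F :: "real => real => real^3 => real^3" where F: "SF UNIV (%p. F (fst p) (snd p))" "\<forall>b t. \<forall>q\<in>S2. F (b + 1) t q = F b t q"
   "\<forall>b t. \<forall>q\<in>S2. t <= 0 --> F b t q = f b q" "\<forall>b t. \<forall>q\<in>S2. t \<ge> 1 --> F b t q = g b q"
  by (rule isotE[OF assms(1)])
 obtain G :: "real => real => real^3 => real^3" where G: "SF UNIV (%p. G (fst p) (snd p))" "\<forall>b t. \<forall>q\<in>S2. G (b + 1) t q = G b t q"
   "\<forall>b t. \<forall>q\<in>S2. t <= 0 --> G b t q = g b q" "\<forall>b t. \<forall>q\<in>S2. t \<ge> 1 --> G b t q = h b q"
  by (rule isotE[OF assms(2)])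
 \<comment> \<open>The first isotopy has reached g for t >= 1/3 and the second leaves g only after
   2/3, so the seam at 1/2 lies inside an interval where both agree.\<close>
 define H where "H b t = (if t < 1/2 then F b (3 * t) else G b (3 * t - 2))" for b t :: real
 have 1: "SF UNIV (%p. F (fst (fst p, 3 * snd p)) (snd (fst p, 3 * snd p)))"
  by (rule SF_reparam[OF F(1)]) (auto intro!: smooth_on_smo_UNIV smo_intros)
 have 2: "SF UNIV (%p. G (fst (fst p, 3 * snd p - 2)) (snd (fst p, 3 * snd p - 2)))"
  by (rule SF_reparam[OF G(1)]) (auto intro!: smooth_on_smo_UNIV smo_intros)
 have "SF UNIV (%p. H (fst p) (snd p))"
 proof (rule SF_local)
  fix p :: "real \<times> real"
  show "\<exists>W. open W & p \<in> W & SF (UNIV \<inter> W) (%p. H (fst p) (snd p))"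
  proof (cases "snd p < 2/3")
   case True
   have "SF (UNIV \<times> {..<2/3}) (%p. H (fst p) (snd p))"
    by (rule SF_cong[OF SF_subset[OF 1 subset_UNIV]]) (use F(4) G(3) in \<open>auto simp: H_def\<close>)
   then show ?thesis using True by (intro exI[of _ "UNIV \<times> {..<2/3}"]) (auto simp: open_Times mem_Times_iff)
  next
   case False
   have "SF (UNIV \<times> {1/3<..}) (%p. H (fst p) (snd p))"
    by (rule SF_cong[OF SF_subset[OF 2 subset_UNIV]]) (use F(4) G(3) in \<open>auto simp: H_def\<close>)
   then show ?thesis using False by (intro exI[of _ "UNIV \<times> {1/3<..}"]) (auto simp: open_Times mem_Times_iff)
  qed
 qed
 then show ?thesis by (intro isotI[of H]) (use F G in \<open>auto simp: H_def\<close>)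
qed

lemma isot_comp_left:
 assumes "isot f g" "SF UNIV h" "!!b q. q \<in> S2 ==> h (b + 1) q = h b q"
 shows "isot (%b q. h b (f b q)) (%b q. h b (g b q))"
proof -
 obtain F :: "real => real => real^3 => real^3" where F: "SF UNIV (%p. F (fst p) (snd p))" "\<forall>b t. \<forall>q\<in>S2. F (b + 1) t q = F b t q"
   "\<forall>b t. \<forall>q\<in>S2. t <= 0 --> F b t q = f b q" "\<forall>b t. \<forall>q\<in>S2. t \<ge> 1 --> F b t q = g b q"
  by (rule isotE[OF assms(1)])
 have h: "SF UNIV (%p :: real \<times> real. h (fst p))"
  by (rule SF_reparam[OF assms(2)]) (auto intro: smooth_on_fst)
 have "F b t q \<in> S2" if "q \<in> S2" for b t q using SF_D(1)[OF F(1) _ that, of "(b, t)"] by simp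
 then show ?thesis
  by (intro isotI[of "%b t q. h b (F b t q)"]) (use F assms(3) SF_comp[OF h F(1)] in auto)
qed

lemma isot_cong:
 assumes "isot f g" "!!b q. q \<in> S2 ==> f' b q = f b q" "!!b q. q \<in> S2 ==> g' b q = g b q" shows "isot f' g'"
proof -
 obtain F :: "real => real => real^3 => real^3" where F: "SF UNIV (%p. F (fst p) (snd p))" "\<forall>b t. \<forall>q\<in>S2. F (b + 1) t q = F b t q"
   "\<forall>b t. \<forall>q\<in>S2. t <= 0 --> F b t q = f b q" "\<forall>b t. \<forall>q\<in>S2. t \<ge> 1 --> F b t q = g b q"
  by (rule isotE[OF assms(1)])
 show ?thesis by (rule isotI[of F]) (use F assms in auto)
qed

lemma vjac_zero_dir:
 assumes "F differentiable (at x)" "vjac F x = 0"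
 shows "\<exists>w. w ~= 0 & pd (0, w) F x = 0"
proof -
 define a where "a = pd (0, 1) F x"
 define b where "b = pd (0, \<i>) F x"
 have J: "Re a * Im b = Im a * Re b" using assms(2) unfolding vjac_def a_def[symmetric] b_def[symmetric] by simp
 have e: "pd (0, w) F x = Re w *\<^sub>R a + Im w *\<^sub>R b" for w unfolding a_def b_def by (rule pd_vertical[OF assms(1)])
 show ?thesis
 proof (cases "a = 0")
  case True then show ?thesis by (intro exI[of _ 1]) (simp add: e)
 next
  case False
  show ?thesis
  proof (cases "Re a = 0")
   case True
   then have "Im a ~= 0" "Re b = 0" using False J by (auto simp: complex_eq_iff)
   then show ?thesis using True by (intro exI[of _ "Complex (Im b) (- Im a)"]) (auto simp: e complex_eq_iff)
  next
   case False
   then show ?thesis using J by (intro exI[of _ "Complex (Re b) (- Re a)"]) (auto simp: e complex_eq_iff)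
  qed
 qed
qed

text \<open>Differentiate G (p, F (p, z)) = z: a vertical vector killed by the derivative of F would
  be killed by the identity.\<close>

lemma vjac_nonzero_of_inverse:
 fixes F :: "'p::euclidean_space \<times> complex => complex"
 assumes F: "smo UNIV F" and G: "smo UNIV G" and GF: "!!p z. G (p, F (p, z)) = z"
 shows "vjac F x ~= 0"
proof
 assume "vjac F x = 0"
 then obtain w where w: "w ~= 0" "pd (0, w) F x = 0"
  using vjac_zero_dir smo_differentiable[OF F] by blast
 have "((%y. (fst y, F y)) has_derivative (%v. (fst v, pd v F x))) (at x)"
  by (intro has_derivative_Pair smo_has_pd[OF F] derivative_intros) auto
 from has_derivative_compose[OF this smo_has_pd[OF G]]
 have "((%y. G (fst y, F y)) has_derivative (%v. pd (fst v, pd v F x) G (fst x, F x))) (at x)" by simp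
 moreover have "(%y. G (fst y, F y)) = snd" using GF by (auto simp: fun_eq_iff)
 ultimately have "(snd has_derivative (%v. pd (fst v, pd v F x) G (fst x, F x))) (at x)" by simp
 from pd_eq[OF this, of "(0, w)"] have "w = pd (0, 0) G (fst x, F x)" using w by (simp add: pd_snd)
 also have "\<dots> = 0" using linear_0[OF pd_linear, of G "(fst x, F x)"] smo_differentiable[OF G]
  by (simp add: zero_prod_def)
 finally show False using w by simp
qed

lemma sg_ne_npole: "sg 1 z ~= npole"
 using ts_ne_iff[of 1 z] by (metis mult_1 npole_nth(3) one_power2)

lemma sg3: "sg 1 z $ 3 = 1 - 2 / (z \<bullet> z + 1)"
 using sg_ne[of 1 z] by simp

text \<open>Projection from the pole turns f into maps of the plane that are the identity far out,
  to which \<open>plane_isotopy\<close> applies. Its positive Jacobian gives local invertibility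
  only; bijectivity follows from \<open>LI_bij\<close>, since the pole is its own only
  preimage.\<close>

proposition sphere_isotopy:
 assumes f: "SF UNIV f" and per: "!!b q. q \<in> S2 ==> f (b + 1) q = f b q"
  and \<eta>: "\<eta> < 1" "!!b q. q \<in> S2 ==> q $ 3 > \<eta> ==> f b q = q"
 shows "isot (%b q. q) f"
proof -
 note S = SF_D[OF f UNIV_I]
 define f' where "f' b = inv_into S2 (f b)" for b
 have f': "SF UNIV f'" unfolding f'_def[abs_def] by (rule SF_inv[OF f])
 note S' = SF_D[OF f' UNIV_I]
 have fN: "f b npole = npole" for b using \<eta>(2)[of npole] \<eta>(1) by simp
 have f'N: "f' b npole = npole" for b using S(4)[of npole b] fN by (simp add: f'_def)
 have nN: "f b (sg 1 z) $ 3 ~= 1" "f' b (sg 1 z) $ 3 ~= 1" for b z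
 proof -
  have s: "sg 1 z \<in> S2" by (rule sg_S2) simp
  have "f b (sg 1 z) ~= npole"
   using fN sg_ne_npole[of z] inj_onD[OF S(5), of b "sg 1 z" npole] s by auto
  then show "f b (sg 1 z) $ 3 ~= 1" using S2_npole_iff[OF S(1)[OF s]] by blast
  have "f' b (sg 1 z) ~= npole"
   using f'N sg_ne_npole[of z] inj_onD[OF S'(5), of b "sg 1 z" npole] s by auto
  then show "f' b (sg 1 z) $ 3 ~= 1" using S2_npole_iff[OF S'(1)[OF s]] by blast
 qed
 define g where "g x = ts 1 (f (fst x) (sg 1 (snd x)))" for x
 define g' where "g' x = ts 1 (f' (fst x) (sg 1 (snd x)))" for x
 have smg: "smo UNIV (%x. ts 1 (c (fst x) (sg 1 (snd x))))"
  if c: "SF UNIV c" and "!!b z. c b (sg 1 z) $ 3 ~= 1" for c :: "real => real^3 => real^3"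
 proof -
  have "smooth_on UNIV (%x::real \<times> complex. c (fst x) (sg 1 (snd x)))"
  proof (rule SF_compose_smooth(1)[OF c smooth_on_fst])
   show "smooth_on UNIV (%x::real \<times> complex. sg 1 (snd x))"
    by (intro smooth_on_smo_UNIV smo_sg smo_intros open_UNIV)
   show "(%x::real \<times> complex. sg 1 (snd x)) ` UNIV \<subseteq> S2" using sg_S2[of 1] by (simp add: image_subset_iff)
  qed simp
  then have "smo UNIV (%x::real \<times> complex. c (fst x) (sg 1 (snd x)))" by (simp add: smooth_on_open_iff)
  then show ?thesis
   by (rule smo_compose[OF smo_ts[of 1] _ _ open_UNIV open_ts]) (use that(2) in auto)
 qed
 have gs: "smo UNIV g" "smo UNIV g'" unfolding g_def[abs_def] g'_def[abs_def] by (rule smg; use f f' nN in simp)+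
 have sgS: "sg 1 z \<in> S2" for z by (rule sg_S2) simp
 have sgg: "sg 1 (g (b, z)) = f b (sg 1 z)" for b z
  unfolding g_def using nN(1)[of b z] S(1)[OF sgS] by (simp add: sg_ts)
 have gg: "g' (b, g (b, z)) = z" for b z
  using S(4)[OF sgS, of b z] ts_sg[of 1 z] by (simp add: g'_def sgg f'_def)
 have jac: "vjac g x ~= 0" for x by (rule vjac_nonzero_of_inverse[OF gs gg])
 \<comment> \<open>The height of \<open>sg 1 z\<close> is 1 - 2 / (z \<bullet> z + 1), and z
   \<bullet> z + 1 is at least the norm of z, so points beyond this radius lie higher than
   \<eta>.\<close>
 define \<rho> where "\<rho> = 2 / (1 - \<eta>)"
 have far: "g (b, z) = z" if z: "norm z > \<rho>" for b z
 proof -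
  have "norm z * norm z + 1 \<ge> norm z" using sum_squares_bound[of "norm z" 1] norm_ge_zero[of z]
   unfolding power2_eq_square by linarith
  then have "z \<bullet> z + 1 > \<rho>" using z by (simp add: dot_square_norm power2_eq_square)
  then have "2 / (z \<bullet> z + 1) < 1 - \<eta>" unfolding \<rho>_def using \<eta>(1)
   by (simp add: divide_less_eq mult.commute)
  then have "sg 1 z $ 3 > \<eta>" unfolding sg3 by linarith
  then show ?thesis using \<eta>(2)[OF sgS] ts_sg[of 1 z] by (simp add: g_def)
 qed
 have gper: "g (b + 1, z) = g (b, z)" for b z using per[OF sgS] by (simp add: g_def)
 have "\<exists>(F :: (real \<times> real) \<times> complex => complex) \<rho>'. smo UNIV F &
  (\<forall>p z. norm z > \<rho>' --> F (p, z) = z) & (\<forall>b t z. F ((b + 1, t), z) = F ((b, t), z)) &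
  (\<forall>b t z. t <= 0 --> F ((b, t), z) = z) & (\<forall>b t z. t \<ge> 1 --> F ((b, t), z) = g (b, z)) &
  (\<forall>x. vjac F x > 0)"
  by (rule plane_isotopy[OF gs(1) gper far jac])
 then obtain F :: "(real \<times> real) \<times> complex => complex" and \<rho>' where F: "smo UNIV F"
  "\<forall>p z. norm z > \<rho>' --> F (p, z) = z" "\<forall>b t z. F ((b + 1, t), z) = F ((b, t), z)"
  "\<forall>b t z. t <= 0 --> F ((b, t), z) = z" "\<forall>b t z. t \<ge> 1 --> F ((b, t), z) = g (b, z)"
  "\<forall>x. vjac F x > 0"
  by (elim exE conjE) (rule that)
 have Fj: "vjac F x ~= 0" for x using F(6) less_irrefl by metis
 define C where "C p q = (if q = npole then npole else sg 1 (F (p, ts 1 q)))" for p q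
 have Csg: "C p (sg 1 w) = sg 1 (F (p, w))" for p w using sg_ne_npole[of w] ts_sg[of 1 w] by (simp add: C_def)
 have S2c: "q = sg 1 (ts 1 q)" if "q \<in> S2" "q ~= npole" for q
  using sg_ts[of 1 q] S2_npole_iff[OF that(1)] that by simp
 have LI: "LI C p q" if q: "q \<in> S2" for p q
 proof (cases "q = npole")
  case False
  have "LI C p (sg 1 (ts 1 q))"
   by (rule LI_chart[OF _ F(1) open_UNIV UNIV_I]) (use Fj Csg in auto)
  then show ?thesis using S2c[OF q False] by simp
 next
  case True
  \<comment> \<open>The height of the circle of radius \<rho>', beyond which F is the
    identity.\<close>
  define \<eta>' where "\<eta>' = 1 - 2 / (\<rho>'\<^sup>2 + 1)"
  have pos: "\<rho>'\<^sup>2 + 1 > 0" by (simp add: add_nonneg_pos)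
  show ?thesis
  proof (rule LI_cong[OF SF_id open_UNIV UNIV_I, of "UNIV \<times> {q. q $ 3 > \<eta>'}"])
   show "open (UNIV \<times> {q::real^3. q $ 3 > \<eta>'})"
    by (intro open_Times open_UNIV open_Collect_less continuous_intros)
   show "(p, q) \<in> UNIV \<times> {q. q $ 3 > \<eta>'}" using True pos by (simp add: \<eta>'_def)
   fix p' :: "real \<times> real" and q' :: "real^3"
   assume a: "(p', q') \<in> UNIV \<times> {q. q $ 3 > \<eta>'}" "q' \<in> S2"
   show "C p' q' = q'"
   proof (cases "q' = npole")
    case False
    define w where "w = ts 1 q'"
    have q': "q' = sg 1 w" using S2c[OF a(2) False] by (simp add: w_def)
    have "2 / (w \<bullet> w + 1) < 2 / (\<rho>'\<^sup>2 + 1)" using a(1) unfolding q' \<eta>'_def by (simp add: sg3 del: sg_nth)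
    then have "\<rho>'\<^sup>2 + 1 < w \<bullet> w + 1" using pos by (simp add: divide_less_eq less_divide_eq mult.commute pos_divide_less_eq pos_less_divide_eq)
    then have "\<rho>' < norm w" unfolding dot_square_norm by (intro power2_less_imp_less[of \<rho>' "norm w"]) auto
    then have "F (p', w) = w" using F(2) by blast
    then show ?thesis unfolding q' Csg by simp
   qed (simp add: C_def)
  qed (use q in auto)
 qed
 have "bij_betw (C p) S2 S2" for p
 proof (rule LI_bij[of _ _ npole])
  show "\<exists>!x. x \<in> S2 & C p x = npole"
   by (rule ex1I[of _ npole]) (use sg_ne_npole in \<open>auto simp: C_def split: if_splits\<close>)
 qed (use LI in auto)
 then have "SF UNIV C" by (intro SF_LI LI) auto
 moreover have "C p q = q" if "q \<in> S2" "snd p <= 0" for p q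
  using S2c[OF that(1)] F(4)[rule_format, of "snd p" "fst p"] that(2) by (auto simp: C_def)
 moreover have "C p q = f (fst p) q" if "q \<in> S2" "snd p \<ge> 1" for p q
  using S2c[OF that(1)] F(5)[rule_format, of "snd p" "fst p"] that(2) sgg fN by (auto simp: C_def)
 ultimately show ?thesis
  by (intro isotI[of "%b t. C (b, t)"]) (auto simp: C_def F(3))
qed

text \<open>The coefficients of the vertical derivative \<open>w \<mapsto> a w + c (cnj w)\<close>.\<close>

definition lin_part :: "('p::euclidean_space \<times> complex => complex) => 'p \<times> complex => complex" where
 "lin_part F x = (pd (0, 1) F x - \<i> * pd (0, \<i>) F x) / 2"

definition anti_part :: "('p::euclidean_space \<times> complex => complex) => 'p \<times> complex => complex" where
 "anti_part F x = (pd (0, 1) F x + \<i> * pd (0, \<i>) F x) / 2"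

lemma pd_parts:
 assumes "F differentiable (at x)"
 shows "pd (0, w) F x = lin_part F x * w + anti_part F x * cnj w"
 by (subst pd_vertical[OF assms]) (simp add: lin_part_def anti_part_def complex_eq_iff field_simps)

lemma vjac_parts: "vjac F x = (norm (lin_part F x))\<^sup>2 - (norm (anti_part F x))\<^sup>2"
 unfolding vjac_def lin_part_def anti_part_def cmod_power2
 by (simp add: power2_eq_square field_simps)

text \<open>Its positivity makes the fibre derivative positive definite, by the estimate below. That
  is a convex condition met by the identity, whereas matrices of positive determinant do not form a
  convex set.\<close>

definition pos_part :: "('p::euclidean_space \<times> complex => complex) => 'p \<times> complex => real" where
 "pos_part F x = Re (lin_part F x) - norm (anti_part F x)"

lemma pos_part:
 assumes "F differentiable (at x)"
 shows "Re (cnj w * pd (0, w) F x) \<ge> pos_part F x * (norm w)\<^sup>2"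
proof -
 have "cnj w * pd (0, w) F x = lin_part F x * (w * cnj w) + anti_part F x * (cnj w)\<^sup>2"
  unfolding pd_parts[OF assms] by (simp add: algebra_simps power2_eq_square)
 also have "w * cnj w = of_real ((norm w)\<^sup>2)" by (rule complex_norm_square[symmetric])
 finally have "Re (cnj w * pd (0, w) F x) = Re (lin_part F x) * (norm w)\<^sup>2 + Re (anti_part F x * (cnj w)\<^sup>2)" by simp
 moreover have "\<bar>Re (anti_part F x * (cnj w)\<^sup>2)\<bar> <= norm (anti_part F x) * (norm w)\<^sup>2"
  using abs_Re_le_cmod[of "anti_part F x * (cnj w)\<^sup>2"] by (simp add: norm_mult norm_power)
 ultimately show ?thesis by (simp add: pos_part_def left_diff_distrib)
qed

lemma smo_parts:
 "smo S F ==> open S ==> smo S (lin_part F)" "smo S F ==> open S ==> smo S (anti_part F)"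
 unfolding lin_part_def[abs_def] anti_part_def[abs_def] by (intro smo_intros smo_pd; simp)+

section \<open>Loops of diffeomorphisms of the sphere\<close>

lemma pd_periodic_at:
 assumes "!!x. f (x + a) = f x" "f differentiable (at (x + a))"
 shows "pd v f (x + a) = pd v f x"
proof -
 have "((%y. y + a) has_derivative (%v. v)) (at x)" by (auto intro!: derivative_eq_intros)
 from has_derivative_compose[OF this has_pd[OF assms(2)]]
 have "(f has_derivative (%v. pd v f (x + a))) (at x)" by (simp add: assms(1))
 from pd_eq[OF this] show ?thesis by simp
qed

lemma smo_SF_chart:
 assumes c: "SF UNIV c" and e: "e\<^sup>2 = 1"
 shows "smo UNIV (%x::real \<times> complex. c (fst x) (sg e (snd x)))"
proof -
 have "smooth_on UNIV (%x::real \<times> complex. c (fst x) (sg e (snd x)))"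
 proof (rule SF_compose_smooth(1)[OF c smooth_on_fst])
  show "smooth_on UNIV (%x::real \<times> complex. sg e (snd x))"
   by (intro smooth_on_smo_UNIV smo_sg smo_intros open_UNIV)
  show "(%x::real \<times> complex. sg e (snd x)) ` UNIV \<subseteq> S2" using sg_S2[OF e] by (simp add: image_subset_iff)
 qed simp
 then show ?thesis by (simp add: smooth_on_open_iff)
qed

lemma stp_deriv_bounded: "\<exists>S\<ge>0. \<forall>x. \<bar>pd 1 stp x\<bar> <= S"
proof -
 have "bounded (pd 1 stp ` cball 0 2)"
  by (intro compact_imp_bounded compact_continuous_image compact_cball
    continuous_on_subset[OF smo_continuous[OF smo_pd[OF smo_stp]] subset_UNIV])
 then obtain S where S: "\<forall>y\<in>pd 1 stp ` cball 0 2. norm y <= S" unfolding bounded_iff by blast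
 have "\<bar>pd 1 stp x\<bar> <= S" for x
 proof (cases "norm x <= 2")
  case True then show ?thesis using S by auto
 next
  case False
  have "pd 1 stp x = pd 1 (%x. if x > 0 then 1 else 0 :: real) x"
   by (rule pd_cong[of "- cball 0 1"]) (use False in auto)
  also have "\<dots> = 0"
  proof (cases "x > 0")
   case True
   have "pd 1 (%x. if x > 0 then 1 else 0 :: real) x = pd 1 (%x. 1::real) x"
    by (rule pd_cong[of "{0<..}"]) (use True in auto)
   then show ?thesis using pd_eq[OF has_derivative_const] by metis
  next
   case F: False
   have "pd 1 (%x. if x > 0 then 1 else 0 :: real) x = pd 1 (%x. 0::real) x"
    by (rule pd_cong[of "{..<0}"]) (use F False in auto)
   then show ?thesis using pd_eq[OF has_derivative_const] by metis
  qed
  finally have "\<bar>pd 1 stp x\<bar> = 0" by simp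
  moreover have "\<bar>pd 1 stp 0\<bar> <= S" using S by auto
  ultimately show ?thesis by linarith
 qed
 moreover have "\<bar>pd 1 stp 0\<bar> <= S" using S by auto
 then have "S \<ge> 0" by linarith
 ultimately show ?thesis by (intro exI[of _ S]) auto
qed

text \<open>A cutoff with \<open>\<bar>w\<bar> \<bar>\<nabla>ct w\<bar>\<close> small: a slowly varying function of \<open>ln \<bar>w\<bar>\<close>.\<close>

lemma log_cutoff:
 assumes "r > 0" "ep > 0"
 shows "\<exists>ct r2. smo UNIV (ct :: complex => real) & r2 > 0 & (\<forall>w. norm w < r2 --> ct w = 1) &
  (\<forall>w. norm w \<ge> r --> ct w = 0) & (\<forall>w. 0 <= ct w & ct w <= 1) &
  (\<forall>v w. \<bar>pd v ct w\<bar> * norm w <= ep * norm v)"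
proof -
 obtain S where S: "S \<ge> 0" "!!x. \<bar>pd 1 stp x\<bar> <= S" using stp_deriv_bounded by blast
 define \<delta> where "\<delta> = ep / (2 * (S + 1))"
 have \<delta>: "\<delta> > 0" "S * \<delta> * 2 <= ep" using S(1) assms(2)
  by (auto simp: \<delta>_def divide_le_eq add_nonneg_pos intro!: divide_pos_pos mult_pos_pos)
 define A where "A w = \<delta> * (ln (r\<^sup>2) - ln (w \<bullet> w))" for w :: complex
 define ct where "ct w = (if w = 0 then 1 else stp (A w))" for w
 \<comment> \<open>The radius at which A reaches 1, as A w = 2 * \<delta> * ln (r / norm w).\<close>
 define r2 where "r2 = r * exp (- (1 / (2 * \<delta>)))"
 have r2: "r2 > 0" using assms(1) by (simp add: r2_def)
 have c1: "ct w = 1" if "norm w < r2" for w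
 proof (cases "w = 0")
  case False
  have "w \<bullet> w <= r2\<^sup>2" using that unfolding dot_square_norm by (intro power_mono) auto
  then have "ln (w \<bullet> w) <= ln (r2\<^sup>2)" using False r2 by (subst ln_le_cancel_iff) auto
  also have "ln (r2\<^sup>2) = ln (r\<^sup>2) - 1 / \<delta>" using assms(1) \<delta>
   by (simp add: r2_def power_mult_distrib ln_mult exp_double[symmetric] ln_realpow)
  finally have "1 / \<delta> <= ln (r\<^sup>2) - ln (w \<bullet> w)" by linarith
  then have "\<delta> * (1 / \<delta>) <= A w" unfolding A_def using \<delta> by (intro mult_left_mono) auto
  then show ?thesis using False \<delta> by (simp add: ct_def)
 qed (simp add: ct_def)
 have c0: "ct w = 0" if "norm w \<ge> r" for w
 proof -
  have "w ~= 0" using that assms(1) by auto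
  moreover have "r\<^sup>2 <= w \<bullet> w" using that assms(1) unfolding dot_square_norm by (intro power_mono) auto
  then have "ln (r\<^sup>2) <= ln (w \<bullet> w)" using assms(1) calculation by (subst ln_le_cancel_iff) auto
  ultimately show ?thesis using \<delta> by (simp add: ct_def A_def mult_le_0_iff)
 qed
 have As: "smo (- {0}) A" unfolding A_def[abs_def] by (intro smo_intros) auto
 have cts: "smo UNIV ct"
 proof (rule smo_local)
  fix w :: complex
  show "\<exists>W. open W & w \<in> W & smo W ct"
  proof (cases "w = 0")
   case True
   have "smo (ball 0 r2) ct" by (rule smo_transform[of _ "%w. 1"]) (auto simp: c1)
   then show ?thesis using True r2 by (intro exI[of _ "ball 0 r2"]) auto
  next
   case False
   have "smo (- {0}) ct" by (rule smo_transform[of _ "%w. stp (A w)"]) (auto simp: ct_def intro!: smo_stpI As)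
   then show ?thesis using False by (intro exI[of _ "- {0}"]) auto
  qed
 qed
 have "\<bar>pd v ct w\<bar> * norm w <= ep * norm v" for v w
 proof (cases "w = 0")
  case False
  have nz: "w \<bullet> w > 0" using False by simp
  have "((%w::complex. w \<bullet> w) has_derivative (%v. 2 * (w \<bullet> v))) (at w)"
   by (auto intro!: derivative_eq_intros simp: inner_commute)
  then have "((%w. ln (w \<bullet> w)) has_derivative (%v. 2 * (w \<bullet> v) * inverse (w \<bullet> w))) (at w)"
   by (rule has_derivative_ln[of "%w. w \<bullet> w" w, OF nz])
  then have dA: "(A has_derivative (%v. \<delta> * (0 - 2 * (w \<bullet> v) * inverse (w \<bullet> w)))) (at w)"
   unfolding A_def[abs_def] by (intro has_derivative_mult_right has_derivative_diff has_derivative_const)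
  have sd: "stp differentiable (at (A w))" using smo_differentiable[OF smo_stp] by simp
  have "pd v ct w = pd v (%w. stp (A w)) w"
   by (rule pd_cong[of "- {0}"]) (use False in \<open>auto simp: ct_def\<close>)
  also have "\<dots> = pd (\<delta> * (0 - 2 * (w \<bullet> v) * inverse (w \<bullet> w))) stp (A w)"
   by (rule pd_eq[OF has_derivative_compose[OF dA has_pd[OF sd]]])
  also have "\<dots> = (\<delta> * (0 - 2 * (w \<bullet> v) * inverse (w \<bullet> w))) * pd 1 stp (A w)"
   using linear_cmul[OF pd_linear[OF sd], of "\<delta> * (0 - 2 * (w \<bullet> v) * inverse (w \<bullet> w))" 1] by simp
  finally have "\<bar>pd v ct w\<bar> = \<delta> * 2 * \<bar>w \<bullet> v\<bar> * inverse (w \<bullet> w) * \<bar>pd 1 stp (A w)\<bar>"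
   using \<delta> nz by (simp add: abs_mult)
  also have "\<dots> <= \<delta> * 2 * (norm w * norm v) * inverse (w \<bullet> w) * S"
   using \<delta>(1) S nz Cauchy_Schwarz_ineq2[of w v] by (intro mult_mono mult_nonneg_nonneg) auto
  finally have "\<bar>pd v ct w\<bar> * norm w <= \<delta> * 2 * (norm w * norm v) * inverse (w \<bullet> w) * S * norm w"
   by (intro mult_right_mono) auto
  also have "\<dots> = (S * \<delta> * 2) * norm v" using False
   by (simp add: dot_square_norm power2_eq_square field_simps)
  also have "\<dots> <= ep * norm v" using \<delta>(2) by (intro mult_right_mono) auto
  finally show ?thesis .
 qed (use assms in simp)
 moreover have "0 <= ct w & ct w <= 1" for w by (simp add: ct_def)
 ultimately show ?thesis using cts r2 c1 c0
  by (intro exI[of _ ct] exI[of _ r2]) auto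
qed

abbreviation pole_chart :: "(real => real^3 => real^3) => real \<times> complex => complex" where
 "pole_chart f x \<equiv> ts (-1) (f (fst x) (sg (-1) (snd x)))"

lemma sgm0 [simp]: "sg (-1) 0 = npole"
 unfolding vec3_eq_iff by simp

lemma sgm3: "sg (-1) w $ 3 = 2 / (w \<bullet> w + 1) - 1"
 using sg_ne[of "-1" w] by (simp del: sg_nth)

text \<open>Near the pole f is averaged with the identity in the chart centred there. The averaged
  derivative stays positive definite, and the derivative of the cutoff is multiplied by w - fh (b,
  w), of norm at most K times that of w; \<open>log_cutoff\<close> makes this product smaller than
  the definiteness.\<close>

lemma straighten_at_pole:
 assumes f: "SF UNIV f" and per: "!!b q. q \<in> S2 ==> f (b + 1) q = f b q" and fN: "!!b. f b npole = npole"
  and pos: "!!b. pos_part (pole_chart f) (b, 0) > 0"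
 shows "\<exists>g \<eta>. isot f g & SF UNIV g & (\<forall>b. \<forall>q\<in>S2. g (b + 1) q = g b q) & \<eta> < 1 &
   (\<forall>b. \<forall>q\<in>S2. q $ 3 > \<eta> --> g b q = q)"
proof -
 note S = SF_D[OF f UNIV_I]
 have e1: "(-1)\<^sup>2 = (1::real)" by simp
 have sgS: "sg (-1) w \<in> S2" for w by (rule sg_S2[OF e1])
 define fh where "fh = pole_chart f"
 define W0 where "W0 = {x :: real \<times> complex. (-1) * f (fst x) (sg (-1) (snd x)) $ 3 ~= 1}"
 note fs = smo_SF_chart[OF f e1]
 have oW0: "open W0" unfolding W0_def
  by (intro open_Collect_neq continuous_intros smo_continuous[OF fs])
 have fhs: "smo W0 fh" unfolding fh_def
  by (rule smo_compose[OF smo_ts[of "-1"] smo_subset[OF fs subset_UNIV] _ oW0 open_ts]) (auto simp: W0_def)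
 have fhd: "fh differentiable (at x)" if "x \<in> W0" for x by (rule smo_differentiable[OF fhs that])
 have zW0: "(b, 0) \<in> W0" for b by (simp add: W0_def fN)
 have fh0: "fh (b, 0) = 0" for b by (simp add: fh_def fN ts_def complex_eq_iff)
 have sgfh: "sg (-1) (fh (b, w)) = f b (sg (-1) w)" if "(b, w) \<in> W0" for b w
  using sg_ts[OF e1 S(1)[OF sgS]] that by (simp add: fh_def W0_def)
 have fhper: "fh (x + (1, 0)) = fh x" for x using per[OF sgS] by (simp add: fh_def)
 have W0per: "(b + 1, w) \<in> W0 \<longleftrightarrow> (b, w) \<in> W0" for b w using per[OF sgS] by (simp add: W0_def)
 have ppc: "continuous_on W0 (pos_part fh)" unfolding pos_part_def
  by (intro continuous_intros smo_continuous[OF smo_parts(1)[OF fhs oW0]] smo_continuous[OF smo_parts(2)[OF fhs oW0]])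
 have "continuous_on {0..1} (%b. pos_part fh (b, 0))"
  by (rule continuous_on_compose2[OF ppc]) (auto intro!: continuous_intros zW0)
 then obtain b0 where "\<forall>b\<in>{0..1}. pos_part fh (b0, 0) <= pos_part fh (b, 0)"
  using continuous_attains_inf[of "{0..1::real}" "%b. pos_part fh (b, 0)"] by (force simp del: atLeastAtMost_iff)
 then have b0: "!!b. b \<in> {0..1} ==> pos_part fh (b0, 0) <= pos_part fh (b, 0)" by blast
 \<comment> \<open>Half the least value over the loop, so that the bound persists in a
   neighbourhood, and at most 1, so that the identity satisfies it as well.\<close>
 define ka where "ka = min (pos_part fh (b0, 0) / 2) 1"
 have ka: "0 < ka" "ka <= 1" "ka < pos_part fh (b0, 0)" using pos[of b0] unfolding ka_def fh_def[symmetric] by auto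
 define A where "A = W0 \<inter> pos_part fh -` {ka<..}"
 have oA: "open A" unfolding A_def by (rule continuous_open_preimage[OF ppc oW0 open_greaterThan])
 have Aper: "(b + 1, w) \<in> A \<longleftrightarrow> (b, w) \<in> A" for b w
 proof -
  have "pos_part fh (b + 1, w) = pos_part fh (b, w)" if "(b, w) \<in> W0"
  proof -
   have "pd v fh ((b, w) + (1, 0)) = pd v fh (b, w)" for v
    by (rule pd_periodic_at[OF fhper fhd]) (use that W0per in simp)
   then show ?thesis by (simp add: pos_part_def lin_part_def anti_part_def)
  qed
  then show ?thesis using W0per unfolding A_def by auto
 qed
 have sA: "{0..1} \<times> {0} \<subseteq> A" using ka(3) b0 zW0 unfolding A_def by force
 have cA: "compact ({0..1} \<times> {0} :: (real \<times> complex) set)" by (intro compact_Times) auto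
 obtain ep where ep: "ep > 0" "(\<Union>x\<in>{0..1} \<times> {0}. ball x ep) \<subseteq> A"
  by (rule compact_subset_open_imp_ball_epsilon_subset[OF cA oA sA])
 define r where "r = ep / 2"
 have r: "r > 0" using ep by (simp add: r_def)
 have inA: "(b, w) \<in> A" if w: "norm w <= r" for b w
 proof -
  have "(frac b, w) \<in> ball (frac b, 0) ep" using w ep(1) by (simp add: dist_Pair_Pair r_def)
  moreover have "(frac b, 0::complex) \<in> {0..1} \<times> {0}" by (simp add: less_imp_le frac_lt_1)
  ultimately have "(frac b, w) \<in> A" using ep(2) by blast
  moreover have "((frac b + of_int \<lfloor>b\<rfloor>, w) \<in> A) = ((frac b, w) \<in> A)"
   by (rule periodic_int[of "%b. (b, w) \<in> A"]) (simp add: Aper)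
  ultimately show ?thesis by (simp add: frac_def)
 qed
 have AW0: "x \<in> W0" "pos_part fh x > ka" if "x \<in> A" for x using that by (auto simp: A_def)
 define B where "B = ({0..1} \<times> cball 0 r :: (real \<times> complex) set)"
 have BA: "B \<subseteq> W0" using inA AW0 unfolding B_def by auto
 have "compact B" unfolding B_def by (intro compact_Times) auto
 then have "bounded ((%x. norm (lin_part fh x) + norm (anti_part fh x)) ` B)"
  by (intro compact_imp_bounded compact_continuous_image continuous_intros
    continuous_on_subset[OF smo_continuous[OF smo_parts(1)[OF fhs oW0]] BA]
    continuous_on_subset[OF smo_continuous[OF smo_parts(2)[OF fhs oW0]] BA])
 then obtain K0 where K0: "\<forall>y\<in>(%x. norm (lin_part fh x) + norm (anti_part fh x)) ` B. norm y <= K0"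
  unfolding bounded_iff by blast
 \<comment> \<open>The summand 1 accounts for the identity and the other one for the derivative of
   \<open>fh\<close>.\<close>
 define K where "K = 1 + \<bar>K0\<bar>"
 have K: "K > 0" by (simp add: K_def)
 have dslice: "((%w. fh (b, w)) has_derivative (%v. pd (0, v) fh (b, w))) (at w)" if "(b, w) \<in> W0" for b w
 proof -
  have "((%w. (b, w)) has_derivative (%v. (0, v))) (at w)" by (auto intro!: derivative_eq_intros)
  from has_derivative_compose[OF this has_pd[OF fhd[OF that]]] show ?thesis .
 qed
 have lip1: "norm (w - fh (b, w)) <= K * norm w" if w: "norm w <= r" and b: "0 <= b" "b <= 1" for b w
 proof -
  have "norm ((w - fh (b, w)) - (0 - fh (b, 0))) <= K * norm (w - 0)"
  proof (rule differentiable_bound[where S = "cball 0 r"])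
   show "convex (cball (0::complex) r)" by simp
   fix x assume x: "x \<in> cball (0::complex) r"
   have xB: "(b, x) \<in> B" using x b by (simp add: B_def)
   then have xW: "(b, x) \<in> W0" using BA by auto
   show "((%w. w - fh (b, w)) has_derivative (%v. v - pd (0, v) fh (b, x))) (at x within cball 0 r)"
    by (intro has_derivative_diff has_derivative_ident has_derivative_at_withinI[OF dslice[OF xW]])
   show "onorm (%v. v - pd (0, v) fh (b, x)) <= K"
   proof (rule onorm_bound)
    fix v
    have "norm (v - pd (0, v) fh (b, x)) <= norm v + norm (pd (0, v) fh (b, x))" by (rule norm_triangle_ineq4)
    also have "norm (pd (0, v) fh (b, x)) <= (norm (lin_part fh (b, x)) + norm (anti_part fh (b, x))) * norm v"
     unfolding pd_parts[OF fhd[OF xW]] by (rule order_trans[OF norm_triangle_ineq]) (simp add: norm_mult distrib_right)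
    also have "\<dots> <= \<bar>K0\<bar> * norm v" using K0 xB by (intro mult_right_mono) force+
    finally show "norm (v - pd (0, v) fh (b, x)) <= K * norm v" by (simp add: K_def distrib_right)
   qed (use K in simp)
  qed (use w r in auto)
  then show ?thesis by (simp add: fh0)
 qed
 have lip: "norm (w - fh (b, w)) <= K * norm w" if w: "norm w <= r" for b w
 proof -
  have "fh (frac b + of_int \<lfloor>b\<rfloor>, w) = fh (frac b, w)"
   by (rule periodic_int[of "%b. fh (b, w)"]) (use fhper[of "(_, w)"] in simp)
  then have "fh (b, w) = fh (frac b, w)" by (simp add: frac_def)
  then show ?thesis using lip1[OF w, of "frac b"] by (simp add: less_imp_le frac_lt_1)
 qed
 define r1 where "r1 = r / 2"
 have r1: "0 < r1" "r1 < r" using r by (auto simp: r1_def)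
 \<comment> \<open>With this bound the cutoff term is at most ka / 2 times the squared length, half
   of what the averaged derivative provides.\<close>
 have "ka / (2 * K) > 0" using ka K by simp
 from log_cutoff[OF r1(1) this]
 obtain ct r2 where ct: "smo UNIV (ct :: complex => real)" "r2 > 0" "!!w. norm w < r2 ==> ct w = 1"
  "!!w. norm w \<ge> r1 ==> ct w = 0" "!!w. 0 <= ct w" "!!w. ct w <= 1"
  "!!v w. \<bar>pd v ct w\<bar> * norm w <= ka / (2 * K) * norm v" by blast
 define FT where "FT x = fh (fst (fst x), snd x) + (stp (snd (fst x)) * ct (snd x)) *\<^sub>R (snd x - fh (fst (fst x), snd x))"
  for x :: "(real \<times> real) \<times> complex"
 define WT where "WT = {x :: (real \<times> real) \<times> complex. norm (snd x) < r}"
 have oWT: "open WT" unfolding WT_def by (intro open_Collect_less continuous_intros)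
 have WTW: "(fst (fst x), snd x) \<in> W0" "(fst (fst x), snd x) \<in> A" if "x \<in> WT" for x
  using that inA[of "snd x" "fst (fst x)"] AW0 by (auto simp: WT_def)
 have FTs: "smo WT FT"
 proof -
  have "smo WT (%x. fh (fst (fst x), snd x))"
   by (rule smo_compose[OF fhs _ _ oWT oW0]) (auto intro!: smo_intros oWT WTW)
  moreover have "smo WT (%x. ct (snd x))" by (rule smo_compose_UNIV[OF ct(1) _ oWT]) (intro smo_intros oWT)
  ultimately show ?thesis unfolding FT_def[abs_def] by (intro smo_intros oWT)
 qed
 have Re_pos: "Re (cnj v * pd (0, v) FT (p, w)) > 0" if w: "norm w < r" and v: "v ~= 0" for v p w
 proof -
  define b where "b = fst p"
  define \<tau> where "\<tau> = stp (snd p)"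
  have \<tau>: "0 <= \<tau>" "\<tau> <= 1" by (auto simp: \<tau>_def)
  have bA: "(b, w) \<in> A" by (rule inA) (use w in simp)
  note bW = AW0(1)[OF bA]
  have cd: "(ct has_derivative (%v. pd v ct w)) (at w)" by (rule smo_has_pd[OF ct(1)]) simp
  have "pd (0, v) FT (p, w) = pd v (%w. FT (p, w)) w"
   by (rule pd_slice[symmetric], rule smo_differentiable[OF FTs]) (use w in \<open>simp add: WT_def\<close>)
  also have "\<dots> = pd (0, v) fh (b, w) + ((\<tau> * ct w) *\<^sub>R (v - pd (0, v) fh (b, w)) + (\<tau> * pd v ct w) *\<^sub>R (w - fh (b, w)))"
  proof (rule pd_eq)
   show "((%w. FT (p, w)) has_derivative (%v. pd (0, v) fh (b, w) +
     ((\<tau> * ct w) *\<^sub>R (v - pd (0, v) fh (b, w)) + (\<tau> * pd v ct w) *\<^sub>R (w - fh (b, w))))) (at w)"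
    unfolding FT_def fst_conv snd_conv b_def[symmetric] \<tau>_def[symmetric]
    by (intro has_derivative_add dslice[OF bW] has_derivative_scaleR has_derivative_mult_right cd
      has_derivative_diff has_derivative_ident)
  qed
  finally have e0: "pd (0, v) FT (p, w) = pd (0, v) fh (b, w) + ((\<tau> * ct w) *\<^sub>R (v - pd (0, v) fh (b, w)) + (\<tau> * pd v ct w) *\<^sub>R (w - fh (b, w)))" .
  have e: "cnj v * pd (0, v) FT (p, w) = (1 - \<tau> * ct w) *\<^sub>R (cnj v * pd (0, v) fh (b, w))
    + (\<tau> * ct w) *\<^sub>R (cnj v * v) + (\<tau> * pd v ct w) *\<^sub>R (cnj v * (w - fh (b, w)))"
   unfolding e0 by (simp add: algebra_simps scaleR_conv_of_real)
  define l where "l = \<tau> * ct w"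
  have l: "0 <= l" "l <= 1" using \<tau> ct(5,6)[of w] by (auto simp: l_def mult_le_one)
  have nv: "(norm v)\<^sup>2 > 0" using v by simp
  have "Re (cnj v * pd (0, v) fh (b, w)) \<ge> ka * (norm v)\<^sup>2"
   using pos_part[OF fhd[OF bW], of v] AW0(2)[OF bA] nv
    mult_right_mono[of ka "pos_part fh (b, w)" "(norm v)\<^sup>2"] by linarith
  then have i1: "(1 - l) * Re (cnj v * pd (0, v) fh (b, w)) \<ge> (1 - l) * (ka * (norm v)\<^sup>2)"
   using l by (intro mult_left_mono) auto
  have "ka * (norm v)\<^sup>2 <= 1 * (norm v)\<^sup>2" using ka by (intro mult_right_mono) auto
  then have i2: "l * (norm v)\<^sup>2 \<ge> l * (ka * (norm v)\<^sup>2)" using l by (intro mult_left_mono) auto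
  have "\<bar>(\<tau> * pd v ct w) * Re (cnj v * (w - fh (b, w)))\<bar> <= \<bar>\<tau> * pd v ct w\<bar> * (norm v * norm (w - fh (b, w)))"
   unfolding abs_mult[of "\<tau> * pd v ct w"] using abs_Re_le_cmod[of "cnj v * (w - fh (b, w))"]
   by (intro mult_left_mono) (auto simp: norm_mult)
  also have "\<dots> <= \<bar>\<tau> * pd v ct w\<bar> * (norm v * (K * norm w))"
   using lip[of w b] w by (intro mult_left_mono) auto
  also have "\<dots> <= (1 * \<bar>pd v ct w\<bar>) * (norm v * (K * norm w))"
   unfolding abs_mult using \<tau> K by (intro mult_right_mono) auto
  also have "\<dots> = (\<bar>pd v ct w\<bar> * norm w) * (norm v * K)" by simp
  also have "\<dots> <= (ka / (2 * K) * norm v) * (norm v * K)" using K by (intro mult_right_mono ct(7)) auto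
  also have "\<dots> = ka / 2 * (norm v)\<^sup>2" using K by (simp add: power2_eq_square)
  finally have i3: "(\<tau> * pd v ct w) * Re (cnj v * (w - fh (b, w))) \<ge> - (ka / 2 * (norm v)\<^sup>2)" by linarith
  have "Re (cnj v * v) = (norm v)\<^sup>2" unfolding cmod_power2 by (simp add: power2_eq_square)
  then have "Re (cnj v * pd (0, v) FT (p, w)) = (1 - l) * Re (cnj v * pd (0, v) fh (b, w)) + l * (norm v)\<^sup>2
    + (\<tau> * pd v ct w) * Re (cnj v * (w - fh (b, w)))"
   unfolding e l_def[symmetric] plus_complex.simps scaleR_complex.simps by simp
  also have "\<dots> \<ge> (1 - l) * (ka * (norm v)\<^sup>2) + l * (ka * (norm v)\<^sup>2) - ka / 2 * (norm v)\<^sup>2"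
   using i1 i2 i3 by linarith
  also have "(1 - l) * (ka * (norm v)\<^sup>2) + l * (ka * (norm v)\<^sup>2) - ka / 2 * (norm v)\<^sup>2 = ka / 2 * (norm v)\<^sup>2"
   by (simp add: algebra_simps)
  finally show ?thesis using ka nv mult_pos_pos[of "ka / 2" "(norm v)\<^sup>2"] by linarith
 qed
 have jac: "vjac FT (p, w) ~= 0" if "norm w < r" for p w
 proof
  assume "vjac FT (p, w) = 0"
  moreover have "FT differentiable (at (p, w))" by (rule smo_differentiable[OF FTs]) (use that in \<open>simp add: WT_def\<close>)
  ultimately obtain v where "v ~= 0" "pd (0, v) FT (p, w) = 0" using vjac_zero_dir by blast
  then show False using Re_pos[OF that, of v p] by simp
 qed
 \<comment> \<open>By the mean value theorem along the ray to w, \<open>fh (b, w)\<close> lies in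
   the open half plane of w, and so does its average with w. Thus 0 is taken only at 0, which
   singles out the value with one preimage that \<open>LI_bij\<close> asks for.\<close>
 have FTnz: "FT (p, w) ~= 0" if w: "norm w < r" "w ~= 0" for p w
 proof -
  define b where "b = fst p"
  have sW: "norm (s *\<^sub>R w) <= r" if "0 <= s" "s <= 1" for s
   using w(1) that mult_left_le_one_le[of "norm w" s] by simp
  have "\<exists>s>0. s < 1 & Re (cnj w * fh (b, 1 *\<^sub>R w)) - Re (cnj w * fh (b, 0 *\<^sub>R w)) = (1 - 0) * Re (cnj w * pd (0, w) fh (b, s *\<^sub>R w))"
  proof (rule MVT2)
   fix s :: real assume s: "0 <= s" "s <= 1"
   have "(b, s *\<^sub>R w) \<in> W0" using inA[OF sW[OF s]] AW0 by blast
   have "((%s. s *\<^sub>R w) has_derivative (%h. h *\<^sub>R w)) (at s)" by (auto intro!: derivative_eq_intros)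
   from has_derivative_compose[OF this dslice[OF \<open>(b, s *\<^sub>R w) \<in> W0\<close>]]
   have "((%s. fh (b, s *\<^sub>R w)) has_derivative (%h. pd (0, h *\<^sub>R w) fh (b, s *\<^sub>R w))) (at s)" .
   then have "((%s. Re (cnj w * fh (b, s *\<^sub>R w))) has_derivative (%h. Re (cnj w * pd (0, h *\<^sub>R w) fh (b, s *\<^sub>R w)))) (at s)"
    by (intro has_derivative_Re has_derivative_mult_right)
   moreover have "(%h. Re (cnj w * pd (0, h *\<^sub>R w) fh (b, s *\<^sub>R w))) = (%h. Re (cnj w * pd (0, w) fh (b, s *\<^sub>R w)) * h)"
   proof
    fix h
    have "pd (0, h *\<^sub>R w) fh (b, s *\<^sub>R w) = h *\<^sub>R pd (0, w) fh (b, s *\<^sub>R w)"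
     using linear_cmul[OF pd_linear[OF fhd[OF \<open>(b, s *\<^sub>R w) \<in> W0\<close>]], of h "(0, w)"] by simp
    then show "Re (cnj w * pd (0, h *\<^sub>R w) fh (b, s *\<^sub>R w)) = Re (cnj w * pd (0, w) fh (b, s *\<^sub>R w)) * h"
     by (simp only: mult_scaleR_right scaleR_complex.simps mult.commute)
   qed
   ultimately show "((%s. Re (cnj w * fh (b, s *\<^sub>R w))) has_real_derivative Re (cnj w * pd (0, w) fh (b, s *\<^sub>R w))) (at s)"
    by (simp add: has_field_derivative_def)
  qed simp
  then obtain s where s: "0 < s" "s < 1" "Re (cnj w * fh (b, w)) = Re (cnj w * pd (0, w) fh (b, s *\<^sub>R w))"
   by (auto simp: fh0 simp del: times_complex.simps)
  have sA: "(b, s *\<^sub>R w) \<in> A" using inA[OF sW] s by simp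
  have "Re (cnj w * fh (b, w)) \<ge> pos_part fh (b, s *\<^sub>R w) * (norm w)\<^sup>2"
   unfolding s(3) by (rule pos_part[OF fhd[OF AW0(1)[OF sA]]])
  moreover have "pos_part fh (b, s *\<^sub>R w) * (norm w)\<^sup>2 > 0" using AW0(2)[OF sA] ka w(2) by (intro mult_pos_pos) auto
  ultimately have p1: "Re (cnj w * fh (b, w)) > 0" by linarith
  have "Re (cnj w * w) = (norm w)\<^sup>2" unfolding cmod_power2 by (simp add: power2_eq_square)
  then have p2: "Re (cnj w * w) > 0" using w(2) by simp
  define l where "l = stp (snd p) * ct w"
  have l: "0 <= l" "l <= 1" using ct(5,6)[of w] by (auto simp: l_def mult_le_one)
  have "cnj w * FT (p, w) = (1 - l) *\<^sub>R (cnj w * fh (b, w)) + l *\<^sub>R (cnj w * w)"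
   unfolding FT_def b_def l_def by (simp add: algebra_simps scaleR_conv_of_real)
  then have "Re (cnj w * FT (p, w)) = (1 - l) * Re (cnj w * fh (b, w)) + l * Re (cnj w * w)"
   by (simp only: plus_complex.simps scaleR_complex.simps)
  also have "\<dots> > 0"
  proof (cases "l = 0")
   case False
   then show ?thesis using l p1 p2 by (intro add_nonneg_pos mult_nonneg_nonneg mult_pos_pos) auto
  qed (use p1 in simp)
  finally show ?thesis by auto
 qed
 \<comment> \<open>On D the chart formula replaces f. Beyond radius r1 < r the cutoff vanishes and
   the formula returns f, so C is locally one or the other and the border of D causes no
   break.\<close>
 define D where "D = {q :: real^3. q $ 3 ~= -1 & norm (ts (-1) q) < r}"
 define C where "C p q = (if q \<in> D then sg (-1) (FT (p, ts (-1) q)) else f (fst p) q)" for p q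
 have sgD: "sg (-1) w \<in> D \<longleftrightarrow> norm w < r" for w
  using ts_ne_iff[OF e1, of w] ts_sg[OF e1, of w] by (auto simp: D_def simp del: sg_nth)
 have Csg: "C p (sg (-1) w) = sg (-1) (FT (p, w))" if "norm w < r" for p w
  using sgD[of w] that ts_sg[OF e1, of w] by (simp add: C_def)
 have S2D: "q = sg (-1) (ts (-1) q)" if "q \<in> S2" "q \<in> D" for q
  using sg_ts[OF e1 that(1)] that(2) by (auto simp: D_def)
 have Cf: "C p q = f (fst p) q" if q: "q \<in> S2" "q \<notin> sg (-1) ` cball 0 r1" for p q
 proof (cases "q \<in> D")
  case True
  define w where "w = ts (-1) q"
  have qw: "q = sg (-1) w" "norm w < r" using S2D[OF q(1) True] True by (auto simp: w_def D_def)
  then have "norm w > r1" using q(2) by (metis image_eqI mem_cball_0 not_less)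
  then have "FT (p, w) = fh (fst p, w)" using ct(4)[of w] by (simp add: FT_def)
  then show ?thesis unfolding qw(1) Csg[OF qw(2)] using sgfh AW0(1)[OF inA] qw(2) by simp
 qed (simp add: C_def)
 have LI: "LI C p q" if q: "q \<in> S2" for p q
 proof (cases "q \<in> D")
  case True
  have "LI C p (sg (-1) (ts (-1) q))"
   by (rule LI_chart[OF e1 FTs oWT]) (use True jac Csg in \<open>auto simp: WT_def D_def\<close>)
  then show ?thesis using S2D[OF q True] by simp
 next
  case False
  have d: "SF UNIV (%p :: real \<times> real. f (fst p))"
   by (rule SF_reparam[OF f]) (auto intro: smooth_on_fst)
  have "compact (sg (-1) ` cball 0 r1)"
   by (rule compact_continuous_image[OF continuous_on_subset[OF smo_continuous[OF smo_sg[OF smo_ident open_UNIV]] subset_UNIV] compact_cball])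
  then have o: "open (UNIV \<times> - (sg (-1) ` cball 0 r1) :: ((real \<times> real) \<times> (real^3)) set)"
   by (intro open_Times open_UNIV open_Compl compact_imp_closed)
  have "q \<notin> sg (-1) ` cball 0 r1"
  proof
   assume "q \<in> sg (-1) ` cball 0 r1"
   then obtain w where w: "q = sg (-1) w" "norm w <= r1" by (rule imageE) (simp add: that)
   then show False using False sgD[of w] r1(2) by simp
  qed
  then have qo: "(p, q) \<in> UNIV \<times> - (sg (-1) ` cball 0 r1)" by simp
  show ?thesis
   by (rule LI_cong[OF d open_UNIV UNIV_I o qo q]) (use Cf in \<open>auto simp del: sg_nth\<close>)
 qed
 have C0: "C p npole = npole" for p
  using Csg[of 0 p] r by (simp add: FT_def fh0)
 have "bij_betw (C p) S2 S2" for p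
 proof (rule LI_bij[of _ _ npole])
  show "\<exists>!x. x \<in> S2 & C p x = npole"
  proof (rule ex1I[of _ npole])
   fix x assume x: "x \<in> S2 & C p x = npole"
   show "x = npole"
   proof (cases "x \<in> D")
    case True
    define w where "w = ts (-1) x"
    have xw: "x = sg (-1) w" "norm w < r" using S2D[of x] x True by (auto simp: w_def D_def)
    have "sg (-1) (FT (p, w)) = sg (-1) 0" using x Csg[OF xw(2), of p] xw(1) by simp
    then have "FT (p, w) = 0" using ts_sg[OF e1] by metis
    then have "w = 0" using FTnz[OF xw(2)] by blast
    then show ?thesis using xw by simp
   next
    case False
    then have "f (fst p) x = f (fst p) npole" using x by (simp add: C_def fN)
    then show ?thesis using inj_onD[OF S(5)] x by (metis npole_S2(1))
   qed
  qed (use C0 in simp)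
 qed (use LI in auto)
 then have CS: "SF UNIV C" by (intro SF_LI LI) auto
 have Cper: "C (b + 1, t) q = C (b, t) q" if "q \<in> S2" for b t q
  using per[OF that] fhper[of "(b, _)"] by (simp add: C_def FT_def)
 have C0': "C (b, t) q = f b q" if "q \<in> S2" "t <= 0" for b t q
 proof (cases "q \<in> D")
  case True
  define w where "w = ts (-1) q"
  have qw: "q = sg (-1) w" "norm w < r" using S2D[of q] that True by (auto simp: w_def D_def)
  show ?thesis unfolding qw(1) Csg[OF qw(2)] using sgfh AW0(1)[OF inA] qw(2) that by (simp add: FT_def)
 qed (simp add: C_def)
 define g where "g b = C (b, 1)" for b
 have g1: "SF UNIV g" unfolding g_def[abs_def]
  by (rule SF_reparam[OF CS]) (auto intro!: smooth_on_smo_UNIV smo_intros)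
 have g2: "isot f g"
  by (rule isotI[of "%b t. C (b, t)"])
    (use CS Cper C0' in \<open>auto simp: g_def C_def FT_def\<close>)
 have m0: "min r2 r > 0" using ct(2) r by simp
 define X where "X = (min r2 r)\<^sup>2 + 1"
 \<comment> \<open>The height of the circle of radius min r2 r, inside which the cutoff is
   1.\<close>
 define \<eta> where "\<eta> = 2 / X - 1"
 have X: "X > 1" unfolding X_def using zero_less_power[OF m0, of 2] by linarith
 have \<eta>1: "\<eta> < 1" using X unfolding \<eta>_def by (simp add: divide_less_eq)
 have \<eta>2: "g b q = q" if q: "q \<in> S2" "q $ 3 > \<eta>" for b q
 proof -
  have "\<eta> > -1" using X by (simp add: \<eta>_def)
  then have "q $ 3 ~= -1" using q by linarith
  define w where "w = ts (-1) q"
  have qw: "q = sg (-1) w" using sg_ts[OF e1 q(1)] \<open>q $ 3 ~= -1\<close> by (simp add: w_def)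
  define Y where "Y = w \<bullet> w + 1"
  have Y: "Y > 0" unfolding Y_def by (rule add_nonneg_pos[OF inner_ge_zero zero_less_one])
  have "2 / X < 2 / Y" using q(2) unfolding qw \<eta>_def sgm3 Y_def[symmetric] by linarith
  then have "Y < X" using X Y by (simp add: field_simps)
  then have "(norm w)\<^sup>2 < (min r2 r)\<^sup>2" unfolding X_def Y_def dot_square_norm by linarith
  then have w: "norm w < min r2 r" by (rule power2_less_imp_less) (use m0 in simp)
  then have "FT ((b, 1), w) = w" using ct(3)[of w] by (simp add: FT_def)
  then show ?thesis unfolding g_def qw using Csg[of w] w by simp
 qed
 show ?thesis
  by (rule exI[of _ g], rule exI[of _ \<eta>]) (use g1 g2 \<eta>1 \<eta>2 Cper in \<open>auto simp: g_def\<close>)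
qed

text \<open>A positive Jacobian makes the complex linear part of the derivative at the pole nonzero,
  so it has an angle, which grows by n full turns over a period. Rotating the angle away leaves a
  positive real linear part that dominates the antilinear part, as \<open>straighten_at_pole\<close>
  requires.\<close>

lemma winding_at_pole:
 assumes f: "SF UNIV f" and per: "!!b q. q \<in> S2 ==> f (b + 1) q = f b q" and fN: "!!b. f b npole = npole"
  and jac: "!!b. vjac (pole_chart f) (b, 0) > 0"
 shows "\<exists>n::int. isot (%b. rot (of_int n * b)) f"
proof -
 note S = SF_D[OF f UNIV_I]
 have e1: "(-1)\<^sup>2 = (1::real)" by simp
 have sgS: "sg (-1) w \<in> S2" for w by (rule sg_S2[OF e1])
 define fh where "fh = pole_chart f"
 define W0 where "W0 = {x :: real \<times> complex. (-1) * f (fst x) (sg (-1) (snd x)) $ 3 ~= 1}"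
 note fs = smo_SF_chart[OF f e1]
 have oW0: "open W0" unfolding W0_def
  by (intro open_Collect_neq continuous_intros smo_continuous[OF fs])
 have fhs: "smo W0 fh" unfolding fh_def
  by (rule smo_compose[OF smo_ts[of "-1"] smo_subset[OF fs subset_UNIV] _ oW0 open_ts]) (auto simp: W0_def)
 have zW0: "(b, 0) \<in> W0" for b by (simp add: W0_def fN)
 have fhd: "fh differentiable (at (b, 0))" for b by (rule smo_differentiable[OF fhs zW0])
 have sgfh: "sg (-1) (fh x) = f (fst x) (sg (-1) (snd x))" if "x \<in> W0" for x
  using sg_ts[OF e1 S(1)[OF sgS]] that by (simp add: fh_def W0_def)
 have fhper: "fh (x + (1, 0)) = fh x" for x using per[OF sgS] by (simp add: fh_def)
 define a where "a b = lin_part fh (b, 0)" for b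
 have as: "smo UNIV a" unfolding a_def[abs_def]
  by (rule smo_compose[OF smo_parts(1)[OF fhs oW0] _ _ open_UNIV oW0]) (auto intro!: smo_intros zW0)
 have gt: "norm (a b) > norm (anti_part fh (b, 0))" for b
 proof -
  have "vjac fh (b, 0) > 0" using jac[of b] by (simp only: fh_def)
  then have "(norm (anti_part fh (b, 0)))\<^sup>2 < (norm (lin_part fh (b, 0)))\<^sup>2" unfolding vjac_parts by linarith
  then show ?thesis unfolding a_def by (rule power2_less_imp_less) (rule norm_ge_zero)
 qed
 have anz: "a b ~= 0" for b using gt[of b] norm_ge_zero[of "anti_part fh (b, 0)"] by auto
 have aper: "a (b + 1) = a b" for b
 proof -
  have "pd v fh ((b, 0) + (1, 0)) = pd v fh (b, 0)" for v
   by (rule pd_periodic_at[where f = fh and a = "(1, 0)", OF fhper]) (use fhd[of "b + 1"] in simp)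
  then show ?thesis by (simp add: a_def lin_part_def)
 qed
 obtain l where l: "continuous_on UNIV l" "!!b. a b = exp (l b)"
  using continuous_logarithm_on_contractible[OF smo_continuous[OF as] contractible_UNIV] anz by auto
 have ls: "smo UNIV l" by (rule smo_logarithm[OF l(1) _ as open_UNIV]) (rule l(2))
 define d where "d b = l (b + 1) - l b" for b
 have dc: "continuous_on UNIV d" unfolding d_def
  by (intro continuous_on_diff l(1) continuous_on_compose2[OF l(1)]) (auto intro!: continuous_intros)
 have dexp: "exp (d b) = 1" for b
  using l(2)[of b] l(2)[of "b + 1"] aper[of b] anz[of b] by (simp add: d_def exp_diff)
 have "exp (d 0) = 1" by (rule dexp)
 then obtain n :: int where n: "Im (d 0) = of_int (2 * n) * pi" unfolding exp_eq_1 by blast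
 have dn: "Im (d b) = 2 * pi * of_int n" for b
 proof -
  have "d b = d 0" by (rule exp_const_imp_const[OF connected_UNIV dc dexp]) auto
  then show ?thesis using n by simp
 qed
 define \<alpha> where "\<alpha> b = Im (l b) / (2 * pi)" for b
 have \<alpha>1: "\<alpha> (b + 1) = \<alpha> b + of_int n" for b
  using dn[of b] by (simp add: \<alpha>_def d_def field_simps)
 have \<alpha>s: "smo UNIV \<alpha>" unfolding \<alpha>_def[abs_def] by (intro smo_intros ls open_UNIV) auto
 define g where "g b q = rot (- \<alpha> b) (f b q)" for b q
 have g: "SF UNIV g" unfolding g_def[abs_def]
  by (rule SF_comp[OF SF_rot f]) (intro smooth_on_smo_UNIV smo_intros \<alpha>s open_UNIV)
 have rper: "rot (\<alpha> (b + 1)) q = rot (\<alpha> b) q" "rot (- \<alpha> (b + 1)) q = rot (- \<alpha> b) q" for b q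
  using rot_add[of "\<alpha> b" "of_int n" q] rot_add[of "- \<alpha> b" "of_int (- n)" q] rot_int[of n q] rot_int[of "- n" q]
  by (simp_all add: \<alpha>1)
 have gper: "g (b + 1) q = g b q" if "q \<in> S2" for b q using per[OF that] rper by (simp add: g_def)
 have rotN: "rot t npole = npole" for t unfolding vec3_eq_iff by simp
 have gN: "g b npole = npole" for b by (simp add: g_def fN rotN)
 define k where "k x = cis (2 * pi * (- \<alpha> (fst x))) * fh x" for x
 have ks: "smo W0 k" unfolding k_def[abs_def]
  by (intro smo_intros fhs oW0 smo_compose_UNIV[OF \<alpha>s])
 have gk: "pole_chart g x = k x" if "x \<in> W0" for x
  using sgfh[OF that] ts_sg[OF e1] by (simp add: g_def k_def sgfh[OF that, symmetric] rot_sg)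
 have pdg: "pd (0, v) (pole_chart g) (b, 0) = cis (2 * pi * (- \<alpha> b)) * pd (0, v) fh (b, 0)" for b v
 proof -
  have "pd (0, v) (pole_chart g) (b, 0) = pd (0, v) k (b, 0)"
   by (rule pd_cong[OF oW0 zW0]) (rule gk)
  also have "\<dots> = pd v (%w. k (b, w)) 0"
   by (rule pd_slice[symmetric], rule smo_differentiable[OF ks zW0])
  also have "\<dots> = cis (2 * pi * (- \<alpha> b)) * pd (0, v) fh (b, 0)"
  proof (rule pd_eq)
   have "((%w. (b, w)) has_derivative (%v. (0, v))) (at 0)" by (auto intro!: derivative_eq_intros)
   from has_derivative_compose[OF this has_pd[OF fhd]]
   show "((%w. k (b, w)) has_derivative (%v. cis (2 * pi * (- \<alpha> b)) * pd (0, v) fh (b, 0))) (at 0)"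
    unfolding k_def fst_conv by (rule has_derivative_mult_right)
  qed
  finally show ?thesis .
 qed
 have pos: "pos_part (pole_chart g) (b, 0) > 0" for b
 proof -
  have "lin_part (pole_chart g) (b, 0) = cis (2 * pi * (- \<alpha> b)) * a b"
   unfolding lin_part_def a_def pdg by (simp add: algebra_simps)
  also have "\<dots> = of_real (exp (Re (l b))) * (cis (Im (l b)) * cis (- Im (l b)))"
   unfolding l(2) exp_eq_polar[of "l b"] by (simp add: \<alpha>_def)
  also have "\<dots> = of_real (exp (Re (l b)))" by (simp add: cis_mult)
  finally have "Re (lin_part (pole_chart g) (b, 0)) = norm (a b)" by (simp add: l(2))
  moreover have "anti_part (pole_chart g) (b, 0) = cis (2 * pi * (- \<alpha> b)) * anti_part fh (b, 0)"
   unfolding anti_part_def pdg by (simp add: algebra_simps)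
  then have "norm (anti_part (pole_chart g) (b, 0)) = norm (anti_part fh (b, 0))" by (simp add: norm_mult)
  ultimately show ?thesis using gt[of b] by (simp add: pos_part_def)
 qed
 have ex: "\<exists>g' \<eta>. isot g g' & SF UNIV g' & (\<forall>b. \<forall>q\<in>S2. g' (b + 1) q = g' b q) & \<eta> < 1 &
   (\<forall>b. \<forall>q\<in>S2. q $ 3 > \<eta> --> g' b q = q)"
  by (rule straighten_at_pole[OF g]) (fact gper gN pos)+
 obtain g' \<eta> where g': "isot g g'" "SF UNIV g'" "\<forall>b. \<forall>q\<in>S2. g' (b + 1) q = g' b q" "\<eta> < 1"
   "\<forall>b. \<forall>q\<in>S2. q $ 3 > \<eta> --> g' b q = q"
  using ex by (elim exE conjE) (rule that)
 have "isot (%b q. q) g'" by (rule sphere_isotopy[OF g'(2) _ g'(4)]) (use g'(3,5) in auto)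
 then have i1: "isot (%b q. q) g" using isot_sym[OF g'(1)] isot_trans by blast
 have "isot (%b q. rot (\<alpha> b) q) (%b q. rot (\<alpha> b) (g b q))"
  by (rule isot_comp_left[OF i1 SF_rot]) (auto intro!: smooth_on_smo_UNIV \<alpha>s rper)
 moreover have "rot (\<alpha> b) (g b q) = f b q" for b q by (simp add: g_def rot_add[symmetric])
 ultimately have i2: "isot (%b. rot (\<alpha> b)) f" by simp
 \<comment> \<open>The difference of \<alpha> b and n b is periodic, so the two angles can be
   interpolated linearly: over a period every intermediate angle grows by the integer n.\<close>
 have i3: "isot (%b. rot (of_int n * b)) (%b. rot (\<alpha> b))"
 proof (rule isotI[of "%b t. rot (of_int n * b + stp t * (\<alpha> b - of_int n * b))"])
  show "SF UNIV (%p. rot (of_int n * fst p + stp (snd p) * (\<alpha> (fst p) - of_int n * fst p)))"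
   by (intro SF_rot smooth_on_smo_UNIV smo_intros smo_compose_UNIV[OF \<alpha>s] open_UNIV)
  fix b t :: real and q :: "real^3"
  have "of_int n * (b + 1) + stp t * (\<alpha> (b + 1) - of_int n * (b + 1)) = (of_int n * b + stp t * (\<alpha> b - of_int n * b)) + of_int n"
   unfolding \<alpha>1 by (simp add: algebra_simps)
  then show "rot (of_int n * (b + 1) + stp t * (\<alpha> (b + 1) - of_int n * (b + 1))) q
    = rot (of_int n * b + stp t * (\<alpha> b - of_int n * b)) q"
   by (simp only: rot_add[of _ "of_int n"] rot_int)
 qed auto
 show ?thesis by (rule exI[of _ n]) (rule isot_trans[OF i3 i2])
qed

section \<open>Reflections, and moving the image of the pole\<close>

definition refl :: "real^3 => real^3 => real^3" where
 "refl x v = v - (2 * (x \<bullet> v) / (x \<bullet> x)) *\<^sub>R x"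

lemma refl_refl: "x ~= 0 ==> refl x (refl x v) = v"
 by (simp add: refl_def inner_diff_right algebra_simps)

lemma refl_inner: "x ~= 0 ==> refl x v \<bullet> refl x v = v \<bullet> v"
 by (simp add: refl_def inner_diff_left inner_diff_right inner_commute field_simps power2_eq_square)

lemma refl_S2: "x ~= 0 ==> v \<in> S2 ==> refl x v \<in> S2"
 using refl_inner[of x v] by (simp add: norm_eq_sqrt_inner)

lemma linear_refl: "linear (refl x)"
 by (rule linearI) (simp_all add: refl_def inner_add_right algebra_simps add_divide_distrib)

lemma det_refl: assumes "x ~= 0" shows "det (matrix (refl x)) = -1"
proof -
 define k where "k = 2 / (x \<bullet> x)"
 have k: "k * (x $ 1 * x $ 1 + x $ 2 * x $ 2 + x $ 3 * x $ 3) = 2"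
  using assms unfolding inner3[symmetric] by (simp add: k_def)
 have ax: "axis j (1::real) $ i = (if i = j then 1 else 0)" for i j :: 3 by (simp add: axis_def)
 have m: "matrix (refl x) $ i $ j = (if i = j then 1 else 0) - k * (x $ j) * (x $ i)" for i j
  by (simp add: matrix_def refl_def k_def inner_axis ax)
 have "det (matrix (refl x)) = 1 - k * (x $ 1 * x $ 1 + x $ 2 * x $ 2 + x $ 3 * x $ 3)"
  unfolding det_3 m by (simp add: algebra_simps)
 then show ?thesis using k by simp
qed

lemma SF_refl:
 fixes x :: "'p::euclidean_space => real^3"
 assumes "smo UNIV x" "!!z. x z ~= 0" shows "SF UNIV (%z. refl (x z))"
proof (rule SF_I[where d = "%z. refl (x z)"])
 have "smo UNIV (%y. refl (x (fst y)) (snd y))" unfolding refl_def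
  by (intro smo_intros smo_compose_UNIV[OF assms(1)] open_UNIV) (simp add: assms(2))
 then show "smooth_on (UNIV \<times> S2) (%y. refl (x (fst y)) (snd y))"
   "smooth_on (UNIV \<times> S2) (%y. refl (x (fst y)) (snd y))" by (rule smooth_on_smo_UNIV)+
qed (use assms(2) refl_S2 refl_refl in auto)

text \<open>\<open>refl p\<close> sends p to - p, and the reflection along p + u sends - p to u. The
  product turns p to u in their plane and depends smoothly on p as long as p is not opposite to
  u.\<close>

lemma refl_move:
 assumes "norm p = 1" "norm u = 1" "p + u ~= (0::real^3)" shows "refl (p + u) (refl p p) = u"
proof -
 have pp: "p \<bullet> p = 1" "u \<bullet> u = 1" using assms by (simp_all add: dot_square_norm)
 have s: "(p + u) \<bullet> (p + u) = 2 * (1 + p \<bullet> u)" using pp by (simp add: inner_add_left inner_add_right inner_commute)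
 moreover have "(p + u) \<bullet> (p + u) ~= 0" using assms(3) by simp
 ultimately have nz: "1 + p \<bullet> u ~= 0" by auto
 have 1: "refl p p = - p" using pp by (simp add: refl_def scaleR_2)
 have 2: "2 * ((p + u) \<bullet> - p) / ((p + u) \<bullet> (p + u)) = - 1"
  unfolding s using nz pp by (simp add: inner_add_left inner_add_right inner_commute field_simps)
 show ?thesis unfolding 1 unfolding refl_def 2 by simp
qed

text \<open>The segment from p b to p b + u avoids 0, because p b and u are unit vectors that are
  not opposite; at its start the two reflections cancel.\<close>

lemma isot_move:
 assumes f: "SF UNIV f" and per: "!!b q. q \<in> S2 ==> f (b + 1) q = f b q"
  and p: "smo UNIV p" "!!b. p (b + 1) = p b" "!!b. norm (p b) = 1" and u: "norm u = 1" "!!b. p b + u ~= 0"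
 shows "isot f (%b q. refl (p b + u) (refl (p b) (f b q)))"
  "SF UNIV (%b q. refl (p b + u) (refl (p b) (f b q)))"
proof -
 have pnz: "p b ~= 0" for b using p(3)[of b] by auto
 have nz: "p b + s *\<^sub>R u ~= 0" if "0 <= s" "s <= 1" for b s
 proof
  assume "p b + s *\<^sub>R u = 0"
  then have e: "p b = - (s *\<^sub>R u)" by (simp add: eq_neg_iff_add_eq_0)
  then have "norm (p b) = s" using that u(1) by simp
  then have "s = 1" using p(3) by simp
  then show False using e u(2)[of b] by simp
 qed
 have nzs: "p b + stp t *\<^sub>R u ~= 0" for b t by (rule nz) auto
 let ?F = "%b t q. refl (p b + stp t *\<^sub>R u) (refl (p b) (f b q))"
 have A: "SF UNIV (%x. refl (p (fst x) + stp (snd x) *\<^sub>R u))"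
  by (rule SF_refl) (auto intro!: smo_intros smo_compose_UNIV[OF p(1)] simp: nzs)
 have B: "SF UNIV (%x::real \<times> real. refl (p (fst x)))"
  by (rule SF_refl) (auto intro!: smo_intros smo_compose_UNIV[OF p(1)] pnz)
 have C: "SF UNIV (%x::real \<times> real. f (fst x))"
  by (rule SF_reparam[OF f]) (auto intro: smooth_on_fst)
 have F: "SF UNIV (%x q. refl (p (fst x) + stp (snd x) *\<^sub>R u) (refl (p (fst x)) (f (fst x) q)))"
  by (rule SF_comp[OF A SF_comp[OF B C]])
 show "isot f (%b q. refl (p b + u) (refl (p b) (f b q)))"
  by (rule isotI[of ?F]) (use F per p(2) pnz in \<open>auto simp: refl_refl\<close>)
 from SF_reparam[OF F, of UNIV "%b. (b, 1)"]
 show "SF UNIV (%b q. refl (p b + u) (refl (p b) (f b q)))"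
  by (simp add: smooth_on_smo_UNIV smo_intros)
qed

text \<open>The cone over a smooth curve is the smooth image of a plane and so has measure 0 in
  space, as has the line through the pole; together they cannot contain every direction.\<close>

lemma curve_misses_point:
 assumes p: "smo UNIV (p :: real => real^3)"
 shows "\<exists>c\<in>S2. c ~= npole & (\<forall>b. c ~= p b)"
proof (rule ccontr)
 assume "\<not> ?thesis"
 then have c: "c = npole \<or> c \<in> range p" if "c \<in> S2" for c using that by blast
 define h where "h x = fst x *\<^sub>R p (snd x)" for x :: "real \<times> real"
 have hs: "smo UNIV h" unfolding h_def[abs_def] by (intro smo_intros smo_compose_UNIV[OF p] open_UNIV)
 have "negligible (range h)"
  by (rule negligible_differentiable_image_lowdim)
    (use smo_differentiable[OF hs] in \<open>auto simp: differentiable_on_def intro: differentiable_at_withinI\<close>)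
 moreover have "negligible (range (%s::real. s *\<^sub>R npole))"
  by (rule negligible_differentiable_image_lowdim) (auto intro!: derivative_intros simp: differentiable_on_def)
 ultimately have "negligible (range h \<union> range (%s::real. s *\<^sub>R npole))" by (rule negligible_Un)
 moreover have "y \<in> range h \<union> range (%s::real. s *\<^sub>R npole)" for y :: "real^3"
 proof (cases "y = 0")
  case True
  then have "y = h (0, 0)" by (simp add: h_def)
  then show ?thesis by blast
 next
  case False
  then have "y /\<^sub>R norm y \<in> S2" by simp
  from c[OF this] show ?thesis
  proof
   assume "y /\<^sub>R norm y = npole"
   then have "y = norm y *\<^sub>R npole" using False by (metis norm_eq_zero scaleR_one scaleR_scaleR right_inverse)
   then show ?thesis by blast
  next
   assume "y /\<^sub>R norm y \<in> range p"
   then obtain b where "y /\<^sub>R norm y = p b" by blast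
   then have "y = h (norm y, b)" using False unfolding h_def by (metis fst_conv snd_conv norm_eq_zero scaleR_one scaleR_scaleR right_inverse)
   then show ?thesis by blast
  qed
 qed
 then have "range h \<union> range (%s::real. s *\<^sub>R npole) = UNIV" by blast
 ultimately show False using non_negligible_UNIV by metis
qed

abbreviation rad :: "(real^3 => real^3) => real^3 => real^3" where
 "rad f y \<equiv> norm y *\<^sub>R f (y /\<^sub>R norm y)"

lemma rad_differentiable:
 assumes "smooth_on S2 f" "x \<in> S2" shows "rad f differentiable (at x)"
proof -
 obtain W F where W: "open W" "x \<in> W" "smo W F" "\<forall>y\<in>S2 \<inter> W. F y = f y"
  by (rule smooth_onE[OF assms])
 have x: "norm x = 1" using assms(2) by simp
 define n where "n y = y /\<^sub>R norm y" for y :: "real^3"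
 have ns: "smo (- {0}) n" unfolding n_def[abs_def] by (intro smo_intros) auto
 define V where "V = - {0} \<inter> n -` W"
 have oV: "open V" unfolding V_def by (rule continuous_open_preimage[OF smo_continuous[OF ns] _ W(1)]) auto
 have xV: "x \<in> V" using x W(2) by (auto simp: V_def n_def)
 have "smo V (%y. norm y *\<^sub>R F (n y))"
  by (intro smo_scaleR smo_normI smo_ident smo_compose[OF W(3) smo_subset[OF ns]] oV W(1)) (auto simp: V_def)
 then have "smo V (rad f)"
 proof (rule smo_transform[OF _ oV])
  fix y assume "y \<in> V"
  then have "n y \<in> W" "n y \<in> S2" by (auto simp: V_def n_def)
  then show "rad f y = norm y *\<^sub>R F (n y)" using W(4) by (simp add: n_def)
 qed
 then show ?thesis using smo_differentiable xV by blast
qed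

text \<open>The derivative of the radial extension fixes the pole, by homogeneity, and keeps third
  coordinates, because norms are preserved. So the determinant is that of the tangential block, and
  the factors 2 and 1/2 from the chart and its inverse cancel.\<close>

lemma det_rad_pole:
 assumes g: "smooth_on S2 g" "!!q. q \<in> S2 ==> g q \<in> S2" "g npole = npole"
  and h: "!!w. h (b, w) = ts (-1) (g (sg (-1) w))" and hd: "h differentiable (at (b, 0))"
 shows "det (matrix (frechet_derivative (rad g) (at npole))) = vjac h (b, 0)"
proof -
 define L where "L v = pd v (rad g) npole" for v
 have L: "(rad g has_derivative L) (at npole)" unfolding L_def
  by (rule has_pd[OF rad_differentiable[OF g(1)]]) simp
 have L3: "L v $ 3 = v $ 3" for v
 proof -
  have "((%y. rad g y \<bullet> rad g y) has_derivative (%v. rad g npole \<bullet> L v + L v \<bullet> rad g npole)) (at npole)"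
   by (rule has_derivative_inner[OF L L])
  then have 1: "((%y. y \<bullet> y) has_derivative (%v. rad g npole \<bullet> L v + L v \<bullet> rad g npole)) (at npole)"
  proof (rule has_derivative_transform_within_open[of _ _ _ _ "- {0}"])
   fix y :: "real^3" assume y: "y \<in> - {0}"
   then have "g (y /\<^sub>R norm y) \<in> S2" by (intro g(2)) auto
   then have "g (y /\<^sub>R norm y) \<bullet> g (y /\<^sub>R norm y) = 1" by (simp add: dot_square_norm)
   then show "rad g y \<bullet> rad g y = y \<bullet> y" by (simp add: dot_square_norm power2_eq_square)
  qed (auto simp: axis_eq_0_iff)
  have "((%y::real^3. y \<bullet> y) has_derivative (%v. npole \<bullet> v + v \<bullet> npole)) (at npole)"
   by (auto intro!: derivative_eq_intros)
  then have "(%v. rad g npole \<bullet> L v + L v \<bullet> rad g npole) = (%v. npole \<bullet> v + v \<bullet> npole)"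
   by (rule has_derivative_unique[OF 1])
  from fun_cong[OF this, of v] show ?thesis using g(3) by (simp add: inner3)
 qed
 have LN: "L npole = npole"
 proof -
  have d1: "((%t::real. t *\<^sub>R npole) has_derivative (%s. s *\<^sub>R npole)) (at 1)"
   by (auto intro!: derivative_eq_intros)
  have "((%t::real. rad g (t *\<^sub>R npole)) has_derivative (%s. L (s *\<^sub>R npole))) (at 1)"
   by (rule has_derivative_compose[OF d1]) (use L in simp)
  then have "((%t::real. t *\<^sub>R npole) has_derivative (%s. L (s *\<^sub>R npole))) (at 1)"
   by (rule has_derivative_transform_within_open[of _ _ _ _ "{0<..}"]) (use g(3) in auto)
  from has_derivative_unique[OF d1 this] have "1 *\<^sub>R npole = L (1 *\<^sub>R npole)" by metis
  then show ?thesis by simp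
 qed
 have sgd: "((sg (-1)) has_derivative (%v. pd v (sg (-1)) 0)) (at 0)"
  by (rule smo_has_pd[OF smo_sg[OF smo_ident open_UNIV]]) simp
 have key: "pd v (sg (-1)) 0 $ i = D v" if "((%z. sg (-1) z $ i) has_derivative D) (at 0)" for i D v
  using fun_cong[OF has_derivative_unique[OF bounded_linear.has_derivative[OF bounded_linear_vec_nth sgd] that], of v] .
 have E: "pd v (sg (-1)) 0 = 2 *\<^sub>R (Re v *\<^sub>R axis 1 1 + Im v *\<^sub>R axis 2 1)" for v
 proof -
  have "pd v (sg (-1)) 0 $ 1 = 2 * Re v"
   by (rule key, unfold sg_nth) (auto intro!: derivative_eq_intros)
  moreover have "pd v (sg (-1)) 0 $ 2 = 2 * Im v"
   by (rule key, unfold sg_nth) (auto intro!: derivative_eq_intros)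
  moreover have "pd v (sg (-1)) 0 $ 3 = 0"
   by (rule key, unfold sg_nth) (auto intro!: derivative_eq_intros)
  ultimately show ?thesis unfolding vec3_eq_iff by (simp add: axis_def)
 qed
 have d2: "((%w. rad g (sg (-1) w)) has_derivative (%v. L (pd v (sg (-1)) 0))) (at 0)"
  by (rule has_derivative_compose[OF sgd]) (use L in simp)
 define G where "G v = L (pd v (sg (-1)) 0)" for v
 have d2i: "((%w. rad g (sg (-1) w) $ i) has_derivative (%v. G v $ i)) (at 0)" for i
  unfolding G_def by (rule bounded_linear.has_derivative[OF bounded_linear_vec_nth d2])
 have r0: "rad g (sg (-1) 0) = npole" using g(3) by simp
 have linL: "linear L" using has_derivative_linear[OF L] .
 have G: "G v = 2 *\<^sub>R (Re v *\<^sub>R L (axis 1 1) + Im v *\<^sub>R L (axis 2 1))" for v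
  unfolding G_def E by (simp add: linear_cmul[OF linL] linear_add[OF linL])
 have inv: "((%w. inverse (1 + rad g (sg (-1) w) $ 3)) has_derivative (%v. - (inverse 2 * G v $ 3 * inverse 2))) (at 0)"
 proof -
  have "((%w. 1 + rad g (sg (-1) w) $ 3) has_derivative (%v. 0 + G v $ 3)) (at 0)"
   by (intro has_derivative_add has_derivative_const d2i)
  from Deriv.has_derivative_inverse[OF _ this] show ?thesis using r0 by simp
 qed
 have comp: "((%w. inverse (1 + rad g (sg (-1) w) $ 3) * rad g (sg (-1) w) $ i) has_derivative (%v. G v $ i / 2)) (at 0)"
  if "i = 1 \<or> i = 2" for i
  using has_derivative_mult[OF inv d2i[of i]] r0 that by auto
 have hw: "(%w. h (b, w)) = (%w. Complex (inverse (1 + rad g (sg (-1) w) $ 3) * rad g (sg (-1) w) $ 1)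
   (inverse (1 + rad g (sg (-1) w) $ 3) * rad g (sg (-1) w) $ 2))"
 proof
  fix w
  have "norm (sg (-1) w) = 1" using sg_S2[of "-1" w] by simp
  then show "h (b, w) = Complex (inverse (1 + rad g (sg (-1) w) $ 3) * rad g (sg (-1) w) $ 1)
   (inverse (1 + rad g (sg (-1) w) $ 3) * rad g (sg (-1) w) $ 2)"
   by (simp add: h ts_def complex_eq_iff)
 qed
 have "((%w. h (b, w)) has_derivative (%v. Complex (G v $ 1 / 2) (G v $ 2 / 2))) (at 0)"
  unfolding hw by (intro has_derivative_Complex comp) auto
 from pd_eq[OF this] have pdh: "pd (0, v) h (b, 0) = Complex (G v $ 1 / 2) (G v $ 2 / 2)" for v
  by (simp add: pd_slice[OF hd])
 have m: "matrix L $ i $ j = L (axis j 1) $ i" for i j by (simp add: matrix_def)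
 have "det (matrix L) = L (axis 1 1) $ 1 * L (axis 2 1) $ 2 - L (axis 2 1) $ 1 * L (axis 1 1) $ 2"
  unfolding det_3 m L3 LN by (simp add: axis_def)
 also have "\<dots> = vjac h (b, 0)" unfolding vjac_def pdh G by simp
 finally show ?thesis by (simp add: L_def[abs_def])
qed

text \<open>The image of the pole is brought back to the pole in two moves, as a direct one would
  fail where it is opposite to the pole. Taking u opposite to a point c that the curve misses and
  that differs from the pole keeps both moves away from opposite points. The composite of four
  reflections has determinant 1, so the Jacobian at the pole is positive and
  \<open>winding_at_pole\<close> applies.\<close>

theorem sphere_loop_classification:
 assumes f: "SF UNIV f" and per: "!!b q. q \<in> S2 ==> f (b + 1) q = f b q"
  and op: "!!b. orientation_preserving_S2 (f b)"
 shows "\<exists>n::int. isot (%b. rot (of_int n * b)) f"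
proof -
 define p where "p b = f b npole" for b
 have pS: "p b \<in> S2" for b using SF_D(1)[OF f UNIV_I] by (simp add: p_def)
 have "smooth_on UNIV p" unfolding p_def[abs_def]
  by (rule SF_compose_smooth(1)[OF f]) (auto intro!: smooth_on_smo_UNIV)
 then have ps: "smo UNIV p" by (simp add: smooth_on_open_iff)
 obtain c where c: "c \<in> S2" "c ~= npole" "!!b. c ~= p b" using curve_misses_point[OF ps] by blast
 define u where "u = - c"
 have u: "norm u = 1" "p b + u ~= 0" "u + npole ~= 0" "u ~= 0" for b using c by (auto simp: u_def)
 have pper: "p (b + 1) = p b" for b using per by (simp add: p_def)
 have pn: "norm (p b) = 1" "p b ~= 0" for b using pS[of b] by auto
 define f1 where "f1 b q = refl (p b + u) (refl (p b) (f b q))" for b q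
 have f1: "isot f f1" "SF UNIV f1" unfolding f1_def[abs_def]
  by (rule isot_move[OF f per ps pper pn(1) u(1,2)]; assumption)+
 have f1per: "f1 (b + 1) q = f1 b q" if "q \<in> S2" for b q using per[OF that] pper by (simp add: f1_def)
 have f1N: "f1 b npole = u" for b
  unfolding f1_def using refl_move[OF pn(1) u(1,2)] by (simp add: p_def)
 define f2 where "f2 b q = refl (u + npole) (refl u (f1 b q))" for b q
 have f2: "isot f1 f2" "SF UNIV f2" unfolding f2_def[abs_def]
  by (rule isot_move[OF f1(2) f1per smo_const, of u npole]; use u in simp)+
 have f2per: "f2 (b + 1) q = f2 b q" if "q \<in> S2" for b q using f1per[OF that] by (simp add: f2_def)
 have f2N: "f2 b npole = npole" for b
  unfolding f2_def f1N using refl_move[OF u(1) _ u(3)] by simp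
 define A where "A b v = refl (u + npole) (refl u (refl (p b + u) (refl (p b) v)))" for b v
 have A: "linear (A b)" for b unfolding A_def[abs_def]
  using linear_compose[OF linear_compose[OF linear_compose[OF linear_refl[of "p b"] linear_refl[of "p b + u"]] linear_refl[of u]] linear_refl[of "u + npole"]]
  by (simp add: o_def)
 have detA: "det (matrix (A b)) = 1" for b
 proof -
  have "matrix (A b) = matrix (refl (u + npole)) ** (matrix (refl u) ** (matrix (refl (p b + u)) ** matrix (refl (p b))))"
  proof -
   have "A b = refl (u + npole) \<circ> (refl u \<circ> (refl (p b + u) \<circ> refl (p b)))" by (auto simp: A_def fun_eq_iff)
   then show ?thesis by (simp add: matrix_compose linear_compose linear_refl)
  qed
  then show ?thesis using u pn by (simp add: det_mul det_refl)
 qed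
 have f2A: "f2 b q = A b (f b q)" for b q by (simp add: f2_def f1_def A_def)
 have e1: "(-1)\<^sup>2 = (1::real)" by simp
 have "vjac (pole_chart f2) (b, 0) > 0" for b
 proof -
  have sl: "smooth_on S2 (c b)" if "SF UNIV c" for c :: "real => real^3 => real^3"
   by (rule SF_compose_smooth(1)[OF that, of S2 "%_. b" "%q. q"]) (auto intro!: smooth_on_smo_UNIV smo_intros)
  have W: "(b, 0) \<in> {x. (-1) * f2 (fst x) (sg (-1) (snd x)) $ 3 ~= 1}" by (simp add: f2N)
  have "pole_chart f2 differentiable (at (b, 0))"
  proof (rule smo_differentiable[OF smo_compose[OF smo_ts[of "-1"] smo_subset[OF smo_SF_chart[OF f2(2) e1] subset_UNIV] _ _ open_ts] W])
   show "open {x. (-1) * f2 (fst x) (sg (-1) (snd x)) $ 3 ~= 1}"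
    by (intro open_Collect_neq continuous_intros smo_continuous[OF smo_SF_chart[OF f2(2) e1]])
  qed auto
  then have "vjac (pole_chart f2) (b, 0) = det (matrix (frechet_derivative (rad (f2 b)) (at npole)))"
   by (intro det_rad_pole[symmetric] sl f2) (use SF_D(1)[OF f2(2) UNIV_I] f2N in auto)
  also have "frechet_derivative (rad (f2 b)) (at npole) = A b \<circ> frechet_derivative (rad (f b)) (at npole)"
  proof -
   have "(rad (f b) has_derivative frechet_derivative (rad (f b)) (at npole)) (at npole)"
    by (rule has_pd[OF rad_differentiable[OF sl[OF f]]]) simp
   moreover have "bounded_linear (A b)" using A by (rule linear_conv_bounded_linear[THEN iffD1])
   ultimately have "((%y. A b (rad (f b) y)) has_derivative (%v. A b (frechet_derivative (rad (f b)) (at npole) v))) (at npole)"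
    by (rule bounded_linear.has_derivative[rotated])
   moreover have "(%y. A b (rad (f b) y)) = rad (f2 b)"
    using linear_cmul[OF A] by (auto simp: fun_eq_iff f2A)
   ultimately show ?thesis using frechet_derivative_at by (metis (no_types, lifting) comp_def ext)
  qed
  also have "det (matrix (A b \<circ> frechet_derivative (rad (f b)) (at npole))) =
    det (matrix (frechet_derivative (rad (f b)) (at npole)))"
   using linear_frechet_derivative[OF rad_differentiable[OF sl[OF f]], of npole] A
   by (simp add: matrix_compose det_mul detA)
  also have "\<dots> > 0" using op[of b] unfolding orientation_preserving_S2_def by simp
  finally show ?thesis .
 qed
 from winding_at_pole[OF f2(2) f2per f2N this]
 obtain n :: int where "isot (%b. rot (of_int n * b)) f2" by blast
 then have "isot (%b. rot (of_int n * b)) f"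
  using isot_trans isot_sym f1(1) f2(1) by metis
 then show ?thesis by blast
qed

lemma refl_axis_rot:
 "refl (axis 3 1) (rot t q) = rot t (refl (axis 3 1) q)" "refl (axis 1 1) (rot t q) = rot (- t) (refl (axis 1 1) q)"
proof -
 have r: "refl (axis i 1) v = v - (2 * v $ i) *\<^sub>R axis i 1" for i :: 3 and v
  by (simp add: refl_def inner_axis' inner_axis_axis)
 show "refl (axis 3 1) (rot t q) = rot t (refl (axis 3 1) q)" "refl (axis 1 1) (rot t q) = rot (- t) (refl (axis 1 1) q)"
  unfolding r vec3_eq_iff by (simp_all add: axis_def algebra_simps)
qed

text \<open>The isotopy conjugates the second factor of \<open>rot (k b) \<circ> rot (k b)\<close> by a rotation that
 moves the axis to its negative.\<close>

lemma isot_rot_even: "isot (%b q. q) (%b. rot (of_int (2 * k) * b))"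
proof -
 define u :: "real => real^3" where "u t = cos (stp t * (pi / 2)) *\<^sub>R axis 3 1 + sin (stp t * (pi / 2)) *\<^sub>R axis 1 1" for t
 have us: "smo UNIV u" unfolding u_def[abs_def] by (intro smo_intros smo_compose_UNIV[OF smo_stp] open_UNIV)
 have "u t \<bullet> u t = 1" for t
  by (simp add: u_def inner_add_left inner_add_right inner_axis_axis power2_eq_square[symmetric])
 then have unz: "u t ~= 0" for t using inner_zero_left[of "u t"] zero_neq_one by metis
 have per: "rot (of_int k * (b + 1)) q = rot (of_int k * b) q" "rot (- (of_int k * (b + 1))) q = rot (- (of_int k * b)) q" for b q
  using rot_add[of "of_int k * b" "of_int k" q] rot_add[of "- (of_int k * b)" "of_int (- k)" q] rot_int[of k q] rot_int[of "- k" q]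
  by (simp_all add: algebra_simps)
 have R: "SF UNIV (%p :: real \<times> real. refl (u (snd p)))"
  by (rule SF_refl) (auto intro!: smo_compose_UNIV[OF us] smo_intros simp: unz)
 have K: "SF UNIV (%p :: real \<times> real. rot (of_int k * fst p))" "SF UNIV (%p :: real \<times> real. rot (- (of_int k * fst p)))"
  by (intro SF_rot smooth_on_smo_UNIV smo_intros open_UNIV)+
 \<comment> \<open>For t <= 0 the reflection is along the axis of rotation and commutes with
   rotations, so everything cancels; for t >= 1 it is along a horizontal vector and inverts
   rotations, which doubles the angle.\<close>
 let ?F = "%b t q. rot (of_int k * b) (refl (u t) (rot (- (of_int k * b)) (refl (u t) q)))"
 show ?thesis
 proof (rule isotI[of ?F])
  show "SF UNIV (%p. ?F (fst p) (snd p))" by (rule SF_comp[OF K(1) SF_comp[OF R SF_comp[OF K(2) R]]])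
 next
  fix b t :: real and q :: "real^3"
  show "?F (b + 1) t q = ?F b t q" unfolding per ..
  show "?F b t q = q" if "t <= 0"
  proof -
   have u0: "u t = axis 3 1" using that by (simp add: u_def)
   show ?thesis unfolding u0 refl_axis_rot by (simp add: rot_add[symmetric] refl_refl axis_eq_0_iff)
  qed
  show "?F b t q = rot (of_int (2 * k) * b) q" if "t \<ge> 1"
  proof -
   have u0: "u t = axis 1 1" using that by (simp add: u_def)
   show ?thesis unfolding u0 refl_axis_rot
    by (simp add: rot_add[symmetric] refl_refl axis_eq_0_iff mult_ac)
  qed
 qed
qed

section \<open>Orientation in families, and the parity of loops\<close>

lemma SF_slice: assumes "SF Z c" "z \<in> Z" shows "smooth_on S2 (c z)"
 by (rule SF_compose_smooth(1)[OF assms(1), of S2 "%_. z" "%q. q"]) (use assms(2) in \<open>auto intro!: smooth_on_smo_UNIV smo_intros\<close>)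

abbreviation rdet :: "(real^3 => real^3) => real^3 => real" where
 "rdet f x \<equiv> det (matrix (frechet_derivative (rad f) (at x)))"

lemma rad_cong: assumes "!!q. q \<in> S2 ==> f q = g q" shows "rad f = rad g"
proof
 fix y show "rad f y = rad g y" by (cases "y = 0") (simp_all add: assms)
qed

lemma rdet_id: assumes "!!q. q \<in> S2 ==> f q = q" shows "rdet f x = 1"
proof -
 have "rad f = rad (%q. q)" by (rule rad_cong) (rule assms)
 also have "\<dots> = (%y. y)"
 proof
  fix y :: "real^3" show "rad (%q. q) y = y" by (cases "y = 0") simp_all
 qed
 finally have "rad f = (%y. y)" .
 then show ?thesis by (simp add: matrix_id_mat_1[unfolded id_def])
qed

lemma rdet_comp:
 assumes f: "smooth_on S2 f" and g: "smooth_on S2 g" "!!q. q \<in> S2 ==> g q \<in> S2" and x: "x \<in> S2"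
 shows "rdet (%q. f (g q)) x = rdet f (g x) * rdet g x"
proof -
 have gx: "rad g x = g x" using x by simp
 note df = rad_differentiable[OF f g(2)[OF x]] and dg = rad_differentiable[OF g(1) x]
 have "(rad f has_derivative frechet_derivative (rad f) (at (g x))) (at (rad g x))"
  unfolding gx using df frechet_derivative_works by blast
 moreover have "(rad g has_derivative frechet_derivative (rad g) (at x)) (at x)"
  using dg frechet_derivative_works by blast
 ultimately have "((%y. rad f (rad g y)) has_derivative (%v. frechet_derivative (rad f) (at (g x)) (frechet_derivative (rad g) (at x) v))) (at x)"
  by (rule has_derivative_compose[rotated])
 moreover have "(%y. rad f (rad g y)) = rad (%q. f (g q))"
 proof
  fix y :: "real^3"
  show "rad f (rad g y) = rad (%q. f (g q)) y"
  proof (cases "y = 0")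
   case False
   then have "norm (g (y /\<^sub>R norm y)) = 1" using g(2)[of "y /\<^sub>R norm y"] by simp
   then show ?thesis using False by simp
  qed simp
 qed
 ultimately have "(rad (%q. f (g q)) has_derivative (%v. frechet_derivative (rad f) (at (g x)) (frechet_derivative (rad g) (at x) v))) (at x)"
  by simp
 from frechet_derivative_at[OF this]
 have "frechet_derivative (rad (%q. f (g q))) (at x) = frechet_derivative (rad f) (at (g x)) \<circ> frechet_derivative (rad g) (at x)"
  by (simp add: o_def)
 then show ?thesis
  using linear_frechet_derivative[OF df] linear_frechet_derivative[OF dg] by (simp add: matrix_compose det_mul)
qed

lemma op_cong:
 assumes "orientation_preserving_S2 f" "!!q. q \<in> S2 ==> g q = f q" shows "orientation_preserving_S2 g"
 unfolding orientation_preserving_S2_def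
proof
 fix x :: "real^3" assume x: "x \<in> S2"
 have "rad g = rad f" by (rule rad_cong) (rule assms(2))
 from arg_cong[OF this, of "%F. det (matrix (frechet_derivative F (at x)))"]
 have e: "rdet g x = rdet f x" .
 show "rdet g x > 0" unfolding e using assms(1) x unfolding orientation_preserving_S2_def by blast
qed

lemma op_comp:
 assumes "orientation_preserving_S2 f" "orientation_preserving_S2 g"
  "smooth_on S2 f" "smooth_on S2 g" "!!q. q \<in> S2 ==> g q \<in> S2"
 shows "orientation_preserving_S2 (%q. f (g q))"
 unfolding orientation_preserving_S2_def
proof
 fix x :: "real^3" assume x: "x \<in> S2"
 have "rdet f (g x) > 0" "rdet g x > 0" using assms(1,2) assms(5)[OF x] x unfolding orientation_preserving_S2_def by auto
 then show "rdet (%q. f (g q)) x > 0" using rdet_comp[OF assms(3,4,5) x] by simp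
qed

lemma op_inverse:
 assumes "orientation_preserving_S2 f" "smooth_on S2 f" "smooth_on S2 g" "!!q. q \<in> S2 ==> g q \<in> S2"
  "!!q. q \<in> S2 ==> f (g q) = q"
 shows "orientation_preserving_S2 g"
 unfolding orientation_preserving_S2_def
proof
 fix x :: "real^3" assume x: "x \<in> S2"
 have p: "rdet f (g x) > 0" using assms(1) assms(4)[OF x] unfolding orientation_preserving_S2_def by auto
 have e: "rdet f (g x) * rdet g x = 1"
  using rdet_comp[OF assms(2,3,4) x] rdet_id[of "%q. f (g q)" x] assms(5) by simp
 have "0 < rdet f (g x) * rdet g x" unfolding e by (rule zero_less_one)
 from zero_less_mult_pos[OF this p] show "rdet g x > 0" .
qed

text \<open>The determinant of the radial extension is continuous in the parameter and never 0,
  since the inverse map contributes the reciprocal factor; so its sign is constant along the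
  line.\<close>

lemma op_isotopy:
 fixes c :: "real => real^3 => real^3"
 assumes c: "SF UNIV c" and op: "orientation_preserving_S2 (c s)"
 shows "orientation_preserving_S2 (c t)"
 unfolding orientation_preserving_S2_def
proof
 fix x :: "real^3" assume x: "x \<in> S2"
 have nz: "rdet (c t) x ~= 0" for t
 proof
  assume 0: "rdet (c t) x = 0"
  have "rdet (%q. inv_into S2 (c t) (c t q)) x = rdet (inv_into S2 (c t)) (c t x) * rdet (c t) x"
   by (rule rdet_comp[of "inv_into S2 (c t)" "c t" x, OF SF_slice[OF SF_inv[OF c] UNIV_I] SF_slice[OF c UNIV_I] SF_D(1)[OF c UNIV_I] x])
  moreover have "rdet (%q. inv_into S2 (c t) (c t q)) x = 1"
   by (rule rdet_id) (use SF_D[OF c UNIV_I] in simp)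
  ultimately show False using 0 by simp
 qed
 define T :: "(real \<times> (real^3)) set" where "T = UNIV \<times> - {0}"
 have oT: "open T" unfolding T_def by (intro open_Times) auto
 define G where "G y = norm (snd y) *\<^sub>R c (fst y) (snd y /\<^sub>R norm (snd y))" for y :: "real \<times> (real^3)"
 have nzT: "snd y ~= 0" if "y \<in> T" for y using that by (auto simp: T_def)
 have "smooth_on T (%y. c (fst y) (snd y /\<^sub>R norm (snd y)))"
 proof (rule SF_compose_smooth(1)[OF c])
  have "smo T (%y. snd y /\<^sub>R norm (snd y))" by (intro smo_intros oT) (use nzT in auto)
  then show "smooth_on T (%y. snd y /\<^sub>R norm (snd y))" by (rule smo_imp_smooth_on[OF _ oT])
 qed (use nzT in \<open>auto intro: smooth_on_fst\<close>)
 then have "smo T (%y. c (fst y) (snd y /\<^sub>R norm (snd y)))" by (simp add: smooth_on_open_iff[OF oT])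
 then have Gs: "smo T G" unfolding G_def[abs_def] by (intro smo_intros oT) (use nzT in auto)
 have inT: "(t, x) \<in> T" for t using x by (auto simp: T_def)
 have pdG: "frechet_derivative (rad (c t)) (at x) v = pd (0, v) G (t, x)" for t v
  using pd_slice[OF smo_differentiable[OF Gs inT[of t]], of v] by (simp add: G_def)
 have cont: "continuous_on UNIV (%t. pd (0, v) G (t, x) $ i)" for v i
  by (intro continuous_intros continuous_on_compose2[OF smo_continuous[OF smo_pd[OF Gs]]]) (use inT in auto)
 have m: "matrix (frechet_derivative (rad (c t)) (at x)) $ i $ j = pd (0, axis j 1) G (t, x) $ i" for t i j
  unfolding matrix_def pdG by simp
 have cr: "continuous_on UNIV (%t. rdet (c t) x)"
  unfolding det_3 m by (intro continuous_on_add continuous_on_diff continuous_on_mult cont)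
 have pos: "rdet (c s) x > 0" using op x unfolding orientation_preserving_S2_def by auto
 show "rdet (c t) x > 0"
  by (rule nonzero_connected_pos[of UNIV "%t. rdet (c t) x" s t]) (rule connected_UNIV cr nz UNIV_I pos)+
qed

text \<open>Composition with the contractible loop of \<open>isot_rot_even\<close> changes the
  winding number by an arbitrary even integer.\<close>

theorem sphere_loop_parity:
 assumes f: "SF UNIV f" and per: "!!b q. q \<in> S2 ==> f (b + 1) q = f b q"
  and op: "!!b. orientation_preserving_S2 (f b)"
 shows "\<exists>n::int. \<forall>m. even (m - n) --> isot (%b. rot (of_int m * b)) f"
proof -
 obtain n :: int where n: "isot (%b. rot (of_int n * b)) f" using sphere_loop_classification[OF f per op] by blast
 show ?thesis
 proof (intro exI[of _ n] allI impI)
  fix m :: int assume "even (m - n)"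
  then obtain k where "m - n = 2 * k" by (rule evenE)
  then have mk: "m = n + 2 * k" by simp
  have k: "of_int m * b = of_int n * b + of_int (2 * k) * (b :: real)" for b
   by (simp add: mk algebra_simps)
  have r: "rot (of_int n * (b + 1)) q = rot (of_int n * b) q" for b q
   using rot_add[of "of_int n * b" "of_int n" q] rot_int[of n q] by (simp add: algebra_simps)
  have "isot (%b q. rot (of_int n * b) q) (%b q. rot (of_int n * b) (rot (of_int (2 * k) * b) q))"
   by (rule isot_comp_left[OF isot_rot_even SF_rot]) (auto intro!: smooth_on_smo_UNIV smo_intros r)
  then have "isot (%b. rot (of_int n * b)) (%b. rot (of_int m * b))"
   by (rule isot_cong) (simp_all add: k rot_add)
  then show "isot (%b. rot (of_int m * b)) f" by (intro isot_trans[OF isot_sym n])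
 qed
qed

section \<open>Charts and trivializations\<close>

definition v4 :: "(real \<times> real) \<times> complex => real^4" where
 "v4 x = fst (fst x) *\<^sub>R axis 1 1 + snd (fst x) *\<^sub>R axis 2 1 + Re (snd x) *\<^sub>R axis 3 1 + Im (snd x) *\<^sub>R axis 4 1"

lemma four_neq [simp]: "(4::4) ~= 1" "(4::4) ~= 2" "(4::4) ~= 3" "(3::4) ~= 1" "(3::4) ~= 2" "(3::4) ~= 4"
 "(2::4) ~= 1" "(2::4) ~= 3" "(2::4) ~= 4" "(1::4) ~= 2" "(1::4) ~= 3" "(1::4) ~= 4"
 by simp_all

lemma v4_nth [simp]: "v4 x $ 1 = fst (fst x)" "v4 x $ 2 = snd (fst x)" "v4 x $ 3 = Re (snd x)" "v4 x $ 4 = Im (snd x)"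
 by (simp_all add: v4_def axis_def)

text \<open>The chart is explicit: angles relative to b0 by the principal logarithm, valid on open
  half circles, and stereographic projection from a pole different from q0.\<close>

lemma product_chart:
 fixes b0 :: "complex \<times> complex"
 assumes U: "openin (top_of_set T2) U" and b0: "b0 \<in> U" and q0: "q0 \<in> S2"
 shows "\<exists>V \<psi>. (V, \<psi>) \<in> charts (embedded_manifold (U \<times> S2) :: (_, real^4) manifold) & (b0, q0) \<in> V"
proof -
 obtain G where G: "open G" "U = T2 \<inter> G" using U unfolding openin_open by blast
 define e :: real where "e = (if q0 $ 3 = 1 then -1 else 1)"
 have e: "e\<^sup>2 = 1" "e * q0 $ 3 ~= 1" by (auto simp: e_def)
 define b1 b2 where "b1 = fst b0" and "b2 = snd b0"
 have b: "norm b1 = 1" "norm b2 = 1" using b0 G(2) by (auto simp: b1_def b2_def)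
 define l where "l c z = Im (Ln (z * cnj c))" for c z :: complex
 have cc: "c * cnj c = 1" if "norm c = 1" for c :: complex using complex_norm_square[of c] that by simp
 have l1: "c * cis (l c z) = z" "\<bar>l c z\<bar> < pi / 2" if "norm c = 1" "norm z = 1" "Re (z * cnj c) > 0" for c z
 proof -
  have w: "z * cnj c ~= 0" "norm (z * cnj c) = 1" using that(1,2) by (auto simp: norm_mult)
  have "exp (Ln (z * cnj c)) = z * cnj c" by (rule exp_Ln[OF w(1)])
  moreover have "Re (Ln (z * cnj c)) = 0" unfolding Re_Ln[OF w(1)] w(2) by simp
  ultimately have "cis (l c z) = z * cnj c" unfolding l_def using exp_eq_polar[of "Ln (z * cnj c)"] by (simp only: exp_zero of_real_1 mult_1)
  then have "c * cis (l c z) = (c * cnj c) * z" by (simp only: mult_ac)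
  then show "c * cis (l c z) = z" using cc[OF that(1)] by simp
  show "\<bar>l c z\<bar> < pi / 2" unfolding l_def using Re_Ln_pos_lt[OF w(1)] that(3) by blast
 qed
 have l2: "l c (c * cis t) = t" if "norm c = 1" "\<bar>t\<bar> < pi / 2" for c t
 proof -
  have "c * cis t * cnj c = (c * cnj c) * exp (\<i> * t)" by (simp only: mult_ac cis_conv_exp)
  then have "c * cis t * cnj c = exp (\<i> * t)" using cc[OF that(1)] by simp
  moreover have "- pi < t" "t <= pi" using that(2) pi_gt_zero unfolding abs_less_iff by linarith+
  then have "Ln (exp (\<i> * t)) = \<i> * t" by (intro Ln_exp) simp_all
  ultimately show ?thesis unfolding l_def by simp
 qed
 define H where "H = {x :: (complex \<times> complex) \<times> (real^3). Re (fst (fst x) * cnj b1) > 0 & Re (snd (fst x) * cnj b2) > 0 & e * snd x $ 3 ~= 1}"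
 have oH: "open H" unfolding H_def
  by (intro open_Collect_conj open_Collect_less open_Collect_neq continuous_intros)
 define V where "V = (U \<times> S2) \<inter> H"
 define \<psi> where "\<psi> x = v4 ((l b1 (fst (fst x)), l b2 (snd (fst x))), ts e (snd x))" for x
 define \<theta> where "\<theta> v = ((b1 * cis (v $ 1), b2 * cis (v $ 2)), sg e (Complex (v $ 3) (v $ 4)))" for v :: "real^4"
 define Q where "Q = {v :: real^4. v $ 1 < pi / 2 & - (pi / 2) < v $ 1 & v $ 2 < pi / 2 & - (pi / 2) < v $ 2} \<inter> (%v. fst (\<theta> v)) -` G"
 have tsS: "smo H (%x. ts e (snd x))"
  by (rule smo_compose[OF smo_ts smo_linear[OF bounded_linear_snd smo_ident oH] _ oH open_ts]) (auto simp: H_def)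
 have \<psi>s: "smo H \<psi>" unfolding \<psi>_def[abs_def] l_def v4_def fst_conv snd_conv
  by (intro smo_intros tsS oH) (auto simp: H_def complex_nonpos_Reals_iff)
 have \<theta>s: "smo UNIV \<theta>" unfolding \<theta>_def[abs_def] by (intro smo_intros smo_sg open_UNIV)
 have oQ: "open Q" unfolding Q_def
  by (intro open_Int open_Collect_conj open_Collect_less open_vimage G(1) continuous_intros smo_continuous[OF \<theta>s])
 have \<psi>\<theta>: "\<psi> (\<theta> v) = v" "\<theta> v \<in> V" if "v \<in> Q" for v
 proof -
  have v: "\<bar>v $ 1\<bar> < pi / 2" "\<bar>v $ 2\<bar> < pi / 2" using that by (auto simp: Q_def)
  show "\<psi> (\<theta> v) = v" unfolding vec_eq_iff forall_4 \<psi>_def \<theta>_def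
   using l2 v b ts_sg[OF e(1)] by simp
  have pos: "Re (c * cis t * cnj c) > 0" if "norm c = 1" "\<bar>t\<bar> < pi / 2" for c t
  proof -
   have "c * cis t * cnj c = (c * cnj c) * cis t" by (simp only: mult_ac)
   then have "c * cis t * cnj c = cis t" using cc[OF that(1)] by simp
   moreover have "cos t > 0" using that(2) by (intro cos_gt_zero_pi) auto
   ultimately show ?thesis by (simp only: cis.simps)
  qed
  have "\<theta> v \<in> H" unfolding H_def \<theta>_def mem_Collect_eq fst_conv snd_conv
   by (intro conjI pos b v ts_ne_iff[OF e(1)])
  moreover have "fst (\<theta> v) \<in> T2" using b by (simp add: \<theta>_def norm_mult)
  moreover have "snd (\<theta> v) \<in> S2" using sg_S2[OF e(1)] by (simp add: \<theta>_def del: mem_sphere)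
  moreover have "fst (\<theta> v) \<in> G" using that by (simp add: Q_def)
  ultimately show "\<theta> v \<in> V" by (simp add: V_def G(2) mem_Times_iff)
 qed
 have \<theta>\<psi>: "\<theta> (\<psi> x) = x" "\<psi> x \<in> Q" if "x \<in> V" for x
 proof -
  have x: "x \<in> H" "fst x \<in> U" "snd x \<in> S2" using that by (auto simp: V_def)
  have n: "norm (fst (fst x)) = 1" "norm (snd (fst x)) = 1" using x(2) G(2) by (auto simp: mem_Times_iff)
  have r: "Re (fst (fst x) * cnj b1) > 0" "Re (snd (fst x) * cnj b2) > 0" "e * snd x $ 3 ~= 1" using x(1) by (auto simp: H_def)
  note a = l1[OF b(1) n(1) r(1)] l1[OF b(2) n(2) r(2)]
  have cx: "Complex (Re z) (Im z) = z" for z by (simp add: complex_eq_iff)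
  show 1: "\<theta> (\<psi> x) = x" using a(1,3) sg_ts[OF e(1) x(3) r(3)] by (simp add: \<theta>_def \<psi>_def cx prod_eq_iff)
  have "- (pi / 2) < l b1 (fst (fst x))" "l b1 (fst (fst x)) < pi / 2" "- (pi / 2) < l b2 (snd (fst x))" "l b2 (snd (fst x)) < pi / 2"
   using a(2,4) by linarith+
  then show "\<psi> x \<in> Q" using 1 x(2) G(2) by (simp add: Q_def) (simp add: \<psi>_def)
 qed
 have img: "\<psi> ` V = Q"
 proof
  show "Q \<subseteq> \<psi> ` V" using \<psi>\<theta> by (metis image_eqI subsetI)
 qed (use \<theta>\<psi>(2) in blast)
 have inj: "inj_on \<psi> V" using \<theta>\<psi>(1) by (metis inj_onI)
 have inv: "inv_into V \<psi> v = \<theta> v" if "v \<in> Q" for v using inv_into_f_f[OF inj \<psi>\<theta>(2)[OF that]] \<psi>\<theta>(1)[OF that] by simp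
 have "(V, \<psi>) \<in> charts (embedded_manifold (U \<times> S2) :: (_, real^4) manifold)"
  unfolding embedded_manifold_def manifold.simps mem_Collect_eq prod.case
 proof (intro conjI inj)
  show "openin (top_of_set (U \<times> S2)) V" unfolding V_def using oH by (rule openin_open_Int)
  show "open (\<psi> ` V)" unfolding img by (rule oQ)
  show "smooth_on V \<psi>" by (rule smo_smooth_on[OF \<psi>s oH]) (simp add: V_def)
  show "smooth_on (\<psi> ` V) (inv_into V \<psi>)" unfolding img
   by (rule smooth_on_transform[OF smooth_on_smo_UNIV[OF \<theta>s] inv])
 qed
 moreover have "(b0, q0) \<in> H" unfolding H_def using cc[OF b(1)] cc[OF b(2)] e(2)
  by (simp add: b1_def[symmetric] b2_def[symmetric] del: times_complex.simps)
 then have "(b0, q0) \<in> V" using b0 q0 by (simp add: V_def)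
 ultimately show ?thesis by (intro exI conjI)
qed

lemma chart_facts:
 assumes M: "smooth_manifold M" and W: "(W, ph) \<in> charts M"
 shows "openin (mtop M) W" "W \<subseteq> points M" "open (ph ` W)" "inj_on ph W"
  "openin (mtop M) A ==> A \<subseteq> W ==> open (ph ` A)"
  "open N ==> openin (mtop M) {p \<in> W. ph p \<in> N}"
proof -
 have a: "openin (mtop M) W" "open (ph ` W)" "homeomorphic_map (subtopology (mtop M) W) (top_of_set (ph ` W)) ph"
  using M W unfolding smooth_manifold_def by auto
 show "openin (mtop M) W" "open (ph ` W)" by (fact a)+
 show WM: "W \<subseteq> points M" by (rule openin_subset[OF a(1)])
 then have t: "topspace (subtopology (mtop M) W) = W" by (auto simp: topspace_subtopology)
 show "inj_on ph W" using homeomorphic_imp_injective_map[OF a(3)] unfolding t .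
 show "open (ph ` A)" if A: "openin (mtop M) A" "A \<subseteq> W"
 proof -
  have "openin (subtopology (mtop M) W) A" using A by (simp add: openin_open_subtopology[OF a(1)])
  then have "openin (top_of_set (ph ` W)) (ph ` A)" using homeomorphic_imp_open_map[OF a(3)] unfolding open_map_def by simp
  then show ?thesis using a(2) openin_open_eq by blast
 qed
 show "openin (mtop M) {p \<in> W. ph p \<in> N}" if "open N"
 proof -
  have "openin (top_of_set (ph ` W)) (ph ` W \<inter> N)" using that by (rule openin_open_Int)
  from openin_continuous_map_preimage[OF homeomorphic_imp_continuous_map[OF a(3)] this]
  have "openin (subtopology (mtop M) W) {p \<in> W. ph p \<in> ph ` W \<inter> N}" unfolding t .
  moreover have "{p \<in> W. ph p \<in> ph ` W \<inter> N} = {p \<in> W. ph p \<in> N}" by auto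
  ultimately show ?thesis by (simp add: openin_open_subtopology[OF a(1)])
 qed
qed

text \<open>Smoothness in charts of U x S2 becomes smoothness of Ph and its inverse as maps of the
  ambient space, by composing a chart of the product with its own inverse;
  \<open>product_chart\<close> ensures that there are enough charts.\<close>

lemma trivialization_smooth:
 fixes Ph :: "'a => (complex \<times> complex) \<times> (real^3)"
 assumes M: "smooth_manifold M" and Q: "openin (mtop M) Q" and U: "openin (top_of_set T2) U"
  and D: "diffeomorphism (open_submanifold M Q) (embedded_manifold (U \<times> S2) :: (_, real^4) manifold) Ph"
 shows "bij_betw Ph Q (U \<times> S2)"
  "continuous_map (subtopology (mtop M) Q) (top_of_set (U \<times> S2)) Ph"
  "continuous_map (top_of_set (U \<times> S2)) (mtop M) (inv_into Q Ph)"
  "(W, ph) \<in> charts M ==> smooth_on {x \<in> U \<times> S2. inv_into Q Ph x \<in> W} (%x. ph (inv_into Q Ph x))"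
  "(W, ph) \<in> charts M ==> smooth_on (ph ` (W \<inter> Q)) (%y. Ph (inv_into W ph y))"
proof -
 let ?E = "embedded_manifold (U \<times> S2) :: (_, real^4) manifold"
 have pM: "points (open_submanifold M Q) = Q" using openin_subset[OF Q] by (auto simp: open_submanifold_def topspace_subtopology)
 have pE: "points ?E = U \<times> S2" by (simp add: embedded_manifold_def)
 have tE: "mtop ?E = top_of_set (U \<times> S2)" "mtop (open_submanifold M Q) = subtopology (mtop M) Q" by (simp_all add: embedded_manifold_def open_submanifold_def)
 show bij: "bij_betw Ph Q (U \<times> S2)" using D unfolding diffeomorphism_def pM pE by blast
 have s: "smooth_map (open_submanifold M Q) ?E Ph" "smooth_map ?E (open_submanifold M Q) (inv_into Q Ph)"
  using D unfolding diffeomorphism_def pM by blast+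
 show c: "continuous_map (subtopology (mtop M) Q) (top_of_set (U \<times> S2)) Ph"
  using s(1) unfolding smooth_map_def tE by blast
 have "continuous_map (top_of_set (U \<times> S2)) (subtopology (mtop M) Q) (inv_into Q Ph)"
  using s(2) unfolding smooth_map_def tE by blast
 then show "continuous_map (top_of_set (U \<times> S2)) (mtop M) (inv_into Q Ph)" by (rule continuous_map_into_fulltopology)
 have chE: "openin (top_of_set (U \<times> S2)) V" "inj_on \<psi> V" "smooth_on V \<psi>" "smooth_on (\<psi> ` V) (inv_into V \<psi>)"
  if "(V, \<psi>) \<in> charts ?E" for V and \<psi> :: "_ => real^4"
  using that by (simp_all add: embedded_manifold_def)
 have inQ: "inv_into Q Ph x \<in> Q" if "x \<in> U \<times> S2" for x using bij_betw_inv_into[OF bij] that bij_betwE by blast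
 show "smooth_on {x \<in> U \<times> S2. inv_into Q Ph x \<in> W} (%x. ph (inv_into Q Ph x))" if W: "(W, ph) \<in> charts M"
 proof (rule smooth_on_local)
  fix x assume x: "x \<in> {x \<in> U \<times> S2. inv_into Q Ph x \<in> W}"
  then obtain V \<psi> where V: "(V, \<psi>) \<in> charts ?E" "x \<in> V"
   using product_chart[OF U, of "fst x" "snd x"] by (auto simp: mem_Times_iff)
  obtain G where G: "open G" "V = (U \<times> S2) \<inter> G" using chE(1)[OF V(1)] unfolding openin_open by blast
  have WQ: "(W \<inter> Q, ph) \<in> charts (open_submanifold M Q)" using W by (force simp: open_submanifold_def)
  have a: "smooth_on (\<psi> ` {p \<in> V. inv_into Q Ph p \<in> W \<inter> Q}) (ph \<circ> inv_into Q Ph \<circ> inv_into V \<psi>)"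
   using s(2) V(1) WQ unfolding smooth_map_def by blast
  show "\<exists>G. open G & x \<in> G & smooth_on ({x \<in> U \<times> S2. inv_into Q Ph x \<in> W} \<inter> G) (%x. ph (inv_into Q Ph x))"
  proof (intro exI[of _ G] conjI)
   show "smooth_on ({x \<in> U \<times> S2. inv_into Q Ph x \<in> W} \<inter> G) (%x. ph (inv_into Q Ph x))"
   proof (rule smooth_on_transform[OF smooth_on_compose[OF a smooth_on_subset[OF chE(3)[OF V(1)]]]])
    show "\<psi> ` ({x \<in> U \<times> S2. inv_into Q Ph x \<in> W} \<inter> G) \<subseteq> \<psi> ` {p \<in> V. inv_into Q Ph p \<in> W \<inter> Q}"
     using inQ G(2) by (intro image_mono) auto
    fix y assume "y \<in> {x \<in> U \<times> S2. inv_into Q Ph x \<in> W} \<inter> G"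
    then have "inv_into V \<psi> (\<psi> y) = y" using G(2) by (intro inv_into_f_f chE(2)[OF V(1)]) auto
    then show "ph (inv_into Q Ph y) = (ph \<circ> inv_into Q Ph \<circ> inv_into V \<psi>) (\<psi> y)" by simp
   qed (use G(2) in auto)
  qed (use G V(2) in auto)
 qed
 show "smooth_on (ph ` (W \<inter> Q)) (%y. Ph (inv_into W ph y))" if W: "(W, ph) \<in> charts M"
 proof (rule smooth_on_local)
  note cW = chart_facts[OF M W]
  fix y assume "y \<in> ph ` (W \<inter> Q)"
  then obtain p where p: "y = ph p" "p \<in> W" "p \<in> Q" by blast
  then have "Ph p \<in> U \<times> S2" using bij bij_betwE by blast
  then obtain V \<psi> where V: "(V, \<psi>) \<in> charts ?E" "Ph p \<in> V"
   using product_chart[OF U, of "fst (Ph p)" "snd (Ph p)"] by (auto simp: mem_Times_iff)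
  define A where "A = {p \<in> W \<inter> Q. Ph p \<in> V}"
  have tQ: "topspace (subtopology (mtop M) Q) = Q" using openin_subset[OF Q] by (auto simp: topspace_subtopology)
  have "openin (subtopology (mtop M) Q) {p \<in> Q. Ph p \<in> V}"
   using openin_continuous_map_preimage[OF c chE(1)[OF V(1)]] unfolding tQ .
  then have "openin (mtop M) {p \<in> Q. Ph p \<in> V}" by (simp add: openin_open_subtopology[OF Q])
  moreover have "A = W \<inter> {p \<in> Q. Ph p \<in> V}" by (auto simp: A_def)
  ultimately have "openin (mtop M) A" using cW(1) by auto
  then have oA: "open (ph ` A)" by (rule cW(5)) (auto simp: A_def)
  have WQ: "(W \<inter> Q, ph) \<in> charts (open_submanifold M Q)" using W by (force simp: open_submanifold_def)
  have a: "smooth_on (ph ` A) (\<psi> \<circ> Ph \<circ> inv_into (W \<inter> Q) ph)"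
   using s(1) V(1) WQ unfolding smooth_map_def A_def by blast
  have i: "inv_into (W \<inter> Q) ph (ph r) = r" "inv_into W ph (ph r) = r" if "r \<in> A" for r
   using that cW(4) by (auto simp: A_def intro!: inv_into_f_f intro: inj_on_subset)
  show "\<exists>G. open G & y \<in> G & smooth_on (ph ` (W \<inter> Q) \<inter> G) (%y. Ph (inv_into W ph y))"
  proof (intro exI[of _ "ph ` A"] conjI oA)
   have "smooth_on (ph ` A) (%y. Ph (inv_into W ph y))"
   proof (rule smooth_on_transform[OF smooth_on_compose[OF chE(4)[OF V(1)] a]])
    show "(\<psi> \<circ> Ph \<circ> inv_into (W \<inter> Q) ph) ` ph ` A \<subseteq> \<psi> ` V" using i by (auto simp: A_def)
    fix y assume "y \<in> ph ` A"
    then obtain r where r: "y = ph r" "r \<in> A" by blast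
    then show "Ph (inv_into W ph y) = inv_into V \<psi> ((\<psi> \<circ> Ph \<circ> inv_into (W \<inter> Q) ph) y)"
     using i inv_into_f_f[OF chE(2)[OF V(1)], of "Ph r"] by (simp add: A_def)
   qed
   then show "smooth_on (ph ` (W \<inter> Q) \<inter> ph ` A) (%y. Ph (inv_into W ph y))" by (rule smooth_on_subset) auto
   show "y \<in> ph ` A" using p V(2) by (auto simp: A_def)
  qed
 qed
qed

section \<open>Trivializing the pulled back bundle\<close>

text \<open>The data shared by both cases of the theorem: an oriented atlas of local
  trivializations. For a product one global trivialization is an atlas.\<close>

locale sphere_bundle =
 fixes M :: "('a, real^4) manifold" and \<pi> :: "'a => complex \<times> complex"
  and \<T> :: "((complex \<times> complex) set \<times> ('a => (complex \<times> complex) \<times> (real^3))) set"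
 assumes M: "smooth_manifold M"
  and base: "p \<in> points M ==> \<pi> p \<in> T2"
  and over_open: "(U, Ph) \<in> \<T> ==> openin (mtop M) (over M \<pi> U)"
  and triv: "(U, Ph) \<in> \<T> ==> local_trivialization M \<pi> U Ph"
  and cover: "(\<Union>(U, Ph)\<in>\<T>. U) = T2"
  and transition_op: "(U, Ph) \<in> \<T> ==> (V, \<Psi>) \<in> \<T> ==> b \<in> U ==> b \<in> V ==>
   orientation_preserving_S2 (%q. snd (\<Psi> (inv_into (over M \<pi> U) Ph (b, q))))"
begin

text \<open>\<open>good E W Th\<close>: \<open>Th\<close> trivialises the pullback of the bundle under \<open>E\<close> over \<open>W\<close>, smoothly and
 compatibly with the orientations.\<close>

definition good :: "('p::euclidean_space => complex \<times> complex) => 'p set => ('p => real^3 => 'a) => bool" where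
 "good E W Th \<longleftrightarrow> (\<forall>z\<in>W. \<forall>q\<in>S2. Th z q \<in> points M & \<pi> (Th z q) = E z) &
   (\<forall>(U, Ph)\<in>\<T>. SF {z \<in> W. E z \<in> U} (%z q. snd (Ph (Th z q))) &
    (\<forall>z\<in>W. E z \<in> U --> orientation_preserving_S2 (%q. snd (Ph (Th z q)))))"

lemma goodD:
 assumes "good E W Th"
 shows "z \<in> W ==> q \<in> S2 ==> Th z q \<in> points M" "z \<in> W ==> q \<in> S2 ==> \<pi> (Th z q) = E z"
  "(U, Ph) \<in> \<T> ==> SF {z \<in> W. E z \<in> U} (%z q. snd (Ph (Th z q)))"
  "(U, Ph) \<in> \<T> ==> z \<in> W ==> E z \<in> U ==> orientation_preserving_S2 (%q. snd (Ph (Th z q)))"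
 using assms unfolding good_def by auto

lemma goodI:
 assumes "!!z q. z \<in> W ==> q \<in> S2 ==> Th z q \<in> points M" "!!z q. z \<in> W ==> q \<in> S2 ==> \<pi> (Th z q) = E z"
  "!!U Ph. (U, Ph) \<in> \<T> ==> SF {z \<in> W. E z \<in> U} (%z q. snd (Ph (Th z q)))"
  "!!U Ph z. (U, Ph) \<in> \<T> ==> z \<in> W ==> E z \<in> U ==> orientation_preserving_S2 (%q. snd (Ph (Th z q)))"
 shows "good E W Th"
 using assms unfolding good_def by auto

lemma triv_facts:
 assumes "(U, Ph) \<in> \<T>"
 shows "openin (top_of_set T2) U" "p \<in> over M \<pi> U ==> Ph p = (\<pi> p, snd (Ph p))"
  "diffeomorphism (open_submanifold M (over M \<pi> U)) (embedded_manifold (U \<times> S2) :: (_, real^4) manifold) Ph"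
 using triv[OF assms] unfolding local_trivialization_def by (auto simp: prod_eq_iff)

lemmas triv_smooth = trivialization_smooth[OF M over_open triv_facts(1) triv_facts(3)]

lemma triv_inv:
 assumes t: "(U, Ph) \<in> \<T>" and x: "b \<in> U" "q \<in> S2"
 shows "inv_into (over M \<pi> U) Ph (b, q) \<in> over M \<pi> U" "Ph (inv_into (over M \<pi> U) Ph (b, q)) = (b, q)"
  "\<pi> (inv_into (over M \<pi> U) Ph (b, q)) = b"
proof -
 note bij = triv_smooth(1)[OF t t t]
 show 1: "inv_into (over M \<pi> U) Ph (b, q) \<in> over M \<pi> U" using bij_betwE[OF bij_betw_inv_into[OF bij]] x by blast
 show 2: "Ph (inv_into (over M \<pi> U) Ph (b, q)) = (b, q)" using bij_betw_inv_into_right[OF bij] x by blast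
 show "\<pi> (inv_into (over M \<pi> U) Ph (b, q)) = b" using triv_facts(2)[OF t 1] 2 by simp
qed

lemma triv_inj:
 assumes t: "(U, Ph) \<in> \<T>" and "p \<in> points M" "p' \<in> points M" "\<pi> p = \<pi> p'" "\<pi> p \<in> U" "snd (Ph p) = snd (Ph p')"
 shows "p = p'"
proof -
 have o: "p \<in> over M \<pi> U" "p' \<in> over M \<pi> U" using assms by (auto simp: over_def)
 have "Ph p = Ph p'" using triv_facts(2)[OF t o(1)] triv_facts(2)[OF t o(2)] assms(4,6) by metis
 then show ?thesis using triv_smooth(1)[OF t t t] o by (meson bij_betw_imp_inj_on inj_onD)
qed

lemma chart_at: assumes "b \<in> T2" obtains U Ph where "(U, Ph) \<in> \<T>" "b \<in> U"
 using assms cover by blast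

lemma good_base: assumes "good E W Th" "z \<in> W" shows "E z \<in> T2"
 using goodD(1,2)[OF assms npole_S2(1)] base by metis

lemma good_fibre:
 assumes g: "good E W Th" and z: "z \<in> W" shows "bij_betw (Th z) S2 {p \<in> points M. \<pi> p = E z}"
proof -
 obtain U Ph where U: "(U, Ph) \<in> \<T>" "E z \<in> U" by (rule chart_at[OF good_base[OF g z]])
 note S = SF_D[OF goodD(3)[OF g U(1)], of z]
 show ?thesis unfolding bij_betw_def
 proof
  show "inj_on (Th z) S2" using S(5) z U(2) by (auto simp: inj_on_def)
  show "Th z ` S2 = {p \<in> points M. \<pi> p = E z}"
  proof
   show "{p \<in> points M. \<pi> p = E z} \<subseteq> Th z ` S2"
   proof
    fix p assume p: "p \<in> {p \<in> points M. \<pi> p = E z}"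
    then have po: "p \<in> over M \<pi> U" using U(2) by (simp add: over_def)
    then have "Ph p \<in> U \<times> S2" using triv_smooth(1)[OF U(1) U(1) U(1)] bij_betwE by blast
    then have s: "snd (Ph p) \<in> S2" by (simp add: mem_Times_iff)
    define q where "q = inv_into S2 (%q. snd (Ph (Th z q))) (snd (Ph p))"
    have q: "q \<in> S2" "snd (Ph (Th z q)) = snd (Ph p)" unfolding q_def using S(2,3)[OF _ s] z U(2) by auto
    have "p = Th z q" by (rule triv_inj[OF U(1)]) (use p q U goodD(1,2)[OF g z q(1)] in auto)
    then show "p \<in> Th z ` S2" using q(1) by blast
   qed
  qed (use goodD(1,2)[OF g z] in auto)
 qed
qed

lemma good_subset: "good E W Th ==> V \<subseteq> W ==> good E V Th"
proof (rule goodI)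
 assume g: "good E W Th" and V: "V \<subseteq> W"
 fix U Ph assume t: "(U, Ph) \<in> \<T>"
 show "SF {z \<in> V. E z \<in> U} (%z q. snd (Ph (Th z q)))"
  by (rule SF_subset[OF goodD(3)[OF g t]]) (use V in auto)
 show "orientation_preserving_S2 (%q. snd (Ph (Th z q)))" if "z \<in> V" "E z \<in> U" for z
  by (rule goodD(4)[OF g t _ that(2)]) (use V that in blast)
qed (use goodD in blast)+

lemma good_cong:
 assumes g: "good E W Th" and eq: "!!z q. z \<in> W ==> q \<in> S2 ==> Th' z q = Th z q" and E: "!!z. z \<in> W ==> E' z = E z"
 shows "good E' W Th'"
proof (rule goodI)
 fix U Ph assume t: "(U, Ph) \<in> \<T>"
 have "{z \<in> W. E' z \<in> U} = {z \<in> W. E z \<in> U}" using E by auto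
 then show "SF {z \<in> W. E' z \<in> U} (%z q. snd (Ph (Th' z q)))"
  using SF_cong[OF goodD(3)[OF g t], of "%z q. snd (Ph (Th' z q))"] eq by simp
 show "orientation_preserving_S2 (%q. snd (Ph (Th' z q)))" if "z \<in> W" "E' z \<in> U" for z
  by (rule op_cong[OF goodD(4)[OF g t that(1)]]) (use that E eq in auto)
qed (use goodD(1,2)[OF g] eq E in auto)

lemma good_local:
 assumes "!!z. z \<in> W ==> \<exists>N. open N & z \<in> N & good E (W \<inter> N) Th" shows "good E W Th"
proof (rule goodI)
 fix U Ph assume t: "(U, Ph) \<in> \<T>"
 show "SF {z \<in> W. E z \<in> U} (%z q. snd (Ph (Th z q)))"
 proof (rule SF_local)
  fix z assume "z \<in> {z \<in> W. E z \<in> U}"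
  then obtain N where N: "open N" "z \<in> N" "good E (W \<inter> N) Th" using assms by blast
  have "{z \<in> W. E z \<in> U} \<inter> N = {z \<in> W \<inter> N. E z \<in> U}" by auto
  then show "\<exists>N. open N & z \<in> N & SF ({z \<in> W. E z \<in> U} \<inter> N) (%z q. snd (Ph (Th z q)))"
   using N goodD(3)[OF N(3) t] by (intro exI[of _ N]) simp
 qed
 fix z assume z: "z \<in> W" "E z \<in> U"
 then obtain N where N: "z \<in> N" "good E (W \<inter> N) Th" using assms by blast
 show "orientation_preserving_S2 (%q. snd (Ph (Th z q)))" by (rule goodD(4)[OF N(2) t]) (use z N in auto)
next
 fix z and q :: "real^3" assume z: "z \<in> W" "q \<in> S2"
 then obtain N where N: "z \<in> N" "good E (W \<inter> N) Th" using assms by blast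
 show "Th z q \<in> points M" "\<pi> (Th z q) = E z" using goodD(1,2)[OF N(2)] z N by auto
qed

lemma good_comp:
 assumes g: "good E W Th" and d: "SF W d" "!!z. z \<in> W ==> orientation_preserving_S2 (d z)"
 shows "good E W (%z q. Th z (d z q))"
proof (rule goodI)
 fix U Ph assume t: "(U, Ph) \<in> \<T>"
 have d': "SF {z \<in> W. E z \<in> U} d" by (rule SF_subset[OF d(1)]) auto
 show "SF {z \<in> W. E z \<in> U} (%z q. snd (Ph (Th z (d z q))))" by (rule SF_comp[OF goodD(3)[OF g t] d'])
 fix z assume z: "z \<in> W" "E z \<in> U"
 then have z': "z \<in> {z \<in> W. E z \<in> U}" by simp
 show "orientation_preserving_S2 (%q. snd (Ph (Th z (d z q))))"
  by (rule op_comp[OF goodD(4)[OF g t z] d(2)[OF z(1)] SF_slice[OF goodD(3)[OF g t] z'] SF_slice[OF d' z'] SF_D(1)[OF d' z']])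
qed (use goodD(1,2)[OF g] SF_D(1)[OF d(1)] in auto)

lemma good_reparam:
 assumes g: "good E W Th" and f: "smooth_on V f" "f ` V \<subseteq> W"
 shows "good (%z. E (f z)) V (%z. Th (f z))"
proof (rule goodI)
 fix U Ph assume t: "(U, Ph) \<in> \<T>"
 show "SF {z \<in> V. E (f z) \<in> U} (%z q. snd (Ph (Th (f z) q)))"
  by (rule SF_reparam[OF goodD(3)[OF g t] smooth_on_subset[OF f(1)]]) (use f(2) in auto)
qed (use goodD[OF g] f(2) in blast)+

section \<open>Comparing, gluing and extending trivializations\<close>

definition quot :: "('p => real^3 => 'a) => ('p => real^3 => 'a) => 'p => real^3 => real^3" where
 "quot Th Th' z q = inv_into S2 (Th z) (Th' z q)"

lemma quot:
 assumes g: "good E W Th" "good E W Th'" and z: "z \<in> W"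
 shows "q \<in> S2 ==> quot Th Th' z q \<in> S2" "q \<in> S2 ==> Th z (quot Th Th' z q) = Th' z q"
  "orientation_preserving_S2 (quot Th Th' z)"
proof -
 note b = good_fibre[OF g(1) z]
 show 1: "quot Th Th' z q \<in> S2" "Th z (quot Th Th' z q) = Th' z q" if "q \<in> S2" for q
  unfolding quot_def using bij_betwE[OF bij_betw_inv_into[OF b]] bij_betw_inv_into_right[OF b] goodD(1,2)[OF g(2) z that] by auto
 obtain U Ph where U: "(U, Ph) \<in> \<T>" "E z \<in> U" by (rule chart_at[OF good_base[OF g(1) z]])
 have z': "z \<in> {z \<in> W. E z \<in> U}" using z U by simp
 let ?a = "%z q. snd (Ph (Th z q))" and ?a' = "%z q. snd (Ph (Th' z q))"
 note a = goodD(3)[OF g(1) U(1)] and a' = goodD(3)[OF g(2) U(1)]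
 have "orientation_preserving_S2 (%q. inv_into S2 (?a z) (?a' z q))"
  by (rule op_comp[OF op_inverse[OF goodD(4)[OF g(1) U(1) z U(2)] SF_slice[OF a z'] SF_slice[OF SF_inv[OF a] z'] SF_D(2,3)[OF a z']]
    goodD(4)[OF g(2) U(1) z U(2)] SF_slice[OF SF_inv[OF a] z'] SF_slice[OF a' z'] SF_D(1)[OF a' z']])
 then show "orientation_preserving_S2 (quot Th Th' z)"
 proof (rule op_cong)
  fix q :: "real^3" assume q: "q \<in> S2"
  show "quot Th Th' z q = inv_into S2 (?a z) (?a' z q)"
   using SF_D(4)[OF a z' 1(1)[OF q]] 1(2)[OF q] by simp
 qed
qed

text \<open>Locally both trivializations can be read in one bundle chart, where the comparison is a
  smooth family followed by the inverse of another one.\<close>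

lemma quot_SF:
 assumes g: "good E W Th" "good E W Th'" and E: "continuous_on W E"
 shows "SF W (quot Th Th')"
proof (rule SF_local)
 fix z assume z: "z \<in> W"
 obtain U Ph where U: "(U, Ph) \<in> \<T>" "E z \<in> U" by (rule chart_at[OF good_base[OF g(1) z]])
 obtain G where G: "open G" "U = T2 \<inter> G" using triv_facts(1)[OF U(1)] unfolding openin_open by blast
 obtain N where N: "open N" "N \<inter> W = E -` G \<inter> W" using E G(1) unfolding continuous_on_open_invariant by blast
 have e: "W \<inter> N = {z \<in> W. E z \<in> U}" using N(2) G(2) good_base[OF g(1)] by blast
 note a = goodD(3)[OF g(1) U(1)] and a' = goodD(3)[OF g(2) U(1)]
 have "SF (W \<inter> N) (quot Th Th')"
 proof (rule SF_cong)
  show "SF (W \<inter> N) (%z q. inv_into S2 (%q. snd (Ph (Th z q))) (snd (Ph (Th' z q))))"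
   unfolding e by (rule SF_comp[OF SF_inv[OF a] a'])
  fix z and q :: "real^3" assume z: "z \<in> W \<inter> N" and q: "q \<in> S2"
  have z': "z \<in> {z \<in> W. E z \<in> U}" "z \<in> W" using z e by auto
  show "quot Th Th' z q = inv_into S2 (%q. snd (Ph (Th z q))) (snd (Ph (Th' z q)))"
   using SF_D(4)[OF a z'(1) quot(1)[OF g z'(2) q]] quot(2)[OF g z'(2) q] by simp
 qed
 then show "\<exists>N. open N & z \<in> N & SF (W \<inter> N) (quot Th Th')" using N(1) z e U(2) by (intro exI[of _ N]) auto
qed

lemma transition_smooth:
 assumes t: "(U, Ph) \<in> \<T>" "(V, \<Psi>) \<in> \<T>"
 shows "smooth_on ((U \<inter> V) \<times> S2) (%x. \<Psi> (inv_into (over M \<pi> U) Ph x))"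
proof (rule smooth_on_local)
 let ?i = "inv_into (over M \<pi> U) Ph"
 fix x assume x: "x \<in> (U \<inter> V) \<times> S2"
 have iM: "?i y \<in> over M \<pi> U" "?i y \<in> over M \<pi> V" if "y \<in> (U \<inter> V) \<times> S2" for y
  using triv_inv[OF t(1), of "fst y" "snd y"] that by (auto simp: mem_Times_iff over_def)
 obtain C ph where C: "(C, ph) \<in> charts M" "?i x \<in> C"
  using M iM(1)[OF x] unfolding smooth_manifold_def over_def by blast
 note cC = chart_facts[OF M C(1)]
 have "openin (top_of_set (U \<times> S2)) {y \<in> U \<times> S2. ?i y \<in> C}"
  using openin_continuous_map_preimage[OF triv_smooth(3)[OF t(1) t(1) t(1)] cC(1)] by simp
 then obtain G where G: "open G" "{y \<in> U \<times> S2. ?i y \<in> C} = (U \<times> S2) \<inter> G" unfolding openin_open by blast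
 show "\<exists>G. open G & x \<in> G & smooth_on ((U \<inter> V) \<times> S2 \<inter> G) (%x. \<Psi> (?i x))"
 proof (intro exI[of _ G] conjI G(1))
  show "x \<in> G" using G(2) x C(2) by blast
  have sub: "(U \<inter> V) \<times> S2 \<inter> G \<subseteq> {y \<in> U \<times> S2. ?i y \<in> C}" unfolding G(2) by auto
  show "smooth_on ((U \<inter> V) \<times> S2 \<inter> G) (%x. \<Psi> (?i x))"
  proof (rule smooth_on_transform[OF smooth_on_compose[OF triv_smooth(5)[OF t(2) t(2) t(2) C(1)] smooth_on_subset[OF triv_smooth(4)[OF t(1) t(1) t(1) C(1)] sub]]])
   show "(%x. ph (?i x)) ` ((U \<inter> V) \<times> S2 \<inter> G) \<subseteq> ph ` (C \<inter> over M \<pi> V)" using sub iM by blast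
   fix y assume "y \<in> (U \<inter> V) \<times> S2 \<inter> G"
   then have "?i y \<in> C" using sub by blast
   then show "\<Psi> (?i y) = \<Psi> (inv_into C ph (ph (?i y)))" by (simp add: inv_into_f_f[OF cC(4)])
  qed
 qed
qed

text \<open>A bundle chart is pulled back. In any other chart it reads as a transition function,
  whose inverse is the transition function with the two charts exchanged.\<close>

lemma good_exists_local:
 assumes E: "smo UNIV E" "!!z. E z \<in> T2"
 shows "\<exists>N Th. open N & z0 \<in> N & good E N Th"
proof -
 obtain U Ph where t: "(U, Ph) \<in> \<T>" "E z0 \<in> U" by (rule chart_at[OF E(2)])
 obtain G where G: "open G" "U = T2 \<inter> G" using triv_facts(1)[OF t(1)] unfolding openin_open by blast
 define N where "N = E -` G"
 have N: "z \<in> N \<longleftrightarrow> E z \<in> U" for z using E(2) G(2) by (auto simp: N_def)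
 let ?i = "inv_into (over M \<pi> U) Ph"
 have "good E N (%z q. ?i (E z, q))"
 proof (rule goodI)
  fix z and q :: "real^3" assume "z \<in> N" "q \<in> S2"
  then show "?i (E z, q) \<in> points M" "\<pi> (?i (E z, q)) = E z"
   using triv_inv[OF t(1)] N by (auto simp: over_def)
 next
  fix V \<Psi> assume s: "(V, \<Psi>) \<in> \<T>"
  let ?Z = "{z \<in> N. E z \<in> V}" and ?j = "inv_into (over M \<pi> V) \<Psi>"
  have sE: "smooth_on (?Z \<times> S2) (%x. (E (fst x), snd x))"
   by (rule smooth_on_smo_UNIV) (auto intro!: smo_intros smo_compose_UNIV[OF E(1)])
  show "SF ?Z (%z q. snd (\<Psi> (?i (E z, q))))"
  proof (rule SF_I[where d = "%z q. snd (Ph (?j (E z, q)))"])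
   show "smooth_on (?Z \<times> S2) (%y. snd (\<Psi> (?i (E (fst y), snd y))))"
    by (rule smooth_on_compose_smo[OF smo_linear[OF bounded_linear_snd smo_ident open_UNIV] open_UNIV smooth_on_compose[OF transition_smooth[OF t(1) s] sE]]) (use N in auto)
   show "smooth_on (?Z \<times> S2) (%y. snd (Ph (?j (E (fst y), snd y))))"
    by (rule smooth_on_compose_smo[OF smo_linear[OF bounded_linear_snd smo_ident open_UNIV] open_UNIV smooth_on_compose[OF transition_smooth[OF s t(1)] sE]]) (use N in auto)
   fix z and q :: "real^3" assume z: "z \<in> ?Z" and q: "q \<in> S2"
   have k: "snd (\<Psi>' (inv_into (over M \<pi> V') Ph' (E z, q))) \<in> S2 &
    snd (Ph' (inv_into (over M \<pi> W') \<Psi>' (E z, snd (\<Psi>' (inv_into (over M \<pi> V') Ph' (E z, q)))))) = q"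
    if s': "(V', Ph') \<in> \<T>" "(W', \<Psi>') \<in> \<T>" "E z \<in> V'" "E z \<in> W'" for V' W' Ph' \<Psi>'
   proof -
    define p where "p = inv_into (over M \<pi> V') Ph' (E z, q)"
    have p: "p \<in> over M \<pi> V'" "Ph' p = (E z, q)" "\<pi> p = E z" unfolding p_def using triv_inv[OF s'(1,3) q] by auto
    then have pW: "p \<in> over M \<pi> W'" using s'(4) by (simp add: over_def)
    have "\<Psi>' p = (E z, snd (\<Psi>' p))" using triv_facts(2)[OF s'(2) pW] p(3) by simp
    moreover have "inv_into (over M \<pi> W') \<Psi>' (\<Psi>' p) = p" using triv_smooth(1)[OF s'(2) s'(2) s'(2)] pW by (meson bij_betw_inv_into_left)
    moreover have "\<Psi>' p \<in> W' \<times> S2" using triv_smooth(1)[OF s'(2) s'(2) s'(2)] pW bij_betwE by blast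
    ultimately show ?thesis using p(2) unfolding p_def[symmetric] by (metis mem_Times_iff snd_conv)
   qed
   show "snd (\<Psi> (?i (E z, q))) \<in> S2 & snd (Ph (?j (E z, q))) \<in> S2 &
    snd (\<Psi> (?i (E z, snd (Ph (?j (E z, q)))))) = q & snd (Ph (?j (E z, snd (\<Psi> (?i (E z, q)))))) = q"
    using k[OF t(1) s] k[OF s t(1)] z N by simp
  qed
  fix z assume "z \<in> N" "E z \<in> V"
  then show "orientation_preserving_S2 (%q. snd (\<Psi> (?i (E z, q))))" using transition_op[OF t(1) s] N by blast
 qed
 moreover have "open N" unfolding N_def by (rule open_vimage[OF G(1) smo_continuous[OF E(1)]])
 moreover have "z0 \<in> N" using N t(2) by blast
 ultimately show ?thesis by (intro exI conjI)
qed

text \<open>Over the overlap the two trivializations differ by a family d. To correct the second one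
  on all of B, d is extended by precomposition with s, which maps B into the overlap and is the
  identity where A and B meet.\<close>

lemma good_glue:
 assumes g: "good E W1 Th1" "good E W2 Th2" and o: "open A" "open B" and AB: "A \<subseteq> W1" "B \<subseteq> W2"
  and s: "smooth_on B s" "s ` B \<subseteq> W1 \<inter> W2" "!!z. z \<in> A ==> z \<in> B ==> s z = z" and E: "continuous_on UNIV E"
 shows "\<exists>Th. good E (A \<union> B) Th"
proof -
 define d where "d = quot Th2 Th1"
 have g': "good E (W1 \<inter> W2) Th2" "good E (W1 \<inter> W2) Th1" by (rule good_subset[OF g(2) Int_lower2], rule good_subset[OF g(1) Int_lower1])
 have d: "SF (W1 \<inter> W2) d" unfolding d_def by (rule quot_SF[OF g' continuous_on_subset[OF E subset_UNIV]])
 define Th where "Th z q = (if z \<in> A then Th1 z q else Th2 z (d (s z) q))" for z q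
 have gB: "good E B (%z q. Th2 z (d (s z) q))"
  by (rule good_comp[OF good_subset[OF g(2) AB(2)] SF_reparam[OF d s(1,2)]]) (use s(2) quot(3)[OF g'] in \<open>auto simp: d_def\<close>)
 have "good E (A \<union> B) Th"
 proof (rule good_local)
  fix z assume z: "z \<in> A \<union> B"
  show "\<exists>N. open N & z \<in> N & good E ((A \<union> B) \<inter> N) Th"
  proof (cases "z \<in> A")
   case True
   have "(A \<union> B) \<inter> A = A" by auto
   moreover have "good E A Th" by (rule good_cong[OF good_subset[OF g(1) AB(1)]]) (auto simp: Th_def)
   ultimately show ?thesis using True o by (intro exI[of _ A]) auto
  next
   case False
   have "(A \<union> B) \<inter> B = B" by auto
   moreover have "good E B Th"
   proof (rule good_cong[OF gB])
    fix z and q :: "real^3" assume z: "z \<in> B" and q: "q \<in> S2"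
    show "Th z q = Th2 z (d (s z) q)"
    proof (cases "z \<in> A")
     case True
     then have "z \<in> W1 \<inter> W2" using z AB by blast
     from quot(2)[OF g' this q] show ?thesis using s(3)[OF True z] True by (simp add: Th_def d_def)
    qed (simp add: Th_def)
   qed simp
   ultimately show ?thesis using False z o by (intro exI[of _ B]) auto
  qed
 qed
 then show ?thesis by blast
qed

lemma good_strip_glue:
 fixes E :: "real \<times> real => complex \<times> complex"
 assumes g: "good E ({a<..<b} \<times> J) Th1" "good E ({a'<..<b'} \<times> J) Th2" and ab: "a <= a'" "a' < b" "b <= b'"
  and J: "open J" and E: "continuous_on UNIV E"
 shows "\<exists>Th. good E ({a<..<b'} \<times> J) Th"
proof -
 define m where "m = (a' + b) / 2"
 have m: "a' < m" "m < b" using ab by (auto simp: m_def)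
 \<comment> \<open>The first coordinate is kept up to m and is constantly m beyond the midpoint of m
   and b; to the right of a' it therefore stays between a' and b.\<close>
 define s where "s z = (fst z + stp ((fst z - m) * 2 / (b - m)) * (m - fst z), snd z)" for z :: "real \<times> real"
 have ss: "smo UNIV s" unfolding s_def[abs_def] by (intro smo_intros open_UNIV) (use m in auto)
 have s1: "s z = z" if "fst z <= m" for z
 proof -
  have "(fst z - m) * 2 / (b - m) <= 0" using that m by (intro divide_nonpos_pos) auto
  then show ?thesis by (simp add: s_def)
 qed
 have s2: "a' < fst (s z)" "fst (s z) < b" if z: "a' < fst z" for z
 proof -
  define t where "t = stp ((fst z - m) * 2 / (b - m))"
  have t: "0 <= t" "t <= 1" by (auto simp: t_def)
  have f: "fst (s z) = fst z + t * (m - fst z)" by (simp add: s_def t_def)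
  have "a' < fst (s z) & fst (s z) < b"
  proof (cases "fst z <= m")
   case True then show ?thesis using s1 m z by simp
  next
   case False
   then have 1: "t * (fst z - m) <= 1 * (fst z - m)" using t by (intro mult_right_mono) auto
   show ?thesis
   proof (cases "(fst z - m) * 2 / (b - m) \<ge> 1")
    case True
    then have "t = 1" by (simp add: t_def)
    then show ?thesis using f m by simp
   next
    case f2: False
    then have "(fst z - m) * 2 < b - m" using m by (simp add: field_simps)
    moreover have "0 <= t * (fst z - m)" using t False by simp
    ultimately show ?thesis using f 1 m False by (simp add: algebra_simps)
   qed
  qed
  then show "a' < fst (s z)" "fst (s z) < b" by auto
 qed
 have "\<exists>Th. good E ({a<..<m} \<times> J \<union> {a'<..<b'} \<times> J) Th"
 proof (rule good_glue[OF g _ _ _ _ smooth_on_smo_UNIV[OF ss] _ _ E])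
  show "s ` ({a'<..<b'} \<times> J) \<subseteq> {a<..<b} \<times> J \<inter> {a'<..<b'} \<times> J"
  proof
   fix x assume "x \<in> s ` ({a'<..<b'} \<times> J)"
   then obtain z where z: "x = s z" "a' < fst z" "snd z \<in> J" by auto
   then show "x \<in> {a<..<b} \<times> J \<inter> {a'<..<b'} \<times> J" using s2[OF z(2)] ab by (auto simp: mem_Times_iff s_def)
  qed
 qed (use J m ab s1 in \<open>auto intro: open_Times\<close>)
 moreover have "{a<..<m} \<times> J \<union> {a'<..<b'} \<times> J = {a<..<b'} \<times> J" using m ab by auto
 ultimately show ?thesis by simp
qed

text \<open>Subdivision of the interval by \<open>Bolzano\<close>. J varies with ep because each
  gluing keeps only the thinner of two strips; this serves a first pass, where J ep is an interval
  around y, and a second one, where J is fixed.\<close>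

lemma good_strip:
 fixes E :: "real \<times> real => complex \<times> complex" and J :: "real => real set"
 assumes E: "continuous_on UNIV E" and J: "!!ep. open (J ep)" "!!ep ep'. ep <= ep' ==> J ep \<subseteq> J ep'"
  and loc: "!!x. \<exists>ep>0. \<exists>Th. good E ({x - ep<..<x + ep} \<times> J ep) Th" and ab: "a <= b"
 shows "\<exists>ep>0. \<exists>Th. good E ({a - ep<..<b + ep} \<times> J ep) Th"
 using ab
proof (induct rule: Bolzano)
 case (trans a b c)
 then obtain ep ep' Th Th' where e: "ep > 0" "ep' > 0" "good E ({a - ep<..<b + ep} \<times> J ep) Th" "good E ({b - ep'<..<c + ep'} \<times> J ep') Th'"
  by blast
 define r where "r = min ep ep'"
 have r: "r > 0" "r <= ep" "r <= ep'" using e by (auto simp: r_def)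
 have "\<exists>Th. good E ({a - r<..<c + r} \<times> J r) Th"
 proof (rule good_strip_glue[OF good_subset[OF e(3)] good_subset[OF e(4)] _ _ _ J(1) E])
  show "{a - r<..<b + r} \<times> J r \<subseteq> {a - ep<..<b + ep} \<times> J ep" "{b - r<..<c + r} \<times> J r \<subseteq> {b - ep'<..<c + ep'} \<times> J ep'"
   using r J(2) by (auto dest: subsetD)
 qed (use trans r in auto)
 then show ?case using r(1) by blast
next
 case (local x)
 obtain ep Th where e: "ep > 0" "good E ({x - ep<..<x + ep} \<times> J ep) Th" using loc by blast
 show ?case
 proof (rule exI[of _ "ep / 2"], intro conjI allI impI)
  fix a b assume ab: "a <= x & x <= b & b - a < ep / 2"
  have "good E ({a - ep / 2<..<b + ep / 2} \<times> J (ep / 2)) Th"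
   by (rule good_subset[OF e(2)]) (use ab e(1) J(2)[of "ep / 2" ep] in auto)
  then show "\<exists>ep>0. \<exists>Th. good E ({a - ep<..<b + ep} \<times> J ep) Th" using e(1) by (intro exI[of _ "ep / 2"]) auto
 qed (use e in simp)
qed

text \<open>One pass of \<open>good_strip\<close> along each coordinate, the second one on the
  pullback with coordinates exchanged.\<close>

lemma good_box:
 fixes E :: "real \<times> real => complex \<times> complex"
 assumes E: "smo UNIV E" "!!z. E z \<in> T2" and ab: "a <= b" "c <= d"
 shows "\<exists>Th. good E ({a<..<b} \<times> {c<..<d}) Th"
proof -
 have cE: "continuous_on UNIV E" by (rule smo_continuous[OF E(1)])
 have sw: "smo UNIV (%z :: real \<times> real. (snd z, fst z))" by (intro smo_intros open_UNIV)
 define E' where "E' z = E (snd z, fst z)" for z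
 have cE': "continuous_on UNIV E'" unfolding E'_def[abs_def]
  by (rule continuous_on_compose2[OF cE]) (auto intro!: continuous_intros)
 have row: "\<exists>ep>0. \<exists>Th. good E' ({y - ep<..<y + ep} \<times> {a<..<b}) Th" for y
 proof -
  have "\<exists>ep>0. \<exists>Th. good E ({x - ep<..<x + ep} \<times> {y - ep<..<y + ep}) Th" for x
  proof -
   obtain N Th where N: "open N" "(x, y) \<in> N" "good E N Th" using good_exists_local[OF E, of "(x, y)"] by blast
   obtain A B where AB: "open A" "open B" "(x, y) \<in> A \<times> B" "A \<times> B \<subseteq> N" by (rule open_prod_elim[OF N(1,2)])
   obtain r1 where r1: "r1 > 0" "ball x r1 \<subseteq> A" using AB open_contains_ball by blast
   obtain r2 where r2: "r2 > 0" "ball y r2 \<subseteq> B" using AB open_contains_ball by blast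
   define r where "r = min r1 r2"
   have "{x - r<..<x + r} \<subseteq> ball x r1" "{y - r<..<y + r} \<subseteq> ball y r2" by (auto simp: dist_real_def r_def)
   then have "good E ({x - r<..<x + r} \<times> {y - r<..<y + r}) Th" using r1 r2 AB(4) by (intro good_subset[OF N(3)]) blast
   moreover have "r > 0" using r1 r2 by (simp add: r_def)
   ultimately show ?thesis by blast
  qed
  from good_strip[OF cE _ _ this ab(1)]
  obtain ep Th where e: "ep > 0" "good E ({a - ep<..<b + ep} \<times> {y - ep<..<y + ep}) Th" by (auto simp: subset_iff)
  have "good (%z. E (snd z, fst z)) ({y - ep<..<y + ep} \<times> {a<..<b}) (%z. Th (snd z, fst z))"
   by (rule good_reparam[OF e(2) smooth_on_smo_UNIV[OF sw]]) (use e(1) in auto)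
  then have "good E' ({y - ep<..<y + ep} \<times> {a<..<b}) (%z. Th (snd z, fst z))" unfolding E'_def[abs_def] .
  then show ?thesis using e(1) by blast
 qed
 from good_strip[OF cE' _ _ row ab(2)]
 obtain ep Th where e: "ep > 0" "good E' ({c - ep<..<d + ep} \<times> {a<..<b}) Th" by auto
 have "good (%z. E' (snd z, fst z)) ({a<..<b} \<times> {c<..<d}) (%z. Th (snd z, fst z))"
  by (rule good_reparam[OF e(2) smooth_on_smo_UNIV[OF sw]]) (use e(1) in auto)
 then have "good E ({a<..<b} \<times> {c<..<d}) (%z. Th (snd z, fst z))" unfolding E'_def by simp
 then show ?thesis by blast
qed

end

section \<open>Closing up along one coordinate\<close>

lemma op_id: "orientation_preserving_S2 (%q. q)"
 unfolding orientation_preserving_S2_def using rdet_id[of "%q. q"] by simp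

lemma op_rot: "orientation_preserving_S2 (rot t)"
proof (rule op_isotopy[of rot 0])
 show "SF UNIV rot" using SF_rot[of UNIV "%t. t"] by (simp add: smooth_on_smo_UNIV smo_ident)
 show "orientation_preserving_S2 (rot 0)" by (rule op_cong[OF op_id]) simp
qed

lemma rot_shift: "rot (of_int m * (of_int n * (b + 1))) q = rot (of_int m * (of_int n * b)) q"
 using rot_add[of "of_int m * (of_int n * b)" "of_int (m * n)" q] rot_int[of "m * n" q] by (simp add: algebra_simps)

lemma rot_shift1: "rot (of_int n * (b + 1)) q = rot (of_int n * b) q"
 using rot_shift[of 1 n b q] by simp

context sphere_bundle
begin

text \<open>As E has period 1 in its second argument, Th and its translate trivialize the same
  pullback; D measures how far Th is from closing up.\<close>

lemma shift_quot:
 fixes E :: "real \<times> real => complex \<times> complex"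
 assumes E: "continuous_on UNIV E" "!!b s m. E (b, s + of_int m) = E (b, s)" and g: "good E (B \<times> {-1<..<2}) Th"
 defines "D \<equiv> quot Th (%z. Th (fst z, snd z - 1))"
 shows "SF (B \<times> {0<..<2}) D"
  "b \<in> B ==> 0 < s ==> s < 2 ==> q \<in> S2 ==> D (b, s) q \<in> S2"
  "b \<in> B ==> 0 < s ==> s < 2 ==> q \<in> S2 ==> Th (b, s) (D (b, s) q) = Th (b, s - 1) q"
  "b \<in> B ==> 0 < s ==> s < 2 ==> orientation_preserving_S2 (D (b, s))"
proof -
 have g1: "good E (B \<times> {0<..<2}) Th" by (rule good_subset[OF g]) auto
 have sh: "smo UNIV (%z :: real \<times> real. (fst z, snd z - 1))" by (intro smo_intros open_UNIV)
 have g2: "good E (B \<times> {0<..<2}) (%z. Th (fst z, snd z - 1))"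
 proof (rule good_cong[OF good_reparam[OF g smooth_on_smo_UNIV[OF sh]]])
  fix z :: "real \<times> real"
  show "E z = E (fst z, snd z - 1)" using E(2)[of "fst z" "snd z" "-1"] by simp
 qed auto
 show "SF (B \<times> {0<..<2}) D" unfolding D_def by (rule quot_SF[OF g1 g2 continuous_on_subset[OF E(1) subset_UNIV]])
 show "D (b, s) q \<in> S2" "Th (b, s) (D (b, s) q) = Th (b, s - 1) q"
  if "b \<in> B" "0 < s" "s < 2" "q \<in> S2"
  using quot(1,2)[OF g1 g2, of "(b, s)" q] that unfolding D_def by auto
 show "orientation_preserving_S2 (D (b, s))" if "b \<in> B" "0 < s" "s < 2"
  using quot(3)[OF g1 g2, of "(b, s)"] that unfolding D_def by auto
qed

text \<open>K deforms Th within one period until translation by 1 amounts to the rotation by n b;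
  this rule then continues the corrected trivialization to all s. The last clause keeps the
  periodicity obtained when the other coordinate was closed.\<close>

lemma good_close:
 fixes E :: "real \<times> real => complex \<times> complex" and n :: int and K :: "real => real => real^3 => real^3"
 assumes E: "continuous_on UNIV E" "!!b s m. E (b, s + of_int m) = E (b, s)" and g: "good E (B \<times> {-1<..<2}) Th"
  and K: "SF (B \<times> UNIV) (%z. K (fst z) (snd z))"
   "!!b t q. b \<in> B ==> q \<in> S2 ==> t <= 0 ==> K b t q = q"
   "!!b t q. b \<in> B ==> q \<in> S2 ==> t \<ge> 1 ==> Th (b, 1) (K b t q) = Th (b, 0) (rot (of_int n * b) q)"
 shows "\<exists>Th'. good E (B \<times> UNIV) Th' & (\<forall>b s q. Th' (b, s + 1) q = Th' (b, s) (rot (of_int n * b) q)) &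
  ((\<forall>b s q. Th (b + 1, s) q = Th (b, s) q) --> (\<forall>b t. \<forall>q\<in>S2. K (b + 1) t q = K b t q) -->
   (\<forall>b s. \<forall>q\<in>S2. Th' (b + 1, s) q = Th' (b, s) q))"
proof -
 define D where "D = quot Th (%z. Th (fst z, snd z - 1))"
 note sq = shift_quot[OF E g, folded D_def]
 define W where "W = B \<times> {-1<..<2::real}"
 \<comment> \<open>A local name, unrelated to the stereographic map. The second coordinate is frozen
   at 1 up to 5/8, is unchanged from 3/4 on, and for 1/2 < s < 2 lies in the domain of D.\<close>
 define sg where "sg z = (fst z, 1 + stp (8 * snd z - 5) * (snd z - 1))" for z :: "real \<times> real"
 \<comment> \<open>K is the identity for s <= 1/4 and has ended for s >= 1/2. So Th is unchanged
   below 1/4 and becomes its rotated translate above 3/4; for s between 1/2 and 5/8 both branches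
   agree, since D is evaluated at s = 1.\<close>
 define H where "H z q = (if snd z < 5/8 then K (fst z) (4 * snd z - 1) q else D (sg z) (rot (of_int n * fst z) q))" for z q
 have sgs: "smo UNIV sg" unfolding sg_def[abs_def] by (intro smo_intros open_UNIV)
 have sgD: "0 < snd (sg z)" "snd (sg z) < 2" if "1/2 < snd z" "snd z < 2" for z
 proof -
  have a: "\<bar>stp (8 * snd z - 5) * (snd z - 1)\<bar> <= 1 * \<bar>snd z - 1\<bar>"
   unfolding abs_mult by (intro mult_right_mono) auto
  have b: "\<bar>snd z - 1\<bar> < 1" using that by (simp add: abs_less_iff)
  have "\<bar>stp (8 * snd z - 5) * (snd z - 1)\<bar> < 1" using le_less_trans[OF a[unfolded mult_1] b] .
  then show "0 < snd (sg z)" "snd (sg z) < 2" unfolding abs_less_iff sg_def snd_conv by linarith+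
 qed
 have H1: "SF W (%z. K (fst z) (4 * snd z - 1))"
 proof -
  have "smo UNIV (%z :: real \<times> real. (fst z, 4 * snd z - 1))" by (intro smo_intros open_UNIV)
  moreover have "(%z. (fst z, 4 * snd z - 1)) ` W \<subseteq> B \<times> UNIV" by (auto simp: W_def)
  ultimately have "SF W (%z. K (fst (fst z, 4 * snd z - 1)) (snd (fst z, 4 * snd z - 1)))"
   by (rule SF_reparam[OF K(1) smooth_on_smo_UNIV])
  then show ?thesis by simp
 qed
 have H2: "SF (B \<times> {1/2<..<2}) (%z q. D (sg z) (rot (of_int n * fst z) q))"
 proof (rule SF_comp[OF SF_reparam[OF sq(1) smooth_on_smo_UNIV[OF sgs]] SF_rot])
  show "sg ` (B \<times> {1/2<..<2}) \<subseteq> B \<times> {0<..<2}" using sgD by (auto simp: mem_Times_iff) (auto simp: sg_def)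
  show "smooth_on (B \<times> {1/2<..<2::real}) (%z. of_int n * fst z)" by (rule smooth_on_smo_UNIV) (intro smo_intros open_UNIV)
 qed
 have SK: "SF UNIV (K b)" if "b \<in> B" for b
 proof -
  have "smo UNIV (%t :: real. (b, t))" by (intro smo_intros open_UNIV)
  moreover have "(%t :: real. (b, t)) ` UNIV \<subseteq> B \<times> UNIV" using that by auto
  ultimately have "SF UNIV (%t. K (fst (b, t)) (snd (b, t)))"
   by (rule SF_reparam[OF K(1) smooth_on_smo_UNIV])
  then show ?thesis by simp
 qed
 have eq: "K b (4 * s - 1) q = D (sg (b, s)) (rot (of_int n * b) q)" if "b \<in> B" "1/2 < s" "s < 5/8" "q \<in> S2" for b s q
 proof -
  have s1: "sg (b, s) = (b, 1)" using that by (simp add: sg_def)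
  have r: "rot (of_int n * b) q \<in> S2" using that(4) by (simp only: rot_S2)
  have "(b, 1::real) \<in> B \<times> {-1<..<2}" using that by simp
  then have "inj_on (Th (b, 1)) S2" using good_fibre[OF g] bij_betw_imp_inj_on by blast
  moreover have "Th (b, 1) (K b (4 * s - 1) q) = Th (b, 1) (D (b, 1) (rot (of_int n * b) q))"
   using K(3)[OF that(1,4), of "4 * s - 1"] sq(3)[OF that(1) _ _ r, of 1] that by simp
  ultimately show ?thesis unfolding s1
   using SF_D(1)[OF SK[OF that(1)] UNIV_I that(4)] sq(2)[OF that(1) _ _ r, of 1] by (auto dest: inj_onD)
 qed
 have H: "SF W H"
 proof (rule SF_local)
  fix z assume z: "z \<in> W"
  show "\<exists>N. open N & z \<in> N & SF (W \<inter> N) H"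
  proof (cases "snd z < 5/8")
   case True
   show ?thesis
   proof (intro exI[of _ "{z. snd z < 5/8}"] conjI)
    show "open {z :: real \<times> real. snd z < 5/8}" by (intro open_Collect_less continuous_intros)
    show "SF (W \<inter> {z. snd z < 5/8}) H" by (rule SF_cong[OF SF_subset[OF H1]]) (auto simp: H_def)
   qed (use True in simp)
  next
   case False
   show ?thesis
   proof (intro exI[of _ "{z. 1/2 < snd z}"] conjI)
    show "open {z :: real \<times> real. 1/2 < snd z}" by (intro open_Collect_less continuous_intros)
    show "SF (W \<inter> {z. 1/2 < snd z}) H"
     by (rule SF_cong[OF SF_subset[OF H2]]) (use eq in \<open>auto simp: H_def W_def\<close>)
   qed (use False in simp)
  qed
 qed
 have opH: "orientation_preserving_S2 (H z)" if z: "z \<in> W" for z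
 proof (cases "snd z < 5/8")
  case True
  have b: "fst z \<in> B" using z by (auto simp: W_def)
  have "orientation_preserving_S2 (K (fst z) 0)" by (rule op_cong[OF op_id]) (simp add: K(2)[OF b])
  from op_isotopy[OF SK[OF b] this, of "4 * snd z - 1"] show ?thesis by (rule op_cong) (use True in \<open>simp add: H_def\<close>)
 next
  case False
  have b: "fst z \<in> B" "1/2 < snd z" "snd z < 2" using z False by (auto simp: W_def)
  note s = sgD[OF b(2,3)]
  have z0: "sg z = (fst z, snd (sg z))" by (simp add: sg_def)
  have zD: "sg z \<in> B \<times> {0<..<2}" using b s by (subst z0) simp
  have A: "smooth_on S2 (rot (of_int n * fst z))" using SF_slice[OF SF_rot[of UNIV "%t. t"], of "of_int n * fst z"] by (simp add: smooth_on_smo_UNIV smo_ident)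
  have C: "orientation_preserving_S2 (D (sg z))" using sq(4)[OF b(1) s] z0 by simp
  have "orientation_preserving_S2 (%q. D (sg z) (rot (of_int n * fst z) q))"
   by (rule op_comp[OF C op_rot SF_slice[OF sq(1) zD] A]) (simp only: rot_S2)
  then show ?thesis by (rule op_cong) (use False in \<open>simp add: H_def\<close>)
 qed
 define \<Omega> where "\<Omega> z q = Th z (H z q)" for z q
 have g\<Omega>: "good E W \<Omega>" unfolding \<Omega>_def[abs_def] by (rule good_comp[OF g[folded W_def] H opH])
 have low: "\<Omega> (b, s) q = Th (b, s) q" if "b \<in> B" "s <= 1/4" "q \<in> S2" for b s q
  using that K(2) by (simp add: \<Omega>_def H_def)
 have high: "\<Omega> (b, s) q = Th (b, s - 1) (rot (of_int n * b) q)" if "b \<in> B" "3/4 <= s" "s < 2" "q \<in> S2" for b s q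
 proof -
  have "sg (b, s) = (b, s)" using that by (simp add: sg_def)
  moreover have "rot (of_int n * b) q \<in> S2" using that(4) by (simp only: rot_S2)
  ultimately show ?thesis using that sq(3)[of b s] by (simp add: \<Omega>_def H_def)
 qed
 define Th' where "Th' z q = \<Omega> (fst z, frac (snd z)) (rot (of_int \<lfloor>snd z\<rfloor> * (of_int n * fst z)) q)" for z q
 \<comment> \<open>The formula valid on [m, m + 1) also holds on a quarter to the left of m, by
   \<open>low\<close> and \<open>high\<close>; these overlapping open windows give smoothness at the
   integers.\<close>
 have key: "Th' (b, s) q = \<Omega> (b, s - of_int m) (rot (of_int m * (of_int n * b)) q)"
  if b: "b \<in> B" and s: "- (1/4) < s - of_int m" "s - of_int m < 1" and q: "q \<in> S2" for b s q m
 proof (cases "of_int m <= s")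
  case True
  then have "\<lfloor>s\<rfloor> = m" using s by (simp add: floor_eq_iff)
  then show ?thesis by (simp add: Th'_def frac_def)
 next
  case False
  then have f: "\<lfloor>s\<rfloor> = m - 1" using s by (simp add: floor_eq_iff)
  have rS: "rot t q \<in> S2" for t using q by (simp only: rot_S2)
  have "rot (of_int n * b) (rot (of_int (m - 1) * (of_int n * b)) q) = rot (of_int m * (of_int n * b)) q"
   unfolding rot_add[symmetric] by (simp add: algebra_simps)
  then have "Th' (b, s) q = Th (b, s - of_int m) (rot (of_int m * (of_int n * b)) q)"
   using high[OF b _ _ rS, of "s - of_int (m - 1)" "of_int (m - 1) * (of_int n * b)"] s False by (simp add: Th'_def frac_def f)
  then show ?thesis using low[OF b _ rS, of "s - of_int m"] False s by simp
 qed
 have 1: "good E (B \<times> UNIV) Th'"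
 proof (rule good_local)
  fix z assume z: "z \<in> B \<times> (UNIV :: real set)"
  define m where "m = \<lfloor>snd z\<rfloor>"
  define N where "N = (UNIV :: real set) \<times> {of_int m - 1/4<..<of_int m + (1::real)}"
  have N: "open N" "z \<in> N" unfolding N_def by (auto intro!: open_Times simp: mem_Times_iff m_def) linarith+
  define f where "f z = (fst z, snd z - of_int m)" for z :: "real \<times> real"
  have fs: "smo UNIV f" unfolding f_def[abs_def] by (intro smo_intros open_UNIV)
  have BN: "B \<times> UNIV \<inter> N = B \<times> {of_int m - 1/4<..<of_int m + (1::real)}" by (auto simp: N_def)
  have "good E (B \<times> UNIV \<inter> N) (%z. \<Omega> (f z))"
  proof (rule good_cong[OF good_reparam[OF g\<Omega> smooth_on_smo_UNIV[OF fs]]])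
   fix z show "E z = E (f z)" using E(2)[of "fst z" "snd z" "- m"] by (simp add: f_def)
  qed (auto simp: BN W_def f_def)
  then have "good E (B \<times> UNIV \<inter> N) (%z q. \<Omega> (f z) (rot (of_int m * (of_int n * fst z)) q))"
  proof (rule good_comp[OF _ SF_rot op_rot])
   show "smooth_on (B \<times> UNIV \<inter> N) (%z. of_int m * (of_int n * fst z))" by (rule smooth_on_smo_UNIV) (intro smo_intros open_UNIV)
  qed
  then have "good E (B \<times> UNIV \<inter> N) Th'"
  proof (rule good_cong)
   fix z and q :: "real^3" assume z: "z \<in> B \<times> UNIV \<inter> N" and q: "q \<in> S2"
   have "Th' (fst z, snd z) q = \<Omega> (fst z, snd z - of_int m) (rot (of_int m * (of_int n * fst z)) q)"
    by (rule key) (use z q in \<open>auto simp: N_def\<close>)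
   then show "Th' z q = \<Omega> (f z) (rot (of_int m * (of_int n * fst z)) q)" by (simp add: f_def)
  qed simp
  then show "\<exists>N. open N & z \<in> N & good E (B \<times> UNIV \<inter> N) Th'" by (intro exI[of _ N] conjI N)
 qed
 have 2: "Th' (b, s + 1) q = Th' (b, s) (rot (of_int n * b) q)" for b s q
 proof -
  have "rot (of_int (\<lfloor>s\<rfloor> + 1) * (of_int n * b)) q = rot (of_int \<lfloor>s\<rfloor> * (of_int n * b)) (rot (of_int n * b) q)"
   unfolding rot_add[symmetric] by (simp add: algebra_simps)
  then show ?thesis by (simp add: Th'_def frac_def)
 qed
 have 3: "Th' (b + 1, s) q = Th' (b, s) q"
  if per: "\<forall>b s q. Th (b + 1, s) q = Th (b, s) q" "\<forall>b t. \<forall>q\<in>S2. K (b + 1) t q = K b t q" and q: "q \<in> S2" for b s q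
 proof -
  have tb: "Th (b + 1, s) = Th (b, s)" for s using per(1) by auto
  have Dp: "D (b + 1, s) = D (b, s)" for s by (rule ext) (simp add: D_def quot_def tb)
  have Hp: "H (b + 1, s) q = H (b, s) q" if "q \<in> S2" for s q
   using per(2) that Dp by (simp add: H_def sg_def rot_shift1)
  have "rot t q \<in> S2" for t using q by (simp only: rot_S2)
  then show ?thesis using per(1) Hp by (simp add: Th'_def \<Omega>_def rot_shift)
 qed
 show ?thesis by (rule exI[of _ Th'], intro conjI allI impI ballI, rule 1, rule 2, rule 3; assumption)
qed

end

section \<open>Closing up along both generators\<close>

definition ee :: "real \<times> real => complex \<times> complex" where
 "ee z = (cis (2 * pi * fst z), cis (2 * pi * snd z))"

lemma smo_ee: "smo UNIV ee" unfolding ee_def[abs_def] by (intro smo_intros open_UNIV)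

lemma ee_T2: "ee z \<in> T2" by (simp add: ee_def)

lemma ee_int: "ee (x + of_int i, y + of_int j) = ee (x, y)"
proof -
 have "cis (2 * pi * (t + of_int k)) = cis (2 * pi * t)" for t :: real and k :: int
 proof -
  have "cis (2 * pi * (t + of_int k)) = cis (2 * pi * t) * cis (2 * pi * of_int k)" unfolding cis_mult by (simp add: distrib_left)
  then show ?thesis by (simp add: cis_multiple_2pi)
 qed
 then show ?thesis by (simp add: ee_def)
qed

text \<open>The x direction is closed without twist over a bounded range of y, where the comparison
  maps form a path and can be deformed away. Closing the y direction then meets a loop of
  diffeomorphisms over the circle of x, and its parity supplies n0.\<close>

theorem (in sphere_bundle) twisted_trivialization:
 "\<exists>n0::int. \<forall>n. even (n - n0) --> (\<exists>Th. good ee UNIV Th & (\<forall>x y. \<forall>q\<in>S2. Th (x + 1, y) q = Th (x, y) q) &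
   (\<forall>x y q. Th (x, y + 1) q = Th (x, y) (rot (of_int n * x) q)))"
proof -
 have rS: "rot t q \<in> S2" if "q \<in> S2" for t q using that by (simp only: rot_S2)
 define E' where "E' z = ee (snd z, fst z)" for z :: "real \<times> real"
 have E': "smo UNIV E'" "E' z \<in> T2" "E' (b, s + of_int m) = E' (b, s)" for z b s m
  unfolding E'_def[abs_def] using ee_int[of s m b 0] ee_T2
  by (auto intro!: smo_compose_UNIV[OF smo_ee] smo_intros)
 note cE' = smo_continuous[OF E'(1)]
 obtain Th0 where g0: "good E' ({-3<..<3} \<times> {-1<..<2}) Th0"
  using good_box[OF E'(1,2), of "-3" 3 "-1" 2] by auto
 define D0 where "D0 = quot Th0 (%z. Th0 (fst z, snd z - 1))"
 note sq0 = shift_quot[OF cE' E'(3) g0, folded D0_def]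
 \<comment> \<open>Precomposition with 2 * sin (2 * pi * b) turns the path of comparison maps into a
   loop that still covers -2 < y < 2, so that the classification of loops can be used on a path;
   \<beta> below is a section of this map.\<close>
 define f0 where "f0 b = D0 (2 * sin (2 * pi * b), 1)" for b
 have s3: "2 * sin t \<in> {-3<..<3}" for t :: real
 proof -
  have "- 1 <= sin t" "sin t <= 1" by auto
  then have "- 3 < 2 * sin t" "2 * sin t < 3" by linarith+
  then show ?thesis by simp
 qed
 have f0: "SF UNIV f0" unfolding f0_def[abs_def]
  by (rule SF_reparam[OF sq0(1) smooth_on_smo_UNIV]) (use s3 in \<open>auto intro!: smo_intros\<close>)
 have "2 * pi * (b + 1) = 2 * pi * b + 2 * pi" for b :: real by (simp add: algebra_simps)
 then have p0: "f0 (b + 1) q = f0 b q" for b q by (simp add: f0_def)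
 have op0: "orientation_preserving_S2 (f0 b)" for b unfolding f0_def by (rule sq0(4)[OF s3]) simp_all
 obtain n' :: int where n': "isot (%b. rot (of_int n' * b)) f0" using sphere_loop_classification[OF f0 p0 op0] by blast
 obtain F :: "real => real => real^3 => real^3" where F: "SF UNIV (%p. F (fst p) (snd p))" "\<forall>b t. \<forall>q\<in>S2. F (b + 1) t q = F b t q"
   "\<forall>b t. \<forall>q\<in>S2. t <= 0 --> F b t q = rot (of_int n' * b) q" "\<forall>b t. \<forall>q\<in>S2. t \<ge> 1 --> F b t q = f0 b q"
  by (rule isotE[OF n']) (rule that)
 define w where "w y = Complex (sqrt (1 - (y / 2)\<^sup>2)) (y / 2)" for y :: real
 define \<beta> where "\<beta> y = Im (Ln (w y)) / (2 * pi)" for y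
 define B where "B = {-2<..<2::real}"
 have yB: "0 < 1 - (y / 2)\<^sup>2" if "y \<in> B" for y
 proof -
  have "\<bar>y / 2\<bar> < 1" using that by (auto simp: B_def)
  then have "(y / 2)\<^sup>2 < 1" by (simp only: abs_square_less_1)
  then show ?thesis by simp
 qed
 have \<beta>s: "smo B \<beta>" unfolding \<beta>_def[abs_def] w_def
  by (intro smo_intros) (use yB in \<open>auto simp: B_def complex_nonpos_Reals_iff\<close>)
 have \<beta>: "2 * sin (2 * pi * \<beta> y) = y" if y: "y \<in> B" for y
 proof -
  have nw: "norm (w y) = 1" unfolding w_def complex_norm using yB[OF y] by simp
  then have w0: "w y ~= 0" by auto
  have "Re (Ln (w y)) = 0" unfolding Re_Ln[OF w0] nw by simp
  then have "w y = cis (Im (Ln (w y)))" using exp_Ln[OF w0] exp_eq_polar[of "Ln (w y)"] by simp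
  then have "Im (w y) = sin (Im (Ln (w y)))" by (metis cis.simps(2))
  then show ?thesis by (simp add: \<beta>_def w_def)
 qed
 \<comment> \<open>The inserted rotation makes the deformation start at the identity: for t <= 0 it
   cancels the rotation with which F starts, and for t >= 1 it has died out.\<close>
 define K where "K y t q = F (\<beta> y) t (rot (- (of_int n' * \<beta> y * (1 - stp t))) q)" for y t q
 have \<beta>s2: "smo (B \<times> UNIV) (%z :: real \<times> real. \<beta> (fst z))"
  by (rule smo_compose[OF \<beta>s smo_linear[OF bounded_linear_fst smo_ident]]) (auto simp: B_def open_Times)
 have oB: "open (B \<times> (UNIV :: real set))" by (auto simp: B_def open_Times)
 have "\<exists>Th'. good E' (B \<times> UNIV) Th' & (\<forall>b s q. Th' (b, s + 1) q = Th' (b, s) (rot (of_int 0 * b) q)) &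
  ((\<forall>b s q. Th0 (b + 1, s) q = Th0 (b, s) q) --> (\<forall>b t. \<forall>q\<in>S2. K (b + 1) t q = K b t q) -->
   (\<forall>b s. \<forall>q\<in>S2. Th' (b + 1, s) q = Th' (b, s) q))"
 proof (rule good_close[OF cE' E'(3)])
  show "good E' (B \<times> {-1<..<2}) Th0" by (rule good_subset[OF g0]) (auto simp: B_def)
  show "SF (B \<times> UNIV) (%z. K (fst z) (snd z))" unfolding K_def[abs_def]
  proof (rule SF_comp[OF SF_reparam[OF F(1), of _ "%z. (\<beta> (fst z), snd z)", simplified] SF_rot])
   show "smooth_on (B \<times> UNIV) (%z :: real \<times> real. (\<beta> (fst z), snd z))"
    by (rule smo_imp_smooth_on[OF _ oB]) (intro smo_intros \<beta>s2 oB)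
   show "smooth_on (B \<times> UNIV) (%z :: real \<times> real. - (of_int n' * \<beta> (fst z) * (1 - stp (snd z))))"
    by (rule smo_imp_smooth_on[OF _ oB]) (intro smo_intros \<beta>s2 oB)
  qed
  fix b t :: real and q :: "real^3" assume b: "b \<in> B" and q: "q \<in> S2"
  show "K b t q = q" if "t <= 0"
   using F(3) rS[OF q] that by (simp add: K_def rot_add[symmetric])
  show "Th0 (b, 1) (K b t q) = Th0 (b, 0) (rot (of_int 0 * b) q)" if "t \<ge> 1"
  proof -
   have "K b t q = D0 (b, 1) q" using F(4) q that \<beta>[OF b] by (simp add: K_def f0_def)
   then show ?thesis using sq0(3)[of b 1 q] b q by (simp add: B_def)
  qed
 qed
 then obtain Th1 where g1: "good E' (B \<times> UNIV) Th1" "\<forall>b s q. Th1 (b, s + 1) q = Th1 (b, s) (rot (of_int 0 * b) q)"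
  by (elim exE conjE) (rule that)
 define Th2 where "Th2 z = Th1 (snd z, fst z)" for z
 have sw: "smo UNIV (%z :: real \<times> real. (snd z, fst z))" by (intro smo_intros open_UNIV)
 have g2: "good ee (UNIV \<times> {-1<..<2}) Th2"
  by (rule good_cong[OF good_reparam[OF g1(1) smooth_on_smo_UNIV[OF sw]]]) (auto simp: Th2_def E'_def B_def)
 have p2: "Th2 (x + 1, y) = Th2 (x, y)" for x y using g1(2) by (simp add: Th2_def fun_eq_iff)
 note cee = smo_continuous[OF smo_ee]
 have eper: "ee (b, s + of_int m) = ee (b, s)" for b s m using ee_int[of b 0 s m] by simp
 define D2 where "D2 = quot Th2 (%z. Th2 (fst z, snd z - 1))"
 note sq2 = shift_quot[OF cee eper g2, folded D2_def]
 define f where "f b = D2 (b, 1)" for b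
 have f: "SF UNIV f" unfolding f_def[abs_def]
  by (rule SF_reparam[OF sq2(1) smooth_on_smo_UNIV]) (auto intro!: smo_intros)
 have pf: "f (b + 1) q = f b q" for b q by (simp add: f_def D2_def quot_def p2)
 have opf: "orientation_preserving_S2 (f b)" for b unfolding f_def by (rule sq2(4)) simp_all
 obtain m0 :: int where m0: "\<forall>m. even (m - m0) --> isot (%b. rot (of_int m * b)) f" using sphere_loop_parity[OF f pf opf] by blast
 show ?thesis
 proof (intro exI[of _ "- m0"] allI impI)
  fix n :: int assume n: "even (n - - m0)"
  then have "even (- n - m0)" by simp
  then have i: "isot (%b. rot (of_int (- n) * b)) f" using m0 by blast
  obtain F :: "real => real => real^3 => real^3" where F: "SF UNIV (%p. F (fst p) (snd p))" "\<forall>b t. \<forall>q\<in>S2. F (b + 1) t q = F b t q"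
    "\<forall>b t. \<forall>q\<in>S2. t <= 0 --> F b t q = rot (of_int (- n) * b) q" "\<forall>b t. \<forall>q\<in>S2. t \<ge> 1 --> F b t q = f b q"
   by (rule isotE[OF i]) (rule that)
  \<comment> \<open>The comparison loop f is isotopic to the rotation by - n b, so F preceded by the
    rotation by n b starts at the identity; this is where the sign of m0 comes from.\<close>
  define K where "K b t q = F b t (rot (of_int n * b) q)" for b t q
  have "\<exists>Th'. good ee (UNIV \<times> UNIV) Th' & (\<forall>b s q. Th' (b, s + 1) q = Th' (b, s) (rot (of_int n * b) q)) &
   ((\<forall>b s q. Th2 (b + 1, s) q = Th2 (b, s) q) --> (\<forall>b t. \<forall>q\<in>S2. K (b + 1) t q = K b t q) -->
    (\<forall>b s. \<forall>q\<in>S2. Th' (b + 1, s) q = Th' (b, s) q))"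
  proof (rule good_close[OF cee eper g2])
   have F1: "SF (UNIV \<times> UNIV) (%p. F (fst p) (snd p))" by (rule SF_subset[OF F(1)]) simp
   show "SF (UNIV \<times> UNIV) (%z. K (fst z) (snd z))" unfolding K_def[abs_def]
    by (rule SF_comp[OF F1 SF_rot]) (rule smooth_on_smo_UNIV, intro smo_intros open_UNIV)
   fix b t :: real and q :: "real^3" assume q: "q \<in> S2"
   show "K b t q = q" if "t <= 0" using F(3) rS[OF q] that by (simp add: K_def rot_add[symmetric])
   show "Th2 (b, 1) (K b t q) = Th2 (b, 0) (rot (of_int n * b) q)" if "t \<ge> 1"
    using F(4) rS[OF q] that sq2(3)[of b 1 "rot (of_int n * b) q"] by (simp add: K_def f_def)
  qed
  moreover have "\<forall>b t. \<forall>q\<in>S2. K (b + 1) t q = K b t q"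
   using F(2) rS by (simp add: K_def rot_shift1)
  moreover have "\<forall>b s q. Th2 (b + 1, s) q = Th2 (b, s) q" by (simp add: p2)
  ultimately obtain Th where "good ee (UNIV \<times> UNIV) Th" "\<forall>b s q. Th (b, s + 1) q = Th (b, s) (rot (of_int n * b) q)"
    "\<forall>b s. \<forall>q\<in>S2. Th (b + 1, s) q = Th (b, s) q" by blast
  then show "\<exists>Th. good ee UNIV Th & (\<forall>x y. \<forall>q\<in>S2. Th (x + 1, y) q = Th (x, y) q) &
    (\<forall>x y q. Th (x, y + 1) q = Th (x, y) (rot (of_int n * x) q))"
   unfolding UNIV_Times_UNIV by (intro exI conjI)
 qed
qed

section \<open>Deck transformations\<close>

text \<open>The velocity field of the rotations: the derivative of \<open>rot t q\<close> in t is 2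
  * pi times \<open>jj (rot t q)\<close>.\<close>

definition jj :: "real^3 => real^3" where
 "jj q = (\<chi> i. if i = 1 then - q $ 2 else if i = 2 then q $ 1 else 0)"

lemma jj_nth [simp]: "jj q $ 1 = - q $ 2" "jj q $ 2 = q $ 1" "jj q $ 3 = 0"
 by (simp_all add: jj_def)

lemma bounded_linear_jj: "bounded_linear jj"
 by (rule linear_conv_bounded_linear[THEN iffD1], rule linearI) (simp_all add: vec3_eq_iff)

lemma bounded_linear_rot: "bounded_linear (rot t)"
 by (rule linear_conv_bounded_linear[THEN iffD1], rule linearI) (simp_all add: vec3_eq_iff algebra_simps)

lemma rot_jj: "rot t (jj q) = jj (rot t q)"
 by (simp add: vec3_eq_iff)

lemma rot_inner: "rot t u \<bullet> rot t v = u \<bullet> v"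
proof -
 define c s where "c = cos (2 * pi * t)" and "s = sin (2 * pi * t)"
 have "s\<^sup>2 + c\<^sup>2 = 1" unfolding c_def s_def by (rule sin_cos_squared_add)
 then have "(s * s + c * c) * a = a" for a :: real by (simp add: power2_eq_square)
 from this[of "u $ 1 * v $ 1"] this[of "u $ 2 * v $ 2"]
 show ?thesis unfolding inner3 rot_nth c_def[symmetric] s_def[symmetric] by (simp add: algebra_simps)
qed

lemma rot_has_derivative:
 assumes t: "(\<tau> has_derivative \<tau>') (at x)" and Q: "(Q has_derivative Q') (at x)"
 shows "((%p. rot (\<tau> p) (Q p)) has_derivative (%v. rot (\<tau> x) (Q' v) + (2 * pi * \<tau>' v) *\<^sub>R jj (rot (\<tau> x) (Q x)))) (at x)"
proof -
 have e: "rot s q = cos (2 * pi * s) *\<^sub>R (q - q $ 3 *\<^sub>R axis 3 1) + sin (2 * pi * s) *\<^sub>R jj q + q $ 3 *\<^sub>R axis 3 1" for s q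
  by (simp add: vec3_eq_iff)
 have c: "((%p. cos (2 * pi * \<tau> p)) has_derivative (%v. - sin (2 * pi * \<tau> x) * (2 * pi * \<tau>' v))) (at x)"
  and s: "((%p. sin (2 * pi * \<tau> p)) has_derivative (%v. cos (2 * pi * \<tau> x) * (2 * pi * \<tau>' v))) (at x)"
  by (rule has_derivative_eq_rhs[OF DERIV_compose_FDERIV[OF DERIV_cos has_derivative_mult_right[OF t]]], simp add: mult_ac)
    (rule has_derivative_eq_rhs[OF DERIV_compose_FDERIV[OF DERIV_sin has_derivative_mult_right[OF t]]], simp add: mult_ac)
 have Q3: "((%p. Q p $ 3) has_derivative (%v. Q' v $ 3)) (at x)"
  by (rule bounded_linear.has_derivative[OF bounded_linear_vec_nth Q])
 have Qj: "((%p. jj (Q p)) has_derivative (%v. jj (Q' v))) (at x)"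
  by (rule bounded_linear.has_derivative[OF bounded_linear_jj Q])
 have a: "((%p. Q p $ 3 *\<^sub>R npole) has_derivative (%v. Q' v $ 3 *\<^sub>R npole)) (at x)"
  by (rule has_derivative_scaleR_left[OF Q3])
 show ?thesis unfolding e[of "\<tau> _" "Q _"]
  by (rule has_derivative_eq_rhs[OF has_derivative_add[OF has_derivative_add[OF has_derivative_scaleR[OF c has_derivative_diff[OF Q a]] has_derivative_scaleR[OF s Qj]] a]])
    (auto simp: fun_eq_iff vec3_eq_iff algebra_simps)
qed

locale twisted = sphere_bundle +
 fixes Th :: "real \<times> real => real^3 => 'a" and n :: int
 assumes g: "good ee UNIV Th"
  and per1: "q \<in> S2 ==> Th (x + 1, y) q = Th (x, y) q"
  and per2: "Th (x, y + 1) q = Th (x, y) (rot (of_int n * x) q)"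
begin

definition TH :: "(real \<times> real) \<times> (real^3) => 'a" where "TH x = Th (fst x) (snd x)"

text \<open>For integers \<open>a\<close>, \<open>b\<close> and \<open>c = 0\<close> these are the deck transformations of \<open>TH\<close>.\<close>

definition Fm :: "real => real => real => (real \<times> real) \<times> (real^3) => (real \<times> real) \<times> (real^3)" where
 "Fm a b c x = ((fst (fst x) + a, snd (fst x) + b), rot (c - of_int n * b * fst (fst x)) (snd x))"

lemma Fm_S2: "snd (Fm a b c x) \<in> S2 \<longleftrightarrow> snd x \<in> S2" by (simp only: Fm_def snd_conv rot_S2)

lemma Fm_0: "Fm 0 0 0 x = x" by (simp add: Fm_def)

text \<open>The term - n b a' is a Heisenberg cocycle: a preceding translation of x by a' changes
  the angle - n b x that accompanies the translation of y.\<close>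

lemma Fm_Fm: "Fm a b c (Fm a' b' c' x) = Fm (a + a') (b + b') (c + c' - of_int n * b * a') x"
 by (simp add: Fm_def rot_add[symmetric] algebra_simps)

lemma per1_int: "q \<in> S2 ==> Th (x + of_int i, y) q = Th (x, y) q"
proof (induct i rule: int_induct[of _ 0])
 case (step1 i) then show ?case using per1[of q "x + of_int i" y] by (simp add: algebra_simps)
next
 case (step2 i) then show ?case using per1[of q "x + of_int (i - 1)" y] by (simp add: algebra_simps)
qed simp

lemma per2_int: "Th (x, y + of_int j) q = Th (x, y) (rot (of_int j * (of_int n * x)) q)"
proof (induct j arbitrary: q rule: int_induct[of _ 0])
 case (step1 j) then show ?case using per2[of x "y + of_int j" q] by (simp add: algebra_simps rot_add[symmetric])
next
 case (step2 j)
 have e: "y + of_int (j - 1) + 1 = y + of_int j" by simp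
 have "Th (x, y + of_int (j - 1)) q = Th (x, y + of_int j) (rot (- (of_int n * x)) q)"
  using per2[of x "y + of_int (j - 1)" "rot (- (of_int n * x)) q"] unfolding e by (simp add: rot_add[symmetric])
 then show ?case using step2 by (simp add: rot_add[symmetric] algebra_simps)
qed simp

lemma TH_deck: assumes "snd x \<in> S2" shows "TH (Fm (of_int i) (of_int j) 0 x) = TH x"
proof -
 define X Y where "X = fst (fst x)" and "Y = snd (fst x)"
 have r: "rot (0 - of_int n * of_int j * X) (snd x) \<in> S2" using assms by (simp only: rot_S2)
 have z: "of_int j * (of_int n * X) + (0 - of_int n * of_int j * X) = 0" by (simp add: algebra_simps)
 have "TH (Fm (of_int i) (of_int j) 0 x) = Th (X + of_int i, Y + of_int j) (rot (0 - of_int n * of_int j * X) (snd x))"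
  by (simp add: TH_def Fm_def X_def Y_def)
 also have "\<dots> = Th (X, Y + of_int j) (rot (0 - of_int n * of_int j * X) (snd x))" by (rule per1_int[OF r])
 also have "\<dots> = Th (X, Y) (rot (of_int j * (of_int n * X)) (rot (0 - of_int n * of_int j * X) (snd x)))" by (rule per2_int)
 also have "\<dots> = TH x" unfolding rot_add[symmetric] z rot_0 by (simp add: TH_def X_def Y_def)
 finally show ?thesis .
qed

lemma TH_points: "snd x \<in> S2 ==> TH x \<in> points M" "snd x \<in> S2 ==> \<pi> (TH x) = ee (fst x)"
 unfolding TH_def using goodD(1,2)[OF g UNIV_I] by auto

text \<open>Base points with the same image differ by integers; after a deck transformation both
  points lie over one base point, where Th is injective. So the fibres of TH are exactly the deck
  orbits.\<close>

lemma TH_eq: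
 assumes x: "snd x \<in> S2" "snd x' \<in> S2" and e: "TH x = TH x'"
 shows "\<exists>i j :: int. x' = Fm (of_int i) (of_int j) 0 x"
proof -
 have "ee (fst x) = ee (fst x')" using TH_points(2) x e by metis
 then have c: "cis (2 * pi * fst (fst x')) = cis (2 * pi * fst (fst x))" "cis (2 * pi * snd (fst x')) = cis (2 * pi * snd (fst x))"
  by (auto simp: ee_def)
 have k: "\<exists>i::int. t' = t + of_int i" if "cis (2 * pi * t') = cis (2 * pi * t)" for t t' :: real
 proof -
  have "sin (2 * pi * t') = sin (2 * pi * t) & cos (2 * pi * t') = cos (2 * pi * t)" using that by (auto simp: complex_eq_iff)
  then obtain m :: int where "2 * pi * t' = 2 * pi * t + 2 * pi * m" unfolding sin_cos_eq_iff by blast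
  then have "2 * pi * t' = 2 * pi * (t + m)" by (simp add: distrib_left)
  then have "t' = t + m" by simp
  then show ?thesis by blast
 qed
 obtain i :: int where i: "fst (fst x') = fst (fst x) + of_int i" using k[OF c(1)] by blast
 obtain j :: int where j: "snd (fst x') = snd (fst x) + of_int j" using k[OF c(2)] by blast
 define y where "y = Fm (of_int i) (of_int j) 0 x"
 have fy: "fst y = fst x'" using i j by (simp add: y_def Fm_def prod_eq_iff)
 have sy: "snd y \<in> S2" unfolding y_def Fm_S2 by (rule x(1))
 have "TH y = TH x'" unfolding y_def TH_deck[OF x(1)] by (rule e)
 then have "Th (fst x') (snd y) = Th (fst x') (snd x')" unfolding TH_def fy .
 then have "snd y = snd x'" using bij_betw_imp_inj_on[OF good_fibre[OF g UNIV_I, of "fst x'"]] sy x(2) by (meson inj_onD)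
 then have "x' = y" using fy by (simp add: prod_eq_iff)
 then show ?thesis unfolding y_def by blast
qed

lemma TH_surj: assumes p: "p \<in> points M" shows "\<exists>x. snd x \<in> S2 & TH x = p"
proof -
 have k: "\<exists>t. cis (2 * pi * t) = z" if "norm z = 1" for z
 proof (rule exI[of _ "Arg z / (2 * pi)"])
  have "z ~= 0" using that by auto
  then show "cis (2 * pi * (Arg z / (2 * pi))) = z" using that by (simp add: cis_Arg sgn_eq)
 qed
 have "\<pi> p \<in> T2" by (rule base[OF p])
 then have "norm (fst (\<pi> p)) = 1" "norm (snd (\<pi> p)) = 1" by (auto simp: mem_Times_iff)
 then obtain s t where "cis (2 * pi * s) = fst (\<pi> p)" "cis (2 * pi * t) = snd (\<pi> p)" using k by metis
 then have "\<pi> p = ee (s, t)" by (simp add: ee_def)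
 then have "p \<in> Th (s, t) ` S2" using good_fibre[OF g UNIV_I, of "(s, t)"] p unfolding bij_betw_def by blast
 then obtain q where "q \<in> S2" "p = Th (s, t) q" by blast
 then show ?thesis by (intro exI[of _ "((s, t), q)"]) (simp add: TH_def)
qed

text \<open>In a bundle chart TH is the smooth family provided by \<open>good\<close>; charts of M
  are then reached through the inverse of the bundle chart.\<close>

lemma TH_smooth:
 assumes x: "snd x \<in> S2" and C: "(C, ph) \<in> charts M" "TH x \<in> C"
 shows "\<exists>G. open G & x \<in> G & (\<forall>y\<in>G. snd y \<in> S2 --> TH y \<in> C) & smooth_on (G \<inter> UNIV \<times> S2) (%y. ph (TH y))"
proof -
 obtain U Ph where t: "(U, Ph) \<in> \<T>" "ee (fst x) \<in> U" by (rule chart_at[OF ee_T2])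
 obtain G0 where G0: "open G0" "U = T2 \<inter> G0" using triv_facts(1)[OF t(1)] unfolding openin_open by blast
 define N where "N = ee -` G0"
 have oN: "open N" unfolding N_def by (rule open_vimage[OF G0(1) smo_continuous[OF smo_ee]])
 have N: "z \<in> N \<longleftrightarrow> ee z \<in> U" for z using ee_T2[of z] G0(2) by (simp add: N_def)
 then have Neq: "{z \<in> UNIV. ee z \<in> U} = N" by auto
 define \<alpha> where "\<alpha> y = (ee (fst y), snd (Ph (TH y)))" for y
 note c = goodD(3)[OF g t(1), unfolded Neq]
 have cs: "smooth_on (N \<times> S2) (%y. snd (Ph (TH y)))" using c unfolding SF_def TH_def by blast
 have \<alpha>: "smooth_on (N \<times> S2) \<alpha>" unfolding \<alpha>_def[abs_def]
  by (rule smooth_on_Pair[OF smooth_on_smo_UNIV[OF smo_compose_UNIV[OF smo_ee]] cs]) (auto intro!: smo_intros)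
 let ?i = "inv_into (over M \<pi> U) Ph"
 have iv: "?i (\<alpha> y) = TH y" "\<alpha> y \<in> U \<times> S2" if "y \<in> N \<times> S2" for y
 proof -
  have y: "snd y \<in> S2" "ee (fst y) \<in> U" using that N by (auto simp: mem_Times_iff)
  have o: "TH y \<in> over M \<pi> U" using TH_points[OF y(1)] y(2) by (simp add: over_def)
  have e: "Ph (TH y) = \<alpha> y" using triv_facts(2)[OF t(1) o] TH_points(2)[OF y(1)] by (simp add: \<alpha>_def)
  show "?i (\<alpha> y) = TH y" using bij_betw_inv_into_left[OF triv_smooth(1)[OF t(1) t(1) t(1)] o] unfolding e .
  have "Ph (TH y) \<in> U \<times> S2" using bij_betwE[OF triv_smooth(1)[OF t(1) t(1) t(1)]] o by blast
  then show "\<alpha> y \<in> U \<times> S2" unfolding e .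
 qed
 have "openin (top_of_set (U \<times> S2)) {y \<in> U \<times> S2. ?i y \<in> C}"
  using openin_continuous_map_preimage[OF triv_smooth(3)[OF t(1) t(1) t(1)] chart_facts(1)[OF M C(1)]] by simp
 then obtain G1 where G1: "open G1" "{y \<in> U \<times> S2. ?i y \<in> C} = (U \<times> S2) \<inter> G1" unfolding openin_open by blast
 obtain G2 where G2: "open G2" "G2 \<inter> N \<times> S2 = \<alpha> -` G1 \<inter> N \<times> S2"
  using smooth_on_continuous[OF \<alpha>] G1(1) unfolding continuous_on_open_invariant by blast
 define G where "G = (N \<times> UNIV) \<inter> G2"
 have GC: "\<alpha> y \<in> {y \<in> U \<times> S2. ?i y \<in> C}" "y \<in> N \<times> S2" if "y \<in> G" "snd y \<in> S2" for y
 proof -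
  show y: "y \<in> N \<times> S2" using that by (auto simp: G_def)
  then have "y \<in> \<alpha> -` G1 \<inter> N \<times> S2" using that(1) G2(2) unfolding G_def by blast
  then show "\<alpha> y \<in> {y \<in> U \<times> S2. ?i y \<in> C}" unfolding G1(2) using iv(2)[OF y] by blast
 qed
 show ?thesis
 proof (intro exI[of _ G] conjI ballI impI)
  show "open G" unfolding G_def by (intro open_Int open_Times oN G2(1) open_UNIV)
  have xN: "x \<in> N \<times> S2" using N t(2) x by (simp add: mem_Times_iff del: mem_sphere)
  have "\<alpha> x \<in> {y \<in> U \<times> S2. ?i y \<in> C}" using iv[OF xN] C(2) by simp
  then have "x \<in> \<alpha> -` G1 \<inter> N \<times> S2" unfolding G1(2) using xN by blast
  then show "x \<in> G" using G2(2) xN unfolding G_def by (auto simp: mem_Times_iff)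
  show "TH y \<in> C" if "y \<in> G" "snd y \<in> S2" for y using GC[OF that] iv(1) by auto
  show "smooth_on (G \<inter> UNIV \<times> S2) (%y. ph (TH y))"
  proof (rule smooth_on_transform[OF smooth_on_compose[OF triv_smooth(4)[OF t(1) t(1) t(1) C(1)] smooth_on_subset[OF \<alpha>]]])
   show "G \<inter> UNIV \<times> S2 \<subseteq> N \<times> S2" using GC(2) by (auto simp: mem_Times_iff)
   show "\<alpha> ` (G \<inter> UNIV \<times> S2) \<subseteq> {y \<in> U \<times> S2. ?i y \<in> C}" using GC(1) by (auto simp: mem_Times_iff)
   fix y assume "y \<in> G \<inter> UNIV \<times> S2"
   then show "ph (TH y) = ph (?i (\<alpha> y))" using iv(1)[OF GC(2), of y] by (simp add: mem_Times_iff)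
  qed
 qed
qed

text \<open>A smooth local section of TH near p, read in the chart ph. Tensors on the covering are
  brought down by pulling them back along ka.\<close>

definition li :: "'a set => ('a => real^4) => 'a => (real^4 => (real \<times> real) \<times> (real^3)) => bool" where
 "li C ph p ka \<longleftrightarrow> (\<exists>N. open N & ph p \<in> N & N \<subseteq> ph ` C & smo N ka & (\<forall>y\<in>N. snd (ka y) \<in> S2 & TH (ka y) = inv_into C ph y))"

lemma li_exists:
 assumes x: "snd x \<in> S2" and C: "(C, ph) \<in> charts M" "TH x \<in> C"
 shows "\<exists>ka. li C ph (TH x) ka & ka (ph (TH x)) = x"
proof -
 note cC = chart_facts[OF M C(1)]
 obtain U Ph where t: "(U, Ph) \<in> \<T>" "ee (fst x) \<in> U" by (rule chart_at[OF ee_T2])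
 define z0 where "z0 = fst x"
 define b1 b2 where "b1 = cis (2 * pi * fst z0)" and "b2 = cis (2 * pi * snd z0)"
 have bb: "b1 * cnj b1 = 1" "b2 * cnj b2 = 1" by (simp_all add: b1_def b2_def cis_cnj cis_mult)
 \<comment> \<open>The local inverse of \<open>ee\<close> near z0, by principal logarithms.\<close>
 define \<zeta> where "\<zeta> b = (fst z0 + Im (Ln (fst b * cnj b1)) / (2 * pi), snd z0 + Im (Ln (snd b * cnj b2)) / (2 * pi))" for b
 define R where "R = {b :: complex \<times> complex. 0 < Re (fst b * cnj b1) & 0 < Re (snd b * cnj b2)}"
 have oR: "open R" unfolding R_def by (intro open_Collect_conj open_Collect_less continuous_intros)
 have \<zeta>s: "smo R \<zeta>" unfolding \<zeta>_def[abs_def]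
  by (intro smo_intros oR) (auto simp: R_def complex_nonpos_Reals_iff)
 have l: "c * cis (Im (Ln (z * cnj c))) = z" if "c * cnj c = 1" "norm c = 1" "norm z = 1" for c z :: complex
 proof -
  have w: "z * cnj c ~= 0" "norm (z * cnj c) = 1" using that by (auto simp: norm_mult)
  have "Re (Ln (z * cnj c)) = 0" unfolding Re_Ln[OF w(1)] w(2) by simp
  then have "cis (Im (Ln (z * cnj c))) = z * cnj c" using exp_Ln[OF w(1)] exp_eq_polar[of "Ln (z * cnj c)"] by (simp only: exp_zero of_real_1 mult_1)
  then have "c * cis (Im (Ln (z * cnj c))) = (c * cnj c) * z" by (simp only: mult_ac)
  then show ?thesis using that(1) by simp
 qed
 have e\<zeta>: "ee (\<zeta> b) = b" if "b \<in> T2" for b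
 proof -
  have nb: "norm (fst b) = 1" "norm (snd b) = 1" using that by (auto simp: mem_Times_iff)
  have "cis (2 * pi * (s + Im w / (2 * pi))) = cis (2 * pi * s) * cis (Im w)" for s w by (simp add: cis_mult distrib_left)
  then show ?thesis using l[OF bb(1) _ nb(1)] l[OF bb(2) _ nb(2)]
   by (simp add: ee_def \<zeta>_def b1_def[symmetric] b2_def[symmetric] prod_eq_iff) (simp add: b1_def b2_def)
 qed
 have \<zeta>0: "\<zeta> (ee z0) = z0" "ee z0 \<in> R"
  using bb unfolding \<zeta>_def R_def ee_def fst_conv snd_conv b1_def[symmetric] b2_def[symmetric] by (simp_all del: times_complex.simps)
 define N1 where "N1 = ph ` (C \<inter> over M \<pi> U)"
 have oN1: "open N1" unfolding N1_def using cC(1) over_open[OF t(1)] by (intro cC(5)) auto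
 define \<Psi> where "\<Psi> y = Ph (inv_into C ph y)" for y
 have \<Psi>s: "smo N1 \<Psi>" using triv_smooth(5)[OF t(1) t(1) t(1) C(1)] unfolding \<Psi>_def[abs_def] N1_def[symmetric] smooth_on_open_iff[OF oN1] .
 have iC: "inv_into C ph y \<in> over M \<pi> U" if "y \<in> N1" for y using that by (auto simp: N1_def inv_into_f_f[OF cC(4)])
 have \<Psi>y: "fst (\<Psi> y) = \<pi> (inv_into C ph y)" "fst (\<Psi> y) \<in> U" "snd (\<Psi> y) \<in> S2" if "y \<in> N1" for y
 proof -
  show f: "fst (\<Psi> y) = \<pi> (inv_into C ph y)" using triv_facts(2)[OF t(1) iC[OF that]] unfolding \<Psi>_def by (metis fst_conv)
  have "\<Psi> y \<in> U \<times> S2" unfolding \<Psi>_def using bij_betwE[OF triv_smooth(1)[OF t(1) t(1) t(1)]] iC[OF that] by blast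
  then show "fst (\<Psi> y) \<in> U" "snd (\<Psi> y) \<in> S2" by (auto simp: mem_Times_iff)
 qed
 define N where "N = N1 \<inter> (%y. fst (\<Psi> y)) -` R"
 have oN: "open N" unfolding N_def
  by (intro continuous_open_preimage[OF _ oN1 oR] continuous_on_fst smo_continuous[OF \<Psi>s])
 define c where "c z q = snd (Ph (Th z q))" for z q
 have c: "SF {z. ee z \<in> U} c" using goodD(3)[OF g t(1)] unfolding c_def[abs_def] by simp
 define ka where "ka y = (\<zeta> (fst (\<Psi> y)), inv_into S2 (c (\<zeta> (fst (\<Psi> y)))) (snd (\<Psi> y)))" for y
 have UT: "U \<subseteq> T2" using triv_facts(1)[OF t(1)] openin_imp_subset by blast
 have \<zeta>U: "ee (\<zeta> (fst (\<Psi> y))) = fst (\<Psi> y)" if "y \<in> N1" for y using e\<zeta> UT \<Psi>y(2)[OF that] by blast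
 have \<Psi>N: "smo N (%y. fst (\<Psi> y))" "smo N (%y. snd (\<Psi> y))"
  using smo_subset[OF \<Psi>s, of N] oN by (auto intro!: smo_intros simp: N_def)
 have \<zeta>N: "smo N (%y. \<zeta> (fst (\<Psi> y)))" by (rule smo_compose[OF \<zeta>s \<Psi>N(1) _ oN oR]) (auto simp: N_def)
 have "smooth_on N (%y. inv_into S2 (c (\<zeta> (fst (\<Psi> y)))) (snd (\<Psi> y)))"
 proof (rule SF_compose_smooth(2)[OF c smo_imp_smooth_on[OF \<zeta>N oN] smo_imp_smooth_on[OF \<Psi>N(2) oN]])
  show "(%y. \<zeta> (fst (\<Psi> y))) ` N \<subseteq> {z. ee z \<in> U}"
  proof (rule image_subsetI)
   fix y assume "y \<in> N"
   then have "y \<in> N1" by (simp add: N_def)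
   then show "\<zeta> (fst (\<Psi> y)) \<in> {z. ee z \<in> U}" using \<zeta>U \<Psi>y(2) by simp
  qed
  show "(%y. snd (\<Psi> y)) ` N \<subseteq> S2" using \<Psi>y(3) unfolding N_def by blast
 qed
 then have kas: "smo N ka" unfolding ka_def[abs_def] smooth_on_open_iff[OF oN] by (intro smo_intros \<zeta>N oN)
 have kay: "snd (ka y) \<in> S2 & TH (ka y) = inv_into C ph y" if "y \<in> N" for y
 proof -
  have y: "y \<in> N1" using that by (simp add: N_def)
  have z: "\<zeta> (fst (\<Psi> y)) \<in> {z. ee z \<in> U}" using \<zeta>U[OF y] \<Psi>y(2)[OF y] by simp
  note S = SF_D[OF c z]
  have s: "snd (ka y) \<in> S2" unfolding ka_def snd_conv by (rule S(2)[OF \<Psi>y(3)[OF y]])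
  have "TH (ka y) = inv_into C ph y"
  proof (rule triv_inj[OF t(1) TH_points(1)[OF s]])
   show "inv_into C ph y \<in> points M" using iC[OF y] by (simp add: over_def)
   show "\<pi> (TH (ka y)) = \<pi> (inv_into C ph y)" "\<pi> (TH (ka y)) \<in> U"
    unfolding TH_points(2)[OF s] using \<zeta>U[OF y] \<Psi>y(1,2)[OF y] by (simp_all add: ka_def)
   show "snd (Ph (TH (ka y))) = snd (Ph (inv_into C ph y))"
    using S(3)[OF \<Psi>y(3)[OF y]] by (simp add: TH_def ka_def c_def \<Psi>_def)
  qed
  then show ?thesis using s by blast
 qed
 have i0: "inv_into C ph (ph (TH x)) = TH x" by (rule inv_into_f_f[OF cC(4) C(2)])
 have x1: "ph (TH x) \<in> N1" unfolding N1_def using C(2) TH_points[OF x] t(2) by (auto simp: over_def)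
 have f0: "fst (\<Psi> (ph (TH x))) = ee z0" using \<Psi>y(1)[OF x1] unfolding i0 TH_points(2)[OF x] z0_def .
 have xN: "ph (TH x) \<in> N" using x1 f0 \<zeta>0(2) by (simp add: N_def)
 have "z0 \<in> {z. ee z \<in> U}" using t(2) by (simp add: z0_def)
 from SF_D(4)[OF c this x] have "ka (ph (TH x)) = x"
  unfolding ka_def f0 \<zeta>0(1) by (simp add: \<Psi>_def i0[unfolded TH_def] c_def TH_def z0_def prod_eq_iff)
 moreover have "li C ph (TH x) ka" unfolding li_def
  by (rule exI[of _ N]) (use oN xN kas kay in \<open>auto simp: N_def N1_def\<close>)
 ultimately show ?thesis by blast
qed

end

section \<open>The Lorentz metric\<close>

context twisted
begin

text \<open>The metric of the overview at x, written for arbitrary vectors of the ambient space; the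
  vectors inserted later are tangent to the sphere in the last component.\<close>

definition Gf :: "(real \<times> real) \<times> (real^3) => (real \<times> real) \<times> (real^3) => (real \<times> real) \<times> (real^3) => real" where
 "Gf x v w = fst (fst v) * fst (fst w) - snd (fst v) * snd (fst w) +
   (snd v + (2 * pi * of_int n * snd (fst x) * fst (fst v)) *\<^sub>R jj (snd x)) \<bullet>
   (snd w + (2 * pi * of_int n * snd (fst x) * fst (fst w)) *\<^sub>R jj (snd x))"

definition DF :: "real => real => real => (real \<times> real) \<times> (real^3) => (real \<times> real) \<times> (real^3) => (real \<times> real) \<times> (real^3)" where
 "DF a b c x v = (fst v, rot (c - of_int n * b * fst (fst x)) (snd v) +
   (2 * pi * (- (of_int n * b * fst (fst v)))) *\<^sub>R jj (rot (c - of_int n * b * fst (fst x)) (snd x)))"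

lemma Fm_deriv: "(Fm a b c has_derivative DF a b c x) (at x)"
proof -
 have 1: "((%x :: (real \<times> real) \<times> (real^3). (fst (fst x) + a, snd (fst x) + b)) has_derivative (%v. (fst (fst v), snd (fst v)))) (at x)"
  by (intro has_derivative_Pair) (auto intro!: derivative_eq_intros)
 have t: "((%x :: (real \<times> real) \<times> (real^3). c - of_int n * b * fst (fst x)) has_derivative (%v. - (of_int n * b * fst (fst v)))) (at x)"
  by (auto intro!: derivative_eq_intros)
 have q: "((%x :: (real \<times> real) \<times> (real^3). snd x) has_derivative (%v. snd v)) (at x)"
  by (auto intro!: derivative_eq_intros)
 from has_derivative_Pair[OF 1 rot_has_derivative[OF t q]]
 show ?thesis unfolding Fm_def[abs_def] DF_def[abs_def] by simp
qed

lemma smo_Fm: "smo UNIV (Fm a b c)"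
 unfolding Fm_def[abs_def] by (intro smo_intros open_UNIV)

text \<open>Under Fm the coefficient of dx J q grows by 2 \<pi> n b, and the derivative of the
  rotation by - n b x subtracts the same amount. What remains is a rotation, which is isometric and
  commutes with J.\<close>

lemma Gf_inv: "Gf (Fm a b c x) (DF a b c x v) (DF a b c x w) = Gf x v w"
proof -
 define t where "t = c - of_int n * b * fst (fst x)"
 have lin: "linear (rot t)" using bounded_linear_rot by (rule bounded_linear.linear)
 have k: "snd (DF a b c x v) + (2 * pi * of_int n * snd (fst (Fm a b c x)) * fst (fst (DF a b c x v))) *\<^sub>R jj (snd (Fm a b c x))
   = rot t (snd v + (2 * pi * of_int n * snd (fst x) * fst (fst v)) *\<^sub>R jj (snd x))" for v
  unfolding linear_add[OF lin] linear_cmul[OF lin] rot_jj DF_def Fm_def fst_conv snd_conv t_def[symmetric]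
  by (simp add: algebra_simps)
 show ?thesis unfolding Gf_def k rot_inner by (simp add: DF_def)
qed

lemma liE:
 assumes "li C ph p ka"
 obtains N where "open N" "ph p \<in> N" "N \<subseteq> ph ` C" "smo N ka" "!!y. y \<in> N ==> snd (ka y) \<in> S2" "!!y. y \<in> N ==> TH (ka y) = inv_into C ph y"
 using assms unfolding li_def by auto

text \<open>Correct Fm by the deck transformation that matches the two given lifts at p, and call
  the result F. Then \<open>ka' \<circ> h\<close> and \<open>F \<circ> ka\<close> lift the same map
  and agree near \<open>ph p\<close>, so their derivatives agree and \<open>Gf_inv\<close> applies.
  With f the identity this compares two charts or two lifts.\<close>

lemma lift_in_charts:
 assumes C: "(C, ph) \<in> charts M" "p \<in> C" and D: "(D, \<psi>) \<in> charts M" "f p \<in> D"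
  and l: "li C ph p ka" "li D \<psi> (f p) ka'" and f: "!!x. snd x \<in> S2 ==> f (TH x) = TH (Fm a b c x)"
 defines "h \<equiv> \<psi> \<circ> f \<circ> inv_into C ph"
 shows "\<exists>N. open N & ph p \<in> N & N \<subseteq> ph ` C & smo N h & (\<forall>y\<in>N. f (inv_into C ph y) \<in> D)"
  "Gf (ka (ph p)) (pd v ka (ph p)) (pd w ka (ph p)) =
   Gf (ka' (\<psi> (f p))) (pd (pd v h (ph p)) ka' (\<psi> (f p))) (pd (pd w h (ph p)) ka' (\<psi> (f p)))"
proof -
 note cC = chart_facts[OF M C(1)] and cD = chart_facts[OF M D(1)]
 obtain N where N: "open N" "ph p \<in> N" "N \<subseteq> ph ` C" "smo N ka" "!!y. y \<in> N ==> snd (ka y) \<in> S2" "!!y. y \<in> N ==> TH (ka y) = inv_into C ph y"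
  by (rule liE[OF l(1)]) (rule that)
 obtain N' where N': "open N'" "\<psi> (f p) \<in> N'" "N' \<subseteq> \<psi> ` D" "smo N' ka'" "!!y. y \<in> N' ==> snd (ka' y) \<in> S2" "!!y. y \<in> N' ==> TH (ka' y) = inv_into D \<psi> y"
  by (rule liE[OF l(2)]) (rule that)
 define x0 x1 where "x0 = ka (ph p)" and "x1 = ka' (\<psi> (f p))"
 have x0: "snd x0 \<in> S2" "TH x0 = p" unfolding x0_def using N(5,6)[OF N(2)] inv_into_f_f[OF cC(4) C(2)] by auto
 have x1: "snd x1 \<in> S2" "TH x1 = f p" unfolding x1_def using N'(5,6)[OF N'(2)] inv_into_f_f[OF cD(4) D(2)] by auto
 have Fx: "snd (Fm a b c x) \<in> S2" if "snd x \<in> S2" for x using that by (simp only: Fm_S2)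
 have "TH (Fm a b c x0) = TH x1" using f[OF x0(1)] x0(2) x1(2) by simp
 then obtain i j :: int where ij: "x1 = Fm (of_int i) (of_int j) 0 (Fm a b c x0)" using TH_eq[OF Fx[OF x0(1)] x1(1)] by blast
 define F where "F = Fm (of_int i + a) (of_int j + b) (0 + c - of_int n * of_int j * a)"
 have F: "Fm (of_int i) (of_int j) 0 (Fm a b c x) = F x" for x unfolding F_def by (rule Fm_Fm)
 have Fx1: "F x0 = x1" using ij F by simp
 have fF: "f (TH x) = TH (F x)" if "snd x \<in> S2" for x using f[OF that] TH_deck[OF Fx[OF that], of i j] unfolding F by simp
 have FS: "snd (F x) \<in> S2" if "snd x \<in> S2" for x using that unfolding F_def by (simp only: Fm_S2)
 have Fs: "smo UNIV F" unfolding F_def by (rule smo_Fm)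
 have "TH (F x0) \<in> D" using fF[OF x0(1)] x0(2) D(2) by simp
 from TH_smooth[OF FS[OF x0(1)] D(1) this]
 obtain G where G: "open G" "F x0 \<in> G" "\<forall>y\<in>G. snd y \<in> S2 --> TH y \<in> D" "smooth_on (G \<inter> UNIV \<times> S2) (%y. \<psi> (TH y))" by blast
 define N1 where "N1 = N \<inter> (%y. F (ka y)) -` G"
 have Fka: "smo N (%y. F (ka y))" by (rule smo_compose_UNIV[OF Fs N(4,1)])
 have oN1: "open N1" unfolding N1_def by (rule continuous_open_preimage[OF smo_continuous[OF Fka] N(1) G(1)])
 have y0: "ph p \<in> N1" using N(2) G(2) by (simp add: N1_def x0_def)
 have fD: "f (inv_into C ph y) = TH (F (ka y))" "TH (F (ka y)) \<in> D" "F (ka y) \<in> G \<inter> UNIV \<times> S2" if "y \<in> N1" for y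
 proof -
  have y: "y \<in> N" "F (ka y) \<in> G" using that by (auto simp: N1_def)
  have s: "snd (F (ka y)) \<in> S2" by (rule FS[OF N(5)[OF y(1)]])
  show "f (inv_into C ph y) = TH (F (ka y))" using fF[OF N(5)[OF y(1)]] N(6)[OF y(1)] by simp
  show "TH (F (ka y)) \<in> D" using G(3) y(2) s by blast
  show "F (ka y) \<in> G \<inter> UNIV \<times> S2" using y(2) s by (simp add: mem_Times_iff)
 qed
 have hy: "h y = \<psi> (TH (F (ka y)))" if "y \<in> N1" for y unfolding h_def using fD(1)[OF that] by simp
 have "smo N1 (%y. F (ka y))" by (rule smo_subset[OF Fka]) (auto simp: N1_def)
 then have "smo N1 (%y. \<psi> (TH (F (ka y))))"
  by (rule smooth_on_smo_compose[OF G(4) _ oN1]) (rule image_subsetI, rule fD(3))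
 then have hs: "smo N1 h" by (rule smo_transform[OF _ oN1 hy])
 show "\<exists>N. open N & ph p \<in> N & N \<subseteq> ph ` C & smo N h & (\<forall>y\<in>N. f (inv_into C ph y) \<in> D)"
  by (rule exI[of _ N1]) (use oN1 y0 hs fD N(3) in \<open>auto simp: N1_def\<close>)
 have h0: "h (ph p) = \<psi> (f p)" using hy[OF y0] fD(1)[OF y0] inv_into_f_f[OF cC(4) C(2)] by simp
 define N2 where "N2 = N1 \<inter> h -` N'"
 have oN2: "open N2" unfolding N2_def by (rule continuous_open_preimage[OF smo_continuous[OF hs] oN1 N'(1)])
 have kah: "smo N2 (%y. ka' (h y))" by (rule smo_compose[OF N'(4) smo_subset[OF hs] _ oN2 N'(1)]) (auto simp: N2_def)
 have F2: "smo N2 (%y. F (ka y))" by (rule smo_subset[OF Fka]) (auto simp: N2_def N1_def)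
 \<comment> \<open>Both lifts project to the same point, so they differ by a deck transformation and
   \<delta> has integer entries. It is continuous and 0 at \<open>ph p\<close>, and where its norm
   is below 1 it vanishes.\<close>
 define \<delta> where "\<delta> y = fst (ka' (h y)) - fst (F (ka y))" for y
 have "continuous_on N2 \<delta>" unfolding \<delta>_def[abs_def]
  by (intro continuous_on_diff continuous_on_fst smo_continuous[OF kah] smo_continuous[OF F2])
 from continuous_open_preimage[OF this oN2 open_ball[of 0 1]]
 have o3: "open (N2 \<inter> \<delta> -` ball 0 1)" .
 have y3: "ph p \<in> N2 \<inter> \<delta> -` ball 0 1"
  using y0 h0 N'(2) Fx1 unfolding N2_def \<delta>_def x0_def x1_def by simp
 have eq: "ka' (h y) = F (ka y)" if y: "y \<in> N2 \<inter> \<delta> -` ball 0 1" for y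
 proof -
  have y1: "y \<in> N1" "h y \<in> N'" using y by (auto simp: N2_def)
  have "TH (F (ka y)) = TH (ka' (h y))"
   unfolding N'(6)[OF y1(2)] unfolding hy[OF y1(1)] using inv_into_f_f[OF cD(4) fD(2)[OF y1(1)]] by simp
  moreover have "snd (F (ka y)) \<in> S2" using fD(3)[OF y1(1)] by (simp add: mem_Times_iff)
  ultimately obtain i' j' :: int where ij': "ka' (h y) = Fm (of_int i') (of_int j') 0 (F (ka y))"
   using TH_eq[OF _ N'(5)[OF y1(2)]] by blast
  have d: "\<delta> y = (of_int i', of_int j')" unfolding \<delta>_def ij' by (simp add: Fm_def prod_eq_iff)
  have "norm (\<delta> y) < 1" using y by simp
  then have "norm (real_of_int i') < 1" "norm (real_of_int j') < 1"
   using norm_fst_le[of "real_of_int i'" "real_of_int j'"] norm_snd_le[of "real_of_int j'" "real_of_int i'"] unfolding d by linarith+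
  then have "i' = 0" "j' = 0" by simp_all
  then show ?thesis using ij' Fm_0 by simp
 qed
 have k: "pd (pd v h (ph p)) ka' (\<psi> (f p)) = DF (of_int i + a) (of_int j + b) (0 + c - of_int n * of_int j * a) x0 (pd v ka (ph p))" for v
 proof -
  have a: "(ka' has_derivative (%v. pd v ka' (\<psi> (f p)))) (at (h (ph p)))" unfolding h0 by (rule smo_has_pd[OF N'(4,2)])
  have "((%y. ka' (h y)) has_derivative (%v. pd (pd v h (ph p)) ka' (\<psi> (f p)))) (at (ph p))"
   by (rule has_derivative_compose[OF smo_has_pd[OF hs y0] a])
  then have b: "((%y. F (ka y)) has_derivative (%v. pd (pd v h (ph p)) ka' (\<psi> (f p)))) (at (ph p))"
   by (rule has_derivative_transform_within_open[OF _ o3 y3 eq])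
  have "(F has_derivative DF (of_int i + a) (of_int j + b) (0 + c - of_int n * of_int j * a) x0) (at (ka (ph p)))"
   unfolding F_def x0_def[symmetric] by (rule Fm_deriv)
  from has_derivative_unique[OF b has_derivative_compose[OF smo_has_pd[OF N(4,2)] this]]
  show ?thesis by (rule fun_cong)
 qed
 show "Gf (ka (ph p)) (pd v ka (ph p)) (pd w ka (ph p)) =
   Gf (ka' (\<psi> (f p))) (pd (pd v h (ph p)) ka' (\<psi> (f p))) (pd (pd w h (ph p)) ka' (\<psi> (f p)))"
  unfolding k x1_def[symmetric] x0_def[symmetric] Fx1[symmetric] F_def by (rule Gf_inv[symmetric])
qed

text \<open>At each point some local lift is chosen arbitrarily; \<open>gm_eq\<close> shows that
  every lift gives the same value, so one lift can be used on a whole neighbourhood, which gives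
  smoothness.\<close>

definition gm :: "('a, real^4) metric" where
 "gm K p v w = (let ka = SOME ka. li (fst K) (snd K) p ka
   in Gf (ka (snd K p)) (pd v ka (snd K p)) (pd w ka (snd K p)))"

lemma li_ex: assumes "(C, ph) \<in> charts M" "p \<in> C" shows "\<exists>ka. li C ph p ka"
proof -
 obtain x where x: "snd x \<in> S2" "TH x = p" using TH_surj chart_facts(2)[OF M assms(1)] assms(2) by blast
 show ?thesis using li_exists[OF x(1) assms(1)] x(2) assms(2) by blast
qed

lemma gm_some:
 assumes "(C, ph) \<in> charts M" "p \<in> C"
 obtains ka where "li C ph p ka" "!!v w. gm (C, ph) p v w = Gf (ka (ph p)) (pd v ka (ph p)) (pd w ka (ph p))"
 using that[OF someI_ex[OF li_ex[OF assms]]] by (simp add: gm_def Let_def)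

lemma gm_lift:
 assumes C: "(C, ph) \<in> charts M" "p \<in> C" and D: "(D, \<psi>) \<in> charts M" "f p \<in> D"
  and f: "!!x. snd x \<in> S2 ==> f (TH x) = TH (Fm a b c x)"
 shows "gm (C, ph) p v w = gm (D, \<psi>) (f p) (pd v (\<psi> \<circ> f \<circ> inv_into C ph) (ph p)) (pd w (\<psi> \<circ> f \<circ> inv_into C ph) (ph p))"
proof -
 obtain ka where k: "li C ph p ka" "!!v w. gm (C, ph) p v w = Gf (ka (ph p)) (pd v ka (ph p)) (pd w ka (ph p))"
  by (rule gm_some[OF C]) (rule that)
 obtain ka' where k': "li D \<psi> (f p) ka'" "!!v w. gm (D, \<psi>) (f p) v w = Gf (ka' (\<psi> (f p))) (pd v ka' (\<psi> (f p))) (pd w ka' (\<psi> (f p)))"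
  by (rule gm_some[OF D]) (rule that)
 show ?thesis unfolding k(2) k'(2) by (rule lift_in_charts(2)[OF C D k(1) k'(1) f])
qed

lemma gm_eq:
 assumes C: "(C, ph) \<in> charts M" "p \<in> C" and l: "li C ph p ka"
 shows "gm (C, ph) p v w = Gf (ka (ph p)) (pd v ka (ph p)) (pd w ka (ph p))"
proof -
 note cC = chart_facts[OF M C(1)]
 obtain ka0 where k: "li C ph p ka0" "!!v w. gm (C, ph) p v w = Gf (ka0 (ph p)) (pd v ka0 (ph p)) (pd w ka0 (ph p))"
  by (rule gm_some[OF C]) (rule that)
 have i: "pd v (ph \<circ> (%x. x) \<circ> inv_into C ph) (ph p) = v" for v
 proof -
  have "pd v (ph \<circ> (%x. x) \<circ> inv_into C ph) (ph p) = pd v (%y. y) (ph p)"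
   by (rule pd_cong[OF cC(3)]) (use C(2) in \<open>auto simp: f_inv_into_f\<close>)
  also have "\<dots> = v" by (rule pd_eq[OF has_derivative_ident])
  finally show ?thesis .
 qed
 show ?thesis unfolding k(2)
  using lift_in_charts(2)[where f = "%x. x", OF C C k(1) l, of 0 0 0 v w] unfolding Fm_0 i by simp
qed

text \<open>The derivative L of a lift is an isomorphism onto the tangent space of plane times
  sphere. There the form is positive where dy vanishes, being the sum of dx^2 and a squared norm
  that cannot vanish together, and it is negative on the y direction.\<close>

lemma has_signature_gm:
 assumes C: "(C, ph) \<in> charts M" "p \<in> C" shows "has_signature 3 1 (gm (C, ph) p)"
proof -
 note cC = chart_facts[OF M C(1)]
 obtain ka where l: "li C ph p ka" using li_ex[OF C] by blast
 obtain N where N: "open N" "ph p \<in> N" "N \<subseteq> ph ` C" "smo N ka" "!!y. y \<in> N ==> snd (ka y) \<in> S2" "!!y. y \<in> N ==> TH (ka y) = inv_into C ph y"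
  by (rule liE[OF l]) (rule that)
 define x0 where "x0 = ka (ph p)"
 define L where "L v = pd v ka (ph p)" for v
 have L: "(ka has_derivative L) (at (ph p))" unfolding L_def by (rule smo_has_pd[OF N(4,2)])
 have linL: "linear L" by (rule has_derivative_linear[OF L])
 note La = linear_add[OF linL] and Lc = linear_cmul[OF linL]
 have gL: "gm (C, ph) p v w = Gf x0 (L v) (L w)" for v w unfolding gm_eq[OF C l] x0_def L_def ..
 have x0: "snd x0 \<in> S2" "TH x0 \<in> C" unfolding x0_def using N(5,6)[OF N(2)] inv_into_f_f[OF cC(4) C(2)] C(2) by auto
 from TH_smooth[OF x0(1) C(1) x0(2)]
 obtain G where G: "open G" "x0 \<in> G" "\<forall>y\<in>G. snd y \<in> S2 --> TH y \<in> C" "smooth_on (G \<inter> UNIV \<times> S2) (%y. ph (TH y))" by blast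
 have x0G: "x0 \<in> G \<inter> UNIV \<times> S2" using G(2) x0(1) by (simp add: mem_Times_iff)
 obtain W E where W: "open W" "x0 \<in> W" "smo W E" "\<forall>y\<in>(G \<inter> UNIV \<times> S2) \<inter> W. E y = ph (TH y)"
  by (rule smooth_onE[OF G(4) x0G]) (rule that)
 \<comment> \<open>E extends \<open>ph \<circ> TH\<close> to an open set, so
   \<open>E \<circ> ka\<close> is the identity near \<open>ph p\<close> and L has a left
   inverse.\<close>
 have inj: "v = 0" if v: "L v = 0" for v
 proof -
  have o: "open (N \<inter> ka -` (G \<inter> W))" by (rule continuous_open_preimage[OF smo_continuous[OF N(4)] N(1) open_Int[OF G(1) W(1)]])
  have y0: "ph p \<in> N \<inter> ka -` (G \<inter> W)" using N(2) G(2) W(2) by (simp add: x0_def)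
  have "(E has_derivative (%v. pd v E x0)) (at (ka (ph p)))" unfolding x0_def[symmetric] by (rule smo_has_pd[OF W(3,2)])
  from has_derivative_compose[OF L this]
  have "((%y. E (ka y)) has_derivative (%v. pd (L v) E x0)) (at (ph p))" .
  then have "((%y. y) has_derivative (%v. pd (L v) E x0)) (at (ph p))"
  proof (rule has_derivative_transform_within_open[OF _ o y0])
   fix y assume y: "y \<in> N \<inter> ka -` (G \<inter> W)"
   then have "ka y \<in> (G \<inter> UNIV \<times> S2) \<inter> W" using N(5)[of y] by (simp add: mem_Times_iff)
   then have "E (ka y) = ph (inv_into C ph y)" using W(4) N(6)[of y] y by simp
   then show "E (ka y) = y" using f_inv_into_f[of y ph C] N(3) y by auto
  qed
  from fun_cong[OF has_derivative_unique[OF this has_derivative_ident], of v]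
  have "pd 0 E x0 = v" unfolding v .
  moreover have "pd 0 E x0 = 0" using linear_0[OF has_derivative_linear[OF smo_has_pd[OF W(3,2)]]] .
  ultimately show "v = 0" by simp
 qed
 have injL: "inj L" unfolding linear_injective_0[OF linL] using inj by blast
 \<comment> \<open>The tangent space at x0, of dimension 4; the injective map L takes values in it
   and so fills it, which yields a preimage v0 of the unit vector in y.\<close>
 define T where "T = {x :: (real \<times> real) \<times> (real^3). (0, snd x0) \<bullet> x = 0}"
 have tan: "L v \<in> T" for v
 proof -
  have "((%y. snd (ka y) \<bullet> snd (ka y)) has_derivative (%v. snd x0 \<bullet> snd (L v) + snd (L v) \<bullet> snd x0)) (at (ph p))"
   unfolding x0_def by (rule has_derivative_inner[OF has_derivative_snd[OF L] has_derivative_snd[OF L]])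
  then have "((%y. 1 :: real) has_derivative (%v. snd x0 \<bullet> snd (L v) + snd (L v) \<bullet> snd x0)) (at (ph p))"
   by (rule has_derivative_transform_within_open[OF _ N(1,2)]) (use N(5) in \<open>simp add: dot_square_norm\<close>)
  from fun_cong[OF has_derivative_unique[OF this has_derivative_const], of v]
  have "snd x0 \<bullet> snd (L v) = 0" by (simp add: inner_commute)
  then show ?thesis by (simp add: T_def inner_prod_def)
 qed
 have "snd x0 ~= 0" using x0(1) by auto
 then have nz: "(0 :: real \<times> real, snd x0) ~= 0" by (simp add: zero_prod_def)
 have dT: "dim T = 4" unfolding T_def using dim_hyperplane[OF nz] by simp
 have "dim (range L) = DIM(real^4)" using dim_image_eq[OF linL, of UNIV] injL by (simp add: inj_on_subset)
 then have "range L = T"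
  by (intro subspace_dim_equal linear_subspace_image[OF linL] subspace_UNIV)
    (use tan dT in \<open>auto simp: T_def subspace_hyperplane\<close>)
 moreover have "((0, 1), 0) \<in> T" by (simp add: T_def inner_prod_def)
 ultimately obtain v0 where v0: "L v0 = ((0, 1), 0)" by (metis imageE)
 define P where "P = {v. snd (fst (L v)) = 0}"
 have q: "linear (%v. snd (fst (L v)))" by (rule linearI) (simp_all add: La Lc)
 then have "snd (fst (L v)) = adjoint (%v. snd (fst (L v))) 1 \<bullet> v" for v
  using adjoint_works[OF q, of v 1] by (simp add: inner_commute)
 then obtain u where u: "!!v. snd (fst (L v)) = u \<bullet> v" by blast
 have "u \<bullet> v0 = 1" using u[of v0] v0 by simp
 then have "u ~= 0" by auto
 then have P: "subspace P" "dim P = 3" using dim_hyperplane[of u] subspace_hyperplane[of u] by (simp_all add: P_def u)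
 have "v0 ~= 0" using v0 linear_0[OF linL] by (auto simp: zero_prod_def)
 then have Nn: "subspace (span {v0})" "dim (span {v0}) = 1" by (simp_all add: subspace_span dim_eq_card_independent)
 have bil: "bilinear (gm (C, ph) p)"
  unfolding bilinear_def gL[abs_def]
  by (intro conjI allI linearI) (simp_all add: Gf_def La Lc inner_add_left inner_add_right algebra_simps)
 have sym: "gm (C, ph) p v w = gm (C, ph) p w v" for v w unfolding gL by (simp add: Gf_def inner_commute mult.commute)
 have pos: "gm (C, ph) p v v > 0" if v: "v \<in> P - {0}" for v
 proof -
  define a k where "a = fst (fst (L v))" and "k = snd (L v) + (2 * pi * of_int n * snd (fst x0) * a) *\<^sub>R jj (snd x0)"
  have b: "snd (fst (L v)) = 0" using v by (simp add: P_def)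
  have e: "gm (C, ph) p v v = a * a + k \<bullet> k" unfolding gL Gf_def b k_def a_def by simp
  have "\<not> (a = 0 & k = 0)"
  proof
   assume ak: "a = 0 & k = 0"
   then have a0: "a = 0" and k0: "k = 0" by auto
   have "k = snd (L v)" unfolding k_def a0 by simp
   then have "L v = 0" using k0 a0 b by (simp add: a_def prod_eq_iff)
   then show False using inj[of v] v by simp
  qed
  then show ?thesis unfolding e by (metis add_nonneg_pos add_pos_nonneg inner_ge_zero inner_gt_zero_iff not_real_square_gt_zero zero_le_square)
 qed
 have neg: "gm (C, ph) p v v < 0" if v: "v \<in> span {v0} - {0}" for v
 proof -
  obtain c where c: "v = c *\<^sub>R v0" using v by (auto simp: span_singleton)
  then have "c ~= 0" using v by auto
  moreover have "gm (C, ph) p v v = - (c * c)" unfolding gL Gf_def c Lc v0 by simp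
  ultimately show ?thesis using not_real_square_gt_zero[of c] by linarith
 qed
 show ?thesis unfolding has_signature_def
 proof (intro conjI allI bil sym)
  show "\<exists>P N. subspace P & dim P = 3 & (\<forall>v\<in>P - {0}. gm (C, ph) p v v > 0) &
      subspace N & dim N = 1 & (\<forall>v\<in>N - {0}. gm (C, ph) p v v < 0)"
   by (rule exI[of _ P], rule exI[of _ "span {v0}"]) (use P Nn pos neg in blast)
 qed simp
qed

lemma Lorentz_gm: "Lorentz_metric M gm"
 unfolding Lorentz_metric_def pseudo_Riemannian_metric_def
proof (intro conjI ballI allI; clarify)
 fix C ph p assume "(C, ph) \<in> charts M" "p \<in> C"
 then show "has_signature 3 1 (gm (C, ph) p)" by (rule has_signature_gm)
next
 fix C ph and v w :: "real^4" assume C: "(C, ph) \<in> charts M"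
 note cC = chart_facts[OF M C]
 show "smooth_on (ph ` C) (%y. gm (C, ph) (inv_into C ph y) v w)"
  unfolding smooth_on_open_iff[OF cC(3)]
 proof (rule smo_local)
  fix y assume "y \<in> ph ` C"
  then obtain p where p: "p \<in> C" "y = ph p" by blast
  obtain ka where l: "li C ph p ka" using li_ex[OF C p(1)] by blast
  obtain N where N: "open N" "ph p \<in> N" "N \<subseteq> ph ` C" "smo N ka" "!!y. y \<in> N ==> snd (ka y) \<in> S2" "!!y. y \<in> N ==> TH (ka y) = inv_into C ph y"
   by (rule liE[OF l]) (rule that)
  have jjs: "smo N (%y. jj (snd (ka y)))" by (rule smo_linear[OF bounded_linear_jj smo_linear[OF bounded_linear_snd N(4,1)] N(1)])
  have "smo N (%y. Gf (ka y) (pd v ka y) (pd w ka y))" unfolding Gf_def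
   by (intro smo_intros N(1,4) smo_pd[OF N(4)] jjs)
  then have "smo N (%y. gm (C, ph) (inv_into C ph y) v w)"
  proof (rule smo_transform[OF _ N(1)])
   fix y assume y: "y \<in> N"
   then have i: "inv_into C ph y \<in> C" "ph (inv_into C ph y) = y" using N(3) by (auto intro: inv_into_into f_inv_into_f)
   have "li C ph (inv_into C ph y) ka" unfolding li_def i(2) by (rule exI[of _ N]) (use N y in blast)
   from gm_eq[OF C i(1) this] show "gm (C, ph) (inv_into C ph y) v w = Gf (ka y) (pd v ka y) (pd w ka y)" unfolding i(2) .
  qed
  then show "\<exists>W. open W & y \<in> W & smo W (%y. gm (C, ph) (inv_into C ph y) v w)" using N(1,2) p(2) by blast
 qed
next
 fix C ph D \<psi> p assume C: "(C, ph) \<in> charts M" and D: "(D, \<psi>) \<in> charts M" and p: "p \<in> C" "p \<in> D"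
 show "let D' = frechet_derivative (\<psi> \<circ> inv_into C ph) (at (ph p))
  in \<forall>v w. gm (C, ph) p v w = gm (D, \<psi>) p (D' v) (D' w)"
  using gm_lift[where f = "%x. x", OF C p(1) D p(2), of 0 0 0] Fm_0 by (simp add: Let_def o_def)
qed

lemma smooth_map_lift:
 assumes f: "!!x. snd x \<in> S2 ==> f (TH x) = TH (Fm a b c x)"
 shows "smooth_map M M f"
proof -
 have loc: "\<exists>N. open N & ph p \<in> N & N \<subseteq> ph ` C & smo N (\<psi> \<circ> f \<circ> inv_into C ph) & (\<forall>y\<in>N. f (inv_into C ph y) \<in> D)"
  if C: "(C, ph) \<in> charts M" "p \<in> C" and D: "(D, \<psi>) \<in> charts M" "f p \<in> D" for C ph D \<psi> p
 proof -
  obtain ka where k: "li C ph p ka" using li_ex[OF C] by blast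
  obtain ka' where k': "li D \<psi> (f p) ka'" using li_ex[OF D] by blast
  show ?thesis by (rule lift_in_charts(1)[OF C D k k' f])
 qed
 have fM: "f p \<in> points M" if pM: "p \<in> points M" for p
 proof -
  obtain x where x: "snd x \<in> S2" "TH x = p" using TH_surj[OF pM] by blast
  have "snd (Fm a b c x) \<in> S2" using x(1) by (simp only: Fm_S2)
  then show ?thesis using f[OF x(1)] x(2) TH_points(1) by metis
 qed
 have cov: "\<exists>C ph. (C, ph) \<in> charts M & p \<in> C" if "p \<in> points M" for p
  using M that unfolding smooth_manifold_def by blast
 show ?thesis unfolding smooth_map_def
 proof (intro conjI ballI; clarify?)
  show "continuous_map (mtop M) (mtop M) f" unfolding continuous_map_def
  proof (intro conjI allI impI)
   fix W assume W: "openin (mtop M) W"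
   show "openin (mtop M) {p \<in> points M. f p \<in> W}"
   proof (subst openin_subopen, intro ballI)
    fix p assume p: "p \<in> {p \<in> points M. f p \<in> W}"
    obtain C ph where C: "(C, ph) \<in> charts M" "p \<in> C" using cov p by blast
    obtain D \<psi> where D: "(D, \<psi>) \<in> charts M" "f p \<in> D" using cov fM p by blast
    note cC = chart_facts[OF M C(1)] and cD = chart_facts[OF M D(1)]
    from loc[OF C D] obtain N where N: "open N" "ph p \<in> N" "smo N (\<psi> \<circ> f \<circ> inv_into C ph)" "\<forall>y\<in>N. f (inv_into C ph y) \<in> D" by blast
    have o: "open (\<psi> ` (D \<inter> W))" by (rule cD(5)) (use cD(1) W in auto)
    define N' where "N' = N \<inter> (\<psi> \<circ> f \<circ> inv_into C ph) -` (\<psi> ` (D \<inter> W))"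
    have "open N'" unfolding N'_def by (rule continuous_open_preimage[OF smo_continuous[OF N(3)] N(1) o])
    from cC(6)[OF this] have "openin (mtop M) {q \<in> C. ph q \<in> N'}" .
    moreover have "p \<in> {q \<in> C. ph q \<in> N'}" using C(2) N(2) D(2) p inv_into_f_f[OF cC(4) C(2)] by (auto simp: N'_def)
    moreover have "{q \<in> C. ph q \<in> N'} \<subseteq> {p \<in> points M. f p \<in> W}"
    proof
     fix q assume "q \<in> {q \<in> C. ph q \<in> N'}"
     then have q: "q \<in> C" "f q \<in> D" "\<psi> (f q) \<in> \<psi> ` (D \<inter> W)" using N(4) inv_into_f_f[OF cC(4), of q] by (auto simp: N'_def)
     then have "f q \<in> W" using inj_onD[OF cD(4)] by blast
     then show "q \<in> {p \<in> points M. f p \<in> W}" using q(1) cC(2) by blast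
    qed
    ultimately show "\<exists>T. openin (mtop M) T & p \<in> T & T \<subseteq> {p \<in> points M. f p \<in> W}" by blast
   qed
  qed (use fM in auto)
 next
  fix C ph D \<psi> assume C: "(C, ph) \<in> charts M" and D: "(D, \<psi>) \<in> charts M"
  show "smooth_on (ph ` {p \<in> C. f p \<in> D}) (\<psi> \<circ> f \<circ> inv_into C ph)"
  proof (rule smooth_on_local)
   fix y assume "y \<in> ph ` {p \<in> C. f p \<in> D}"
   then obtain p where p: "p \<in> C" "f p \<in> D" "y = ph p" by blast
   from loc[OF C p(1) D p(2)] obtain N where N: "open N" "ph p \<in> N" "smo N (\<psi> \<circ> f \<circ> inv_into C ph)" by blast
   have "smooth_on (ph ` {p \<in> C. f p \<in> D} \<inter> N) (\<psi> \<circ> f \<circ> inv_into C ph)" by (rule smo_smooth_on[OF N(3,1)]) auto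
   then show "\<exists>W. open W & y \<in> W & smooth_on (ph ` {p \<in> C. f p \<in> D} \<inter> W) (\<psi> \<circ> f \<circ> inv_into C ph)" using N(1,2) p(3) by blast
  qed
 qed
qed

lemma isometry_lift:
 assumes f: "!!x. snd x \<in> S2 ==> f (TH x) = TH (Fm a b c x)"
  and f': "!!x. snd x \<in> S2 ==> inv_into (points M) f (TH x) = TH (Fm a' b' c' x)" and bij: "bij_betw f (points M) (points M)"
 shows "isometry M gm f"
 unfolding isometry_def diffeomorphism_def
proof (intro conjI ballI bij smooth_map_lift[OF f] smooth_map_lift[OF f']; clarify?)
 fix C ph D \<psi> p assume C: "(C, ph) \<in> charts M" and D: "(D, \<psi>) \<in> charts M" and p: "p \<in> C" "f p \<in> D"
 show "let D' = frechet_derivative (\<psi> \<circ> f \<circ> inv_into C ph) (at (ph p))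
  in \<forall>v w. gm (C, ph) p v w = gm (D, \<psi>) (f p) (D' v) (D' w)"
  using gm_lift[OF C p(1) D p(2) f] by (simp add: Let_def)
qed

end

section \<open>A finite Heisenberg group of isometries\<close>

text \<open>The i with h i in A form a subgroup of the integers that contains p but not 1, so by
  Bezout it contains no i prime to p. Hence the cosets of h 0, ..., h (p - 1) are distinct.\<close>

lemma (in group) prime_le_card_rcosets:
 assumes A: "subgroup A G" and fin: "finite (carrier G)"
  and h: "!!i :: int. h i \<in> carrier G" "!!i j. h (i + j) = h i \<otimes> h j"
  and p: "prime p" "h (int p) = \<one>" "h 1 \<notin> A"
 shows "p <= card (rcosets A)"
proof -
 interpret A: subgroup A G by (rule A)
 have h0: "h 0 = \<one>" using h(2)[of 0 0] h(1)[of 0] by (metis add_0 l_cancel_one)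
 have hm: "h (- i) = inv (h i)" for i
  using h(2)[of "- i" i] h0 by (intro inv_equality[symmetric]) (simp_all add: h(1))
 define S where "S = {i. h i \<in> A}"
 have S: "0 \<in> S" "i \<in> S ==> j \<in> S ==> i + j \<in> S" "i \<in> S ==> - i \<in> S" for i j
  by (simp_all add: S_def h0 h(2) hm)
 have Sm: "i * m \<in> S" if "i \<in> S" for i m
 proof (induct m rule: int_induct[of _ 0])
  case (step1 m) then show ?case using S(2)[OF step1(2) that] by (simp add: distrib_left)
 next
  case (step2 m) then show ?case using S(2)[OF step2(2) S(3)[OF that]] by (simp add: right_diff_distrib)
 qed (simp add: S(1))
 have pS: "int p \<in> S" by (simp add: S_def p(2))
 have "inj_on (%i. A #> h i) {0..<int p}"
 proof (rule inj_onI, rule ccontr)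
  fix i j assume ij: "i \<in> {0..<int p}" "j \<in> {0..<int p}" "A #> h i = A #> h j" "i ~= j"
  have "h i \<in> A #> h j" using rcos_self[OF h(1) A, of i] ij(3) by simp
  then obtain a where a: "a \<in> A" "h i = a \<otimes> h j" by (auto simp: r_coset_def)
  have "h (i - j) = a \<otimes> h j \<otimes> inv (h j)" using h(2)[of i "- j"] a(2) hm by simp
  also have "\<dots> = a" using a(1) h(1)[of j] by (simp add: m_assoc)
  finally have d: "i - j \<in> S" using a(1) by (simp add: S_def)
  have "\<bar>i - j\<bar> < int p" using ij(1,2) by auto
  then have "\<not> int p dvd i - j" using ij(4) dvd_imp_le_int[of "i - j" "int p"] by auto
  moreover have "prime (int p)" using p(1) by simp
  ultimately have "coprime (int p) (i - j)" by (intro prime_imp_coprime)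
  then obtain u v where "u * int p + v * (i - j) = 1" using bezout_int[of "int p" "i - j"] by (auto simp: coprime_iff_gcd_eq_1)
  then have "int p * u + (i - j) * v = 1" by (simp add: mult.commute)
  then have "1 \<in> S" using S(2)[OF Sm[OF pS, of u] Sm[OF d, of v]] by simp
  then show False using p(3) by (simp add: S_def)
 qed
 then have "card ((%i. A #> h i) ` {0..<int p}) = p" by (simp add: card_image)
 moreover have "(%i. A #> h i) ` {0..<int p} \<subseteq> rcosets A" using rcosetsI[OF A.subset h(1)] by blast
 moreover have "finite (rcosets A)" using fin by (simp add: RCOSETS_def)
 ultimately show ?thesis by (metis card_mono)
qed

text \<open>That p divides n lets the p-th roots descend; that p does not divide k keeps them from
  commuting.\<close>

locale heisenberg = twisted +
 fixes p :: nat and k :: int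
 assumes p: "prime p" and n: "n = k * int p" and k: "\<not> int p dvd k"
begin

lemma p0: "real p > 0" using prime_gt_0_nat[OF p] by simp

text \<open>Words in the p-th roots of the deck generators. The unit of c is k / p of a turn because
  the commutator of the two roots is, up to sign, the rotation by n / p^2.\<close>

definition Fa :: "int => int => int => (real \<times> real) \<times> (real^3) => (real \<times> real) \<times> (real^3)" where
 "Fa a b c = Fm (of_int a / p) (of_int b / p) (of_int (k * c) / p)"

lemma Fm_int: "Fm a b (c + of_int m) x = Fm a b c x"
proof -
 have "rot (c + of_int m - t) q = rot (c - t) q" for t q
  using rot_add[of "c - t" "of_int m" q] rot_int[of m q] by (simp add: algebra_simps)
 then show ?thesis by (simp add: Fm_def)
qed

lemma Fa_S2: "snd x \<in> S2 ==> snd (Fa a b c x) \<in> S2" unfolding Fa_def Fm_S2 .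

lemma Fa_Fa: "Fa a b c (Fa a' b' c' x) = Fa (a + a') (b + b') (c + c' - b * a') x"
proof -
 have "of_int (k * c) / p + of_int (k * c') / p - of_int n * (of_int b / p) * (of_int a' / p) = of_int (k * (c + c' - b * a')) / real p"
  using p0 by (simp add: n field_simps)
 then show ?thesis unfolding Fa_def Fm_Fm by (simp add: add_divide_distrib)
qed

text \<open>The p-th powers of the roots are deck transformations, and p units of c are an integer
  number of turns; finiteness of the group rests on this.\<close>

lemma Fa_mod: assumes x: "snd x \<in> S2"
 shows "TH (Fa (a + int p * i) (b + int p * j) (c + int p * l) x) = TH (Fa a b c x)"
proof -
 have e: "of_int (a + int p * i) / real p = of_int i + of_int a / p" for a i using p0 by (simp add: field_simps)
 have "of_int (k * (c + int p * l)) / real p = (0 + of_int (k * c) / p - of_int n * of_int j * (of_int a / p)) + of_int (k * l + k * j * a)"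
  using p0 by (simp add: n field_simps)
 then have "Fa (a + int p * i) (b + int p * j) (c + int p * l) x = Fm (of_int i) (of_int j) 0 (Fa a b c x)"
  unfolding Fa_def Fm_Fm e by (simp only: Fm_int)
 then show ?thesis using TH_deck[OF Fa_S2[OF x]] by simp
qed

text \<open>Moving a deck transformation past Fa costs rotations by n b i / p and n j a / p, which
  are integers because p divides n. So Fa maps deck orbits to deck orbits and descends.\<close>

lemma Fa_deck: assumes x: "snd x \<in> S2"
 shows "TH (Fa a b c (Fm (of_int i) (of_int j) 0 x)) = TH (Fa a b c x)"
proof -
 have E: "of_int (k * c) / real p + 0 - of_int n * (of_int b / real p) * of_int i =
   (0 + of_int (k * c) / p - of_int n * of_int j * (of_int a / p)) + of_int (k * j * a - k * b * i)"
  using p0 by (simp add: n field_simps)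
 have "Fa a b c (Fm (of_int i) (of_int j) 0 x) = Fm (of_int i) (of_int j) 0 (Fa a b c x)"
  unfolding Fa_def Fm_Fm E Fm_int by (simp only: add.commute)
 then show ?thesis using TH_deck[OF Fa_S2[OF x]] by simp
qed

text \<open>The chosen preimage is immaterial by \<open>Fa_deck\<close>; the restriction is there
  because members of \<open>Bij\<close> are extensional.\<close>

definition ff :: "int => int => int => 'a => 'a" where
 "ff a b c = restrict (%r. TH (Fa a b c (SOME x. snd x \<in> S2 & TH x = r))) (points M)"

lemma ff_TH: assumes x: "snd x \<in> S2" shows "ff a b c (TH x) = TH (Fa a b c x)"
proof -
 define y where "y = (SOME y. snd y \<in> S2 & TH y = TH x)"
 have y: "snd y \<in> S2 & TH y = TH x" unfolding y_def by (rule someI[of _ x]) (use x in simp)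
 then obtain i j :: int where "x = Fm (of_int i) (of_int j) 0 y" using TH_eq[of y x] x by blast
 then have "TH (Fa a b c x) = TH (Fa a b c y)" using Fa_deck y by simp
 then show ?thesis using TH_points(1)[OF x] by (simp add: ff_def y_def)
qed

lemma ff_ext: "ff a b c \<in> extensional (points M)" by (simp add: ff_def)

lemma ff_eqI: assumes "f \<in> extensional (points M)" "!!x. snd x \<in> S2 ==> f (TH x) = TH (Fa a b c x)"
 shows "f = ff a b c"
proof (rule extensionalityI[OF assms(1) ff_ext])
 fix r assume "r \<in> points M"
 then obtain x where "snd x \<in> S2" "TH x = r" using TH_surj by blast
 then show "f r = ff a b c r" using assms(2) ff_TH by metis
qed

lemma ff_points: assumes "r \<in> points M" shows "ff a b c r \<in> points M"
proof -
 obtain x where x: "snd x \<in> S2" "TH x = r" using TH_surj[OF assms] by blast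
 show ?thesis using ff_TH[OF x(1), of a b c] x(2) TH_points(1)[OF Fa_S2[OF x(1)]] by simp
qed

lemma ff_ff: assumes "r \<in> points M" shows "ff a b c (ff a' b' c' r) = ff (a + a') (b + b') (c + c' - b * a') r"
proof -
 obtain x where x: "snd x \<in> S2" "TH x = r" using TH_surj[OF assms] by blast
 show ?thesis unfolding x(2)[symmetric] ff_TH[OF x(1)] ff_TH[OF Fa_S2[OF x(1)]] Fa_Fa ..
qed

lemma ff_0: "ff 0 0 0 = (\<lambda>r\<in>points M. r)"
 by (rule ff_eqI[symmetric]) (auto simp: Fa_def Fm_0 TH_points(1))

text \<open>The correction - a * b cancels the cocycle term of the product.\<close>

lemma ff_inv: assumes "r \<in> points M"
 shows "ff (- a) (- b) (- c - a * b) (ff a b c r) = r" "ff a b c (ff (- a) (- b) (- c - a * b) r) = r"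
 using ff_ff[OF assms] ff_0 assms by (simp_all add: mult.commute)

lemma ff_bij: "bij_betw (ff a b c) (points M) (points M)"
 by (rule bij_betw_byWitness[where f' = "ff (- a) (- b) (- c - a * b)"]) (auto simp: ff_inv ff_points)

lemma ff_isometry: "isometry M gm (ff a b c)"
proof (rule isometry_lift[OF _ _ ff_bij])
 show "ff a b c (TH x) = TH (Fm (of_int a / p) (of_int b / p) (of_int (k * c) / p) x)" if "snd x \<in> S2" for x
  using ff_TH[OF that] unfolding Fa_def .
 show "inv_into (points M) (ff a b c) (TH x) = TH (Fm (of_int (- a) / p) (of_int (- b) / p) (of_int (k * (- c - a * b)) / p) x)"
  if x: "snd x \<in> S2" for x
 proof -
  have "inv_into (points M) (ff a b c) (TH x) = ff (- a) (- b) (- c - a * b) (TH x)"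
   by (rule inv_into_f_eq[OF bij_betw_imp_inj_on[OF ff_bij]]) (simp_all add: ff_points ff_inv TH_points(1)[OF x])
  then show ?thesis unfolding ff_TH[OF x] Fa_def .
 qed
qed

definition GG :: "('a => 'a) set" where "GG = {ff a b c | a b c. True}"

lemma ff_GG [simp]: "ff a b c \<in> GG" unfolding GG_def by blast

lemma ff_Bij: "ff a b c \<in> Bij (points M)" unfolding Bij_def using ff_ext ff_bij by blast

lemma ff_mult: "ff a b c \<otimes>\<^bsub>BijGroup (points M)\<^esub> ff a' b' c' = ff (a + a') (b + b') (c + c' - b * a')"
proof -
 have "compose (points M) (ff a b c) (ff a' b' c') = ff (a + a') (b + b') (c + c' - b * a')"
 proof (rule extensionalityI[OF compose_extensional ff_ext])
  fix r assume "r \<in> points M"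
  then show "compose (points M) (ff a b c) (ff a' b' c') r = ff (a + a') (b + b') (c + c' - b * a') r"
   using ff_ff by (simp add: compose_eq)
 qed
 then show ?thesis using ff_Bij by (simp add: BijGroup_def)
qed

lemma finite_GG: "finite GG"
proof -
 have e: "ff a b c = ff (a mod int p) (b mod int p) (c mod int p)" for a b c
 proof (rule ff_eqI[OF ff_ext])
  fix x :: "(real \<times> real) \<times> (real^3)" assume x: "snd x \<in> S2"
  have "m mod int p + int p * (m div int p) = m" for m by (rule mod_mult_div_eq)
  then show "ff a b c (TH x) = TH (Fa (a mod int p) (b mod int p) (c mod int p) x)"
   using Fa_mod[OF x, of "a mod int p" "a div int p" "b mod int p" "b div int p" "c mod int p" "c div int p"] ff_TH[OF x] by simp
 qed
 have m: "m mod int p \<in> {0..<int p}" for m using prime_gt_0_nat[OF p] by simp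
 have "GG \<subseteq> (%(a, b, c). ff a b c) ` ({0..<int p} \<times> {0..<int p} \<times> {0..<int p})"
 proof
  fix f assume "f \<in> GG"
  then obtain a b c where "f = ff a b c" unfolding GG_def by blast
  then have "f = (%(a, b, c). ff a b c) (a mod int p, b mod int p, c mod int p)" using e[of a b c] by simp
  then show "f \<in> (%(a, b, c). ff a b c) ` ({0..<int p} \<times> {0..<int p} \<times> {0..<int p})"
   by (rule image_eqI) (use m in \<open>simp del: atLeastLessThan_iff\<close>)
 qed
 then show ?thesis by (rule finite_subset) simp
qed

lemma one_GG: "\<one>\<^bsub>BijGroup (points M)\<^esub> = ff 0 0 0" by (simp add: BijGroup_def ff_0)

lemma ff_m_inv: "ff (- a) (- b) (- c - a * b) \<otimes>\<^bsub>BijGroup (points M)\<^esub> ff a b c = \<one>\<^bsub>BijGroup (points M)\<^esub>"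
 unfolding ff_mult one_GG by (simp add: mult.commute)

lemma subgroup_GG: "subgroup GG (BijGroup (points M))"
proof (rule group.subgroupI[OF group_BijGroup])
 show "GG \<subseteq> carrier (BijGroup (points M))" using ff_Bij by (auto simp: GG_def BijGroup_def)
 show "GG ~= {}" by (auto simp: GG_def)
next
 fix f f' assume f: "f \<in> GG" "f' \<in> GG"
 obtain a b c where a: "f = ff a b c" using f(1) unfolding GG_def by blast
 obtain a' b' c' where a': "f' = ff a' b' c'" using f(2) unfolding GG_def by blast
 show "f \<otimes>\<^bsub>BijGroup (points M)\<^esub> f' \<in> GG" unfolding a a' ff_mult by (rule ff_GG)
next
 fix f assume "f \<in> GG"
 then obtain a b c where f: "f = ff a b c" by (auto simp: GG_def)
 have "inv\<^bsub>BijGroup (points M)\<^esub> f = ff (- a) (- b) (- c - a * b)"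
  unfolding f by (rule group.inv_equality[OF group_BijGroup ff_m_inv]) (use ff_Bij in \<open>simp_all add: BijGroup_def\<close>)
 then show "inv\<^bsub>BijGroup (points M)\<^esub> f \<in> GG" by simp
qed

text \<open>An inverse in \<open>isometry_group\<close> is sought in a smaller carrier, so it has to
  be identified with the inverse in \<open>BijGroup\<close> before closure can be
  transferred.\<close>

lemma subgroup_GG_isometry: "subgroup GG (isometry_group M gm)"
proof -
 let ?B = "BijGroup (points M)" and ?I = "isometry_group M gm"
 interpret B: group ?B by (rule group_BijGroup)
 interpret S: subgroup GG ?B by (rule subgroup_GG)
 have sub: "GG \<subseteq> carrier ?I" using ff_Bij ff_isometry by (auto simp: GG_def isometry_group_def)
 have IB: "carrier ?I \<subseteq> carrier ?B" by (auto simp: isometry_group_def BijGroup_def)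
 have m: "f \<otimes>\<^bsub>?I\<^esub> f' = f \<otimes>\<^bsub>?B\<^esub> f'" "\<one>\<^bsub>?I\<^esub> = \<one>\<^bsub>?B\<^esub>" for f f' by (simp_all add: isometry_group_def)
 have i: "inv\<^bsub>?I\<^esub> f = inv\<^bsub>?B\<^esub> f" if f: "f \<in> GG" for f
  unfolding m_inv_def[of ?I] m
 proof (rule the_equality)
  show "inv\<^bsub>?B\<^esub> f \<in> carrier ?I & f \<otimes>\<^bsub>?B\<^esub> inv\<^bsub>?B\<^esub> f = \<one>\<^bsub>?B\<^esub> & inv\<^bsub>?B\<^esub> f \<otimes>\<^bsub>?B\<^esub> f = \<one>\<^bsub>?B\<^esub>"
   using sub S.m_inv_closed[OF f] S.mem_carrier[OF f] by (auto simp: B.r_inv B.l_inv)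
  fix y assume "y \<in> carrier ?I & f \<otimes>\<^bsub>?B\<^esub> y = \<one>\<^bsub>?B\<^esub> & y \<otimes>\<^bsub>?B\<^esub> f = \<one>\<^bsub>?B\<^esub>"
  then show "y = inv\<^bsub>?B\<^esub> f" using B.inv_equality[of y f] S.mem_carrier[OF f] IB by auto
 qed
 show ?thesis
  by (rule subgroup.intro) (use sub i S.m_inv_closed S.m_closed S.one_closed in \<open>auto simp: m\<close>)
qed

text \<open>These are the two products of the generators. On a point of the equator they differ by
  the rotation by - k / p, which fixes that point only if p divides k.\<close>

lemma ff_neq: "ff 1 1 0 ~= ff 1 1 (-1)"
proof
 assume ne: "ff 1 1 0 = ff 1 1 (-1)"
 define q :: "real^3" where "q = axis 1 1"
 have q: "q \<in> S2" "q $ 1 = 1" "q $ 2 = 0" by (simp add: q_def, simp_all add: q_def axis_def)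
 let ?z = "(of_int 1 / real p, of_int 1 / real p)" and ?r = "rot (of_int (k * (-1)) / p) q"
 have "TH (Fa 1 1 0 ((0, 0), q)) = TH (Fa 1 1 (-1) ((0, 0), q))" using ff_TH[of "((0, 0), q)"] q(1) ne by (metis snd_conv)
 then have "Th ?z q = Th ?z ?r" by (simp add: TH_def Fa_def Fm_def)
 moreover have "?r \<in> S2" using q(1) by (simp only: rot_S2)
 ultimately have "q = ?r" using bij_betw_imp_inj_on[OF good_fibre[OF g UNIV_I, of ?z]] q(1) by (meson inj_onD)
 then have "q $ 1 = ?r $ 1" by simp
 then have "cos (2 * pi * (of_int (k * (-1)) / p)) = 1" unfolding rot_nth q by simp
 then obtain m :: int where "2 * pi * (of_int (k * (-1)) / p) = of_int m * 2 * pi" unfolding cos_one_2pi_int by blast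
 then have "2 * pi * (of_int (k * (-1)) / p) = 2 * pi * of_int m" by (simp only: mult_ac)
 then have "of_int (k * (-1)) / real p = of_int m" by (rule mult_left_cancel[THEN iffD1, rotated]) simp
 then have "of_int (k * (-1)) = of_int m * real p" by (rule nonzero_divide_eq_eq[THEN iffD1, rotated]) (use p0 in simp)
 then have "of_int (- k) = (of_int (m * int p) :: real)" by simp
 then have e: "- k = m * int p" by (simp only: of_int_eq_iff)
 have "int p dvd - k" unfolding e by (rule dvd_triv_right)
 then show False using k by simp
qed

theorem large_index:
 assumes A: "subgroup A (isometry_group M gm \<lparr>carrier := GG\<rparr>)" and c: "comm_group (isometry_group M gm \<lparr>carrier := A\<rparr>)"
 shows "p <= subgroup_index (isometry_group M gm \<lparr>carrier := GG\<rparr>) A"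
proof -
 define G where "G = BijGroup (points M) \<lparr>carrier := GG\<rparr>"
 have e: "isometry_group M gm \<lparr>carrier := X\<rparr> = BijGroup (points M) \<lparr>carrier := X\<rparr>" for X by (simp add: isometry_group_def)
 interpret G: group G unfolding G_def by (rule subgroup.subgroup_is_group[OF subgroup_GG group_BijGroup])
 have A': "subgroup A G" using A unfolding e G_def .
 have cG: "carrier G = GG" "\<one>\<^bsub>G\<^esub> = ff 0 0 0" "ff a b c \<otimes>\<^bsub>G\<^esub> ff a' b' c' = ff (a + a') (b + b') (c + c' - b * a')" for a b c a' b' c'
  unfolding G_def using one_GG ff_mult by simp_all
 have fin: "finite (carrier G)" unfolding cG by (rule finite_GG)
 have "ff 1 0 0 \<notin> A \<or> ff 0 1 0 \<notin> A"
 proof (rule ccontr)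
  assume "\<not> ?thesis"
  then have "ff 1 0 0 \<in> A" "ff 0 1 0 \<in> A" by auto
  then have "ff 1 0 0 \<otimes>\<^bsub>BijGroup (points M)\<^esub> ff 0 1 0 = ff 0 1 0 \<otimes>\<^bsub>BijGroup (points M)\<^esub> ff 1 0 0"
   using comm_monoid.m_comm[OF comm_group.axioms(1)[OF c[unfolded e]], of "ff 1 0 0" "ff 0 1 0"] by simp
  then show False using ff_neq unfolding ff_mult by simp
 qed
 then have "p <= card (rcosets\<^bsub>G\<^esub> A)"
 proof
  assume n: "ff 1 0 0 \<notin> A"
  have "ff (int p) 0 0 = ff 0 0 0"
   by (rule ff_eqI[OF ff_ext]) (use Fa_mod[of _ 0 1 0 0 0 0] ff_TH in simp)
  then show ?thesis
   by (intro G.prime_le_card_rcosets[OF A' fin, of "%i. ff i 0 0"]) (simp_all add: cG p n)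
 next
  assume n: "ff 0 1 0 \<notin> A"
  have "ff 0 (int p) 0 = ff 0 0 0"
   by (rule ff_eqI[OF ff_ext]) (use Fa_mod[of _ 0 0 0 1 0 0] ff_TH in simp)
  then show ?thesis
   by (intro G.prime_le_card_rcosets[OF A' fin, of "%i. ff 0 i 0"]) (simp_all add: cG p n)
 qed
 then show ?thesis unfolding subgroup_index_def e G_def .
qed

end

section \<open>Choice of the prime, and the two kinds of bundle\<close>

theorem (in sphere_bundle) large_abelian_index:
 shows "\<exists>g \<Gamma>. Lorentz_metric M g & subgroup \<Gamma> (isometry_group M g) & finite \<Gamma> &
  (\<forall>A. subgroup A (isometry_group M g \<lparr>carrier := \<Gamma>\<rparr>) & comm_group (isometry_group M g \<lparr>carrier := A\<rparr>) -->
    real (subgroup_index (isometry_group M g \<lparr>carrier := \<Gamma>\<rparr>) A) > C)"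
proof -
 obtain n0 :: int where n0: "\<forall>n. even (n - n0) --> (\<exists>Th. good ee UNIV Th & (\<forall>x y. \<forall>q\<in>S2. Th (x + 1, y) q = Th (x, y) q) &
   (\<forall>x y q. Th (x, y + 1) q = Th (x, y) (rot (of_int n * x) q)))"
  using twisted_trivialization by blast
 \<comment> \<open>The bound 2 makes p odd and keeps it from dividing k; the other bound gives p >
   C.\<close>
 obtain p where p: "prime p" "p > max 2 (nat \<lceil>C\<rceil>)" using bigger_prime by blast
 have "odd p" using p prime_odd_nat by auto
 \<comment> \<open>As p is odd, k * p has the parity of k, which is that of n0.\<close>
 define k :: int where "k = (if even n0 then 2 else 1)"
 have "even (k * int p - n0)" using \<open>odd p\<close> by (simp add: k_def)
 then obtain Th where T: "good ee UNIV Th" "\<forall>x y. \<forall>q\<in>S2. Th (x + 1, y) q = Th (x, y) q"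
   "\<forall>x y q. Th (x, y + 1) q = Th (x, y) (rot (of_int (k * int p) * x) q)" using n0 by blast
 have "\<not> int p dvd k" using p zdvd_imp_le[of "int p" k] by (auto simp: k_def)
 then interpret h: heisenberg M \<pi> \<T> Th "k * int p" p k
  by unfold_locales (use T p in auto)
 have pC: "real p > C" using p(2) by linarith
 show ?thesis
 proof (rule exI[of _ h.gm], rule exI[of _ h.GG], intro conjI allI impI)
  fix A assume A: "subgroup A (isometry_group M h.gm \<lparr>carrier := h.GG\<rparr>) & comm_group (isometry_group M h.gm \<lparr>carrier := A\<rparr>)"
  have "p <= subgroup_index (isometry_group M h.gm \<lparr>carrier := h.GG\<rparr>) A" by (rule h.large_index) (use A in auto)
  then show "real (subgroup_index (isometry_group M h.gm \<lparr>carrier := h.GG\<rparr>) A) > C" using pC by linarith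
 qed (rule h.Lorentz_gm h.subgroup_GG_isometry h.finite_GG)+
qed

text \<open>The diffeomorphism itself is a single global trivialization, with the identity of the
  sphere as its only transition map.\<close>

lemma sphere_bundle_product:
 assumes M: "smooth_manifold M" and D: "diffeomorphism M torus_times_sphere \<Psi>"
 shows "sphere_bundle M (fst \<circ> \<Psi>) {(T2, \<Psi>)}"
proof -
 have pE: "points torus_times_sphere = T2 \<times> S2" by (simp add: embedded_manifold_def)
 have bij: "bij_betw \<Psi> (points M) (T2 \<times> S2)" using D unfolding diffeomorphism_def pE by blast
 have o: "over M (fst \<circ> \<Psi>) T2 = points M" using bij_betwE[OF bij] by (auto simp: over_def mem_Times_iff)
 have sub: "open_submanifold M (points M) = M"
 proof -
  have "(%(V, ph). (V \<inter> points M, ph)) K = K" if "K \<in> charts M" for K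
  proof (cases K)
   case (Pair V ph)
   then have "V \<subseteq> points M" using chart_facts(2)[OF M] that by blast
   then show ?thesis using Pair by auto
  qed
  then have "(%(V, ph). (V \<inter> points M, ph)) ` charts M = charts M" by (simp add: image_def)
  then show ?thesis unfolding open_submanifold_def by simp
 qed
 show ?thesis
 proof (unfold_locales)
  show "smooth_manifold M" by (rule M)
  show "(fst \<circ> \<Psi>) p \<in> T2" if "p \<in> points M" for p using bij_betwE[OF bij] that by (auto simp: mem_Times_iff)
  fix U Ph assume "(U, Ph) \<in> {(T2, \<Psi>)}"
  then have U: "U = T2" "Ph = \<Psi>" by auto
  show "openin (mtop M) (over M (fst \<circ> \<Psi>) U)" unfolding U o by simp
  show "local_trivialization M (fst \<circ> \<Psi>) U Ph" unfolding U local_trivialization_def o sub using D by simp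
  fix V \<Psi>' b assume "(V, \<Psi>') \<in> {(T2, \<Psi>)}" and b: "b \<in> U"
  then have V: "\<Psi>' = \<Psi>" by auto
  show "orientation_preserving_S2 (%q. snd (\<Psi>' (inv_into (over M (fst \<circ> \<Psi>) U) Ph (b, q))))"
  proof (rule op_cong[OF op_id])
   fix q :: "real^3" assume q: "q \<in> S2"
   have "\<Psi> (inv_into (points M) \<Psi> (b, q)) = (b, q)" by (rule bij_betw_inv_into_right[OF bij]) (use b q U in simp)
   then show "snd (\<Psi>' (inv_into (over M (fst \<circ> \<Psi>) U) Ph (b, q))) = q" unfolding V U o by simp
  qed
 qed simp
qed

lemma sphere_bundle_orientable:
 assumes "orientable_S2_bundle M \<pi>" shows "\<exists>\<T>. sphere_bundle M \<pi> \<T>"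
proof -
 have B: "smooth_manifold M" "smooth_map M torus \<pi>" using assms by (auto simp: orientable_S2_bundle_def S2_bundle_over_T2_def)
 obtain \<T> where T: "\<forall>(U, Ph)\<in>\<T>. local_trivialization M \<pi> U Ph" "(\<Union>(U, Ph)\<in>\<T>. U) = T2"
  "\<forall>(U, Ph)\<in>\<T>. \<forall>(V, \<Psi>)\<in>\<T>. \<forall>b\<in>U \<inter> V. orientation_preserving_S2 (%q. snd (\<Psi> (inv_into (over M \<pi> U) Ph (b, q))))"
  using assms unfolding orientable_S2_bundle_def by (elim conjE exE) (rule that)
 have "mtop torus = top_of_set T2" by (simp add: embedded_manifold_def)
 then have c: "continuous_map (mtop M) (top_of_set T2) \<pi>" using B(2) unfolding smooth_map_def by metis
 have "sphere_bundle M \<pi> \<T>"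
 proof (unfold_locales)
  show "smooth_manifold M" by (rule B(1))
  show "\<pi> p \<in> T2" if "p \<in> points M" for p using c that unfolding continuous_map_def by auto
  show "(\<Union>(U, Ph)\<in>\<T>. U) = T2" by (rule T(2))
  fix U Ph assume U: "(U, Ph) \<in> \<T>"
  show l: "local_trivialization M \<pi> U Ph" using T(1) U by blast
  show "openin (mtop M) (over M \<pi> U)" unfolding over_def
   by (rule openin_continuous_map_preimage[OF c]) (use l in \<open>simp add: local_trivialization_def\<close>)
  fix V \<Psi> b assume "(V, \<Psi>) \<in> \<T>" "b \<in> U" "b \<in> V"
  then show "orientation_preserving_S2 (%q. snd (\<Psi> (inv_into (over M \<pi> U) Ph (b, q))))" using T(3) U by fast
 qed
 then show ?thesis by blast
qed

theorem theorem1p2: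
  fixes M :: "('a, real^4) manifold" and C :: real
  assumes "smooth_manifold M"
    and "diffeomorphic M torus_times_sphere \<or> is_nontrivial_S2_fibration_over_T2 M"
    and "C > 0"
  shows "\<exists>g \<Gamma>. Lorentz_metric M g \<and>
           subgroup \<Gamma> (isometry_group M g) \<and> finite \<Gamma> \<and>
           (\<forall>A. subgroup A (isometry_group M g \<lparr>carrier := \<Gamma>\<rparr>) \<and>
                comm_group (isometry_group M g \<lparr>carrier := A\<rparr>) \<longrightarrow>
                real (subgroup_index (isometry_group M g \<lparr>carrier := \<Gamma>\<rparr>) A) > C)"
proof -
  have "\<exists>\<pi> \<T>. sphere_bundle M \<pi> \<T>"
    using assms(2)
  proof
    assume "diffeomorphic M torus_times_sphere"
    then obtain \<Psi> where "diffeomorphism M torus_times_sphere \<Psi>" unfolding diffeomorphic_def by blast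
    then show ?thesis using sphere_bundle_product[OF assms(1)] by blast
  next
    assume "is_nontrivial_S2_fibration_over_T2 M"
    then show ?thesis using sphere_bundle_orientable unfolding is_nontrivial_S2_fibration_over_T2_def by blast
  qed
  then obtain \<pi> \<T> where "sphere_bundle M \<pi> \<T>" by blast
  from sphere_bundle.large_abelian_index[OF this] show ?thesis .
qed

end
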